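(* Let $\Omega\subset\mathbb{R}^n$ be a bounded Lipschitz domain and let $\mathcal{F}[u]=\int_\Omega F(x,u,\nabla u)\,dx$, where $F:\Omega\times\mathbb{R}\times\mathbb{R}^n\to\mathbb{R}$ is measurable with respect to the first variable and continuous with respect to the second and the third variable. Let $M:\Omega\times\mathbb{R}^n\to[0,\infty)$ be a weak $N$-function that is continuous with respect to both variables and such that $M\in\Delta_2$, and suppose that there exist constants $0<\nu,\beta<1<L$ such that $$\nu M(x,\beta\xi)\le F(x,z,\xi)\le L\,(M(x,\xi)+1)\qquad\text{for all } x\in\Omega,\ z\in\mathbb{R},\ \xi\in\mathbb{R}^n.$$ Then the following hold. (i) If $\gamma=0$, $u_0\in V^1L_M(\Omega)$, and $M$ satisfies condition $\mathsf{(B^{gen}_\gamma)}$ (with $\gamma=0$), then $$\inf_{u\in u_0+V^1_0L_M(\Omega)}\mathcal{F}[u]=\inf_{u\in u_0+C_c^\infty(\Omega)}\mathcal{F}[u].$$ (ii) If $\gamma\in(0,1]$, $u_0\in V^1L_M(\Omega)\cap C^{0,\gamma}(\Omega)$, and $M$ satisfies condition $\mathsf{(B^{gen}_\gamma)}$, then $$\inf_{u\in u_0+(V^1_0L_M(\Omega)\cap C^{0,\gamma}(\Omega))}\mathcal{F}[u]=\inf_{u\in u_0+C_c^\infty(\Omega)}\mathcal{F}[u].$$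
   Context: Weak $N$-functions. For $\ell\ge1$, a function $N:\Omega\times\mathbb{R}^\ell\to[0,\infty)$ is a weak $N$-function if: (1) it is Carathéodory (measurable in $x$, continuous in $\xi$); (2) $N(x,0)=0$ and $\xi\mapsto N(x,\xi)$ is convex for a.a. $x\in\Omega$; (3) $N(x,\xi)=N(x,-\xi)$ for a.a. $x\in\Omega$ and all $\xi$; (4) there exist convex functions $m_1,m_2:[0,\infty)\to[0,\infty)$ with $m_1(0)=0$, $m_1(s)>0$ for $s>0$, such that $m_1(|\xi|)\le N(x,\xi)\le m_2(|\xi|)$ for a.a. $x\in\Omega$ and all $\xi$. $M\in\Delta_2$ means: there exist constants $c,C>0$ and a nonnegative integrable $h:\Omega\to\mathbb{R}$ such that for a.e. $x\in\Omega$, $M(x,2\xi)\le cM(x,\xi)+h(x)$ for all $\xi$ with $|\xi|>C$. For a ball $B$ and a weak $N$-function $N$: $N_B^-(\xi)=\operatorname{ess\,inf}_{y\in B\cap\Omega}N(y,\xi)$ and $N_B^+(\xi)=\operatorname{ess\,sup}_{y\in B\cap\Omega}N(y,\xi)$. Condition $\mathsf{(B^{gen}_\gamma)}$: $M(x,\xi)=\sum_{j=1}^{K}M_j(x,\xi_j)$ for some $K\ge1$, where $\xi=(\xi_1,\dots,\xi_K)$ with $\xi_j\in\mathbb{R}^{\ell_j}$, $\mathbb{R}^{\ell_1}\times\dots\times\mathbb{R}^{\ell_K}=\mathbb{R}^n$, and $M_j:\Omega\times\mathbb{R}^{\ell_j}\to[0,\infty)$ are weak $N$-functions; and there exist constants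 $c^\Diamond,C^\Diamond>1$ such that for every ball $B$ with radius $r\le1$, all $j$, and all $\xi_j\in\mathbb{R}^{\ell_j}$ satisfying $(M_j)_B^-(C^\Diamond\xi_j)\le\sup_{|\eta_j|=1}(M_j)_B^-(\eta_j c^\Diamond r^{\gamma-1})$, there holds $(M_j)_B^+(\xi_j)\le(M_j)_B^-(C^\Diamond\xi_j)+1$. (The choice $K=1$ is allowed.) Function spaces. $L_M(\Omega;\mathbb{R}^n)$ is the smallest linear space containing all measurable $\xi:\Omega\to\mathbb{R}^n$ with $\int_\Omega M(x,\xi(x))\,dx<\infty$. $V^1L_M(\Omega)=\{f\in W^{1,1}(\Omega):\nabla f\in L_M(\Omega;\mathbb{R}^n)\}$ and $V^1_0L_M(\Omega)=\{f\in W^{1,1}_0(\Omega):\nabla f\in L_M(\Omega;\mathbb{R}^n)\}$. For $\gamma\in(0,1]$, $h\in C^{0,\gamma}(\Omega)$ means $\sup_{x\ne y\in\Omega}|h(x)-h(y)|/|x-y|^\gamma<\infty$. *)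

theory Defs
  imports "HOL-Analysis.Analysis" "HOL-Probability.Essential_Supremum"
begin

text \<open>Near each boundary point the domain is the strict epigraph of a Lipschitz function, in the
  orthogonal coordinates given by a unit vector \<open>e\<close> (the vertical direction) and its orthogonal
  complement. In dimension one the complement is trivial and \<open>g\<close> is a constant.\<close>

definition lipschitz_boundary :: "(real^'n) set \<Rightarrow> bool" where
  "lipschitz_boundary \<Omega> \<longleftrightarrow>
     (\<forall>p\<in>frontier \<Omega>. \<exists>U e g C.
        open U \<and> p \<in> U \<and> norm e = 1 \<and> C-lipschitz_on {v. v \<bullet> e = 0} g \<and>
        \<Omega> \<inter> U = {y \<in> U. g (y - (y \<bullet> e) *\<^sub>R e) < y \<bullet> e})"

definition bounded_lipschitz_domain :: "(real^'n) set \<Rightarrow> bool" where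
  "bounded_lipschitz_domain \<Omega> \<longleftrightarrow>
     open \<Omega> \<and> connected \<Omega> \<and> \<Omega> \<noteq> {} \<and> bounded \<Omega> \<and> lipschitz_boundary \<Omega>"

definition grad :: "(real^'n \<Rightarrow> real) \<Rightarrow> real^'n \<Rightarrow> real^'n" where
  "grad f x = (\<chi> i. frechet_derivative f (at x) (axis i 1))"

primrec Ck :: "nat \<Rightarrow> (real^'n \<Rightarrow> real) \<Rightarrow> bool" where
  "Ck 0 f \<longleftrightarrow> continuous_on UNIV f"
| "Ck (Suc k) f \<longleftrightarrow> f differentiable_on UNIV \<and> (\<forall>i. Ck k (\<lambda>x. grad f x $ i))"

definition Cc_infinity :: "(real^'n) set \<Rightarrow> (real^'n \<Rightarrow> real) set" where
  "Cc_infinity \<Omega> =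
     {\<phi>. (\<forall>k. Ck k \<phi>) \<and> compact (closure {x. \<phi> x \<noteq> 0}) \<and> closure {x. \<phi> x \<noteq> 0} \<subseteq> \<Omega>}"

text \<open>Functions on \<open>\<Omega>\<close> are total functions whose values outside \<open>\<Omega>\<close> are irrelevant. Elements of the
  Sobolev spaces are representatives, not classes modulo null sets; measurability is always Lebesgue
  measurability on \<open>\<Omega>\<close>.\<close>

definition has_weak_gradient :: "(real^'n) set \<Rightarrow> (real^'n \<Rightarrow> real) \<Rightarrow> (real^'n \<Rightarrow> real^'n) \<Rightarrow> bool" where
  "has_weak_gradient \<Omega> u G \<longleftrightarrow>
     integrable (lebesgue_on \<Omega>) u \<and> integrable (lebesgue_on \<Omega>) G \<and>
     (\<forall>\<phi>\<in>Cc_infinity \<Omega>. \<forall>i.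
        (LINT x|lebesgue_on \<Omega>. u x * grad \<phi> x $ i) = - (LINT x|lebesgue_on \<Omega>. G x $ i * \<phi> x))"

definition W11 :: "(real^'n) set \<Rightarrow> (real^'n \<Rightarrow> real) set" where
  "W11 \<Omega> = {u. \<exists>G. has_weak_gradient \<Omega> u G}"

text \<open>The weak gradient is determined up to a null set, so for \<open>u\<close> in \<open>W11 \<Omega>\<close> the choice below does not
  affect the integrals in which it is used.\<close>

definition wgrad :: "(real^'n) set \<Rightarrow> (real^'n \<Rightarrow> real) \<Rightarrow> real^'n \<Rightarrow> real^'n" where
  "wgrad \<Omega> u = (SOME G. has_weak_gradient \<Omega> u G)"

definition W11_norm :: "(real^'n) set \<Rightarrow> (real^'n \<Rightarrow> real) \<Rightarrow> real" where
  "W11_norm \<Omega> u =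
     (LINT x|lebesgue_on \<Omega>. \<bar>u x\<bar>) + (LINT x|lebesgue_on \<Omega>. norm (wgrad \<Omega> u x))"

definition W11_0 :: "(real^'n) set \<Rightarrow> (real^'n \<Rightarrow> real) set" where
  "W11_0 \<Omega> =
     {u \<in> W11 \<Omega>. \<exists>\<phi>. (\<forall>k::nat. \<phi> k \<in> Cc_infinity \<Omega>) \<and>
                    (\<lambda>k. W11_norm \<Omega> (\<lambda>x. u x - \<phi> k x)) \<longlonglongrightarrow> 0}"

definition holder :: "real \<Rightarrow> (real^'n) set \<Rightarrow> (real^'n \<Rightarrow> real) set" where
  "holder \<gamma> \<Omega> =
     {h. bdd_above {\<bar>h x - h y\<bar> / norm (x - y) powr \<gamma> |x y. x \<in> \<Omega> \<and> y \<in> \<Omega> \<and> x \<noteq> y}}"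

text \<open>The space of the second argument is a linear subspace \<open>V\<close>: either the whole space, or a coordinate
  subspace playing the role of one of the factors in a product decomposition.\<close>

definition weak_N_function ::
  "(real^'n) set \<Rightarrow> (real^'n) set \<Rightarrow> (real^'n \<Rightarrow> real^'n \<Rightarrow> real) \<Rightarrow> bool" where
  "weak_N_function \<Omega> V N \<longleftrightarrow>
     (\<forall>x\<in>\<Omega>. \<forall>\<xi>\<in>V. 0 \<le> N x \<xi>) \<and>
     (\<forall>\<xi>\<in>V. (\<lambda>x. N x \<xi>) \<in> borel_measurable (lebesgue_on \<Omega>)) \<and>
     (\<forall>x\<in>\<Omega>. continuous_on V (N x)) \<and>
     (AE x in lebesgue_on \<Omega>. N x 0 = 0 \<and> convex_on V (N x)) \<and>
     (AE x in lebesgue_on \<Omega>. \<forall>\<xi>\<in>V. N x \<xi> = N x (- \<xi>)) \<and>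
     (\<exists>m1 m2 :: real \<Rightarrow> real.
        convex_on {0..} m1 \<and> convex_on {0..} m2 \<and>
        (\<forall>s\<ge>0. 0 \<le> m1 s \<and> 0 \<le> m2 s) \<and>
        m1 0 = 0 \<and> (\<forall>s>0. 0 < m1 s) \<and>
        (AE x in lebesgue_on \<Omega>. \<forall>\<xi>\<in>V. m1 (norm \<xi>) \<le> N x \<xi> \<and> N x \<xi> \<le> m2 (norm \<xi>)))"

definition Delta2 :: "(real^'n) set \<Rightarrow> (real^'n \<Rightarrow> real^'n \<Rightarrow> real) \<Rightarrow> bool" where
  "Delta2 \<Omega> M \<longleftrightarrow>
     (\<exists>c C h. 0 < c \<and> 0 < C \<and> (\<forall>x\<in>\<Omega>. 0 \<le> h x) \<and> integrable (lebesgue_on \<Omega>) h \<and>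
        (AE x in lebesgue_on \<Omega>. \<forall>\<xi>. norm \<xi> > C \<longrightarrow> M x (2 *\<^sub>R \<xi>) \<le> c * M x \<xi> + h x))"

definition N_plus ::
  "(real^'n) set \<Rightarrow> (real^'n \<Rightarrow> real^'n \<Rightarrow> real) \<Rightarrow> (real^'n) set \<Rightarrow> real^'n \<Rightarrow> ereal" where
  "N_plus \<Omega> N B \<xi> = esssup (lebesgue_on (B \<inter> \<Omega>)) (\<lambda>y. ereal (N y \<xi>))"

definition N_minus ::
  "(real^'n) set \<Rightarrow> (real^'n \<Rightarrow> real^'n \<Rightarrow> real) \<Rightarrow> (real^'n) set \<Rightarrow> real^'n \<Rightarrow> ereal" where
  "N_minus \<Omega> N B \<xi> = - esssup (lebesgue_on (B \<inter> \<Omega>)) (\<lambda>y. - ereal (N y \<xi>))"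

text \<open>A map \<open>b\<close> from the coordinate indices onto \<open>{..<K}\<close> encodes the identification of \<open>\<real>\<^sup>n\<close> with a product
  of \<open>K\<close> spaces of positive dimension: the factor number \<open>j\<close> is the subspace of the vectors supported
  in the coordinates \<open>i\<close> with \<open>b i = j\<close>.\<close>

definition block_space :: "('n \<Rightarrow> nat) \<Rightarrow> nat \<Rightarrow> (real^'n) set" where
  "block_space b j = {\<xi>. \<forall>i. b i \<noteq> j \<longrightarrow> \<xi> $ i = 0}"

definition block_part :: "('n \<Rightarrow> nat) \<Rightarrow> nat \<Rightarrow> real^'n \<Rightarrow> real^'n" where
  "block_part b j \<xi> = (\<chi> i. if b i = j then \<xi> $ i else 0)"

text \<open>Balls that do not meet \<open>\<Omega>\<close> impose no condition: the essential infimum over the empty set is \<open>\<infinity>\<close> and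
  the essential supremum is \<open>-\<infinity>\<close>.\<close>

definition B_gen :: "real \<Rightarrow> (real^'n) set \<Rightarrow> (real^'n \<Rightarrow> real^'n \<Rightarrow> real) \<Rightarrow> bool" where
  "B_gen \<gamma> \<Omega> M \<longleftrightarrow>
     (\<exists>(K::nat) (b :: 'n \<Rightarrow> nat) (Mj :: nat \<Rightarrow> real^'n \<Rightarrow> real^'n \<Rightarrow> real).
        1 \<le> K \<and> range b = {..<K} \<and>
        (\<forall>j<K. weak_N_function \<Omega> (block_space b j) (Mj j)) \<and>
        (\<forall>x\<in>\<Omega>. \<forall>\<xi>. M x \<xi> = (\<Sum>j<K. Mj j x (block_part b j \<xi>))) \<and>
        (\<exists>c C. 1 < c \<and> 1 < C \<and>
           (\<forall>p r. 0 < r \<and> r \<le> 1 \<longrightarrow> (\<forall>j<K. \<forall>\<xi>\<in>block_space b j.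
              N_minus \<Omega> (Mj j) (ball p r) (C *\<^sub>R \<xi>)
                \<le> (SUP \<eta>\<in>{\<eta> \<in> block_space b j. norm \<eta> = 1}.
                      N_minus \<Omega> (Mj j) (ball p r) ((c * r powr (\<gamma> - 1)) *\<^sub>R \<eta>))
              \<longrightarrow> N_plus \<Omega> (Mj j) (ball p r) \<xi>
                \<le> N_minus \<Omega> (Mj j) (ball p r) (C *\<^sub>R \<xi>) + 1))))"

definition linear_space :: "('a \<Rightarrow> 'b::real_vector) set \<Rightarrow> bool" where
  "linear_space S \<longleftrightarrow>
     (\<lambda>x. 0) \<in> S \<and> (\<forall>f\<in>S. \<forall>g\<in>S. (\<lambda>x. f x + g x) \<in> S) \<and> (\<forall>(c::real). \<forall>f\<in>S. (\<lambda>x. c *\<^sub>R f x) \<in> S)"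

definition L_space :: "(real^'n) set \<Rightarrow> (real^'n \<Rightarrow> real^'n \<Rightarrow> real) \<Rightarrow> (real^'n \<Rightarrow> real^'n) set" where
  "L_space \<Omega> M = linear_space hull
     {\<xi>. \<xi> \<in> borel_measurable (lebesgue_on \<Omega>) \<and> (\<integral>\<^sup>+x. ennreal (M x (\<xi> x)) \<partial>lebesgue_on \<Omega>) < \<infinity>}"

definition V1L :: "(real^'n) set \<Rightarrow> (real^'n \<Rightarrow> real^'n \<Rightarrow> real) \<Rightarrow> (real^'n \<Rightarrow> real) set" where
  "V1L \<Omega> M = {f \<in> W11 \<Omega>. wgrad \<Omega> f \<in> L_space \<Omega> M}"

definition V1L_0 :: "(real^'n) set \<Rightarrow> (real^'n \<Rightarrow> real^'n \<Rightarrow> real) \<Rightarrow> (real^'n \<Rightarrow> real) set" where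
  "V1L_0 \<Omega> M = {f \<in> W11_0 \<Omega>. wgrad \<Omega> f \<in> L_space \<Omega> M}"

text \<open>Lebesgue integral of a nonnegative integrand, with values in \<open>[0, \<infinity>]\<close>; \<^const>\<open>ennreal\<close> would truncate
  negative values, so this is the functional only for nonnegative \<open>F\<close>.\<close>

definition functional ::
  "(real^'n) set \<Rightarrow> (real^'n \<Rightarrow> real \<Rightarrow> real^'n \<Rightarrow> real) \<Rightarrow> (real^'n \<Rightarrow> real) \<Rightarrow> ennreal" where
  "functional \<Omega> F u = (\<integral>\<^sup>+x. ennreal (F x (u x) (wgrad \<Omega> u x)) \<partial>lebesgue_on \<Omega>)"

definition translate :: "('a \<Rightarrow> real) \<Rightarrow> ('a \<Rightarrow> real) set \<Rightarrow> ('a \<Rightarrow> real) set" where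
  "translate u0 W = {(\<lambda>x. u0 x + w x) |w. w \<in> W}"

end

theory Submission
  imports Defs
begin

text \<open>Test functions belong to both larger classes of competitors, so one inequality between the infima
  is immediate. The content is the other one: for each competitor \<open>u0 + w\<close> there are test functions
  \<open>\<Phi> m\<close> for which the functional at \<open>u0 + \<Phi> m\<close> tends to its value at \<open>u0 + w\<close> (after a truncation of \<open>w\<close>
  when \<open>\<gamma> = 0\<close>).

  Mollification is the natural candidate for \<open>\<Phi> m\<close>, but Jensen's inequality alone controls the modular
  only if \<open>M\<close> does not depend on \<open>x\<close>; in general the infima can differ
  (Lavrentiev's phenomenon). The condition on balls allows \<open>M\<close> at one point of a ball of radius
  \<open>r\<close> to be compared with \<open>M\<close> at another, for vectors of length at most a multiple of \<open>r powr (\<gamma> - 1)\<close>. This is exactly the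
  size of the gradient after mollification at scale \<open>t\<close>, comparable to \<open>r\<close>: if \<open>w\<close> is Hoelder
  continuous with exponent \<open>\<gamma>\<close> (bounded, for \<open>\<gamma> = 0\<close>), then moving the derivative to the kernel and
  subtracting \<open>w x\<close> bounds the mollified gradient by a multiple of \<open>t powr (\<gamma> - 1)\<close>
  (\<open>smear_gradient_bound\<close>). The gradients that enter the average need not obey this bound; a version of
  Jensen's inequality that first shortens the long ones (\<open>truncated_jensen\<close>) takes care of that. The
  outcome, \<open>smear_modular\<close>, bounds \<open>M x\<close> at a small multiple of the mollified gradient by a constant plus
  the mollification of the integrable function \<open>M y (C *\<^sub>R G y)\<close>, where \<open>G\<close> is the gradient of \<open>w\<close>. These majorants
  converge in \<open>L\<^sup>1\<close>. The condition \<open>\<Delta>\<^sub>2\<close> removes the small multiple, and dominated convergence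
  with \<open>L\<^sup>1\<close>-convergent majorants passes to the limit in the functional (\<open>functional_limit\<close>).

  To obtain compact support, \<open>w\<close> is split by a partition of unity, and each piece is shifted by \<open>t e\<close>,
  where \<open>e\<close> points into the domain, before it is mollified at the smaller scale \<open>t \<epsilon>\<close>
  (\<open>smooth_approximation\<close>). The Lipschitz boundary guarantees that the shifted piece stays inside. The
  additional terms, products of \<open>w\<close> with gradients of the partition, are bounded because \<open>w\<close> is.

  All this requires \<open>w\<close>, extended by zero, to be Hoelder continuous on the whole space, or bounded when
  \<open>\<gamma> = 0\<close>. For \<open>\<gamma> = 0\<close> the function \<open>w\<close> is replaced by smooth truncations, which converge to it
  (\<open>inf_le_bounded\<close>). For \<open>\<gamma> > 0\<close> the function is Hoelder continuous inside the domain by assumption, and its zero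
  boundary values, known only in the Sobolev sense, exclude a jump at the boundary: a jump across a
  Lipschitz graph would contradict the integrability of the gradient (\<open>no_jump\<close>,
  \<open>holder_extension_by_zero\<close>).\<close>

section \<open>Functions of class $C^1$\<close>

lemma GDERIV_D: "GDERIV f x :> D \<Longrightarrow> (f has_derivative (\<lambda>h. h \<bullet> D)) (at x)"
  unfolding gderiv_def by simp

lemma GDERIV_imp_grad:
  fixes f :: "real^'n \<Rightarrow> real"
  assumes "GDERIV f x :> D" shows "grad f x = D"
proof -
  have "frechet_derivative f (at x) = (\<lambda>h. h \<bullet> D)"
    using frechet_derivative_at[OF GDERIV_D[OF assms]] by simp
  then show ?thesis by (simp add: grad_def vec_eq_iff inner_axis' )
qed

lemma differentiable_imp_GDERIV_grad:
  fixes f :: "real^'n \<Rightarrow> real"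
  assumes "f differentiable (at x)" shows "GDERIV f x :> grad f x"
proof -
  obtain f' where f': "(f has_derivative f') (at x)" using assms differentiable_def by blast
  interpret bounded_linear f' using f' has_derivative_bounded_linear by blast
  have fr: "frechet_derivative f (at x) = f'"
    using frechet_derivative_at[OF f'] by simp
  have "f' h = h \<bullet> grad f x" for h
  proof -
    have "f' h = f' (\<Sum>i\<in>UNIV. h $ i *\<^sub>R axis i 1)"
      by (simp add: basis_expansion flip: scalar_mult_eq_scaleR)
    also have "\<dots> = (\<Sum>i\<in>UNIV. h $ i * f' (axis i 1))"
      by (simp add: sum scaleR)
    finally show ?thesis by (simp add: inner_vec_def grad_def fr)
  qed
  then have "f' = (\<lambda>h. h \<bullet> grad f x)" by auto
  then show ?thesis unfolding gderiv_def using f' by simp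
qed

text \<open>Test objects for integration by parts on the whole space. The gradient is carried along as an explicit
  function, so that its measurability and boundedness can be quoted without reference to \<open>grad\<close>.\<close>

definition C1b :: "(real^'n \<Rightarrow> real) \<Rightarrow> (real^'n \<Rightarrow> real^'n) \<Rightarrow> bool" where
  "C1b f D \<longleftrightarrow> (\<forall>x. GDERIV f x :> D x) \<and> continuous_on UNIV D \<and> bounded (range f) \<and> bounded (range D)"

lemma C1bI:
  assumes "\<And>x. GDERIV f x :> D x" "continuous_on UNIV D" "bounded (range f)" "bounded (range D)"
  shows "C1b f D"
  using assms by (auto simp: C1b_def)

lemma C1b_GDERIV: "C1b f D \<Longrightarrow> GDERIV f x :> D x"
  by (auto simp: C1b_def)

lemma GDERIV_isCont: "GDERIV f x :> D \<Longrightarrow> isCont f x"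
  by (meson GDERIV_D has_derivative_continuous)

lemma GDERIV_continuous_on: "(\<And>x. GDERIV f x :> D x) \<Longrightarrow> continuous_on S f"
  by (meson GDERIV_isCont continuous_at_imp_continuous_on)

lemma C1b_continuous: "C1b f D \<Longrightarrow> continuous_on S f" "C1b f D \<Longrightarrow> continuous_on S D"
  by (auto simp: C1b_def intro: GDERIV_continuous_on continuous_on_subset)

lemma C1b_borel:
  assumes "C1b f D" shows "f \<in> borel_measurable borel" "D \<in> borel_measurable borel"
  using C1b_continuous[OF assms] by (auto intro!: borel_measurable_continuous_onI)

lemma C1b_bound:
  assumes "C1b f D" obtains A where "0 \<le> A" "\<And>x. \<bar>f x\<bar> \<le> A" "\<And>x. norm (D x) \<le> A"
proof -
  obtain a b where "\<And>x. \<bar>f x\<bar> \<le> a" "\<And>x. norm (D x) \<le> b"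
    using assms unfolding C1b_def bounded_iff by (metis rangeI real_norm_def)
  then show thesis
    by (intro that[of "max 0 (max a b)"]) (auto simp: max.coboundedI2 max.coboundedI1)
qed

lemma bounded_rangeI: "(\<And>x. norm (f x) \<le> A) \<Longrightarrow> bounded (range f)"
  by (auto simp: bounded_iff)

lemma C1b_const: "C1b (\<lambda>x. c) (\<lambda>x. 0)"
  by (rule C1bI) (auto intro: GDERIV_const)

lemma C1b_mult:
  assumes "C1b f D" "C1b g E" shows "C1b (\<lambda>x. f x * g x) (\<lambda>x. f x *\<^sub>R E x + g x *\<^sub>R D x)"
proof -
  obtain A where A: "0 \<le> A" "\<And>x. \<bar>f x\<bar> \<le> A" "\<And>x. norm (D x) \<le> A" using C1b_bound[OF assms(1)] by metis
  obtain B where B: "0 \<le> B" "\<And>x. \<bar>g x\<bar> \<le> B" "\<And>x. norm (E x) \<le> B" using C1b_bound[OF assms(2)] by metis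
  note c = C1b_continuous[OF assms(1)] C1b_continuous[OF assms(2)]
  show ?thesis
  proof (rule C1bI)
    show "GDERIV (\<lambda>x. f x * g x) x :> f x *\<^sub>R E x + g x *\<^sub>R D x" for x
      by (rule GDERIV_mult[OF C1b_GDERIV[OF assms(1)] C1b_GDERIV[OF assms(2)]])
    show "continuous_on UNIV (\<lambda>x. f x *\<^sub>R E x + g x *\<^sub>R D x)"
      by (rule continuous_on_add[OF continuous_on_scaleR continuous_on_scaleR]) (rule c)+
    have "norm (f x * g x) \<le> A * B" for x
      by (simp only: real_norm_def abs_mult, rule mult_mono') (simp_all add: A B)
    then show "bounded (range (\<lambda>x. f x * g x))" by (rule bounded_rangeI)
    have "norm (f x *\<^sub>R E x + g x *\<^sub>R D x) \<le> A * B + B * A" for x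
    proof -
      have "norm (f x *\<^sub>R E x + g x *\<^sub>R D x) \<le> \<bar>f x\<bar> * norm (E x) + \<bar>g x\<bar> * norm (D x)"
        by (metis norm_scaleR norm_triangle_ineq)
      also have "\<dots> \<le> A * B + B * A"
        by (rule add_mono; rule mult_mono') (simp_all add: A B)
      finally show ?thesis .
    qed
    then show "bounded (range (\<lambda>x. f x *\<^sub>R E x + g x *\<^sub>R D x))" by (rule bounded_rangeI)
  qed
qed

lemma C1b_compose:
  assumes "C1b f D" "\<And>s. DERIV g s :> g' s" "continuous_on UNIV g'"
  shows "C1b (\<lambda>x. g (f x)) (\<lambda>x. g' (f x) *\<^sub>R D x)"
proof -
  obtain A where A: "0 \<le> A" "\<And>x. \<bar>f x\<bar> \<le> A" "\<And>x. norm (D x) \<le> A" using C1b_bound[OF assms(1)] by metis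
  have cg: "continuous_on S g" for S
    by (meson DERIV_isCont assms(2) continuous_at_imp_continuous_on)
  have cg': "continuous_on S g'" for S using assms(3) continuous_on_subset by blast
  have "bounded (g ` {-A..A})" "bounded (g' ` {-A..A})"
    using cg cg' by (auto intro!: compact_imp_bounded compact_continuous_image)
  then obtain B B' where "\<And>s. s \<in> {-A..A} \<Longrightarrow> \<bar>g s\<bar> \<le> B" "\<And>s. s \<in> {-A..A} \<Longrightarrow> \<bar>g' s\<bar> \<le> B'"
    unfolding bounded_iff by (metis imageI real_norm_def)
  then have B: "\<bar>g (f x)\<bar> \<le> B" "\<bar>g' (f x)\<bar> \<le> B'" for x
    using A(2)[of x] by (auto simp: abs_le_iff)
  show ?thesis
  proof (rule C1bI)
    show "GDERIV (\<lambda>x. g (f x)) x :> g' (f x) *\<^sub>R D x" for x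
      by (rule GDERIV_DERIV_compose[OF C1b_GDERIV[OF assms(1)] assms(2)])
    show "continuous_on UNIV (\<lambda>x. g' (f x) *\<^sub>R D x)"
      by (intro continuous_on_scaleR C1b_continuous[OF assms(1)]
           continuous_on_compose2[OF assms(3) C1b_continuous(1)[OF assms(1)]]) auto
    show "bounded (range (\<lambda>x. g (f x)))" by (rule bounded_rangeI[of _ B]) (simp add: B)
    have "norm (g' (f x) *\<^sub>R D x) \<le> B' * A" for x
      unfolding norm_scaleR by (rule mult_mono') (simp_all add: B A)
    then show "bounded (range (\<lambda>x. g' (f x) *\<^sub>R D x))" by (rule bounded_rangeI)
  qed
qed

lemma GDERIV_affine:
  assumes "GDERIV f (a + s *\<^sub>R x) :> D"
  shows "GDERIV (\<lambda>x. f (a + s *\<^sub>R x)) x :> s *\<^sub>R D"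
proof -
  have "((\<lambda>x. a + s *\<^sub>R x) has_derivative (\<lambda>h. s *\<^sub>R h)) (at x)"
    by (auto intro!: derivative_eq_intros)
  from has_derivative_compose[OF this GDERIV_D[OF assms]]
  show ?thesis unfolding gderiv_def by simp
qed

lemma C1b_affine:
  assumes "C1b f D" shows "C1b (\<lambda>x. f (a + s *\<^sub>R x)) (\<lambda>x. s *\<^sub>R D (a + s *\<^sub>R x))"
proof -
  obtain A where A: "0 \<le> A" "\<And>x. \<bar>f x\<bar> \<le> A" "\<And>x. norm (D x) \<le> A" using C1b_bound[OF assms(1)] by metis
  show ?thesis
  proof (rule C1bI)
    show "GDERIV (\<lambda>x. f (a + s *\<^sub>R x)) x :> s *\<^sub>R D (a + s *\<^sub>R x)" for x
      by (rule GDERIV_affine[OF C1b_GDERIV[OF assms]])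
    show "continuous_on UNIV (\<lambda>x. s *\<^sub>R D (a + s *\<^sub>R x))"
      by (intro continuous_intros continuous_on_compose2[OF C1b_continuous(2)[OF assms, of UNIV]]) auto
    show "bounded (range (\<lambda>x. f (a + s *\<^sub>R x)))" by (rule bounded_rangeI[of _ A]) (simp add: A)
    have "norm (s *\<^sub>R D (a + s *\<^sub>R x)) \<le> \<bar>s\<bar> * A" for x
      unfolding norm_scaleR by (rule mult_left_mono) (simp_all add: A)
    then show "bounded (range (\<lambda>x. s *\<^sub>R D (a + s *\<^sub>R x)))" by (rule bounded_rangeI)
  qed
qed

lemma GDERIV_zero_off_support:
  assumes "GDERIV f x :> D" "x \<notin> closure {x. f x \<noteq> 0}" shows "D = 0"
proof -
  let ?U = "- closure {x. f x \<noteq> 0}"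
  have U: "open ?U" "x \<in> ?U" using assms by auto
  have f0: "f y = 0" if "y \<in> ?U" for y
    using that closure_subset[of "{x. f x \<noteq> 0}"] by blast
  have "((\<lambda>y. 0::real) has_derivative (\<lambda>h. h \<bullet> D)) (at x)"
    by (rule has_derivative_transform_within_open[OF GDERIV_D[OF assms(1)] U f0])
  then have "(\<lambda>h. h \<bullet> D) = (\<lambda>h. 0)"
    using has_derivative_unique has_derivative_const by blast
  then have "D \<bullet> D = 0" by metis
  then show ?thesis by simp
qed

lemma continuous_vanishing_bounded:
  fixes D :: "'a::euclidean_space \<Rightarrow> 'b::real_normed_vector"
  assumes "continuous_on UNIV D" "\<And>x. R < norm x \<Longrightarrow> D x = 0"
  shows "bounded (range D)" "uniformly_continuous_on UNIV D"
proof -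
  have "bounded (D ` cball 0 R)"
    using assms(1) by (intro compact_imp_bounded compact_continuous_image) (auto intro: continuous_on_subset)
  moreover have "range D \<subseteq> insert 0 (D ` cball 0 R)" using assms(2) by (force simp: not_le)
  ultimately show "bounded (range D)" by (meson bounded_insert bounded_subset)
  have uc: "uniformly_continuous_on (cball 0 (R + 1)) D"
    using assms(1) by (intro compact_uniformly_continuous) (auto intro: continuous_on_subset)
  show "uniformly_continuous_on UNIV D"
    unfolding uniformly_continuous_on_def
  proof (intro allI impI)
    fix e :: real assume "0 < e"
    then obtain d where d: "d > 0" "\<And>x y. \<lbrakk>x \<in> cball 0 (R + 1); y \<in> cball 0 (R + 1); dist y x < d\<rbrakk> \<Longrightarrow> dist (D y) (D x) < e"
      using uc unfolding uniformly_continuous_on_def by meson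
    show "\<exists>d>0. \<forall>x\<in>UNIV. \<forall>y\<in>UNIV. dist y x < d \<longrightarrow> dist (D y) (D x) < e"
    proof (intro exI[of _ "min d 1"] conjI ballI impI)
      show "0 < min d 1" using d by simp
      fix x y :: 'a assume xy: "dist y x < min d 1"
      have "norm y \<le> norm x + dist y x" "norm x \<le> norm y + dist y x"
        by (metis dist_norm norm_triangle_sub add.commute)
          (metis dist_norm norm_minus_commute norm_triangle_sub add.commute)
      then show "dist (D y) (D x) < e"
        using xy d assms(2)[of x] assms(2)[of y] \<open>0 < e\<close>
        by (cases "x \<in> cball 0 (R + 1) \<and> y \<in> cball 0 (R + 1)") auto
    qed
  qed
qed

definition C1c :: "real \<Rightarrow> (real^'n \<Rightarrow> real) \<Rightarrow> (real^'n \<Rightarrow> real^'n) \<Rightarrow> bool" where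
  "C1c R f D \<longleftrightarrow> C1b f D \<and> (\<forall>x. R < norm x \<longrightarrow> f x = 0 \<and> D x = 0)"

lemma C1cI:
  assumes "\<And>x. GDERIV f x :> D x" "continuous_on UNIV D" "\<And>x. R < norm x \<Longrightarrow> f x = 0"
  shows "C1c R f D"
proof -
  have "x \<in> cball 0 R" if "f x \<noteq> 0" for x
    using assms(3)[of x] that by (cases "R < norm x") auto
  then have "closure {x. f x \<noteq> 0} \<subseteq> cball 0 R"
    by (intro closure_minimal) auto
  then have D0: "D x = 0" if "R < norm x" for x
    using that by (intro GDERIV_zero_off_support[OF assms(1)]) auto
  have "C1b f D"
    by (rule C1bI[OF assms(1,2) continuous_vanishing_bounded(1)[of f R] continuous_vanishing_bounded(1)[of D R]])
       (use assms(2,3) D0 GDERIV_continuous_on[of f D UNIV, OF assms(1)] in auto)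
  then show ?thesis unfolding C1c_def using assms(3) D0 by blast
qed

lemma C1c_C1b: "C1c R f D \<Longrightarrow> C1b f D" by (simp add: C1c_def)

section \<open>Smooth functions and a smooth bump\<close>

lemma Ck_Suc: "Ck (Suc k) f \<longleftrightarrow> (\<forall>x. GDERIV f x :> grad f x) \<and> (\<forall>i. Ck k (\<lambda>x. grad f x $ i))"
  by (auto simp: differentiable_on_def intro: differentiable_imp_GDERIV_grad differentiableI GDERIV_D)

lemma smooth_GDERIV: "(\<And>k. Ck k f) \<Longrightarrow> GDERIV f x :> grad f x"
  using Ck_Suc[of 0 f] by blast

lemma smooth_grad: "(\<And>k. Ck k f) \<Longrightarrow> Ck k (\<lambda>x. grad f x $ i)"
  using Ck_Suc by blast

lemma smooth_continuous_grad:
  assumes "\<And>k. Ck k f" shows "continuous_on S (grad f)"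
proof -
  have "continuous_on UNIV (\<lambda>x. grad f x $ i)" for i
    using smooth_grad[OF assms, of 0 i] by simp
  then have "continuous_on UNIV (\<lambda>x. \<chi> i. grad f x $ i)" by (rule continuous_on_vec_lambda)
  then have "continuous_on UNIV (grad f)" by simp
  then show ?thesis by (rule continuous_on_subset) simp
qed

lemma Cc_infinity_C1c:
  assumes "\<phi> \<in> Cc_infinity \<Omega>"
  obtains R where "C1c R \<phi> (grad \<phi>)"
proof -
  have sm: "\<And>k. Ck k \<phi>" and cp: "compact (closure {x. \<phi> x \<noteq> 0})"
    using assms by (auto simp: Cc_infinity_def)
  obtain R where "\<And>x. x \<in> closure {x. \<phi> x \<noteq> 0} \<Longrightarrow> norm x \<le> R"
    using compact_imp_bounded[OF cp] by (auto simp: bounded_iff)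
  then have "\<phi> x = 0" if "R < norm x" for x
    using that closure_subset by (metis (mono_tags, lifting) linorder_not_le mem_Collect_eq subsetD)
  then show thesis
    using that C1cI[of \<phi> "grad \<phi>" R] smooth_GDERIV[OF sm] smooth_continuous_grad[OF sm] by blast
qed

text \<open>The family \<open>exp (- 1 / t) / t ^ m\<close>, continued by zero to the left of \<open>0\<close>, is mapped into its linear span by
  differentiation (\<open>flat_DERIV\<close>). So no formula for higher derivatives of \<open>exp (- 1 / t)\<close> is needed.\<close>

definition flat :: "nat \<Rightarrow> real \<Rightarrow> real" where
  "flat m t = (if t > 0 then exp (- 1 / t) / t ^ m else 0)"

lemma flat_nonneg: "0 \<le> flat m t" and flat_pos: "0 < t \<Longrightarrow> 0 < flat m t"
  by (auto simp: flat_def)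

lemma flat_at_0: "((\<lambda>t. flat m t) \<longlongrightarrow> 0) (at 0)"
proof -
  have "((\<lambda>t::real. exp (- 1 / t) / t ^ m) \<longlongrightarrow> 0) (at_right 0)"
  proof -
    \<comment> \<open>Substitute \<open>s = 1 / t\<close>.\<close>
    have "((\<lambda>s::real. s ^ m / exp s) \<longlongrightarrow> 0) at_top" by (rule tendsto_power_div_exp_0)
    from filterlim_compose[OF this filterlim_inverse_at_top_right]
    show ?thesis by (simp add: power_inverse field_simps exp_minus inverse_eq_divide)
  qed
  then have "((\<lambda>t. flat m t) \<longlongrightarrow> 0) (at_right 0)"
    by (rule Lim_transform_eventually) (auto simp: eventually_at_filter flat_def)
  moreover have "((\<lambda>t. flat m t) \<longlongrightarrow> 0) (at_left 0)"
    by (rule Lim_transform_eventually[of "\<lambda>_. 0"]) (auto simp: eventually_at_filter flat_def)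
  ultimately show ?thesis by (simp add: filterlim_split_at)
qed

lemma flat_DERIV: "DERIV (flat m) t :> flat (m + 2) t - real m * flat (m + 1) t"
proof -
  consider "t > 0" | "t < 0" | "t = 0" by linarith
  then show ?thesis
  proof cases
    case 1
    have "DERIV (\<lambda>t. exp (- 1 / t) / t ^ m) t :> exp (-1/t) / t^(m+2) - real m * (exp (-1/t) / t^(m+1))"
    proof -
      have "DERIV (\<lambda>t. t ^ m) t :> real m * t ^ m / t"
        using DERIV_pow[of m t] 1 by (cases m) auto
      moreover have "DERIV (\<lambda>t. exp (- 1 / t)) t :> exp (- 1 / t) / t\<^sup>2"
        using 1 by (auto intro!: derivative_eq_intros simp: power2_eq_square)
      ultimately have "DERIV (\<lambda>t. exp (- 1 / t) / t ^ m) t :>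
          (exp (- 1 / t) / t\<^sup>2 * t ^ m - exp (- 1 / t) * (real m * t ^ m / t)) / (t ^ m * t ^ m)"
        using 1 by (intro DERIV_divide) auto
      then show ?thesis
        by (rule DERIV_cong) (use 1 in \<open>simp add: divide_simps power2_eq_square algebra_simps\<close>)
    qed
    then have d: "DERIV (\<lambda>t. exp (- 1 / t) / t ^ m) t :> flat (m + 2) t - real m * flat (m + 1) t"
      using 1 by (simp add: flat_def)
    have "eventually (\<lambda>t. exp (- 1 / t) / t ^ m = flat m t) (nhds t)"
      using 1 eventually_nhds_in_open[of "{0<..}" t] by (auto simp: flat_def elim!: eventually_mono)
    from DERIV_cong_ev[OF refl this refl] d show ?thesis by (rule iffD1)
  next
    case 2
    have "eventually (\<lambda>t. (0::real) = flat m t) (nhds t)"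
      using 2 eventually_nhds_in_open[of "{..<0}" t] by (auto simp: flat_def elim!: eventually_mono)
    from DERIV_cong_ev[OF refl this refl, of 0] have "DERIV (flat m) t :> 0" by simp
    then show ?thesis using 2 flat_def[of "m + 2" t] flat_def[of "m + 1" t] by simp
  next
    case 3
    have "((\<lambda>h. flat m h / h) \<longlongrightarrow> 0) (at 0)"
      by (rule Lim_transform_eventually[OF flat_at_0[of "m+1"]]) (auto simp: eventually_at_filter flat_def)
    then have "DERIV (flat m) 0 :> 0" by (simp add: DERIV_def flat_def[of m 0])
    then show ?thesis using 3 flat_def[of "m + 2" t] flat_def[of "m + 1" t] by simp
  qed
qed

text \<open>An algebra of functions that contains the bump \<open>flat 0 (1 - x \<bullet> x)\<close> and is closed under partial
  derivatives; all its members are therefore smooth.\<close>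

inductive bump_alg :: "(real^'n \<Rightarrow> real) \<Rightarrow> bool" where
  const: "bump_alg (\<lambda>x. c)"
| coord: "bump_alg (\<lambda>x. x $ i)"
| flat: "bump_alg (\<lambda>x. flat m (1 - x \<bullet> x))"
| add: "bump_alg f \<Longrightarrow> bump_alg g \<Longrightarrow> bump_alg (\<lambda>x. f x + g x)"
| mult: "bump_alg f \<Longrightarrow> bump_alg g \<Longrightarrow> bump_alg (\<lambda>x. f x * g x)"

lemma bump_alg_grad:
  fixes f :: "real^'n \<Rightarrow> real"
  assumes "bump_alg f"
  shows "\<exists>D. (\<forall>x. GDERIV f x :> D x) \<and> (\<forall>i. bump_alg (\<lambda>x. D x $ i))"
  using assms
proof (induction rule: bump_alg.induct)
  case (const c)
  show ?case by (intro exI[of _ "\<lambda>x. 0"]) (auto intro: GDERIV_const bump_alg.intros)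
next
  case (coord j)
  have "GDERIV (\<lambda>x::real^'n. x $ j) x :> axis j 1" for x
    unfolding gderiv_def using bounded_linear_imp_has_derivative[OF bounded_linear_vec_nth]
    by (simp add: inner_axis)
  then show ?case by (intro exI[of _ "\<lambda>x. axis j 1"]) (auto simp: bump_alg.intros)
next
  case (flat m)
  have sq: "GDERIV (\<lambda>x::real^'n. 1 - x \<bullet> x) x :> (-2) *\<^sub>R x" for x
    unfolding gderiv_def by (auto intro!: derivative_eq_intros simp: inner_commute)
  let ?d = "\<lambda>x::real^'n. flat (m + 2) (1 - x \<bullet> x) + (- real m) * flat (m + 1) (1 - x \<bullet> x)"
  have "GDERIV (\<lambda>x::real^'n. flat m (1 - x \<bullet> x)) x :> ?d x *\<^sub>R (-2) *\<^sub>R x" for x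
    using GDERIV_DERIV_compose[OF sq flat_DERIV] by simp
  moreover have "bump_alg (\<lambda>x. ?d x * ((-2) * x $ i))" for i by (intro bump_alg.intros)
  moreover have "(?d x *\<^sub>R (-2) *\<^sub>R x) $ i = ?d x * ((-2) * x $ i)" for x i by simp
  ultimately show ?case by (intro exI[of _ "\<lambda>x. ?d x *\<^sub>R (-2) *\<^sub>R x"]) presburger
next
  case (add f g)
  then obtain D E where "\<forall>x. GDERIV f x :> D x" "\<forall>i. bump_alg (\<lambda>x. D x $ i)"
    "\<forall>x. GDERIV g x :> E x" "\<forall>i. bump_alg (\<lambda>x. E x $ i)" by blast
  then show ?case by (intro exI[of _ "\<lambda>x. D x + E x"]) (auto intro: GDERIV_add bump_alg.intros)
next
  case (mult f g)
  then obtain D E where "\<forall>x. GDERIV f x :> D x" "\<forall>i. bump_alg (\<lambda>x. D x $ i)"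
    "\<forall>x. GDERIV g x :> E x" "\<forall>i. bump_alg (\<lambda>x. E x $ i)" by blast
  moreover from this have "bump_alg (\<lambda>x. f x * E x $ i + g x * D x $ i)" for i
    using mult.hyps by (intro bump_alg.add bump_alg.mult) auto
  ultimately show ?case
    by (intro exI[of _ "\<lambda>x. f x *\<^sub>R E x + g x *\<^sub>R D x"]) (auto intro: GDERIV_mult)
qed

lemma bump_alg_Ck: "bump_alg f \<Longrightarrow> Ck k f"
proof (induction k arbitrary: f)
  case 0
  then show ?case using bump_alg_grad[OF 0] by (auto intro: GDERIV_continuous_on)
next
  case (Suc k)
  obtain D where D: "\<forall>x. GDERIV f x :> D x" "\<forall>i. bump_alg (\<lambda>x. D x $ i)"
    using bump_alg_grad[OF Suc.prems] by blast
  then have "grad f = D" by (auto intro: GDERIV_imp_grad)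
  then show ?case unfolding Ck_Suc using D Suc.IH by auto
qed

lemma Ck_cmult: "Ck k f \<Longrightarrow> Ck k (\<lambda>x. c * f x)"
proof (induction k arbitrary: f)
  case 0 then show ?case by (auto intro: continuous_intros)
next
  case (Suc k)
  have "GDERIV (\<lambda>x. c * f x) x :> c *\<^sub>R grad f x" for x
    using GDERIV_mult[OF GDERIV_const[of c x]] Suc.prems[unfolded Ck_Suc] by fastforce
  moreover from this have "grad (\<lambda>x. c * f x) = (\<lambda>x. c *\<^sub>R grad f x)" by (auto intro: GDERIV_imp_grad)
  ultimately show ?case using Suc unfolding Ck_Suc by auto
qed

lemma Ck_affine: "Ck k f \<Longrightarrow> Ck k (\<lambda>x. f (a + s *\<^sub>R x))"
proof (induction k arbitrary: f)
  case 0 then show ?case by (auto intro!: continuous_intros continuous_on_compose2[of UNIV f])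
next
  case (Suc k)
  have "GDERIV (\<lambda>x. f (a + s *\<^sub>R x)) x :> s *\<^sub>R grad f (a + s *\<^sub>R x)" for x
    using GDERIV_affine Suc.prems[unfolded Ck_Suc] by blast
  moreover from this have "grad (\<lambda>x. f (a + s *\<^sub>R x)) = (\<lambda>x. s *\<^sub>R grad f (a + s *\<^sub>R x))"
    by (auto intro: GDERIV_imp_grad)
  moreover have "Ck k (\<lambda>x. s * grad f (a + s *\<^sub>R x) $ i)" for i
    using Ck_cmult[OF Suc.IH[of "\<lambda>x. grad f x $ i"]] Suc.prems unfolding Ck_Suc by auto
  ultimately show ?case unfolding Ck_Suc by auto
qed

definition mollifier :: "real^'n \<Rightarrow> real" where
  "mollifier x = flat 0 (1 - x \<bullet> x) / (LINT y|lborel. flat 0 (1 - y \<bullet> (y::real^'n)))"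

lemma mollifier_raw:
  fixes b :: "real^'n \<Rightarrow> real" defines "b \<equiv> \<lambda>x. flat 0 (1 - x \<bullet> x)"
  shows "\<And>k. Ck k b" "\<And>x. 1 \<le> norm x \<Longrightarrow> b x = 0" "\<And>x. norm x < 1 \<Longrightarrow> 0 < b x" "\<And>x. 0 \<le> b x"
    "integrable lborel b" "0 < (LINT x|lborel. b x)"
proof -
  show sm: "\<And>k. Ck k b" unfolding b_def by (intro bump_alg_Ck bump_alg.intros)
  show out: "b x = 0" if "1 \<le> norm x" for x
  proof -
    have "1 \<le> x \<bullet> x" using that by (metis power2_norm_eq_inner one_le_power)
    then show ?thesis by (simp add: b_def flat_def)
  qed
  show pos: "0 < b x" if "norm x < 1" for x
    using that unfolding b_def
    by (intro flat_pos) (metis abs_norm_cancel abs_square_less_1 diff_gt_0_iff_gt power2_norm_eq_inner)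
  show nn: "0 \<le> b x" for x by (simp add: b_def flat_nonneg)
  have c: "continuous_on UNIV b" using sm[of 0] by simp
  have "b = (\<lambda>x. indicator (cball 0 1) x *\<^sub>R b x)"
    using out by (auto simp: indicator_def fun_eq_iff)
  moreover have "integrable lborel (\<lambda>x. indicator (cball 0 1) x *\<^sub>R b x)"
    by (intro borel_integrable_compact) (auto intro: continuous_on_subset[OF c])
  ultimately show int: "integrable lborel b" by simp
  have "\<not> (AE x in lborel. b x = 0)"
  proof
    assume "AE x in lborel. b x = 0"
    then have "AE x in lborel. x \<notin> ball (0::real^'n) 1"
      by (rule AE_mp) (use pos in \<open>auto intro!: AE_I2 simp: less_le\<close>)
    then have "ball (0::real^'n) 1 \<in> null_sets lborel" by (subst AE_iff_null_sets) auto
    then have "ball (0::real^'n) 1 \<in> null_sets lebesgue" by (rule null_sets_completionI)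
    then have "negligible (ball (0::real^'n) 1)" by (simp add: negligible_iff_null_sets)
    then show False using open_not_negligible[of "ball (0::real^'n) 1"] by simp
  qed
  then show "0 < (LINT x|lborel. b x)"
    using integral_nonneg_eq_0_iff_AE[OF int] nn Bochner_Integration.integral_nonneg[of lborel b]
    by (metis (no_types, lifting) AE_I2 less_le)
qed

lemma mollifier:
  fixes x :: "real^'n"
  shows "Ck k (mollifier :: real^'n \<Rightarrow> real)" "1 \<le> norm x \<Longrightarrow> mollifier x = 0" "0 \<le> mollifier x"
    "integrable lborel (mollifier :: real^'n \<Rightarrow> real)" "(LINT x|lborel. mollifier (x::real^'n)) = 1"
proof -
  note r = mollifier_raw[where 'n='n]
  have eq: "(mollifier :: real^'n \<Rightarrow> real) =
      (\<lambda>x. inverse (LINT y|lborel. flat 0 (1 - y \<bullet> (y::real^'n))) * flat 0 (1 - x \<bullet> x))"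
    by (auto simp: mollifier_def fun_eq_iff field_simps)
  show "Ck k (mollifier :: real^'n \<Rightarrow> real)" unfolding eq by (intro Ck_cmult r)
  show "mollifier x = 0" if "1 \<le> norm x" using r(2)[OF that] by (simp add: mollifier_def)
  show "0 \<le> mollifier x" using r(4)[of x] r(6) by (simp add: mollifier_def)
  show "integrable lborel (mollifier :: real^'n \<Rightarrow> real)" unfolding eq using r(5) by simp
  show "(LINT x|lborel. mollifier (x::real^'n)) = 1" unfolding eq using r(6) by simp
qed

section \<open>Integration over Euclidean space\<close>

lemma lborel_integral_affine:
  fixes f :: "'a::euclidean_space \<Rightarrow> 'b::{banach, second_countable_topology}"
  assumes "c \<noteq> 0" and [measurable]: "f \<in> borel_measurable borel"
  shows "integrable lborel (\<lambda>x. f (t + c *\<^sub>R x)) \<longleftrightarrow> integrable lborel f"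
    and "(LINT x|lborel. f x) = \<bar>c\<bar> ^ DIM('a) *\<^sub>R (LINT x|lborel. f (t + c *\<^sub>R x))"
proof -
  have "integrable lborel f \<longleftrightarrow>
      integrable (density (distr lborel borel (\<lambda>x. t + c *\<^sub>R x)) (\<lambda>_. ennreal (\<bar>c\<bar> ^ DIM('a)))) f"
    using lborel_affine[OF assms(1), of t] by (simp add: ennreal_power)
  also have "\<dots> \<longleftrightarrow> integrable lborel (\<lambda>x. \<bar>c\<bar> ^ DIM('a) *\<^sub>R f (t + c *\<^sub>R x))"
    by (subst integrable_density) (auto simp: integrable_distr_eq)
  also have "\<dots> \<longleftrightarrow> integrable lborel (\<lambda>x. f (t + c *\<^sub>R x))"
  proof
    assume i: "integrable lborel (\<lambda>x. \<bar>c\<bar> ^ DIM('a) *\<^sub>R f (t + c *\<^sub>R x))"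
    have "integrable lborel (\<lambda>x. inverse (\<bar>c\<bar> ^ DIM('a)) *\<^sub>R \<bar>c\<bar> ^ DIM('a) *\<^sub>R f (t + c *\<^sub>R x))"
      by (rule integrable_scaleR_right) (rule i)
    then show "integrable lborel (\<lambda>x. f (t + c *\<^sub>R x))" using assms(1) by simp
  qed auto
  finally show "integrable lborel (\<lambda>x. f (t + c *\<^sub>R x)) \<longleftrightarrow> integrable lborel f" by simp
  have "(LINT x|lborel. f x) =
      (LINT x|density (distr lborel borel (\<lambda>x. t + c *\<^sub>R x)) (\<lambda>_. ennreal (\<bar>c\<bar> ^ DIM('a))). f x)"
    using lborel_affine[OF assms(1), of t] by (simp add: ennreal_power)
  also have "\<dots> = (LINT x|lborel. \<bar>c\<bar> ^ DIM('a) *\<^sub>R f (t + c *\<^sub>R x))"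
    by (subst integral_density) (auto simp: integral_distr)
  finally show "(LINT x|lborel. f x) = \<bar>c\<bar> ^ DIM('a) *\<^sub>R (LINT x|lborel. f (t + c *\<^sub>R x))"
    by simp
qed

lemma lborel_integral_reflect:
  fixes f :: "'a::euclidean_space \<Rightarrow> 'b::{banach, second_countable_topology}"
  assumes [measurable]: "f \<in> borel_measurable borel"
  shows "integrable lborel (\<lambda>y. f (x - y)) \<longleftrightarrow> integrable lborel f"
    and "(LINT y|lborel. f (x - y)) = (LINT y|lborel. f y)"
  using lborel_integral_affine[of "-1" f x] by auto

lemma lborel_integral_translate:
  fixes f :: "'a::euclidean_space \<Rightarrow> 'b::{banach, second_countable_topology}"
  assumes "f \<in> borel_measurable borel"
  shows "integrable lborel (\<lambda>x. f (x + h)) \<longleftrightarrow> integrable lborel f"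
    and "(LINT x|lborel. f (x + h)) = (LINT x|lborel. f x)"
  using lborel_integral_affine[of 1 f h] assms by (auto simp: add.commute)

lemma integrable_scaleR_bounded:
  fixes k :: "'a \<Rightarrow> 'b::{banach, second_countable_topology}" and f :: "'a \<Rightarrow> real"
  assumes "integrable M f" "k \<in> borel_measurable M" "\<And>x. norm (k x) \<le> C"
  shows "integrable M (\<lambda>x. f x *\<^sub>R k x)"
proof (rule Bochner_Integration.integrable_bound)
  show "integrable M (\<lambda>x. C * norm (f x))" using assms(1) by (intro integrable_mult_right integrable_norm)
  show "(\<lambda>x. f x *\<^sub>R k x) \<in> borel_measurable M"
    using assms by (intro borel_measurable_scaleR) auto
  have "norm (f x *\<^sub>R k x) \<le> norm (C * norm (f x))" for x
  proof -
    have "0 \<le> C" using assms(3)[of x] norm_ge_zero order_trans by blast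
    then show ?thesis using assms(3)[of x]
      by (simp add: abs_mult mult.commute[of C] mult_left_mono)
  qed
  then show "AE x in M. norm (f x *\<^sub>R k x) \<le> norm (C * norm (f x))" by simp
qed

lemma integrable_bounded_scaleR:
  fixes k :: "'a \<Rightarrow> 'b::{banach, second_countable_topology}" and f :: "'a \<Rightarrow> real"
  assumes "integrable M k" "f \<in> borel_measurable M" "\<And>x. \<bar>f x\<bar> \<le> C"
  shows "integrable M (\<lambda>x. f x *\<^sub>R k x)"
proof (rule Bochner_Integration.integrable_bound)
  show "integrable M (\<lambda>x. C * norm (k x))" using assms(1) by (intro integrable_mult_right integrable_norm)
  show "(\<lambda>x. f x *\<^sub>R k x) \<in> borel_measurable M"
    using assms by (intro borel_measurable_scaleR) auto
  have "norm (f x *\<^sub>R k x) \<le> norm (C * norm (k x))" for x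
  proof -
    have "0 \<le> C" using assms(3)[of x] abs_ge_zero order_trans by blast
    then show ?thesis using assms(3)[of x] by (simp add: abs_mult mult_right_mono)
  qed
  then show "AE x in M. norm (f x *\<^sub>R k x) \<le> norm (C * norm (k x))" by simp
qed

text \<open>The kernel comes first and may be vector valued, so that the gradient of a convolution is again a
  convolution, with the gradient of the kernel.\<close>

definition conv :: "('a::euclidean_space \<Rightarrow> 'b) \<Rightarrow> ('a \<Rightarrow> real) \<Rightarrow> 'a \<Rightarrow> 'b::{banach, second_countable_topology}" where
  "conv k f x = (LINT y|lborel. f y *\<^sub>R k (x - y))"

lemma conv_integrable:
  fixes k :: "'a::euclidean_space \<Rightarrow> 'b::{banach, second_countable_topology}"
  assumes "integrable lborel f" "k \<in> borel_measurable borel" "\<And>x. norm (k x) \<le> C"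
  shows "integrable lborel (\<lambda>y. f y *\<^sub>R k (x - y))"
  using assms by (intro integrable_scaleR_bounded[where C=C]) auto

lemma conv_continuous:
  fixes k :: "'a::euclidean_space \<Rightarrow> 'b::{banach, second_countable_topology}"
  assumes f: "integrable lborel f" and k: "k \<in> borel_measurable borel" "\<And>x. norm (k x) \<le> C"
    and uc: "uniformly_continuous_on UNIV k"
  shows "continuous_on UNIV (conv k f)"
  unfolding continuous_on_iff
proof (intro ballI allI impI)
  fix x :: 'a and e :: real assume e: "0 < e"
  define N where "N = (LINT y|lborel. \<bar>f y\<bar>) + 1"
  have N: "0 < N" unfolding N_def by (simp add: add_nonneg_pos)
  obtain d where d: "0 < d" "\<And>x y. dist y x < d \<Longrightarrow> dist (k y) (k x) < e / N"
    using uc e N unfolding uniformly_continuous_on_def by (metis UNIV_I divide_pos_pos)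
  show "\<exists>d>0. \<forall>y\<in>UNIV. dist y x < d \<longrightarrow> dist (conv k f y) (conv k f x) < e"
  proof (intro exI[of _ d] conjI ballI impI d(1))
    fix y assume y: "dist y x < d"
    note i = conv_integrable[OF f k]
    have bd: "norm (k (y - u) - k (x - u)) \<le> e / N" for u
      using d(2)[of "y - u" "x - u"] y by (simp add: dist_norm)
    have "norm (conv k f y - conv k f x) = norm (LINT u|lborel. f u *\<^sub>R (k (y - u) - k (x - u)))"
      unfolding conv_def scaleR_diff_right by (subst Bochner_Integration.integral_diff[OF i i]) simp
    also have "\<dots> \<le> (LINT u|lborel. norm (f u *\<^sub>R (k (y - u) - k (x - u))))"
      by (rule integral_norm_bound)
    also have "\<dots> \<le> (LINT u|lborel. \<bar>f u\<bar> * (e / N))"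
    proof (rule integral_mono)
      show "integrable lborel (\<lambda>u. norm (f u *\<^sub>R (k (y - u) - k (x - u))))"
        unfolding scaleR_diff_right using i by (intro integrable_norm Bochner_Integration.integrable_diff)
      show "integrable lborel (\<lambda>u. \<bar>f u\<bar> * (e / N))" using f by simp
      show "norm (f u *\<^sub>R (k (y - u) - k (x - u))) \<le> \<bar>f u\<bar> * (e / N)" for u
        unfolding norm_scaleR by (rule mult_left_mono[OF bd]) simp
    qed
    also have "\<dots> = (N - 1) * (e / N)" by (simp add: N_def)
    also have "\<dots> < e" using N e by (simp add: field_simps)
    finally show "dist (conv k f y) (conv k f x) < e" by (simp add: dist_norm)
  qed
qed

lemma C1_linearization:
  fixes k :: "'a::euclidean_space \<Rightarrow> real"
  assumes "\<And>x. GDERIV k x :> D x" "\<And>x. dist x a \<le> dist b a \<Longrightarrow> dist (D x) (D a) \<le> B"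
  shows "\<bar>k b - k a - (b - a) \<bullet> D a\<bar> \<le> B * norm (b - a)"
proof -
  have "norm (k b - k a - (\<lambda>h. h \<bullet> D a) (b - a)) \<le> norm (b - a) * B"
  proof (rule differentiable_bound_linearization[where S="cball a (dist b a)" and f'="\<lambda>x h. h \<bullet> D x"])
    fix t :: real assume t: "t \<in> {0..1}"
    have "norm (t *\<^sub>R (b - a)) \<le> norm (b - a)" using t by (simp add: mult_left_le_one_le)
    then show "a + t *\<^sub>R (b - a) \<in> cball a (dist b a)" by (simp add: dist_norm)
  next
    fix x show "(k has_derivative (\<lambda>h. h \<bullet> D x)) (at x within cball a (dist b a))"
      by (rule has_derivative_at_withinI[OF GDERIV_D[OF assms(1)]])
  next
    fix x assume "x \<in> cball a (dist b a)"
    then have "norm (D x - D a) \<le> B" using assms(2)[of x] by (simp add: dist_norm norm_minus_commute)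
    then have "norm (h \<bullet> (D x - D a)) \<le> B * norm h" for h
      by (metis Cauchy_Schwarz_ineq2 mult.commute mult_right_mono norm_ge_zero order_trans real_norm_def)
    then show "onorm ((\<lambda>h. h \<bullet> D x) - (\<lambda>h. h \<bullet> D a)) \<le> B"
      by (intro onorm_le) (simp add: inner_diff_right)
  qed simp
  then show ?thesis by (simp add: mult.commute)
qed

text \<open>The remainder of the linearization of \<open>k\<close> is uniformly small, since \<open>D\<close> is uniformly continuous;
  integration against \<open>f\<close> preserves this.\<close>

lemma conv_GDERIV:
  fixes k :: "real^'n \<Rightarrow> real"
  assumes f: "integrable lborel f" and k: "C1b k D" and uc: "uniformly_continuous_on UNIV D"
  shows "GDERIV (conv k f) x :> conv D f x"
proof -
  obtain C where C: "\<And>x. norm (k x) \<le> C" "\<And>x. norm (D x) \<le> C" using C1b_bound[OF k] by (metis real_norm_def)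
  note ik = conv_integrable[OF f C1b_borel(1)[OF k] C(1)] and iD = conv_integrable[OF f C1b_borel(2)[OF k] C(2)]
  define N where "N = (LINT y|lborel. \<bar>f y\<bar>) + 1"
  have N: "0 < N" unfolding N_def by (simp add: add_nonneg_pos)
  show ?thesis
    unfolding gderiv_def has_derivative_at_alt
  proof (intro conjI allI impI bounded_linear_inner_left)
    fix e :: real assume e: "0 < e"
    obtain d where d: "0 < d" "\<And>x y. dist y x < d \<Longrightarrow> dist (D y) (D x) < e / N"
      using uc e N unfolding uniformly_continuous_on_def by (metis UNIV_I divide_pos_pos)
    show "\<exists>d>0. \<forall>y. norm (y - x) < d \<longrightarrow>
        norm (conv k f y - conv k f x - (y - x) \<bullet> conv D f x) \<le> e * norm (y - x)"
    proof (intro exI[of _ d] conjI allI impI d(1))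
      fix y assume y: "norm (y - x) < d"
      define g where "g u = k (y - u) - k (x - u) - (y - x) \<bullet> D (x - u)" for u
      have bd: "\<bar>g u\<bar> \<le> e / N * norm (y - x)" for u
      proof -
        have "dist (D z) (D (x - u)) \<le> e / N" if "dist z (x - u) \<le> dist (y - u) (x - u)" for z
          using d(2)[of z "x - u"] that y by (simp add: dist_norm)
        from C1_linearization[OF C1b_GDERIV[OF k], of "x - u" "y - u", OF this]
        show ?thesis by (simp add: g_def)
      qed
      have eq: "f u * g u = f u *\<^sub>R k (y - u) - f u *\<^sub>R k (x - u) - (y - x) \<bullet> (f u *\<^sub>R D (x - u))" for u
        by (simp add: g_def algebra_simps)
      have ig: "integrable lborel (\<lambda>u. f u * g u)"
        unfolding eq using ik iD by (intro Bochner_Integration.integrable_diff integrable_inner_right) auto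
      have "(LINT u|lborel. f u * g u) = conv k f y - conv k f x - (y - x) \<bullet> conv D f x"
        unfolding eq conv_def using ik iD
        by (simp add: Bochner_Integration.integral_diff Bochner_Integration.integrable_diff integrable_inner_right
             del: inner_scaleR_right)
      then have "norm (conv k f y - conv k f x - (y - x) \<bullet> conv D f x) = norm (LINT u|lborel. f u * g u)"
        by simp
      also have "\<dots> \<le> (LINT u|lborel. norm (f u * g u))"
        by (rule integral_norm_bound)
      also have "\<dots> \<le> (LINT u|lborel. \<bar>f u\<bar> * (e / N * norm (y - x)))"
      proof (rule integral_mono)
        show "integrable lborel (\<lambda>u. norm (f u * g u))" using ig by (rule integrable_norm)
        show "integrable lborel (\<lambda>u. \<bar>f u\<bar> * (e / N * norm (y - x)))" using f by simp
        show "norm (f u * g u) \<le> \<bar>f u\<bar> * (e / N * norm (y - x))" for u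
          by (simp only: real_norm_def abs_mult, rule mult_left_mono[OF bd]) simp
      qed
      also have "\<dots> = (N - 1) * (e / N * norm (y - x))" by (simp add: N_def)
      also have "\<dots> \<le> N * (e / N * norm (y - x))" using e N by (intro mult_right_mono) auto
      also have "\<dots> = e * norm (y - x)" using N by simp
      finally show "norm (conv k f y - conv k f x - (y - x) \<bullet> conv D f x) \<le> e * norm (y - x)" .
    qed
  qed
qed

lemma C1c_uniformly_continuous:
  assumes "C1c R f D" shows "uniformly_continuous_on UNIV f" "uniformly_continuous_on UNIV D"
  using assms C1b_continuous[of f D UNIV]
  by (auto simp: C1c_def intro!: continuous_vanishing_bounded(2)[of _ R])

lemma C1c_integrable:
  assumes "C1c R f D" shows "integrable lborel f" "integrable lborel D"
proof -
  have *: "integrable lborel g" if "continuous_on UNIV g" "\<And>x. R < norm x \<Longrightarrow> g x = 0"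
    for g :: "real^'n \<Rightarrow> 'b::{banach, second_countable_topology}"
  proof -
    have "integrable lborel (\<lambda>x. indicator (cball 0 R) x *\<^sub>R g x)"
      by (intro borel_integrable_compact continuous_on_subset[OF that(1)]) auto
    moreover have "indicator (cball 0 R) x *\<^sub>R g x = g x" for x
      using that(2)[of x] by (auto simp: indicator_def)
    ultimately show ?thesis by simp
  qed
  show "integrable lborel f" "integrable lborel D"
    using assms C1b_continuous[of f D UNIV] by (auto simp: C1c_def intro!: *)
qed

text \<open>The integral of a compactly supported gradient vanishes: convolved with the indicator of a large
  ball, the function becomes constant near the origin.\<close>

lemma C1c_integral_grad:
  fixes f :: "real^'n \<Rightarrow> real"
  assumes "C1c R f D" shows "(LINT x|lborel. D x) = 0"
proof -
  define b :: "real^'n \<Rightarrow> real" where "b = indicator (ball 0 (R + 1))"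
  note f = assms C1c_C1b[OF assms]
  note meas = C1b_borel[OF f(2)]
  have b: "integrable lborel b"
    unfolding b_def using emeasure_lborel_ball_finite[of "0::real^'n" "R + 1"]
    by (intro integrable_real_indicator) (auto simp: less_top)
  have near: "b y *\<^sub>R g (x - y) = g (x - y)"
    if "x \<in> ball 0 1" "\<And>x. R < norm x \<Longrightarrow> g x = 0" for x y and g :: "real^'n \<Rightarrow> 'c::real_vector"
  proof (cases "y \<in> ball 0 (R + 1)")
    case False
    then have "R < norm (x - y)"
      using that(1) norm_triangle_ineq2[of y x] by (simp add: norm_minus_commute)
    then show ?thesis using that(2) by simp
  qed (simp add: b_def)
  have c: "conv f b x = (LINT y|lborel. f y)" if "x \<in> ball 0 1" for x
  proof -
    have "conv f b x = (LINT y|lborel. f (x - y))"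
      unfolding conv_def by (intro Bochner_Integration.integral_cong near[OF that] refl)
        (use f(1) in \<open>auto simp: C1c_def\<close>)
    then show ?thesis using lborel_integral_reflect(2)[OF meas(1), of x] by simp
  qed
  have "GDERIV (conv f b) 0 :> conv D b 0"
    by (rule conv_GDERIV[OF b f(2) C1c_uniformly_continuous(2)[OF f(1)]])
  then have "((\<lambda>x. (LINT y|lborel. f y)) has_derivative (\<lambda>h. h \<bullet> conv D b 0)) (at 0)"
    by (rule has_derivative_transform_within_open[OF GDERIV_D, of _ _ _ "ball 0 1"]) (auto simp: c)
  then have "(\<lambda>h. h \<bullet> conv D b 0) = (\<lambda>h. 0)"
    using has_derivative_unique has_derivative_const by blast
  then have "conv D b 0 \<bullet> conv D b 0 = 0" by metis
  then have "conv D b 0 = 0" by simp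
  moreover have "conv D b 0 = (LINT y|lborel. D (0 - y))"
    unfolding conv_def by (intro Bochner_Integration.integral_cong near refl)
      (use f(1) in \<open>auto simp: C1c_def\<close>)
  moreover have "\<dots> = (LINT y|lborel. D y)" by (rule lborel_integral_reflect(2)[OF meas(2)])
  ultimately show ?thesis by simp
qed

lemma C1c_mult:
  assumes "C1c R f D" "C1b g E" shows "C1c R (\<lambda>x. f x * g x) (\<lambda>x. f x *\<^sub>R E x + g x *\<^sub>R D x)"
  using assms C1b_mult[of f D g E] by (auto simp: C1c_def)

lemma integration_by_parts:
  assumes "C1c R f D" "C1b g E"
  shows "(LINT x|lborel. f x *\<^sub>R E x) = - (LINT x|lborel. g x *\<^sub>R D x)"
proof -
  obtain C where C: "\<And>x. norm (g x) \<le> C" "\<And>x. norm (E x) \<le> C"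
    using C1b_bound[OF assms(2)] by (metis real_norm_def)
  note i = C1c_integrable[OF assms(1)] and m = C1b_borel[OF assms(2)]
  have "(LINT x|lborel. f x *\<^sub>R E x + g x *\<^sub>R D x) = 0"
    by (rule C1c_integral_grad[OF C1c_mult[OF assms]])
  moreover have "integrable lborel (\<lambda>x. f x *\<^sub>R E x)"
    using i(1) m(2) C(2) by (intro integrable_scaleR_bounded[where C=C]) auto
  moreover have "integrable lborel (\<lambda>x. g x *\<^sub>R D x)"
    using i(2) m(1) C(1) by (intro integrable_bounded_scaleR[where C=C]) auto
  ultimately show ?thesis
    by (simp add: eq_neg_iff_add_eq_0)
qed

lemma conv_smooth:
  assumes f: "integrable lborel f"
  shows "\<lbrakk>\<And>m. Ck m k; \<And>x. R < norm x \<Longrightarrow> k x = 0\<rbrakk> \<Longrightarrow> Ck m (conv k f)"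
proof (induction m arbitrary: k)
  case 0
  have c: "C1c R k (grad k)"
    by (rule C1cI[OF smooth_GDERIV[OF 0(1)] smooth_continuous_grad[OF 0(1)] 0(2)])
  then obtain C where "\<And>x. norm (k x) \<le> C"
    using C1b_bound[OF C1c_C1b[OF c]] by (metis real_norm_def)
  then have "continuous_on UNIV (conv k f)"
    by (rule conv_continuous[OF f C1b_borel(1)[OF C1c_C1b[OF c]] _ C1c_uniformly_continuous(1)[OF c]])
  then show ?case by simp
next
  case (Suc m)
  have c: "C1c R k (grad k)"
    by (rule C1cI[OF smooth_GDERIV[OF Suc(2)] smooth_continuous_grad[OF Suc(2)] Suc(3)])
  obtain C where C: "\<And>x. norm (grad k x) \<le> C"
    using C1b_bound[OF C1c_C1b[OF c]] by (metis real_norm_def)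
  have g: "GDERIV (conv k f) x :> conv (grad k) f x" for x
    by (rule conv_GDERIV[OF f C1c_C1b[OF c] C1c_uniformly_continuous(2)[OF c]])
  then have "grad (conv k f) x $ i = conv (\<lambda>x. grad k x $ i) f x" for x i
  proof -
    have "conv (grad k) f x $ i = (LINT y|lborel. (f y *\<^sub>R grad k (x - y)) \<bullet> axis i 1)"
      unfolding conv_def inner_axis[symmetric]
      by (subst integral_inner_left[OF conv_integrable[OF f C1b_borel(2)[OF C1c_C1b[OF c]] C]])
         (simp add: inner_axis)
    then show ?thesis using GDERIV_imp_grad[OF g] by (simp add: conv_def inner_axis)
  qed
  moreover have "Ck m (conv (\<lambda>x. grad k x $ i) f)" for i
    by (rule Suc.IH) (use c smooth_grad[OF Suc(2)] in \<open>auto simp: C1c_def\<close>)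
  ultimately show ?case unfolding Ck_Suc using g GDERIV_imp_grad[OF g] by simp
qed

section \<open>Averages over small shifts\<close>

definition trans_mod :: "('a::euclidean_space \<Rightarrow> 'b::{banach, second_countable_topology}) \<Rightarrow> 'a \<Rightarrow> real" where
  "trans_mod f h = (LINT x|lborel. norm (f (x + h) - f x))"

lemma integrable_translate:
  fixes f :: "'a::euclidean_space \<Rightarrow> 'b::{banach, second_countable_topology}"
  assumes "integrable lborel f" shows "integrable lborel (\<lambda>x. f (x + h))"
  using lborel_integral_translate(1)[of f h] assms by auto

lemma trans_mod_nonneg: "0 \<le> trans_mod f h"
  by (simp add: trans_mod_def)

lemma trans_mod_triangle:
  fixes f :: "'a::euclidean_space \<Rightarrow> 'b::{banach, second_countable_topology}"
  assumes f: "integrable lborel f" and g: "integrable lborel g"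
  shows "trans_mod f h \<le> trans_mod g h + 2 * (LINT x|lborel. norm (f x - g x))"
proof -
  note t = integrable_translate[OF f, of h] integrable_translate[OF g, of h]
  have d: "integrable lborel (\<lambda>x. norm (f x - g x))" "integrable lborel (\<lambda>x. norm (f (x + h) - g (x + h)))"
    "integrable lborel (\<lambda>x. norm (g (x + h) - g x))" "integrable lborel (\<lambda>x. norm (f (x + h) - f x))"
    using f g t by auto
  have "trans_mod f h \<le> (LINT x|lborel. norm (g (x + h) - g x) + norm (f (x + h) - g (x + h)) + norm (f x - g x))"
    unfolding trans_mod_def
  proof (rule integral_mono)
    fix x
    have "f (x + h) - f x = (g (x + h) - g x) + (f (x + h) - g (x + h)) + (g x - f x)" by simp
    then show "norm (f (x + h) - f x) \<le> norm (g (x + h) - g x) + norm (f (x + h) - g (x + h)) + norm (f x - g x)"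
      by (metis norm_add_rule_thm norm_minus_commute order_refl)
  qed (use d in auto)
  also have "\<dots> = trans_mod g h + (LINT x|lborel. norm (f (x + h) - g (x + h))) + (LINT x|lborel. norm (f x - g x))"
    using d by (simp add: trans_mod_def)
  also have "(LINT x|lborel. norm (f (x + h) - g (x + h))) = (LINT x|lborel. norm (f x - g x))"
    using lborel_integral_translate(2)[of "\<lambda>x. norm (f x - g x)" h] d(1) by auto
  finally show ?thesis by simp
qed

text \<open>For an indicator, translation preserves the integral, so the negative and the positive part of the
  difference have the same integral. The positive part lives on \<open>U\<close> and tends to zero at each of its points
  because \<open>U\<close> is open.\<close>

lemma trans_mod_open:
  fixes U :: "'a::euclidean_space set" and c :: "'b::{banach, second_countable_topology}"
  assumes U: "open U" "emeasure lborel U < \<infinity>" and h: "h \<longlonglongrightarrow> 0"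
  shows "(\<lambda>n. trans_mod (\<lambda>x. indicator U x *\<^sub>R c) (h n)) \<longlonglongrightarrow> 0"
proof -
  have [measurable]: "U \<in> sets borel" using U by auto
  let ?I = "indicator U :: 'a \<Rightarrow> real"
  have i: "integrable lborel ?I" using U by (intro integrable_real_indicator) auto
  have it: "integrable lborel (\<lambda>x. ?I (x + h n))" for n by (rule integrable_translate[OF i])
  define p where "p n x = max 0 (?I x - ?I (x + h n))" for n x
  have ip: "integrable lborel (p n)" for n
    unfolding p_def using i it by (intro integrable_max) auto
  have eq: "trans_mod (\<lambda>x. ?I x *\<^sub>R c) (h n) = 2 * norm c * (LINT x|lborel. p n x)" for n
  proof -
    have "norm (?I (x + h n) *\<^sub>R c - ?I x *\<^sub>R c) = norm c * (2 * p n x + (?I (x + h n) - ?I x))" for x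
      by (auto simp: p_def indicator_def)
    then have "trans_mod (\<lambda>x. ?I x *\<^sub>R c) (h n) =
        norm c * (2 * (LINT x|lborel. p n x) + ((LINT x|lborel. ?I (x + h n)) - (LINT x|lborel. ?I x)))"
      unfolding trans_mod_def using ip it i
      by (simp del: Bochner_Integration.integral_indicator)
    then show ?thesis using lborel_integral_translate(2)[of ?I "h n"] by simp
  qed
  have "(\<lambda>n. LINT x|lborel. p n x) \<longlonglongrightarrow> (LINT x|(lborel::'a measure). 0)"
  proof (rule integral_dominated_convergence[where w="?I"])
    show "AE x in lborel. (\<lambda>n. p n x) \<longlonglongrightarrow> 0"
    proof (intro AE_I2)
      fix x show "(\<lambda>n. p n x) \<longlonglongrightarrow> 0"
      proof (cases "x \<in> U")
        case True
        have "(\<lambda>n. x + h n) \<longlonglongrightarrow> x" using tendsto_add[OF tendsto_const h, of x] by simp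
        then have "eventually (\<lambda>n. x + h n \<in> U) sequentially"
          using U(1) True topological_tendstoD by blast
        then have "eventually (\<lambda>n. 0 = p n x) sequentially"
          by eventually_elim (auto simp: p_def)
        then show ?thesis by (rule Lim_transform_eventually[OF tendsto_const])
      qed (auto simp: p_def)
    qed
    show "AE x in lborel. norm (p n x) \<le> ?I x" for n
      by (auto simp: p_def indicator_def)
  qed (use i ip in auto)
  then have "(\<lambda>n. 2 * norm c * (LINT x|lborel. p n x)) \<longlonglongrightarrow> 2 * norm c * 0"
    by (intro tendsto_intros) simp
  then show ?thesis by (simp add: eq)
qed

lemma tendsto_zero_by_approx:
  fixes a :: "nat \<Rightarrow> real"
  assumes "\<And>e. 0 < e \<Longrightarrow> \<exists>b. b \<longlonglongrightarrow> 0 \<and> (\<forall>n. \<bar>a n\<bar> \<le> b n + e)"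
  shows "a \<longlonglongrightarrow> 0"
proof (rule LIMSEQ_I)
  fix r :: real assume "0 < r"
  then obtain b where b: "b \<longlonglongrightarrow> 0" "\<And>n. \<bar>a n\<bar> \<le> b n + r / 2" using assms[of "r/2"] by auto
  obtain N where N: "\<And>n. n \<ge> N \<Longrightarrow> norm (b n - 0) < r / 2"
    using LIMSEQ_D[OF b(1), of "r/2"] \<open>0 < r\<close> by auto
  have "norm (a n - 0) < r" if "n \<ge> N" for n
    using N[OF that] b(2)[of n] by simp
  then show "\<exists>no. \<forall>n\<ge>no. norm (a n - 0) < r" by blast
qed

text \<open>Continuity of translations in \<open>L\<^sup>1\<close>, from open sets to measurable sets by outer regularity and then to
  integrable functions by the usual induction.\<close>

lemma trans_mod_tendsto:
  fixes f :: "'a::euclidean_space \<Rightarrow> 'b::{banach, second_countable_topology}"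
  assumes f: "integrable lborel f" and h: "h \<longlonglongrightarrow> 0"
  shows "(\<lambda>n. trans_mod f (h n)) \<longlonglongrightarrow> 0"
  using f
proof (induction rule: integrable_induct)
  case (base A c)
  show ?case
  proof (rule tendsto_zero_by_approx)
    fix e :: real assume "0 < e"
    define d where "d = e / (2 * (norm c + 1))"
    have d: "0 < d" using \<open>0 < e\<close> by (simp add: d_def add_nonneg_pos)
    have [measurable]: "A \<in> sets borel" using base by simp
    have "A \<in> sets lebesgue" using base(1) by (simp add: sets_completionI_sets)
    then obtain U where U: "open U" "A \<subseteq> U" "U - A \<in> lmeasurable" "emeasure lebesgue (U - A) < ennreal d"
      using sets_lebesgue_outer_open[OF _ d] by metis
    have [measurable]: "U \<in> sets borel" using U by auto
    have UA: "emeasure lborel (U - A) < ennreal d" using U(4) by simp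
    have fin: "emeasure lborel (U - A) < \<infinity>" using UA by (simp add: top.not_eq_extremum order_less_trans)
    have "emeasure lborel U \<le> emeasure lborel A + emeasure lborel (U - A)"
      using emeasure_subadditive[of A lborel "U - A"] U(2) by (simp add: Un_absorb1)
    then have Uf: "emeasure lborel U < \<infinity>"
      using base(2) fin by (metis ennreal_add_less_top infinity_ennreal_def order_le_less_trans)
    have iA: "integrable lborel (\<lambda>x. indicator A x *\<^sub>R c)" and iU: "integrable lborel (\<lambda>x. indicator U x *\<^sub>R c)"
      using base(2) Uf by (auto intro!: integrable_scaleR_left integrable_real_indicator)
    have "(LINT x|lborel. norm (indicator A x *\<^sub>R c - indicator U x *\<^sub>R c)) =
        (LINT x|lborel. indicator (U - A) x * norm c)"
      using U(2) by (intro Bochner_Integration.integral_cong) (auto simp: indicator_def)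
    also have "\<dots> = measure lborel (U - A) * norm c" by simp
    also have "\<dots> \<le> d * norm c"
      using UA fin d by (intro mult_right_mono) (auto simp: measure_def enn2real_leI less_imp_le)
    also have "\<dots> \<le> d * (norm c + 1)" using d by (intro mult_left_mono) auto
    also have "\<dots> = e / 2" using norm_ge_zero[of c] by (simp add: d_def field_simps del: norm_ge_zero)
    finally have "2 * (LINT x|lborel. norm (indicator A x *\<^sub>R c - indicator U x *\<^sub>R c)) \<le> e" by simp
    then have "\<bar>trans_mod (\<lambda>x. indicator A x *\<^sub>R c) (h n)\<bar> \<le> trans_mod (\<lambda>x. indicator U x *\<^sub>R c) (h n) + e" for n
      using trans_mod_triangle[OF iA iU, of "h n"] trans_mod_nonneg[of "\<lambda>x. indicator A x *\<^sub>R c" "h n"] by linarith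
    then show "\<exists>b. b \<longlonglongrightarrow> 0 \<and> (\<forall>n. \<bar>trans_mod (\<lambda>x. indicator A x *\<^sub>R c) (h n)\<bar> \<le> b n + e)"
      using trans_mod_open[OF U(1) Uf h, of c] by blast
  qed
next
  case (add f g)
  note t = integrable_translate[OF add.hyps(1)] integrable_translate[OF add.hyps(2)]
  have le: "\<bar>trans_mod (\<lambda>x. f x + g x) (h n)\<bar> \<le> trans_mod f (h n) + trans_mod g (h n)" for n
  proof -
    have "trans_mod (\<lambda>x. f x + g x) (h n) \<le>
        (LINT x|lborel. norm (f (x + h n) - f x) + norm (g (x + h n) - g x))"
      unfolding trans_mod_def
    proof (rule integral_mono)
      show "norm (f (x + h n) + g (x + h n) - (f x + g x)) \<le> norm (f (x + h n) - f x) + norm (g (x + h n) - g x)" for x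
        by (metis add_diff_add norm_triangle_ineq)
    qed (use add.hyps t in auto)
    also have "\<dots> = trans_mod f (h n) + trans_mod g (h n)"
      unfolding trans_mod_def using add.hyps t by (intro Bochner_Integration.integral_add) auto
    finally show ?thesis using trans_mod_nonneg[of "\<lambda>x. f x + g x" "h n"] by linarith
  qed
  have "(\<lambda>n. trans_mod f (h n) + trans_mod g (h n)) \<longlonglongrightarrow> 0"
    using tendsto_add[OF add.IH(1) add.IH(2)] by simp
  from Lim_null_comparison[OF _ this, of "\<lambda>n. trans_mod (\<lambda>x. f x + g x) (h n)"] le
  show ?case by (simp only: real_norm_def eventually_True)
next
  case (lim f s)
  have "(\<lambda>i. LINT x|lborel. norm (f x - s i x)) \<longlonglongrightarrow> (LINT x|(lborel::'a measure). 0)"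
  proof (rule integral_dominated_convergence[where w="\<lambda>x. 3 * norm (f x)"])
    show "AE x in lborel. (\<lambda>i. norm (f x - s i x)) \<longlonglongrightarrow> 0"
    proof (rule AE_I2)
      fix x
      have "(\<lambda>i. norm (f x - s i x)) \<longlonglongrightarrow> norm (f x - f x)" using lim.hyps(2)[of x] by (intro tendsto_intros) auto
      then show "(\<lambda>i. norm (f x - s i x)) \<longlonglongrightarrow> 0" by simp
    qed
    show "AE x in lborel. norm (norm (f x - s i x)) \<le> 3 * norm (f x)" for i
    proof (rule AE_I2)
      fix x show "norm (norm (f x - s i x)) \<le> 3 * norm (f x)"
        using lim.hyps(3)[of x i] norm_triangle_ineq4[of "f x" "s i x"] by simp
    qed
  qed (use lim.hyps(1,4) in auto)
  then have l: "(\<lambda>i. 2 * (LINT x|lborel. norm (f x - s i x))) \<longlonglongrightarrow> 0" using tendsto_mult_right_zero by fastforce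
  show ?case
  proof (rule tendsto_zero_by_approx)
    fix e :: real assume "0 < e"
    from order_tendstoD(2)[OF l this]
    have "\<exists>i. 2 * (LINT x|lborel. norm (f x - s i x)) < e"
      by (rule eventually_happens'[OF sequentially_bot])
    then obtain i where i: "2 * (LINT x|lborel. norm (f x - s i x)) < e" ..
    have "\<bar>trans_mod f (h n)\<bar> \<le> trans_mod (s i) (h n) + e" for n
      using trans_mod_triangle[OF lim.hyps(4) lim.hyps(1)[of i], of "h n"] trans_mod_nonneg[of f "h n"] i by linarith
    then show "\<exists>b. b \<longlonglongrightarrow> 0 \<and> (\<forall>n. \<bar>trans_mod f (h n)\<bar> \<le> b n + e)"
      using lim.IH[of i] by blast
  qed
qed

lemma trans_mod_small:
  fixes f :: "'a::euclidean_space \<Rightarrow> 'b::{banach, second_countable_topology}"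
  assumes f: "integrable lborel f" and e: "0 < e"
  obtains d where "0 < d" "\<And>h. norm h \<le> d \<Longrightarrow> trans_mod f h \<le> e"
proof (rule ccontr)
  assume "\<not> thesis"
  then have "\<exists>h. norm h \<le> inverse (real (Suc n)) \<and> e < trans_mod f h" for n
    using that[of "inverse (real (Suc n))"] by (force simp: not_le)
  then obtain h where h: "\<And>n. norm (h n) \<le> inverse (real (Suc n))" "\<And>n. e < trans_mod f (h n)" by metis
  have "h \<longlonglongrightarrow> 0"
    by (rule Lim_null_comparison[OF always_eventually LIMSEQ_inverse_real_of_nat]) (use h in blast)
  from order_tendstoD(2)[OF trans_mod_tendsto[OF f this] e] have "eventually (\<lambda>n. trans_mod f (h n) < e) sequentially" .
  then obtain N where "trans_mod f (h N) < e" by (auto simp: eventually_sequentially)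
  then show False using h(2)[of N] by simp
qed

text \<open>The average of \<open>f\<close> over the ball of radius \<open>t \<epsilon>\<close> about \<open>x - t e\<close>, weighted by the mollifier.\<close>

definition smear :: "real^'n \<Rightarrow> real \<Rightarrow> real \<Rightarrow> (real^'n \<Rightarrow> 'b) \<Rightarrow> real^'n \<Rightarrow> 'b::{banach, second_countable_topology}" where
  "smear e \<epsilon> t f x = (LINT z|lborel. mollifier z *\<^sub>R f (x - t *\<^sub>R (e + \<epsilon> *\<^sub>R z)))"

lemma mollifier_C1c: "C1c 1 (mollifier :: real^'n \<Rightarrow> real) (grad mollifier)"
  by (rule C1cI[OF smooth_GDERIV[OF mollifier(1)] smooth_continuous_grad[OF mollifier(1)]])
     (simp add: mollifier(2))

lemma mollifier_borel [measurable]: "(mollifier :: real^'n \<Rightarrow> real) \<in> borel_measurable borel"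
  using C1b_borel(1)[OF C1c_C1b[OF mollifier_C1c]] .

lemma mollifier_bound: obtains C where "\<And>x::real^'n. \<bar>mollifier x\<bar> \<le> C"
  using C1b_bound[OF C1c_C1b[OF mollifier_C1c]] by metis

lemma smear_shift:
  fixes x e z :: "real^'n"
  shows "x - t *\<^sub>R (e + \<epsilon> *\<^sub>R z) = (x - t *\<^sub>R e) + (- t * \<epsilon>) *\<^sub>R z"
  by (simp add: algebra_simps)

lemma smear_integrable_at:
  fixes f :: "real^'n \<Rightarrow> 'b::{banach, second_countable_topology}"
  assumes f: "integrable lborel f" and "t * \<epsilon> \<noteq> 0"
  shows "integrable lborel (\<lambda>z. f (x - t *\<^sub>R (e + \<epsilon> *\<^sub>R z)))"
    "integrable lborel (\<lambda>z. mollifier z *\<^sub>R f (x - t *\<^sub>R (e + \<epsilon> *\<^sub>R z)))"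
proof -
  show i: "integrable lborel (\<lambda>z. f (x - t *\<^sub>R (e + \<epsilon> *\<^sub>R z)))"
    unfolding smear_shift using lborel_integral_affine(1)[of "- t * \<epsilon>" f "x - t *\<^sub>R e"] assms by auto
  obtain C where "\<And>x::real^'n. \<bar>mollifier x\<bar> \<le> C" using mollifier_bound[where 'n='n] by blast
  then show "integrable lborel (\<lambda>z. mollifier z *\<^sub>R f (x - t *\<^sub>R (e + \<epsilon> *\<^sub>R z)))"
    by (intro integrable_bounded_scaleR[OF i]) auto
qed

text \<open>By Fubini's theorem the distance to \<open>f\<close> is at most the mean of \<open>trans_mod f\<close> over the shifts that enter
  the average, and these have length at most \<open>2 t\<close>.\<close>

lemma smear_L1:
  fixes f :: "real^'n \<Rightarrow> 'b::{banach, second_countable_topology}"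
  assumes f: "integrable lborel f" and e: "norm e \<le> 1" and eps: "0 < \<epsilon>" "\<epsilon> \<le> 1"
    and t: "\<And>m. 0 < t m" "t \<longlonglongrightarrow> 0"
  shows "integrable lborel (smear e \<epsilon> (t m) f)"
    and "(\<lambda>m. LINT x|lborel. norm (smear e \<epsilon> (t m) f x - f x)) \<longlonglongrightarrow> 0"
proof -
  have [measurable]: "f \<in> borel_measurable borel" using f by auto
  define s where "s m z = - (t m *\<^sub>R (e + \<epsilon> *\<^sub>R z))" for m and z :: "real^'n"
  have s: "x - t m *\<^sub>R (e + \<epsilon> *\<^sub>R z) = x + s m z" for x m z by (simp add: s_def)
  have [measurable]: "s m \<in> borel_measurable borel" for m unfolding s_def by measurable
  have ns: "norm (s m z) \<le> 2 * t m" if "norm z < 1" for m z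
  proof -
    have "norm (e + \<epsilon> *\<^sub>R z) \<le> norm e + \<bar>\<epsilon>\<bar> * norm z" by (metis norm_scaleR norm_triangle_ineq)
    also have "\<dots> \<le> 1 + 1 * 1" using e eps that by (intro add_mono mult_mono) auto
    finally have "t m * norm (e + \<epsilon> *\<^sub>R z) \<le> t m * 2" using t(1)[of m] by (intro mult_left_mono) auto
    then show ?thesis using t(1)[of m] by (simp add: s_def)
  qed
  have te: "t m * \<epsilon> \<noteq> 0" for m using t(1)[of m] eps by simp
  show int: "integrable lborel (smear e \<epsilon> (t m) f)" for m
  proof -
    let ?F = "\<lambda>(z, x). mollifier z *\<^sub>R f (x + s m z)"
    have "integrable (lborel \<Otimes>\<^sub>M lborel) ?F"
    proof (rule lborel_pair.Fubini_integrable)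
      have "(LINT x|lborel. norm (?F (z, x))) = (LINT x|lborel. norm (f x)) * mollifier z" for z
        using lborel_integral_translate(2)[of "\<lambda>x. norm (f x)" "s m z"] by (simp add: mollifier(3))
      then show "integrable lborel (\<lambda>z. LINT x|lborel. norm (?F (z, x)))"
        by (simp only: integrable_mult_right[OF mollifier(4)])
      show "AE z in lborel. integrable lborel (\<lambda>x. ?F (z, x))"
        using integrable_translate[OF f] by simp
    qed measurable
    from lborel_pair.integrable_snd[of "\<lambda>z x. mollifier z *\<^sub>R f (x + s m z)", OF this]
    show ?thesis unfolding smear_def s by simp
  qed
  show "(\<lambda>m. LINT x|lborel. norm (smear e \<epsilon> (t m) f x - f x)) \<longlonglongrightarrow> 0"
  proof (rule LIMSEQ_I)
    fix r :: real assume "0 < r"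
    then obtain d where d: "0 < d" "\<And>h. norm h \<le> d \<Longrightarrow> trans_mod f h \<le> r / 2"
      using trans_mod_small[OF f, of "r/2"] by auto
    obtain N where N: "\<And>m. m \<ge> N \<Longrightarrow> norm (t m - 0) < d / 2"
      using LIMSEQ_D[OF t(2), of "d/2"] d by auto
    have "norm ((LINT x|lborel. norm (smear e \<epsilon> (t m) f x - f x)) - 0) < r" if "m \<ge> N" for m
    proof -
      have small: "trans_mod f (s m z) \<le> r / 2" if "norm z < 1" for z
        using ns[OF that, of m] N[OF \<open>m \<ge> N\<close>] t(1)[of m] by (intro d(2)) simp
      let ?F = "\<lambda>(z, x). mollifier z * norm (f (x + s m z) - f x)"
      have tm: "(LINT x|lborel. norm (?F (z, x))) = mollifier z * trans_mod f (s m z)" for z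
        by (simp add: mollifier(3) trans_mod_def)
      have le: "mollifier z * trans_mod f (s m z) \<le> mollifier z * (r / 2)" for z
      proof (cases "norm z < 1")
        case True
        then show ?thesis by (intro mult_left_mono small mollifier(3))
      qed (simp add: mollifier(2))
      have itm: "integrable lborel (\<lambda>z. mollifier z * trans_mod f (s m z))"
      proof (rule Bochner_Integration.integrable_bound)
        show "integrable lborel (\<lambda>z::real^'n. mollifier z * (r / 2))" by (rule integrable_mult_left[OF mollifier(4)])
        show "(\<lambda>z. mollifier z * trans_mod f (s m z)) \<in> borel_measurable lborel"
          unfolding trans_mod_def by measurable
        show "AE z in lborel. norm (mollifier z * trans_mod f (s m z)) \<le> norm (mollifier z * (r / 2))"
          using le \<open>0 < r\<close> by (intro AE_I2) (simp add: mollifier(3) trans_mod_nonneg)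
      qed
      have iF: "integrable (lborel \<Otimes>\<^sub>M lborel) ?F"
      proof (rule lborel_pair.Fubini_integrable)
        show "integrable lborel (\<lambda>z. LINT x|lborel. norm (?F (z, x)))"
          unfolding tm by (rule itm)
        show "AE z in lborel. integrable lborel (\<lambda>x. ?F (z, x))"
          using integrable_translate[OF f] f by (intro AE_I2) simp
      qed measurable
      have pt: "norm (smear e \<epsilon> (t m) f x - f x) \<le> (LINT z|lborel. ?F (z, x))" for x
      proof -
        note i1 = smear_integrable_at(2)[OF f te, where x=x and e=e, unfolded s]
        have i2: "integrable lborel (\<lambda>z::real^'n. mollifier z *\<^sub>R f x)" using mollifier(4) by (rule integrable_scaleR_left)
        have "smear e \<epsilon> (t m) f x - f x = (LINT z|lborel. mollifier z *\<^sub>R f (x + s m z)) - (LINT z|lborel. mollifier (z::real^'n) *\<^sub>R f x)"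
          unfolding smear_def s by (simp add: integral_scaleR_left[OF mollifier(4)] mollifier(5))
        also have "\<dots> = (LINT z|lborel. mollifier z *\<^sub>R f (x + s m z) - mollifier z *\<^sub>R f x)"
          using i1 i2 by simp
        finally have eq: "smear e \<epsilon> (t m) f x - f x =
            (LINT z|lborel. mollifier z *\<^sub>R f (x + s m z) - mollifier z *\<^sub>R f x)" .
        have "norm (smear e \<epsilon> (t m) f x - f x) \<le>
            (LINT z|lborel. norm (mollifier z *\<^sub>R f (x + s m z) - mollifier z *\<^sub>R f x))"
          unfolding eq by (rule integral_norm_bound)
        also have "\<dots> = (LINT z|lborel. ?F (z, x))"
        proof (rule Bochner_Integration.integral_cong[OF refl])
          fix z :: "real^'n"
          show "norm (mollifier z *\<^sub>R f (x + s m z) - mollifier z *\<^sub>R f x) = ?F (z, x)"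
            unfolding scaleR_diff_right[symmetric] norm_scaleR by (simp add: mollifier(3))
        qed
        finally show ?thesis .
      qed
      have "(LINT x|lborel. norm (smear e \<epsilon> (t m) f x - f x)) \<le> (LINT x|lborel. LINT z|lborel. ?F (z, x))"
      proof (rule integral_mono[OF _ _ pt])
        show "integrable lborel (\<lambda>x. norm (smear e \<epsilon> (t m) f x - f x))"
          using int f by auto
        show "integrable lborel (\<lambda>x. LINT z|lborel. ?F (z, x))"
          using lborel_pair.integrable_snd[of "\<lambda>z x. ?F (z, x)"] iF by simp
      qed
      also have "\<dots> = (LINT z|lborel. LINT x|lborel. ?F (z, x))"
        using lborel_pair.Fubini_integral[of "\<lambda>z x. ?F (z, x)"] iF by simp
      also have "\<dots> = (LINT z|lborel. mollifier z * trans_mod f (s m z))"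
        by (simp add: trans_mod_def)
      also have "\<dots> \<le> (LINT z|lborel. mollifier (z::real^'n) * (r / 2))"
        by (rule integral_mono[OF itm integrable_mult_left[OF mollifier(4)] le])
        also have "\<dots> = r / 2" by (simp add: mollifier(5))
      finally show ?thesis using \<open>0 < r\<close> by simp
    qed
    then show "\<exists>no. \<forall>m\<ge>no. norm ((LINT x|lborel. norm (smear e \<epsilon> (t m) f x - f x)) - 0) < r" by blast
  qed
qed

text \<open>The kernel of \<open>smear\<close> as a convolution. The argument of the mollifier is \<open>(u - t e) / (t \<epsilon>)\<close>, written as an
  affine function of \<open>u\<close> to which the rules for affine substitutions apply.\<close>

definition shift_kernel :: "real^'n \<Rightarrow> real \<Rightarrow> real \<Rightarrow> real^'n \<Rightarrow> real" where
  "shift_kernel e \<epsilon> t u = inverse ((t * \<epsilon>) ^ CARD('n)) * mollifier (inverse (t * \<epsilon>) *\<^sub>R (- t *\<^sub>R e) + inverse (t * \<epsilon>) *\<^sub>R u)"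

lemma shift_kernel_support:
  fixes e :: "real^'n"
  assumes "0 < t" "0 < \<epsilon>" "shift_kernel e \<epsilon> t u \<noteq> 0"
  shows "norm (u - t *\<^sub>R e) < t * \<epsilon>"
proof -
  have "inverse (t * \<epsilon>) *\<^sub>R (- t *\<^sub>R e) + inverse (t * \<epsilon>) *\<^sub>R u = inverse (t * \<epsilon>) *\<^sub>R (u - t *\<^sub>R e)"
    by (simp add: algebra_simps)
  then have "norm (inverse (t * \<epsilon>) *\<^sub>R (u - t *\<^sub>R e)) < 1"
    using assms(3) mollifier(2)[of "inverse (t * \<epsilon>) *\<^sub>R (u - t *\<^sub>R e)"] by (auto simp: shift_kernel_def not_le[symmetric])
  then have "inverse (t * \<epsilon>) * norm (u - t *\<^sub>R e) < 1" using assms by (simp only: norm_scaleR) simp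
  then show ?thesis using assms by (simp add: field_simps)
qed

lemma shift_kernel_smooth: "Ck k (shift_kernel e \<epsilon> t)"
  unfolding shift_kernel_def by (intro Ck_cmult Ck_affine mollifier)

lemma shift_kernel_C1c:
  fixes e :: "real^'n"
  assumes "0 < t" "0 < \<epsilon>" "\<epsilon> \<le> 1" "norm e \<le> 1"
  shows "C1c (2 * t) (shift_kernel e \<epsilon> t) (grad (shift_kernel e \<epsilon> t))"
proof (rule C1cI[OF smooth_GDERIV[OF shift_kernel_smooth] smooth_continuous_grad[OF shift_kernel_smooth]])
  fix x :: "real^'n" assume x: "2 * t < norm x"
  show "shift_kernel e \<epsilon> t x = 0"
  proof (rule ccontr)
    assume "shift_kernel e \<epsilon> t x \<noteq> 0"
    then have "norm (x - t *\<^sub>R e) < t * \<epsilon>" using shift_kernel_support assms by blast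
    moreover have "t * \<epsilon> \<le> t * 1" "t * norm e \<le> t * 1" using assms by (auto intro!: mult_left_mono)
    moreover have "norm x \<le> norm (x - t *\<^sub>R e) + t * norm e"
      using norm_triangle_sub[of x "t *\<^sub>R e"] assms(1) by simp
    ultimately show False using x by simp
  qed
qed

lemma smear_eq_conv:
  fixes e :: "real^'n" and f :: "real^'n \<Rightarrow> 'b::{banach, second_countable_topology}"
  assumes "0 < t" "0 < \<epsilon>" and [measurable]: "f \<in> borel_measurable borel"
  shows "smear e \<epsilon> t f x = (LINT y|lborel. shift_kernel e \<epsilon> t (x - y) *\<^sub>R f y)"
proof -
  have te: "t * \<epsilon> \<noteq> 0" using assms by simp
  have [measurable]: "shift_kernel e \<epsilon> t \<in> borel_measurable borel" unfolding shift_kernel_def by measurable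
  have k: "shift_kernel e \<epsilon> t (x - ((x - t *\<^sub>R e) + (- t * \<epsilon>) *\<^sub>R z)) = inverse ((t * \<epsilon>) ^ CARD('n)) * mollifier z" for z
  proof -
    have "inverse (t * \<epsilon>) *\<^sub>R (- t *\<^sub>R e) + inverse (t * \<epsilon>) *\<^sub>R (x - ((x - t *\<^sub>R e) + (- t * \<epsilon>) *\<^sub>R z)) =
        (inverse (t * \<epsilon>) * (t * \<epsilon>)) *\<^sub>R z"
      by (simp add: algebra_simps)
    also have "\<dots> = z" unfolding left_inverse[OF te] by simp
    finally show ?thesis unfolding shift_kernel_def by (simp only:)
  qed
  have "(LINT y|lborel. shift_kernel e \<epsilon> t (x - y) *\<^sub>R f y) =
     \<bar>- t * \<epsilon>\<bar> ^ DIM(real^'n) *\<^sub>R (LINT z|lborel. shift_kernel e \<epsilon> t (x - ((x - t *\<^sub>R e) + (- t * \<epsilon>) *\<^sub>R z)) *\<^sub>R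
        f ((x - t *\<^sub>R e) + (- t * \<epsilon>) *\<^sub>R z))"
    using te by (intro lborel_integral_affine(2)) auto
  also have "\<dots> = (t * \<epsilon>) ^ CARD('n) *\<^sub>R (LINT z|lborel. inverse ((t * \<epsilon>) ^ CARD('n)) *\<^sub>R
      (mollifier z *\<^sub>R f ((x - t *\<^sub>R e) + (- t * \<epsilon>) *\<^sub>R z)))"
    unfolding k using assms by (simp add: abs_mult)
  also have "\<dots> = smear e \<epsilon> t f x"
    unfolding smear_def smear_shift using te by (subst integral_scaleR_right) simp
  finally show ?thesis by simp
qed

lemma shift_kernel_mass:
  fixes e :: "real^'n"
  assumes "0 < t" "0 < \<epsilon>" shows "(LINT y|lborel. shift_kernel e \<epsilon> t (x - y)) = 1"
  using smear_eq_conv[OF assms, of "\<lambda>_. 1::real" e x] by (simp add: smear_def mollifier)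

lemma shift_kernel_nonneg: "0 < t \<Longrightarrow> 0 < \<epsilon> \<Longrightarrow> 0 \<le> shift_kernel e \<epsilon> t u"
  by (simp add: shift_kernel_def mollifier)

text \<open>Scaling: the gradient of the kernel has mass of order \<open>1 / t\<close>. This factor turns the oscillation
  \<open>t powr \<gamma>\<close> of a function into the size \<open>t powr (\<gamma> - 1)\<close> of its mollified gradient.\<close>

lemma shift_kernel_grad_mass:
  fixes e :: "real^'n"
  assumes "0 < t" "0 < \<epsilon>"
  shows "(LINT y|lborel. norm (grad (shift_kernel e \<epsilon> t) (x - y))) =
      (LINT z|lborel. norm (grad mollifier (z::real^'n))) / (t * \<epsilon>)"
proof -
  define c where "c = inverse (t * \<epsilon>)"
  define a where "a = c *\<^sub>R (- t *\<^sub>R e)"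
  have c: "0 < c" using assms by (simp add: c_def)
  have te: "t * \<epsilon> = inverse c" by (simp add: c_def)
  have K: "shift_kernel e \<epsilon> t = (\<lambda>u. c ^ CARD('n) * mollifier (a + c *\<^sub>R u))"
    by (rule ext) (simp only: shift_kernel_def c_def a_def power_inverse)
  have g: "grad (shift_kernel e \<epsilon> t) u = (c ^ CARD('n) * c) *\<^sub>R grad mollifier (a + c *\<^sub>R u)" for u :: "real^'n"
  proof (rule GDERIV_imp_grad)
    show "GDERIV (shift_kernel e \<epsilon> t) u :> (c ^ CARD('n) * c) *\<^sub>R grad mollifier (a + c *\<^sub>R u)"
      unfolding K using GDERIV_mult[OF GDERIV_const[of "c ^ CARD('n)"] GDERIV_affine[OF smooth_GDERIV[OF mollifier(1)], where x=u and a=a and s=c]]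
      by simp
  qed
  have [measurable]: "(grad mollifier :: real^'n \<Rightarrow> real^'n) \<in> borel_measurable borel"
    using C1b_borel(2)[OF C1c_C1b[OF mollifier_C1c]] .
  have "(LINT y|lborel. norm (grad (shift_kernel e \<epsilon> t) (x - y))) = (LINT u|lborel. norm (grad (shift_kernel e \<epsilon> t) u))"
    unfolding g by (rule lborel_integral_reflect(2)) measurable
  also have "\<dots> = c * (\<bar>c\<bar> ^ DIM(real^'n) *\<^sub>R (LINT u|lborel. norm (grad mollifier (a + c *\<^sub>R u))))"
    unfolding g using c by (simp add: abs_mult)
  also have "\<dots> = c * (LINT z|lborel. norm (grad mollifier (z::real^'n)))"
    using c by (subst lborel_integral_affine(2)[of c "\<lambda>z. norm (grad mollifier (z::real^'n))" a]) auto
  finally show ?thesis by (simp add: c_def field_simps)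
qed

section \<open>Weak gradients\<close>

lemma AE_lebesgue_on_iff:
  fixes \<Omega> :: "'a::euclidean_space set"
  assumes "open \<Omega>"
  shows "(AE x in lebesgue_on \<Omega>. P x) \<longleftrightarrow> (AE x in lborel. x \<in> \<Omega> \<longrightarrow> P x)"
  using assms by (simp add: AE_restrict_space_iff AE_completion_iff)

lemma lebesgue_on_borel:
  fixes f :: "'a::euclidean_space \<Rightarrow> 'b::{banach, second_countable_topology}"
  assumes \<Omega>: "open \<Omega>" and f: "f \<in> borel_measurable borel" "\<And>x. x \<notin> \<Omega> \<Longrightarrow> f x = 0"
  shows "integrable (lebesgue_on \<Omega>) f \<longleftrightarrow> integrable lborel f"
    and "(LINT x|lebesgue_on \<Omega>. f x) = (LINT x|lborel. f x)"
proof -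
  have eq: "(\<lambda>x. indicator \<Omega> x *\<^sub>R f x) = f" using f(2) by (auto simp: indicator_def fun_eq_iff)
  have s: "\<Omega> \<inter> space lebesgue \<in> sets lebesgue" using \<Omega> by simp
  show "integrable (lebesgue_on \<Omega>) f \<longleftrightarrow> integrable lborel f"
    unfolding integrable_restrict_space[OF s] eq using f(1) by (simp add: integrable_completion)
  show "(LINT x|lebesgue_on \<Omega>. f x) = (LINT x|lborel. f x)"
    unfolding integral_restrict_space[OF s] eq using f(1) by (simp add: integral_completion)
qed

lemma AE_lborel_lebesgue_on: "open \<Omega> \<Longrightarrow> AE x in lborel. P x \<Longrightarrow> AE x in lebesgue_on \<Omega>. P x"
  unfolding AE_lebesgue_on_iff by (auto elim: eventually_mono)

lemma lebesgue_on_restrict_L1: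
  fixes \<Omega> :: "'a::euclidean_space set" and f :: "'a \<Rightarrow> real"
  assumes op: "open \<Omega>" and f: "integrable lborel f"
  shows "integrable (lebesgue_on \<Omega>) f" "(LINT x|lebesgue_on \<Omega>. norm (f x)) \<le> (LINT x|lborel. norm (f x))"
proof -
  have s: "\<Omega> \<inter> space lebesgue \<in> sets lebesgue" using op by simp
  have sl: "\<Omega> \<in> sets lborel" using op by simp
  note i = integrable_mult_indicator[OF sl f]
  show "integrable (lebesgue_on \<Omega>) f"
    unfolding integrable_restrict_space[OF s] using i borel_measurable_integrable[OF i] by (simp only: integrable_completion)
  have fb: "f \<in> borel_measurable lborel" using f by simp
  have m: "(\<lambda>x. indicator \<Omega> x *\<^sub>R norm (f x)) \<in> borel_measurable lborel" using fb sl by measurable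
  have "(LINT x|lebesgue_on \<Omega>. norm (f x)) = (LINT x|lborel. indicator \<Omega> x *\<^sub>R norm (f x))"
    unfolding integral_restrict_space[OF s] by (rule integral_completion[OF m])
  also have "\<dots> \<le> (LINT x|lborel. norm (f x))"
    using integrable_mult_indicator[OF sl integrable_norm[OF f]] f
    by (intro integral_mono) (auto split: split_indicator)
  finally show "(LINT x|lebesgue_on \<Omega>. norm (f x)) \<le> (LINT x|lborel. norm (f x))" .
qed

lemma borel_lebesgue_on:
  assumes "f \<in> borel_measurable borel" shows "f \<in> borel_measurable (lebesgue_on (\<Omega> :: 'a::euclidean_space set))"
proof -
  have "f \<in> borel_measurable lborel" using assms by simp
  then show ?thesis by (intro measurable_restrict_space1 measurable_completion)
qed

lemma borel_representative_real:
  fixes f :: "'a::euclidean_space \<Rightarrow> real"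
  assumes \<Omega>: "open \<Omega>" and f: "f \<in> borel_measurable (lebesgue_on \<Omega>)"
  obtains g where "g \<in> borel_measurable borel" "\<And>x. x \<notin> \<Omega> \<Longrightarrow> g x = 0" "AE x in lebesgue_on \<Omega>. f x = g x"
proof -
  have "(\<lambda>x. if x \<in> \<Omega> then f x else 0) \<in> borel_measurable lebesgue"
    using \<Omega> by (intro borel_measurable_if_I f) auto
  then obtain g where g: "g \<in> borel_measurable lborel" "AE x in lborel. (if x \<in> \<Omega> then f x else 0) = g x"
    using completion_ex_borel_measurable_real by blast
  have [measurable]: "\<Omega> \<in> sets borel" "g \<in> borel_measurable borel" using \<Omega> g by auto
  show thesis
  proof
    show "(\<lambda>x. indicator \<Omega> x * g x) \<in> borel_measurable borel" by measurable
    show "AE x in lebesgue_on \<Omega>. f x = indicator \<Omega> x * g x"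
      unfolding AE_lebesgue_on_iff[OF \<Omega>] using g(2) by eventually_elim auto
  qed auto
qed

lemma vec_nth_borel [measurable]: "(\<lambda>v::real^'n. v $ i) \<in> borel_measurable borel"
  by (intro borel_measurable_continuous_onI continuous_intros)

lemma borel_representative_vec:
  fixes f :: "'a::euclidean_space \<Rightarrow> real^'n"
  assumes \<Omega>: "open \<Omega>" and f: "f \<in> borel_measurable (lebesgue_on \<Omega>)"
  obtains g where "g \<in> borel_measurable borel" "\<And>x. x \<notin> \<Omega> \<Longrightarrow> g x = 0" "AE x in lebesgue_on \<Omega>. f x = g x"
proof -
  have "\<exists>g. g \<in> borel_measurable borel \<and> (\<forall>x. x \<notin> \<Omega> \<longrightarrow> g x = 0) \<and> (AE x in lebesgue_on \<Omega>. f x $ i = g x)" for i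
  proof -
    have "(\<lambda>x. f x $ i) \<in> borel_measurable (lebesgue_on \<Omega>)" using measurable_compose[OF f vec_nth_borel] .
    from borel_representative_real[OF \<Omega> this] show ?thesis by metis
  qed
  then obtain g where g: "\<And>i. g i \<in> borel_measurable borel" "\<And>i x. x \<notin> \<Omega> \<Longrightarrow> g i x = 0"
    "\<And>i. AE x in lebesgue_on \<Omega>. f x $ i = g i x" by metis
  show thesis
  proof
    show "(\<lambda>x. \<chi> i. g i x) \<in> borel_measurable borel"
      using g(1) by (subst borel_measurable_euclidean_space) (auto simp: Basis_vec_def inner_axis)
    show "(\<chi> i. g i x) = 0" if "x \<notin> \<Omega>" for x using g(2)[OF that] by (simp add: vec_eq_iff)
    have "AE x in lebesgue_on \<Omega>. \<forall>i. f x $ i = g i x"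
      using g(3) by (intro eventually_all_finite) auto
    then show "AE x in lebesgue_on \<Omega>. f x = (\<chi> i. g i x)" by eventually_elim (simp add: vec_eq_iff)
  qed
qed

lemma vec_integral_nth:
  fixes f :: "'a \<Rightarrow> real^'n"
  assumes "integrable M f" shows "(LINT x|M. f x) $ i = (LINT x|M. f x $ i)"
  using integral_bounded_linear[OF bounded_linear_vec_nth assms] by simp

text \<open>The fundamental lemma of the calculus of variations: the mollified function vanishes at distance
  more than the mollification radius from the complement.\<close>

lemma fundamental_lemma:
  fixes g :: "real^'n \<Rightarrow> real^'n"
  assumes \<Omega>: "open \<Omega>" and g: "integrable lborel g"
    and test: "\<And>\<phi>. \<phi> \<in> Cc_infinity \<Omega> \<Longrightarrow> (LINT x|lborel. \<phi> x *\<^sub>R g x) = 0"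
  shows "AE x in lborel. x \<in> \<Omega> \<longrightarrow> g x = 0"
proof -
  define t where "t m = inverse (real (Suc m))" for m
  have t: "\<And>m. 0 < t m" "t \<longlonglongrightarrow> 0" unfolding t_def using LIMSEQ_inverse_real_of_nat by auto
  have zero: "smear 0 1 (t m) g x = 0" if "cball x (t m) \<subseteq> \<Omega>" for m x
  proof -
    have gb: "g \<in> borel_measurable borel" using g by auto
    define \<phi> where "\<phi> = (\<lambda>y. shift_kernel 0 1 (t m) (x + (-1) *\<^sub>R y))"
    have "y \<in> cball x (t m)" if "\<phi> y \<noteq> 0" for y
      using shift_kernel_support[OF t(1) zero_less_one, of 0 m "x - y"] that
      by (simp add: \<phi>_def dist_norm)
    then have cl: "closure {y. \<phi> y \<noteq> 0} \<subseteq> cball x (t m)" by (intro closure_minimal) auto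
    then have "compact (closure {y. \<phi> y \<noteq> 0})"
      unfolding compact_eq_bounded_closed using bounded_subset[OF bounded_cball] by blast
    moreover have "Ck k \<phi>" for k unfolding \<phi>_def by (rule Ck_affine[OF shift_kernel_smooth])
    moreover have "closure {y. \<phi> y \<noteq> 0} \<subseteq> \<Omega>" using cl that by (rule subset_trans)
    ultimately have "\<phi> \<in> Cc_infinity \<Omega>" unfolding Cc_infinity_def by simp
    from test[OF this] show ?thesis
      by (simp add: smear_eq_conv[OF t(1) zero_less_one gb] \<phi>_def)
  qed
  have "(\<lambda>m. LINT x|lborel. norm (smear 0 1 (t m) g x - g x)) \<longlonglongrightarrow> 0"
    and i: "\<And>m. integrable lborel (smear 0 1 (t m) g)"
    using smear_L1[OF g, of 0 1 t] t by auto
  then obtain r where r: "strict_mono r" "AE x in lborel. (\<lambda>m. smear 0 1 (t (r m)) g x - g x) \<longlonglongrightarrow> 0"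
    using tendsto_L1_AE_subseq[of lborel "\<lambda>m x. smear 0 1 (t m) g x - g x"] g by auto
  from r(2) show ?thesis
  proof eventually_elim
    case (elim x)
    show ?case
    proof
      assume "x \<in> \<Omega>"
      then obtain d where d: "0 < d" "cball x d \<subseteq> \<Omega>" using \<Omega> open_contains_cball by blast
      have "(\<lambda>m. t (r m)) \<longlonglongrightarrow> 0" using LIMSEQ_subseq_LIMSEQ[OF t(2) r(1)] by (simp add: o_def)
      then have "eventually (\<lambda>m. t (r m) < d) sequentially" using d(1) order_tendstoD(2) by blast
      then have "eventually (\<lambda>m. smear 0 1 (t (r m)) g x - g x = - g x) sequentially"
      proof eventually_elim
        case (elim m)
        then have "cball x (t (r m)) \<subseteq> \<Omega>" using d(2) subset_cball[of "t (r m)" d x] by auto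
        then show ?case using zero by simp
      qed
      from LIMSEQ_unique[OF elim tendsto_eventually[OF this]] have "- g x = 0" by simp
      then show "g x = 0" by simp
    qed
  qed
qed

lemma Cc_infinity_off: "\<phi> \<in> Cc_infinity \<Omega> \<Longrightarrow> x \<notin> \<Omega> \<Longrightarrow> \<phi> x = 0"
  using closure_subset[of "{x. \<phi> x \<noteq> 0}"] unfolding Cc_infinity_def by blast

lemma Cc_infinity_grad_off:
  assumes "\<phi> \<in> Cc_infinity \<Omega>" "x \<notin> \<Omega>" shows "grad \<phi> x = 0"
proof -
  obtain R where "C1c R \<phi> (grad \<phi>)" using Cc_infinity_C1c[OF assms(1)] .
  then have "GDERIV \<phi> x :> grad \<phi> x" using C1b_GDERIV C1c_C1b by blast
  then show ?thesis by (rule GDERIV_zero_off_support) (use assms in \<open>auto simp: Cc_infinity_def\<close>)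
qed

lemma has_weak_gradient_unique:
  fixes \<Omega> :: "(real^'n) set"
  assumes \<Omega>: "open \<Omega>" and G: "has_weak_gradient \<Omega> u G" and H: "has_weak_gradient \<Omega> u H"
  shows "AE x in lebesgue_on \<Omega>. G x = H x"
proof -
  have iG: "integrable (lebesgue_on \<Omega>) G" and iH: "integrable (lebesgue_on \<Omega>) H"
    using G H by (auto simp: has_weak_gradient_def)
  then have iD: "integrable (lebesgue_on \<Omega>) (\<lambda>x. G x - H x)" by simp
  then obtain g where g: "g \<in> borel_measurable borel" "\<And>x. x \<notin> \<Omega> \<Longrightarrow> g x = 0"
    "AE x in lebesgue_on \<Omega>. G x - H x = g x"
    using borel_representative_vec[OF \<Omega> borel_measurable_integrable[OF iD]] by blast
  have ig: "integrable (lebesgue_on \<Omega>) g"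
    using iD g(3) borel_lebesgue_on[OF g(1)] by (subst integrable_cong_AE[symmetric, where f="\<lambda>x. G x - H x"]) auto
  then have igl: "integrable lborel g" using lebesgue_on_borel(1)[OF \<Omega> g(1,2)] by simp
  have "AE x in lborel. x \<in> \<Omega> \<longrightarrow> g x = 0"
  proof (rule fundamental_lemma[OF \<Omega> igl])
    fix \<phi> assume phi: "\<phi> \<in> Cc_infinity \<Omega>"
    obtain R where c: "C1c R \<phi> (grad \<phi>)" using Cc_infinity_C1c[OF phi] .
    obtain C where C: "\<And>x. \<bar>\<phi> x\<bar> \<le> C" using C1b_bound[OF C1c_C1b[OF c]] by metis
    have pb: "\<phi> \<in> borel_measurable borel" using C1b_borel(1)[OF C1c_C1b[OF c]] .
    have m: "integrable (lebesgue_on \<Omega>) (\<lambda>x. \<phi> x *\<^sub>R k x)" if "integrable (lebesgue_on \<Omega>) k" for k :: "real^'n \<Rightarrow> real^'n"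
      by (rule integrable_bounded_scaleR[OF that borel_lebesgue_on[OF pb] C])
    have "(LINT x|lebesgue_on \<Omega>. \<phi> x *\<^sub>R G x) $ i = (LINT x|lebesgue_on \<Omega>. \<phi> x *\<^sub>R H x) $ i" for i
    proof -
      have "(LINT x|lebesgue_on \<Omega>. G x $ i * \<phi> x) = (LINT x|lebesgue_on \<Omega>. H x $ i * \<phi> x)"
      proof -
        have "(LINT x|lebesgue_on \<Omega>. u x * grad \<phi> x $ i) = - (LINT x|lebesgue_on \<Omega>. G x $ i * \<phi> x)"
          using G phi unfolding has_weak_gradient_def by blast
        moreover have "(LINT x|lebesgue_on \<Omega>. u x * grad \<phi> x $ i) = - (LINT x|lebesgue_on \<Omega>. H x $ i * \<phi> x)"
          using H phi unfolding has_weak_gradient_def by blast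
        ultimately show ?thesis by linarith
      qed
      then show ?thesis
        using m[OF iG] m[OF iH] by (simp add: vec_integral_nth mult.commute)
    qed
    then have eq: "(LINT x|lebesgue_on \<Omega>. \<phi> x *\<^sub>R G x) = (LINT x|lebesgue_on \<Omega>. \<phi> x *\<^sub>R H x)"
      by (simp add: vec_eq_iff)
    have "(LINT x|lborel. \<phi> x *\<^sub>R g x) = (LINT x|lebesgue_on \<Omega>. \<phi> x *\<^sub>R g x)"
      using pb g by (intro lebesgue_on_borel(2)[OF \<Omega>, symmetric]) auto
    also have "\<dots> = (LINT x|lebesgue_on \<Omega>. \<phi> x *\<^sub>R G x - \<phi> x *\<^sub>R H x)"
    proof (rule integral_cong_AE)
      show "AE x in lebesgue_on \<Omega>. \<phi> x *\<^sub>R g x = \<phi> x *\<^sub>R G x - \<phi> x *\<^sub>R H x"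
        using g(3) by eventually_elim (simp add: scaleR_diff_right[symmetric])
      show "(\<lambda>x. \<phi> x *\<^sub>R g x) \<in> borel_measurable (lebesgue_on \<Omega>)"
        using m[OF ig] by auto
      show "(\<lambda>x. \<phi> x *\<^sub>R G x - \<phi> x *\<^sub>R H x) \<in> borel_measurable (lebesgue_on \<Omega>)"
        using m[OF iG] m[OF iH] by auto
    qed
    also have "\<dots> = 0" using m[OF iG] m[OF iH] eq by simp
    finally show "(LINT x|lborel. \<phi> x *\<^sub>R g x) = 0" .
  qed
  then have "AE x in lebesgue_on \<Omega>. g x = 0" by (simp add: AE_lebesgue_on_iff[OF \<Omega>])
  with g(3) show ?thesis by eventually_elim simp
qed

lemma has_weak_gradient_wgrad: "u \<in> W11 \<Omega> \<Longrightarrow> has_weak_gradient \<Omega> u (wgrad \<Omega> u)"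
  using someI_ex[of "has_weak_gradient \<Omega> u"] by (simp add: W11_def wgrad_def)

lemma wgrad_eq:
  assumes "open \<Omega>" "has_weak_gradient \<Omega> u G" shows "AE x in lebesgue_on \<Omega>. wgrad \<Omega> u x = G x"
  using assms by (intro has_weak_gradient_unique[OF assms(1) has_weak_gradient_wgrad]) (auto simp: W11_def)

lemma C1c_integrable_lebesgue_on:
  assumes "open \<Omega>" "C1c R f D"
  shows "integrable (lebesgue_on \<Omega>) f" "integrable (lebesgue_on \<Omega>) D"
proof -
  have s: "\<Omega> \<inter> space lebesgue \<in> sets lebesgue" using assms by simp
  have \<Omega>: "\<Omega> \<in> sets lborel" using assms by simp
  note i = C1c_integrable[OF assms(2), THEN integrable_mult_indicator[OF \<Omega>]]
  show "integrable (lebesgue_on \<Omega>) f" "integrable (lebesgue_on \<Omega>) D"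
    unfolding integrable_restrict_space[OF s]
    using i i[THEN borel_measurable_integrable] by (simp_all only: integrable_completion)
qed

lemma has_weak_gradient_diff_add:
  assumes G: "has_weak_gradient \<Omega> u G" and H: "has_weak_gradient \<Omega> v H" and \<Omega>: "open \<Omega>"
  shows "has_weak_gradient \<Omega> (\<lambda>x. u x - v x) (\<lambda>x. G x - H x)"
    and "has_weak_gradient \<Omega> (\<lambda>x. u x + v x) (\<lambda>x. G x + H x)"
proof -
  have i: "integrable (lebesgue_on \<Omega>) u" "integrable (lebesgue_on \<Omega>) G"
    "integrable (lebesgue_on \<Omega>) v" "integrable (lebesgue_on \<Omega>) H"
    using G H by (auto simp: has_weak_gradient_def)
  have *: "integrable (lebesgue_on \<Omega>) (\<lambda>x. w x * grad \<phi> x $ j)"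
       "integrable (lebesgue_on \<Omega>) (\<lambda>x. K x $ j * \<phi> x)"
    if phi: "\<phi> \<in> Cc_infinity \<Omega>" and w: "integrable (lebesgue_on \<Omega>) w" and K: "integrable (lebesgue_on \<Omega>) K"
    for \<phi> j and w :: "real^'a \<Rightarrow> real" and K :: "real^'a \<Rightarrow> real^'a"
  proof -
    obtain R where c: "C1c R \<phi> (grad \<phi>)" using Cc_infinity_C1c[OF phi] .
    note b = borel_lebesgue_on[OF C1b_borel(1)[OF C1c_C1b[OF c]], of \<Omega>] borel_lebesgue_on[OF C1b_borel(2)[OF C1c_C1b[OF c]], of \<Omega>]
    obtain C where C: "\<And>x. \<bar>\<phi> x\<bar> \<le> C" "\<And>x. norm (grad \<phi> x) \<le> C" using C1b_bound[OF C1c_C1b[OF c]] by metis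
    have "integrable (lebesgue_on \<Omega>) (\<lambda>x. w x *\<^sub>R (grad \<phi> x $ j))"
    proof (rule integrable_scaleR_bounded[OF w])
      show "(\<lambda>x. grad \<phi> x $ j) \<in> borel_measurable (lebesgue_on \<Omega>)" using measurable_compose[OF b(2) vec_nth_borel] .
      show "norm (grad \<phi> x $ j) \<le> C" for x using C(2)[of x] component_le_norm_cart[of "grad \<phi> x" j] by simp
    qed
    then show "integrable (lebesgue_on \<Omega>) (\<lambda>x. w x * grad \<phi> x $ j)" by simp
    have "integrable (lebesgue_on \<Omega>) (\<lambda>x. K x $ j)"
      using integrable_bounded_linear[OF bounded_linear_vec_nth K] by simp
    then have "integrable (lebesgue_on \<Omega>) (\<lambda>x. \<phi> x *\<^sub>R (K x $ j))"
      by (rule integrable_bounded_scaleR[OF _ b(1) C(1)])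
    then show "integrable (lebesgue_on \<Omega>) (\<lambda>x. K x $ j * \<phi> x)" by (simp add: mult.commute)
  qed
  have eqs: "(LINT x|lebesgue_on \<Omega>. u x * grad \<phi> x $ j) = - (LINT x|lebesgue_on \<Omega>. G x $ j * \<phi> x)"
    "(LINT x|lebesgue_on \<Omega>. v x * grad \<phi> x $ j) = - (LINT x|lebesgue_on \<Omega>. H x $ j * \<phi> x)"
    if "\<phi> \<in> Cc_infinity \<Omega>" for \<phi> j using G H that by (auto simp: has_weak_gradient_def)
  show "has_weak_gradient \<Omega> (\<lambda>x. u x - v x) (\<lambda>x. G x - H x)"
    unfolding has_weak_gradient_def using i * eqs by (auto simp: left_diff_distrib)
  show "has_weak_gradient \<Omega> (\<lambda>x. u x + v x) (\<lambda>x. G x + H x)"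
    unfolding has_weak_gradient_def using i * eqs by (auto simp: distrib_right)
qed

text \<open>Two test functions are integrated by parts on the whole space, where both vanish outside \<open>\<Omega>\<close>.\<close>

lemma has_weak_gradient_Cc:
  assumes \<Omega>: "open \<Omega>" and phi: "\<phi> \<in> Cc_infinity \<Omega>"
  shows "has_weak_gradient \<Omega> \<phi> (grad \<phi>)"
  unfolding has_weak_gradient_def
proof (intro conjI ballI allI)
  obtain R where c: "C1c R \<phi> (grad \<phi>)" using Cc_infinity_C1c[OF phi] .
  show "integrable (lebesgue_on \<Omega>) \<phi>" "integrable (lebesgue_on \<Omega>) (grad \<phi>)"
    using C1c_integrable_lebesgue_on[OF \<Omega> c] by auto
  fix \<psi> i assume psi: "\<psi> \<in> Cc_infinity \<Omega>"
  obtain S where d: "C1c S \<psi> (grad \<psi>)" using Cc_infinity_C1c[OF psi] .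
  note b = C1b_borel[OF C1c_C1b[OF c]] C1b_borel[OF C1c_C1b[OF d]]
  have [measurable]: "(\<lambda>x. grad \<phi> x $ i) \<in> borel_measurable borel" "(\<lambda>x. grad \<psi> x $ i) \<in> borel_measurable borel"
    using b by (auto intro: measurable_compose[OF _ vec_nth_borel])
  obtain C where C: "\<And>x. norm (\<psi> x) \<le> C" "\<And>x. norm (grad \<psi> x) \<le> C"
    using C1b_bound[OF C1c_C1b[OF d]] by (metis real_norm_def)
  have int: "integrable lborel (\<lambda>x. \<phi> x *\<^sub>R grad \<psi> x)" "integrable lborel (\<lambda>x. \<psi> x *\<^sub>R grad \<phi> x)"
    using b C by (auto intro!: integrable_scaleR_bounded[OF C1c_integrable(1)[OF c], where C=C]
        integrable_bounded_scaleR[OF C1c_integrable(2)[OF c], where C=C])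
  have "(LINT x|lebesgue_on \<Omega>. \<phi> x * grad \<psi> x $ i) = (LINT x|lborel. \<phi> x * grad \<psi> x $ i)"
    using b Cc_infinity_off[OF phi] by (intro lebesgue_on_borel(2)[OF \<Omega>]) auto
  also have "\<dots> = (LINT x|lborel. \<phi> x *\<^sub>R grad \<psi> x) $ i"
    by (simp add: vec_integral_nth[OF int(1)])
  also have "\<dots> = - (LINT x|lborel. \<psi> x *\<^sub>R grad \<phi> x) $ i"
    using integration_by_parts[OF c C1c_C1b[OF d]] by simp
  also have "\<dots> = - (LINT x|lborel. grad \<phi> x $ i * \<psi> x)"
    by (simp add: vec_integral_nth[OF int(2)] mult.commute)
  also have "\<dots> = - (LINT x|lebesgue_on \<Omega>. grad \<phi> x $ i * \<psi> x)"
    using b Cc_infinity_off[OF psi] by (subst lebesgue_on_borel(2)[OF \<Omega>]) auto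
  finally show "(LINT x|lebesgue_on \<Omega>. \<phi> x * grad \<psi> x $ i) = - (LINT x|lebesgue_on \<Omega>. grad \<phi> x $ i * \<psi> x)" .
qed

section \<open>Zero boundary values\<close>

text \<open>A Borel representative, extended by zero, of a function in the closure of the test functions.\<close>

definition zero_trace :: "(real^'n) set \<Rightarrow> (real^'n \<Rightarrow> real) \<Rightarrow> (real^'n \<Rightarrow> real^'n) \<Rightarrow> bool" where
  "zero_trace \<Omega> w G \<longleftrightarrow>
     integrable lborel w \<and> integrable lborel G \<and> (\<forall>x. x \<notin> \<Omega> \<longrightarrow> w x = 0 \<and> G x = 0) \<and>
     (\<exists>\<phi>. (\<forall>k::nat. \<phi> k \<in> Cc_infinity \<Omega>) \<and>
        (\<lambda>k. LINT x|lborel. \<bar>w x - \<phi> k x\<bar>) \<longlonglongrightarrow> 0 \<and>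
        (\<lambda>k. LINT x|lborel. norm (G x - grad (\<phi> k) x)) \<longlonglongrightarrow> 0)"

text \<open>The norm that defines the closure equals the sum of the two integrals over the whole space, because
  weak gradients are unique up to null sets.\<close>

lemma W11_0_zero_trace:
  fixes \<Omega> :: "(real^'n) set"
  assumes \<Omega>: "open \<Omega>" and u: "u \<in> W11_0 \<Omega>"
    and w: "w \<in> borel_measurable borel" "\<And>x. x \<notin> \<Omega> \<Longrightarrow> w x = 0" "AE x in lebesgue_on \<Omega>. u x = w x"
    and G: "G \<in> borel_measurable borel" "\<And>x. x \<notin> \<Omega> \<Longrightarrow> G x = 0" "AE x in lebesgue_on \<Omega>. wgrad \<Omega> u x = G x"
  shows "zero_trace \<Omega> w G"
proof -
  obtain \<phi> where phi: "\<And>k. \<phi> k \<in> Cc_infinity \<Omega>" "(\<lambda>k. W11_norm \<Omega> (\<lambda>x. u x - \<phi> k x)) \<longlonglongrightarrow> 0"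
    using u by (auto simp: W11_0_def)
  have hw: "has_weak_gradient \<Omega> u (wgrad \<Omega> u)" using u has_weak_gradient_wgrad by (auto simp: W11_0_def)
  then have iu: "integrable (lebesgue_on \<Omega>) u" "integrable (lebesgue_on \<Omega>) (wgrad \<Omega> u)"
    by (auto simp: has_weak_gradient_def)
  have "integrable (lebesgue_on \<Omega>) w"
    using iu(1) w(3) borel_lebesgue_on[OF w(1)] by (subst integrable_cong_AE[symmetric, where f=u]) auto
  then have iw: "integrable lborel w" using lebesgue_on_borel(1)[OF \<Omega> w(1,2)] by simp
  have "integrable (lebesgue_on \<Omega>) G"
    using iu(2) G(3) borel_lebesgue_on[OF G(1)] by (subst integrable_cong_AE[symmetric, where f="wgrad \<Omega> u"]) auto
  then have iG: "integrable lborel G" using lebesgue_on_borel(1)[OF \<Omega> G(1,2)] by simp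
  have eq: "W11_norm \<Omega> (\<lambda>x. u x - \<phi> k x) =
      (LINT x|lborel. \<bar>w x - \<phi> k x\<bar>) + (LINT x|lborel. norm (G x - grad (\<phi> k) x))" for k
  proof -
    obtain R where c: "C1c R (\<phi> k) (grad (\<phi> k))" using Cc_infinity_C1c[OF phi(1)] .
    note [measurable] = C1b_borel[OF C1c_C1b[OF c]] w(1) G(1)
    note hd = has_weak_gradient_diff_add(1)[OF hw has_weak_gradient_Cc[OF \<Omega> phi(1)[of k]] \<Omega>]
    note hi = has_weak_gradient_wgrad[of "\<lambda>x. u x - \<phi> k x" \<Omega>, unfolded has_weak_gradient_def]
    have W: "(\<lambda>x. u x - \<phi> k x) \<in> W11 \<Omega>" using hd by (auto simp: W11_def)
    have "(LINT x|lebesgue_on \<Omega>. \<bar>u x - \<phi> k x\<bar>) = (LINT x|lebesgue_on \<Omega>. \<bar>w x - \<phi> k x\<bar>)"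
    proof (rule integral_cong_AE)
      show "AE x in lebesgue_on \<Omega>. \<bar>u x - \<phi> k x\<bar> = \<bar>w x - \<phi> k x\<bar>" using w(3) by eventually_elim simp
      show "(\<lambda>x. \<bar>u x - \<phi> k x\<bar>) \<in> borel_measurable (lebesgue_on \<Omega>)" using hi W by auto
      show "(\<lambda>x. \<bar>w x - \<phi> k x\<bar>) \<in> borel_measurable (lebesgue_on \<Omega>)" by (intro borel_lebesgue_on) measurable
    qed
    also have "\<dots> = (LINT x|lborel. \<bar>w x - \<phi> k x\<bar>)"
      using w(2) Cc_infinity_off[OF phi(1)] by (intro lebesgue_on_borel(2)[OF \<Omega>]) auto
    finally have 1: "(LINT x|lebesgue_on \<Omega>. \<bar>u x - \<phi> k x\<bar>) = (LINT x|lborel. \<bar>w x - \<phi> k x\<bar>)" .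
    have "(LINT x|lebesgue_on \<Omega>. norm (wgrad \<Omega> (\<lambda>x. u x - \<phi> k x) x)) = (LINT x|lebesgue_on \<Omega>. norm (G x - grad (\<phi> k) x))"
    proof (rule integral_cong_AE)
      show "AE x in lebesgue_on \<Omega>. norm (wgrad \<Omega> (\<lambda>x. u x - \<phi> k x) x) = norm (G x - grad (\<phi> k) x)"
        using wgrad_eq[OF \<Omega> hd] G(3) by eventually_elim simp
      have "wgrad \<Omega> (\<lambda>x. u x - \<phi> k x) \<in> borel_measurable (lebesgue_on \<Omega>)" using hi W by auto
      then show "(\<lambda>x. norm (wgrad \<Omega> (\<lambda>x. u x - \<phi> k x) x)) \<in> borel_measurable (lebesgue_on \<Omega>)" by measurable
      show "(\<lambda>x. norm (G x - grad (\<phi> k) x)) \<in> borel_measurable (lebesgue_on \<Omega>)" by (intro borel_lebesgue_on) measurable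
    qed
    also have "\<dots> = (LINT x|lborel. norm (G x - grad (\<phi> k) x))"
      using G(2) Cc_infinity_grad_off[OF phi(1)] by (intro lebesgue_on_borel(2)[OF \<Omega>]) auto
    finally show ?thesis using 1 by (simp add: W11_norm_def)
  qed
  have nn: "0 \<le> (LINT x|lborel. \<bar>w x - \<phi> k x\<bar>)" "0 \<le> (LINT x|lborel. norm (G x - grad (\<phi> k) x))" for k by auto
  have "(\<lambda>k. LINT x|lborel. \<bar>w x - \<phi> k x\<bar>) \<longlonglongrightarrow> 0"
    by (rule tendsto_sandwich[OF _ _ tendsto_const phi(2)]) (auto simp: eq nn)
  moreover have "(\<lambda>k. LINT x|lborel. norm (G x - grad (\<phi> k) x)) \<longlonglongrightarrow> 0"
    by (rule tendsto_sandwich[OF _ _ tendsto_const phi(2)]) (auto simp: eq nn)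
  ultimately show ?thesis unfolding zero_trace_def using iw iG w(2) G(2) phi(1) by blast
qed

text \<open>For a function that vanishes outside \<open>\<Omega>\<close>, this contains zero boundary values: the admissible \<open>\<phi>\<close> do not
  vanish at the boundary of \<open>\<Omega>\<close>, and no boundary term appears.\<close>

definition global_wgrad :: "(real^'n \<Rightarrow> real) \<Rightarrow> (real^'n \<Rightarrow> real^'n) \<Rightarrow> bool" where
  "global_wgrad w G \<longleftrightarrow> integrable lborel w \<and> integrable lborel G \<and>
     (\<forall>\<phi> D. C1b \<phi> D \<longrightarrow> (LINT x|lborel. w x *\<^sub>R D x) = - (LINT x|lborel. \<phi> x *\<^sub>R G x))"

lemma integral_tendsto_of_L1:
  fixes f :: "'a \<Rightarrow> 'b::{banach, second_countable_topology}"
  assumes "integrable M f" "\<And>k. integrable M (g k)" "a \<longlonglongrightarrow> 0"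
    and "\<And>k. (LINT x|M. norm (f x - g k x)) \<le> a k"
  shows "(\<lambda>k. LINT x|M. g k x) \<longlonglongrightarrow> (LINT x|M. f x)"
proof -
  have "norm ((LINT x|M. g k x) - (LINT x|M. f x)) \<le> a k" for k
  proof -
    have "norm ((LINT x|M. g k x) - (LINT x|M. f x)) = norm (LINT x|M. f x - g k x)"
      using assms(1,2) by (simp add: norm_minus_commute)
    also have "\<dots> \<le> (LINT x|M. norm (f x - g k x))" by (rule integral_norm_bound)
    finally show ?thesis using assms(4)[of k] by simp
  qed
  then have "(\<lambda>k. (LINT x|M. g k x) - (LINT x|M. f x)) \<longlonglongrightarrow> 0"
    by (intro Lim_null_comparison[OF _ assms(3)]) auto
  then show ?thesis using LIM_zero_iff by blast
qed

lemma global_wgrad_limit: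
  fixes w :: "real^'n \<Rightarrow> real"
  assumes w: "integrable lborel w" and G: "integrable lborel G"
    and c: "\<And>k. C1c (R k) (v k) (E k)"
    and lw: "(\<lambda>k. LINT x|lborel. \<bar>w x - v k x\<bar>) \<longlonglongrightarrow> 0"
    and lG: "(\<lambda>k. LINT x|lborel. norm (G x - E k x)) \<longlonglongrightarrow> 0"
  shows "global_wgrad w G"
  unfolding global_wgrad_def
proof (intro conjI w G allI impI)
  fix \<phi> :: "real^'n \<Rightarrow> real" and D assume phi: "C1b \<phi> D"
  obtain C where C: "0 \<le> C" "\<And>x. \<bar>\<phi> x\<bar> \<le> C" "\<And>x. norm (D x) \<le> C" using C1b_bound[OF phi] by metis
  note b = C1b_borel[OF phi]
  note iv = C1c_integrable[OF c]
  have l1: "(\<lambda>k. LINT x|lborel. v k x *\<^sub>R D x) \<longlonglongrightarrow> (LINT x|lborel. w x *\<^sub>R D x)"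
  proof (rule integral_tendsto_of_L1)
    show "(\<lambda>k. C * (LINT x|lborel. \<bar>w x - v k x\<bar>)) \<longlonglongrightarrow> 0" using tendsto_mult_right_zero[OF lw] by simp
    show "integrable lborel (\<lambda>x. w x *\<^sub>R D x)" "integrable lborel (\<lambda>x. v k x *\<^sub>R D x)" for k
      using w iv(1) b(2) C(3) by (auto intro!: integrable_scaleR_bounded[where C=C])
    then have i: "integrable lborel (\<lambda>x. norm (w x *\<^sub>R D x - v k x *\<^sub>R D x))" for k by auto
    show "(LINT x|lborel. norm (w x *\<^sub>R D x - v k x *\<^sub>R D x)) \<le> C * (LINT x|lborel. \<bar>w x - v k x\<bar>)" for k
    proof -
      have "(LINT x|lborel. norm (w x *\<^sub>R D x - v k x *\<^sub>R D x)) \<le> (LINT x|lborel. C * \<bar>w x - v k x\<bar>)"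
      proof (rule integral_mono[OF i])
        show "integrable lborel (\<lambda>x. C * \<bar>w x - v k x\<bar>)" using w iv(1) by auto
        show "norm (w x *\<^sub>R D x - v k x *\<^sub>R D x) \<le> C * \<bar>w x - v k x\<bar>" for x
          unfolding scaleR_diff_left[symmetric] norm_scaleR using C(3)[of x]
          by (simp add: mult.commute[of C] mult_left_mono)
      qed
      then show ?thesis by simp
    qed
  qed
  have l2: "(\<lambda>k. LINT x|lborel. \<phi> x *\<^sub>R E k x) \<longlonglongrightarrow> (LINT x|lborel. \<phi> x *\<^sub>R G x)"
  proof (rule integral_tendsto_of_L1)
    show "(\<lambda>k. C * (LINT x|lborel. norm (G x - E k x))) \<longlonglongrightarrow> 0" using tendsto_mult_right_zero[OF lG] by simp
    show "integrable lborel (\<lambda>x. \<phi> x *\<^sub>R G x)" "integrable lborel (\<lambda>x. \<phi> x *\<^sub>R E k x)" for k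
      using G iv(2) b(1) C(2) by (auto intro!: integrable_bounded_scaleR[where C=C])
    then have i: "integrable lborel (\<lambda>x. norm (\<phi> x *\<^sub>R G x - \<phi> x *\<^sub>R E k x))" for k by auto
    show "(LINT x|lborel. norm (\<phi> x *\<^sub>R G x - \<phi> x *\<^sub>R E k x)) \<le> C * (LINT x|lborel. norm (G x - E k x))" for k
    proof -
      have "(LINT x|lborel. norm (\<phi> x *\<^sub>R G x - \<phi> x *\<^sub>R E k x)) \<le> (LINT x|lborel. C * norm (G x - E k x))"
      proof (rule integral_mono[OF i])
        show "integrable lborel (\<lambda>x. C * norm (G x - E k x))" using G iv(2) by auto
        show "norm (\<phi> x *\<^sub>R G x - \<phi> x *\<^sub>R E k x) \<le> C * norm (G x - E k x)" for x
          unfolding scaleR_diff_right[symmetric] norm_scaleR using C(2)[of x]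
          by (simp add: mult_right_mono)
      qed
      then show ?thesis by simp
    qed
  qed
  have "(\<lambda>k. LINT x|lborel. v k x *\<^sub>R D x) = (\<lambda>k. - (LINT x|lborel. \<phi> x *\<^sub>R E k x))"
    using integration_by_parts[OF c phi] by auto
  then show "(LINT x|lborel. w x *\<^sub>R D x) = - (LINT x|lborel. \<phi> x *\<^sub>R G x)"
    using LIMSEQ_unique[OF l1] tendsto_minus[OF l2] by simp
qed

text \<open>The chain rule; the identity function gives the weak gradient of the extension by zero itself.\<close>

lemma zero_trace_chain:
  fixes w :: "real^'n \<Rightarrow> real"
  assumes z: "zero_trace \<Omega> w G"
    and th: "\<And>s. DERIV \<theta> s :> \<theta>' s" "continuous_on UNIV \<theta>'" "\<theta> 0 = 0" "\<And>s. \<bar>\<theta>' s\<bar> \<le> 1"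
  shows "global_wgrad (\<lambda>x. \<theta> (w x)) (\<lambda>x. \<theta>' (w x) *\<^sub>R G x)"
proof -
  obtain \<phi> where iw: "integrable lborel w" and iG: "integrable lborel G"
    and phi: "\<And>k::nat. \<phi> k \<in> Cc_infinity \<Omega>" "(\<lambda>k. LINT x|lborel. \<bar>w x - \<phi> k x\<bar>) \<longlonglongrightarrow> 0"
        "(\<lambda>k. LINT x|lborel. norm (G x - grad (\<phi> k) x)) \<longlonglongrightarrow> 0"
    using z by (auto simp: zero_trace_def)
  have "\<forall>k. \<exists>R. C1c R (\<phi> k) (grad (\<phi> k))" using Cc_infinity_C1c[OF phi(1)] by metis
  then obtain R where c: "\<And>k. C1c (R k) (\<phi> k) (grad (\<phi> k))" by metis
  note ip = C1c_integrable[OF c]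
  have lip: "\<bar>\<theta> a - \<theta> b\<bar> \<le> \<bar>a - b\<bar>" for a b
  proof -
    have "norm (\<theta> a - \<theta> b) \<le> 1 * norm (a - b)"
      by (rule field_differentiable_bound[where S=UNIV and f'=\<theta>']) (use th in \<open>auto intro: has_field_derivative_at_within\<close>)
    then show ?thesis by simp
  qed
  have ct: "continuous_on UNIV \<theta>" using th(1) DERIV_isCont continuous_at_imp_continuous_on by blast
  have [measurable]: "\<theta> \<in> borel_measurable borel" "\<theta>' \<in> borel_measurable borel"
    "w \<in> borel_measurable borel" "G \<in> borel_measurable borel"
    "\<And>k. \<phi> k \<in> borel_measurable borel" "\<And>k. grad (\<phi> k) \<in> borel_measurable borel"
    using ct th(2) iw iG C1b_borel[OF C1c_C1b[OF c]] by (auto intro: borel_measurable_continuous_onI)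
  have "integrable lborel (\<lambda>x. w x - \<phi> k x)" for k using iw ip by auto
  with phi(2) obtain r where r: "strict_mono r" "AE x in lborel. (\<lambda>k. w x - \<phi> (r k) x) \<longlonglongrightarrow> 0"
    using tendsto_L1_AE_subseq[of lborel "\<lambda>k x. w x - \<phi> k x"] by auto
  have itG: "integrable lborel (\<lambda>x. \<theta>' (w x) *\<^sub>R G x)"
    using th(4) by (intro integrable_bounded_scaleR[OF iG, where C=1]) auto
  have itw: "integrable lborel (\<lambda>x. \<theta> (w x))"
    using lip[of _ 0] th(3) by (intro Bochner_Integration.integrable_bound[OF iw]) auto
  have cc: "C1c (R k) (\<lambda>x. \<theta> (\<phi> k x)) (\<lambda>x. \<theta>' (\<phi> k x) *\<^sub>R grad (\<phi> k) x)" for k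
    using c[of k] C1b_compose[OF C1c_C1b[OF c[of k]] th(1,2)] th(3) by (auto simp: C1c_def)
  note icc = C1c_integrable[OF cc]
  show ?thesis
  proof (rule global_wgrad_limit[where v="\<lambda>k x. \<theta> (\<phi> (r k) x)" and E="\<lambda>k x. \<theta>' (\<phi> (r k) x) *\<^sub>R grad (\<phi> (r k)) x", OF itw itG cc])
    have le: "(LINT x|lborel. \<bar>\<theta> (w x) - \<theta> (\<phi> k x)\<bar>) \<le> (LINT x|lborel. \<bar>w x - \<phi> k x\<bar>)" for k
      using itw icc(1)[of k] iw ip(1)[of k] lip by (intro integral_mono) auto
    have "(\<lambda>k. LINT x|lborel. \<bar>w x - \<phi> (r k) x\<bar>) \<longlonglongrightarrow> 0"
      using LIMSEQ_subseq_LIMSEQ[OF phi(2) r(1)] by (simp add: o_def)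
    then show "(\<lambda>k. LINT x|lborel. \<bar>\<theta> (w x) - \<theta> (\<phi> (r k) x)\<bar>) \<longlonglongrightarrow> 0"
      by (rule Lim_null_comparison[rotated]) (use le in auto)
    define q where "q k x = norm ((\<theta>' (w x) - \<theta>' (\<phi> (r k) x)) *\<^sub>R G x)" for k x
    have iq: "integrable lborel (q k)" for k
    proof -
      have "\<bar>\<theta>' (w x) - \<theta>' (\<phi> (r k) x)\<bar> \<le> 2" for x using th(4)[of "w x"] th(4)[of "\<phi> (r k) x"] by linarith
      then show ?thesis unfolding q_def
        by (intro integrable_norm integrable_bounded_scaleR[OF iG, where C=2]) auto
    qed
    have "(\<lambda>k. LINT x|lborel. q k x) \<longlonglongrightarrow> (LINT x|(lborel::(real^'n) measure). 0)"
    proof (rule integral_dominated_convergence[where w="\<lambda>x. 2 * norm (G x)"])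
      show "AE x in lborel. (\<lambda>k. q k x) \<longlonglongrightarrow> 0"
        using r(2)
      proof eventually_elim
        case (elim x)
        then have "(\<lambda>k. w x - (w x - \<phi> (r k) x)) \<longlonglongrightarrow> w x - 0" by (intro tendsto_intros)
        then have "(\<lambda>k. \<phi> (r k) x) \<longlonglongrightarrow> w x" by simp
        then have "(\<lambda>k. \<theta>' (\<phi> (r k) x)) \<longlonglongrightarrow> \<theta>' (w x)"
          using th(2) continuous_on_tendsto_compose[of UNIV \<theta>'] by auto
        then have "(\<lambda>k. q k x) \<longlonglongrightarrow> norm ((\<theta>' (w x) - \<theta>' (w x)) *\<^sub>R G x)"
          unfolding q_def by (intro tendsto_intros)
        then show ?case by simp
      qed
      have "norm (q k x) \<le> 2 * norm (G x)" for k x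
      proof -
        have "\<bar>\<theta>' (w x) - \<theta>' (\<phi> (r k) x)\<bar> \<le> 2" using th(4)[of "w x"] th(4)[of "\<phi> (r k) x"] by linarith
        then show ?thesis by (simp add: q_def mult_right_mono)
      qed
      then show "AE x in lborel. norm (q k x) \<le> 2 * norm (G x)" for k by simp
    qed (use iG iq in auto)
    then have lq: "(\<lambda>k. LINT x|lborel. q k x) \<longlonglongrightarrow> 0" by simp
    have lg: "(\<lambda>k. LINT x|lborel. norm (G x - grad (\<phi> (r k)) x)) \<longlonglongrightarrow> 0"
      using LIMSEQ_subseq_LIMSEQ[OF phi(3) r(1)] by (simp add: o_def)
    have le: "(LINT x|lborel. norm (\<theta>' (w x) *\<^sub>R G x - \<theta>' (\<phi> (r k) x) *\<^sub>R grad (\<phi> (r k)) x)) \<le>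
        (LINT x|lborel. q k x) + (LINT x|lborel. norm (G x - grad (\<phi> (r k)) x))" for k
    proof -
      have i2: "integrable lborel (\<lambda>x. norm (G x - grad (\<phi> (r k)) x))" using iG ip(2) by auto
      have "(LINT x|lborel. norm (\<theta>' (w x) *\<^sub>R G x - \<theta>' (\<phi> (r k) x) *\<^sub>R grad (\<phi> (r k)) x)) \<le>
        (LINT x|lborel. q k x + norm (G x - grad (\<phi> (r k)) x))"
      proof (rule integral_mono)
        show "integrable lborel (\<lambda>x. norm (\<theta>' (w x) *\<^sub>R G x - \<theta>' (\<phi> (r k) x) *\<^sub>R grad (\<phi> (r k)) x))"
          using itG icc(2)[of "r k"] by auto
        show "integrable lborel (\<lambda>x. q k x + norm (G x - grad (\<phi> (r k)) x))" using iq i2 by auto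
        fix x
        have "\<theta>' (w x) *\<^sub>R G x - \<theta>' (\<phi> (r k) x) *\<^sub>R grad (\<phi> (r k)) x =
            (\<theta>' (w x) - \<theta>' (\<phi> (r k) x)) *\<^sub>R G x + \<theta>' (\<phi> (r k) x) *\<^sub>R (G x - grad (\<phi> (r k)) x)"
          by (simp add: algebra_simps)
        then have "norm (\<theta>' (w x) *\<^sub>R G x - \<theta>' (\<phi> (r k) x) *\<^sub>R grad (\<phi> (r k)) x) \<le>
            q k x + \<bar>\<theta>' (\<phi> (r k) x)\<bar> * norm (G x - grad (\<phi> (r k)) x)"
          unfolding q_def by (metis norm_scaleR norm_triangle_ineq)
        also have "\<dots> \<le> q k x + 1 * norm (G x - grad (\<phi> (r k)) x)"
          using th(4) by (intro add_left_mono mult_right_mono) auto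
        finally show "norm (\<theta>' (w x) *\<^sub>R G x - \<theta>' (\<phi> (r k) x) *\<^sub>R grad (\<phi> (r k)) x) \<le>
            q k x + norm (G x - grad (\<phi> (r k)) x)" by simp
      qed
      also have "\<dots> = (LINT x|lborel. q k x) + (LINT x|lborel. norm (G x - grad (\<phi> (r k)) x))"
        using iq i2 by simp
      finally show ?thesis .
    qed
    show "(\<lambda>k. LINT x|lborel. norm (\<theta>' (w x) *\<^sub>R G x - \<theta>' (\<phi> (r k) x) *\<^sub>R grad (\<phi> (r k)) x)) \<longlonglongrightarrow> 0"
      by (rule Lim_null_comparison[OF _ tendsto_add_zero[OF lq lg]]) (use le in auto)
  qed
qed

section \<open>Lipschitz boundaries\<close>

text \<open>The fundamental theorem of calculus along the segment from \<open>y\<close> to \<open>y + s e\<close>, integrated over \<open>Q\<close>; the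
  segments stay in \<open>T\<close>. The point is that only the gradient on \<open>T\<close> enters.\<close>

lemma C1c_translate_estimate:
  fixes \<phi> :: "real^'n \<Rightarrow> real"
  assumes c: "C1c R \<phi> D" and e: "norm e = 1" and s: "0 \<le> s"
    and [measurable]: "Q \<in> sets borel" "T \<in> sets borel"
    and QT: "\<And>y r. y \<in> Q \<Longrightarrow> 0 \<le> r \<Longrightarrow> r \<le> s \<Longrightarrow> y + r *\<^sub>R e \<in> T"
  shows "(LINT y|lborel. indicator Q y * \<bar>\<phi> (y + s *\<^sub>R e) - \<phi> y\<bar>) \<le> s * (LINT y|lborel. indicator T y * norm (D y))"
proof -
  note b = C1b_borel[OF C1c_C1b[OF c]]
  note [measurable] = b
  note i = C1c_integrable[OF c]
  have cD: "continuous_on S D" for S using C1b_continuous(2)[OF C1c_C1b[OF c]] .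
  define J where "J = (LINT y|lborel. indicator T y * norm (D y))"
  let ?F = "\<lambda>(r::real, y). indicator {0..s} r * (indicator Q y * norm (D (y + r *\<^sub>R e)))"
  have iT: "integrable lborel (\<lambda>y. indicator T y * norm (D y))"
    using integrable_mult_indicator[of T lborel "\<lambda>y. norm (D y)"] i by simp
  have iDr: "integrable lborel (\<lambda>y. norm (D (y + r *\<^sub>R e)))" for r
    using integrable_translate[OF i(2)] by (rule integrable_norm)
  have iQ: "integrable lborel (\<lambda>y. indicator Q y * norm (D (y + r *\<^sub>R e)))" for r
    using integrable_mult_indicator[of Q lborel, OF _ iDr[of r]] by simp
  have le: "(LINT y|lborel. indicator Q y * norm (D (y + r *\<^sub>R e))) \<le> J" if "0 \<le> r" "r \<le> s" for r
  proof -
    have iTr: "integrable lborel (\<lambda>y. indicator T (y + r *\<^sub>R e) * norm (D (y + r *\<^sub>R e)))"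
      using integrable_translate[OF iT, of "r *\<^sub>R e"] .
    have "(LINT y|lborel. indicator Q y * norm (D (y + r *\<^sub>R e))) \<le>
        (LINT y|lborel. indicator T (y + r *\<^sub>R e) * norm (D (y + r *\<^sub>R e)))"
      using QT that by (intro integral_mono[OF iQ iTr] mult_right_mono) (auto split: split_indicator)
    also have "\<dots> = J"
      unfolding J_def by (rule lborel_integral_translate(2)) measurable
    finally show ?thesis .
  qed
  have J0: "0 \<le> J" unfolding J_def by simp
  have inner: "(LINT y|lborel. ?F (r, y)) \<le> indicator {0..s} r * J" for r
    using le[of r] by (auto split: split_indicator)
  have inner0: "0 \<le> (LINT y|lborel. ?F (r, y))" for r by (auto intro!: integral_nonneg_AE)
  have "integrable lborel (indicator {0..s} :: real \<Rightarrow> real)"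
    using s by (intro integrable_real_indicator) auto
  then have iJ: "integrable lborel (\<lambda>r::real. indicator {0..s} r * J)" by (rule integrable_mult_left)
  have iF: "integrable (lborel \<Otimes>\<^sub>M lborel) ?F"
  proof (rule lborel_pair.Fubini_integrable)
    have eq: "(LINT y|lborel. norm (?F (r, y))) = (LINT y|lborel. ?F (r, y))" for r
      by (intro Bochner_Integration.integral_cong) auto
    show "integrable lborel (\<lambda>r. LINT y|lborel. norm (?F (r, y)))"
      unfolding eq
    proof (rule Bochner_Integration.integrable_bound[OF iJ])
      show "(\<lambda>r. LINT y|lborel. ?F (r, y)) \<in> borel_measurable lborel" by measurable
      show "AE r in lborel. norm (LINT y|lborel. ?F (r, y)) \<le> norm (indicator {0..s} r * J)"
        using inner inner0 J0 by (intro AE_I2) (simp only: real_norm_def abs_of_nonneg, smt (verit))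
    qed
    show "AE r in lborel. integrable lborel (\<lambda>y. ?F (r, y))" using iQ by (intro AE_I2) auto
  qed measurable
  have pt: "\<bar>\<phi> (y + s *\<^sub>R e) - \<phi> y\<bar> \<le> (LINT r|lborel. indicator {0..s} r * norm (D (y + r *\<^sub>R e)))" for y
  proof -
    have line: "((\<lambda>r. y + r *\<^sub>R e) has_derivative (\<lambda>h. h *\<^sub>R e)) (at r)" for r
      by (auto intro!: derivative_eq_intros)
    have d: "DERIV (\<lambda>r. \<phi> (y + r *\<^sub>R e)) r :> e \<bullet> D (y + r *\<^sub>R e)" for r
      unfolding has_field_derivative_def
      using has_derivative_compose[OF line GDERIV_D[OF C1b_GDERIV[OF C1c_C1b[OF c]]]]
      by (simp add: mult_commute_abs)
    have cont: "continuous_on S (\<lambda>r. D (y + r *\<^sub>R e))" for S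
      by (rule continuous_on_compose2[OF cD[of UNIV]]) (auto intro!: continuous_intros)
    have ic: "isCont (\<lambda>r. e \<bullet> D (y + r *\<^sub>R e)) r" for r
      using cont[of UNIV] by (intro continuous_intros) (auto simp: continuous_on_eq_continuous_at)
    have "\<phi> (y + s *\<^sub>R e) - \<phi> (y + 0 *\<^sub>R e) = (LINT r|lborel. (e \<bullet> D (y + r *\<^sub>R e)) * indicator {0..s} r)"
      by (rule integral_FTC_Icc_real[OF s d ic, symmetric])
    then have "\<bar>\<phi> (y + s *\<^sub>R e) - \<phi> y\<bar> = norm (LINT r|lborel. indicator {0..s} r *\<^sub>R (e \<bullet> D (y + r *\<^sub>R e)))"
      by (simp add: mult.commute)
    also have "\<dots> \<le> (LINT r|lborel. norm (indicator {0..s} r *\<^sub>R (e \<bullet> D (y + r *\<^sub>R e))))"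
      by (rule integral_norm_bound)
    also have "\<dots> \<le> (LINT r|lborel. indicator {0..s} r *\<^sub>R norm (D (y + r *\<^sub>R e)))"
    proof (rule integral_mono)
      show "integrable lborel (\<lambda>r. norm (indicator {0..s} r *\<^sub>R (e \<bullet> D (y + r *\<^sub>R e))))"
        by (intro integrable_norm borel_integrable_compact continuous_intros cont) auto
      show "integrable lborel (\<lambda>r. indicator {0..s} r *\<^sub>R norm (D (y + r *\<^sub>R e)))"
        by (intro borel_integrable_compact continuous_intros cont) auto
      show "norm (indicator {0..s} r *\<^sub>R (e \<bullet> D (y + r *\<^sub>R e))) \<le> indicator {0..s} r *\<^sub>R norm (D (y + r *\<^sub>R e))" for r
        using Cauchy_Schwarz_ineq2[of e "D (y + r *\<^sub>R e)"] e by (auto split: split_indicator)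
    qed
    finally show ?thesis by simp
  qed
  have "integrable lborel (\<lambda>y. \<phi> (y + s *\<^sub>R e) - \<phi> y)" using integrable_translate[OF i(1)] i(1) by auto
  then have i1: "integrable lborel (\<lambda>y. indicator Q y * \<bar>\<phi> (y + s *\<^sub>R e) - \<phi> y\<bar>)"
    using integrable_mult_indicator[of Q lborel, OF _ integrable_abs] by simp
  have "(LINT y|lborel. indicator Q y * \<bar>\<phi> (y + s *\<^sub>R e) - \<phi> y\<bar>) \<le> (LINT y|lborel. LINT r|lborel. ?F (r, y))"
  proof (rule integral_mono[OF i1])
    show "integrable lborel (\<lambda>y. LINT r|lborel. ?F (r, y))"
      using lborel_pair.integrable_snd[of "\<lambda>r y. ?F (r, y)"] iF by simp
    fix y
    have "(LINT r|lborel. ?F (r, y)) = indicator Q y * (LINT r|lborel. indicator {0..s} r * norm (D (y + r *\<^sub>R e)))"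
      by (cases "y \<in> Q") simp_all
    then show "indicator Q y * \<bar>\<phi> (y + s *\<^sub>R e) - \<phi> y\<bar> \<le> (LINT r|lborel. ?F (r, y))"
      using pt[of y] by (simp add: mult_left_mono)
  qed
  also have "\<dots> = (LINT r|lborel. LINT y|lborel. ?F (r, y))"
    using lborel_pair.Fubini_integral[of "\<lambda>r y. ?F (r, y)"] iF by simp
  also have "\<dots> \<le> (LINT r|lborel. indicator {0..s} r * J)"
    using lborel_pair.integrable_fst[of "\<lambda>r y. ?F (r, y)"] iF
    by (intro integral_mono[OF _ iJ inner]) simp
  also have "\<dots> = s * J" using s by simp
  finally show ?thesis by (simp add: J_def)
qed

lemma zero_trace_translate_estimate:
  fixes w :: "real^'n \<Rightarrow> real"
  assumes z: "zero_trace \<Omega> w G" and e: "norm e = 1" and s: "0 \<le> s"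
    and Q: "Q \<in> sets borel" and T: "T \<in> sets borel"
    and QT: "\<And>y r. y \<in> Q \<Longrightarrow> 0 \<le> r \<Longrightarrow> r \<le> s \<Longrightarrow> y + r *\<^sub>R e \<in> T"
  shows "(LINT y|lborel. indicator Q y * \<bar>w (y + s *\<^sub>R e) - w y\<bar>) \<le> s * (LINT y|lborel. indicator T y * norm (G y))"
proof -
  obtain \<phi> where iw: "integrable lborel w" and iG: "integrable lborel G"
    and phi: "\<And>k::nat. \<phi> k \<in> Cc_infinity \<Omega>" "(\<lambda>k. LINT x|lborel. \<bar>w x - \<phi> k x\<bar>) \<longlonglongrightarrow> 0"
        "(\<lambda>k. LINT x|lborel. norm (G x - grad (\<phi> k) x)) \<longlonglongrightarrow> 0"
    using z by (auto simp: zero_trace_def)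
  have "\<exists>R. C1c R (\<phi> k) (grad (\<phi> k))" for k using Cc_infinity_C1c[OF phi(1)] by metis
  then obtain R where c: "\<And>k. C1c (R k) (\<phi> k) (grad (\<phi> k))" by metis
  note ip = C1c_integrable[OF c]
  have Ql: "Q \<in> sets lborel" and Tl: "T \<in> sets lborel" using Q T by auto
  have indQ: "integrable lborel (\<lambda>y. indicator Q y * f y)" if "integrable lborel f" for f :: "real^'n \<Rightarrow> real"
    using integrable_mult_indicator[OF Ql that] by simp
  have indT: "integrable lborel (\<lambda>y. indicator T y * f y)" if "integrable lborel f" for f :: "real^'n \<Rightarrow> real"
    using integrable_mult_indicator[OF Tl that] by simp
  let ?A = "\<lambda>k. LINT x|lborel. \<bar>w x - \<phi> k x\<bar>" and ?B = "\<lambda>k. LINT x|lborel. norm (G x - grad (\<phi> k) x)"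
  have main: "(LINT y|lborel. indicator Q y * \<bar>w (y + s *\<^sub>R e) - w y\<bar>) \<le>
      s * (LINT y|lborel. indicator T y * norm (G y)) + s * ?B k + 2 * ?A k" for k
  proof -
    have id: "integrable lborel (\<lambda>y. \<bar>w y - \<phi> k y\<bar>)" using iw ip(1)[of k] by auto
    have ids: "integrable lborel (\<lambda>y. \<bar>w (y + s *\<^sub>R e) - \<phi> k (y + s *\<^sub>R e)\<bar>)" using integrable_translate[OF id] .
    have il: "integrable lborel (\<lambda>y. \<bar>w (y + s *\<^sub>R e) - w y\<bar>)" using integrable_translate[OF iw] iw by auto
    have im: "integrable lborel (\<lambda>y. \<bar>\<phi> k (y + s *\<^sub>R e) - \<phi> k y\<bar>)" using integrable_translate[OF ip(1)] ip(1) by auto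
    have "(LINT y|lborel. indicator Q y * \<bar>w (y + s *\<^sub>R e) - w y\<bar>) \<le>
       (LINT y|lborel. indicator Q y * \<bar>\<phi> k (y + s *\<^sub>R e) - \<phi> k y\<bar> + \<bar>w (y + s *\<^sub>R e) - \<phi> k (y + s *\<^sub>R e)\<bar> + \<bar>w y - \<phi> k y\<bar>)"
    proof (rule integral_mono[OF indQ[OF il]])
      show "integrable lborel (\<lambda>y. indicator Q y * \<bar>\<phi> k (y + s *\<^sub>R e) - \<phi> k y\<bar> + \<bar>w (y + s *\<^sub>R e) - \<phi> k (y + s *\<^sub>R e)\<bar> + \<bar>w y - \<phi> k y\<bar>)"
        using indQ[OF im] ids id by auto
      show "indicator Q y * \<bar>w (y + s *\<^sub>R e) - w y\<bar> \<le>
        indicator Q y * \<bar>\<phi> k (y + s *\<^sub>R e) - \<phi> k y\<bar> + \<bar>w (y + s *\<^sub>R e) - \<phi> k (y + s *\<^sub>R e)\<bar> + \<bar>w y - \<phi> k y\<bar>" for y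
        by (cases "y \<in> Q") auto
    qed
    also have "\<dots> = (LINT y|lborel. indicator Q y * \<bar>\<phi> k (y + s *\<^sub>R e) - \<phi> k y\<bar>) +
       (LINT y|lborel. \<bar>w (y + s *\<^sub>R e) - \<phi> k (y + s *\<^sub>R e)\<bar>) + ?A k"
      using indQ[OF im] ids id by simp
    also have "(LINT y|lborel. \<bar>w (y + s *\<^sub>R e) - \<phi> k (y + s *\<^sub>R e)\<bar>) = ?A k"
      using lborel_integral_translate(2)[of "\<lambda>y. \<bar>w y - \<phi> k y\<bar>"] id by auto
    finally have 1: "(LINT y|lborel. indicator Q y * \<bar>w (y + s *\<^sub>R e) - w y\<bar>) \<le>
        (LINT y|lborel. indicator Q y * \<bar>\<phi> k (y + s *\<^sub>R e) - \<phi> k y\<bar>) + ?A k + ?A k" .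
    have 2: "(LINT y|lborel. indicator Q y * \<bar>\<phi> k (y + s *\<^sub>R e) - \<phi> k y\<bar>) \<le>
        s * (LINT y|lborel. indicator T y * norm (grad (\<phi> k) y))"
      by (rule C1c_translate_estimate[OF c e s Q T QT])
    have "(LINT y|lborel. indicator T y * norm (grad (\<phi> k) y)) \<le>
        (LINT y|lborel. indicator T y * norm (G y) + norm (G y - grad (\<phi> k) y))"
    proof (rule integral_mono)
      show "integrable lborel (\<lambda>y. indicator T y * norm (grad (\<phi> k) y))"
        using indT[OF integrable_norm[OF ip(2)]] .
      show "integrable lborel (\<lambda>y. indicator T y * norm (G y) + norm (G y - grad (\<phi> k) y))"
        using indT[OF integrable_norm[OF iG]] iG ip(2)[of k] by auto
      show "indicator T y * norm (grad (\<phi> k) y) \<le> indicator T y * norm (G y) + norm (G y - grad (\<phi> k) y)" for y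
        using norm_triangle_sub[of "grad (\<phi> k) y" "G y"] by (auto split: split_indicator simp: norm_minus_commute)
    qed
    also have "\<dots> = (LINT y|lborel. indicator T y * norm (G y)) + ?B k"
      using indT[OF integrable_norm[OF iG]] iG ip(2)[of k] by simp
    finally have "s * (LINT y|lborel. indicator T y * norm (grad (\<phi> k) y)) \<le>
        s * ((LINT y|lborel. indicator T y * norm (G y)) + ?B k)" using s by (rule mult_left_mono)
    with 1 2 show ?thesis unfolding distrib_left by linarith
  qed
  have "(\<lambda>k. s * (LINT y|lborel. indicator T y * norm (G y)) + s * ?B k + 2 * ?A k) \<longlonglongrightarrow>
      s * (LINT y|lborel. indicator T y * norm (G y)) + s * 0 + 2 * 0"
    by (intro tendsto_intros phi)
  then show ?thesis using main by (intro LIMSEQ_le_const) auto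
qed

text \<open>Coordinates adapted to a Lipschitz graph: the orthogonal projection \<open>base\<close> and the signed vertical
  distance \<open>height\<close> to the graph. Vertical shifts fix the first and translate the second.\<close>

locale graph_chart =
  fixes e :: "real^'n" and g :: "real^'n \<Rightarrow> real" and C :: real
  assumes e: "norm e = 1" and g: "C-lipschitz_on {v. v \<bullet> e = 0} g"
begin

definition base :: "real^'n \<Rightarrow> real^'n" where "base y = y - (y \<bullet> e) *\<^sub>R e"
definition height :: "real^'n \<Rightarrow> real" where "height y = y \<bullet> e - g (base y)"

lemma ee: "e \<bullet> e = 1" using e by (simp add: norm_eq_1)

lemma base_perp: "base y \<bullet> e = 0" by (simp add: base_def inner_diff_left ee)

lemma base_shift: "base (y + s *\<^sub>R e) = base y"
  by (simp add: base_def inner_add_left ee scaleR_add_left)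

lemma height_shift: "height (y + s *\<^sub>R e) = height y + s"
  by (simp add: height_def base_shift inner_add_left ee)

lemma C_nonneg: "0 \<le> C" using g by (rule lipschitz_on_nonneg)

lemma base_diff: "norm (base y - base z) \<le> norm (y - z)"
proof -
  define d where "d = y - z"
  have "base y - base z = d - (d \<bullet> e) *\<^sub>R e" by (simp add: base_def d_def algebra_simps)
  moreover have "norm (d - (d \<bullet> e) *\<^sub>R e) ^ 2 = norm d ^ 2 - (d \<bullet> e) ^ 2"
  proof -
    have 1: "e \<bullet> d = d \<bullet> e" by (rule inner_commute)
    show ?thesis unfolding power2_norm_eq_inner
      by (simp add: inner_diff_left inner_diff_right ee 1 power2_eq_square)
  qed
  ultimately have "norm (base y - base z) ^ 2 = norm (y - z) ^ 2 - ((y - z) \<bullet> e) ^ 2"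
    by (simp add: d_def)
  then have "norm (base y - base z) ^ 2 \<le> norm (y - z) ^ 2" by simp
  then show ?thesis by (rule power2_le_imp_le) simp
qed

lemma g_diff: "\<bar>g (base y) - g (base z)\<bar> \<le> C * norm (base y - base z)"
  using lipschitz_onD[OF g, of "base y" "base z"] by (simp add: base_perp dist_norm)

lemma height_diff: "\<bar>height y - height z\<bar> \<le> (1 + C) * norm (y - z)"
proof -
  have "\<bar>(y - z) \<bullet> e\<bar> \<le> norm (y - z)" using Cauchy_Schwarz_ineq2[of "y - z" e] e by simp
  moreover have "\<bar>g (base y) - g (base z)\<bar> \<le> C * norm (y - z)"
    using g_diff[of y z] mult_left_mono[OF base_diff C_nonneg] by (rule order_trans)
  ultimately show ?thesis by (simp add: height_def inner_diff_left algebra_simps)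
qed

lemma near: "norm (y - z) \<le> (1 + C) * norm (base y - base z) + \<bar>height y - height z\<bar>"
proof -
  have "y - z = (base y - base z) + ((y - z) \<bullet> e) *\<^sub>R e" by (simp add: base_def algebra_simps)
  then have "norm (y - z) \<le> norm (base y - base z) + \<bar>(y - z) \<bullet> e\<bar>"
    using norm_triangle_ineq[of "base y - base z" "((y - z) \<bullet> e) *\<^sub>R e"] e by simp
  moreover have "(y - z) \<bullet> e = (height y - height z) + (g (base y) - g (base z))"
    by (simp add: height_def inner_diff_left)
  ultimately show ?thesis using g_diff[of y z] by (simp add: algebra_simps)
qed

lemma height_continuous: "continuous_on S height"
proof (rule continuous_on_subset[OF lipschitz_on_continuous_on subset_UNIV])
  show "(1 + C)-lipschitz_on UNIV height"
    using height_diff C_nonneg by (intro lipschitz_onI) (auto simp: dist_norm)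
qed

lemma base_continuous: "continuous_on S base"
  unfolding base_def by (intro continuous_intros)

lemma borel_chart [measurable]: "height \<in> borel_measurable borel" "base \<in> borel_measurable borel"
  using height_continuous base_continuous by (auto intro: borel_measurable_continuous_onI)

text \<open>A jump across the graph is impossible: shifting the strip of height \<open>s\<close> below the graph by \<open>s\<close>
  in the vertical direction costs at least its measure, which is proportional to \<open>s\<close>, whereas the
  translation estimate bounds the cost by \<open>s\<close> times an integral of the gradient that tends to \<open>0\<close>.\<close>

lemma no_jump:
  assumes z: "zero_trace \<Omega> w G" and p: "height p = 0" and \<delta>: "0 < \<delta>"
    and loc: "\<And>y. y \<in> ball p \<delta> \<Longrightarrow> y \<in> \<Omega> \<longleftrightarrow> 0 < height y"
    and a: "0 < a" "\<And>y. y \<in> \<Omega> \<Longrightarrow> y \<in> ball p \<delta> \<Longrightarrow> a \<le> \<bar>w y\<bar>"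
  shows False
proof -
  \<comment> \<open>The cylinder of radius \<open>r\<close> and height \<open>h\<close> about \<open>p\<close> lies in the ball, by \<open>near\<close>. The set \<open>Q s\<close> is its
    strip of height \<open>s\<close> below the graph, and \<open>T s\<close> contains all vertical shifts of \<open>Q s\<close> by at most \<open>s\<close>.\<close>
  define h where "h = \<delta> / 4"
  define r where "r = \<delta> / (4 * (1 + C))"
  have h: "0 < h" and r: "0 < r" using \<delta> C_nonneg by (auto simp: h_def r_def)
  have rC: "(1 + C) * r = \<delta> / 4" using C_nonneg by (simp add: r_def field_simps)
  have inball: "y \<in> ball p \<delta>" if "norm (base y - base p) < r" "\<bar>height y\<bar> \<le> h" for y
  proof -
    have "(1 + C) * norm (base y - base p) \<le> (1 + C) * r" using that C_nonneg by (intro mult_left_mono) auto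
    then show ?thesis using near[of y p] that rC p \<delta> by (simp add: h_def dist_norm norm_minus_commute)
  qed
  define Q where "Q s = {y. norm (base y - base p) < r \<and> - s < height y \<and> height y \<le> 0}" for s
  define T where "T s = {y. norm (base y - base p) < r \<and> - s < height y \<and> height y \<le> s}" for s
  have Qb: "Q s \<in> sets borel" and Tb: "T s \<in> sets borel" for s
    unfolding Q_def T_def by measurable
  have iw: "integrable lborel w" and iG: "integrable lborel G" and off: "\<And>x. x \<notin> \<Omega> \<Longrightarrow> w x = 0" "\<And>x. x \<notin> \<Omega> \<Longrightarrow> G x = 0"
    using z by (auto simp: zero_trace_def)
  define m where "m s = (LINT y|lborel. indicator (Q s) y :: real)" for s
  have iQ: "integrable lborel (indicator (Q s) :: real^'n \<Rightarrow> real)" if "s \<le> h" for s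
  proof -
    have "Q s \<subseteq> ball p \<delta>" using inball that by (auto simp: Q_def)
    then have "emeasure lborel (Q s) \<le> emeasure lborel (ball p \<delta>)" by (intro emeasure_mono) auto
    also have "\<dots> < \<infinity>" by (rule emeasure_lborel_ball_finite)
    finally show ?thesis using Qb by (intro integrable_real_indicator) auto
  qed
  \<comment> \<open>A strip of height \<open>c + s\<close> is a strip of height \<open>c\<close> on top of a shifted strip of height \<open>s\<close>.\<close>
  have stack: "indicator (Q (c + s)) y = (indicator (Q c) y + indicator (Q s) (y + c *\<^sub>R e) :: real)"
    if "0 \<le> s" "0 \<le> c" for c s y
    using that by (auto simp: Q_def indicator_def base_shift height_shift)
  have mult: "m (real N * s) = real N * m s" if "0 \<le> s" "real N * s \<le> h" for N s
    using that(2)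
  proof (induction N)
    case 0
    have "Q 0 = {}" by (auto simp: Q_def)
    then show ?case by (simp add: m_def)
  next
    case (Suc N)
    have Ns: "0 \<le> real N * s" using that(1) by simp
    have Suc_s: "real (Suc N) * s = real N * s + s" by (simp add: algebra_simps)
    have s: "real N * s \<le> h" "s \<le> h"
      using Suc.prems that(1) Ns unfolding Suc_s by linarith+
    have eq: "indicator (Q (real (Suc N) * s)) y =
        (indicator (Q (real N * s)) y + indicator (Q s) (y + (real N * s) *\<^sub>R e) :: real)" for y
      unfolding Suc_s by (rule stack[OF that(1) Ns])
    have "m (real (Suc N) * s) = (LINT y|lborel. indicator (Q (real N * s)) y) +
        (LINT y|lborel. indicator (Q s) (y + (real N * s) *\<^sub>R e) :: real)"
      unfolding m_def eq
      by (rule Bochner_Integration.integral_add[OF iQ[OF s(1)] integrable_translate[OF iQ[OF s(2)]]])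
    also have "(LINT y|lborel. indicator (Q s) (y + (real N * s) *\<^sub>R e) :: real) = m s"
      unfolding m_def by (rule lborel_integral_translate(2)[OF borel_measurable_indicator[OF Qb]])
    also have "(LINT y|lborel. indicator (Q (real N * s)) y) = real N * m s"
      using Suc.IH[OF s(1)] by (simp add: m_def)
    finally show ?case by (simp add: algebra_simps)
  qed
  \<comment> \<open>The strip of height \<open>h\<close> contains a ball about the point at depth \<open>h / 2\<close> below \<open>p\<close>.\<close>
  have mpos: "0 < m h"
  proof -
    define q where "q = p + (- h / 2) *\<^sub>R e"
    define \<rho> where "\<rho> = min r (h / (4 * (1 + C)))"
    have "(1 + C) * \<rho> \<le> (1 + C) * (h / (4 * (1 + C)))"
      using C_nonneg by (intro mult_left_mono) (auto simp: \<rho>_def)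
    also have "\<dots> = h / 4" using C_nonneg by (simp add: field_simps)
    finally have rho: "0 < \<rho>" "\<rho> \<le> r" "(1 + C) * \<rho> \<le> h / 4"
      using r h C_nonneg by (auto simp: \<rho>_def)
    have sub: "ball q \<rho> \<subseteq> Q h"
    proof
      fix y assume "y \<in> ball q \<rho>"
      then have d: "norm (y - q) < \<rho>" by (simp add: dist_norm norm_minus_commute)
      have "norm (base y - base q) < r" using base_diff[of y q] d rho by linarith
      then have 1: "norm (base y - base p) < r" by (simp only: q_def base_shift)
      have "(1 + C) * norm (y - q) \<le> (1 + C) * \<rho>" using d C_nonneg by (intro mult_left_mono) auto
      then have "\<bar>height y - height q\<bar> \<le> h / 4" using height_diff[of y q] rho by linarith
      moreover have "height q = - h / 2" unfolding q_def height_shift p by simp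
      ultimately have "- h < height y \<and> height y \<le> 0" using h by linarith
      then show "y \<in> Q h" using 1 by (simp add: Q_def)
    qed
    have "emeasure lborel (Q h) < \<infinity>"
      using iQ[OF order_refl] Qb by (simp add: integrable_indicator_iff)
    then have "measure lborel (ball q \<rho>) \<le> measure lborel (Q h)"
      using sub Qb by (intro measure_mono_fmeasurable) (auto simp: fmeasurable_def)
    moreover have "0 < measure lborel (ball q \<rho>)" by (rule content_ball_pos[OF rho(1)])
    moreover have "m h = measure lborel (Q h)" by (simp add: m_def)
    ultimately show ?thesis by linarith
  qed
  define J where "J s = (LINT y|lborel. indicator (T s) y * norm (G y))" for s
  \<comment> \<open>Shifting \<open>Q s\<close> up by \<open>s\<close> moves each of its points from outside \<open>\<Omega>\<close>, where \<open>w\<close> vanishes, to a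
    point of \<open>\<Omega>\<close> where \<open>w\<close> has absolute value at least \<open>a\<close>.\<close>
  have step: "a * m h \<le> h * J (h / real (Suc N))" for N
  proof -
    define s where "s = h / real (Suc N)"
    have s: "0 < s" "s \<le> h" "real (Suc N) * s = h" using h by (auto simp: s_def field_simps)
    have "m h = real (Suc N) * m s" using mult[of s "Suc N"] s by simp
    moreover have "a * m s \<le> s * J s"
    proof -
      have iwd: "integrable lborel (\<lambda>y. \<bar>w (y + s *\<^sub>R e) - w y\<bar>)" using integrable_translate[OF iw] iw by auto
      have "a * m s = (LINT y|lborel. indicator (Q s) y * a)" by (simp add: m_def mult.commute)
      also have "\<dots> \<le> (LINT y|lborel. indicator (Q s) y * \<bar>w (y + s *\<^sub>R e) - w y\<bar>)"
      proof (rule integral_mono)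
        show "integrable lborel (\<lambda>y. indicator (Q s) y * a)" using iQ[OF s(2)] by (rule integrable_mult_left)
        show "integrable lborel (\<lambda>y. indicator (Q s) y * \<bar>w (y + s *\<^sub>R e) - w y\<bar>)"
          using integrable_mult_indicator[OF _ iwd, of "Q s"] Qb by simp
        fix y
        show "indicator (Q s) y * a \<le> indicator (Q s) y * \<bar>w (y + s *\<^sub>R e) - w y\<bar>"
        proof (cases "y \<in> Q s")
          case True
          then have y: "norm (base y - base p) < r" "- s < height y" "height y \<le> 0" by (auto simp: Q_def)
          have "y \<notin> \<Omega>" using loc[OF inball[OF y(1)]] y s by auto
          moreover have yb: "y + s *\<^sub>R e \<in> ball p \<delta>" using y s by (intro inball) (auto simp: base_shift height_shift)
          then have "y + s *\<^sub>R e \<in> \<Omega>" using loc[OF yb] y by (simp add: height_shift)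
          ultimately show ?thesis using a(2)[OF _ yb] off(1)[of y] by (auto split: split_indicator)
        qed simp
      qed
      also have "\<dots> \<le> s * (LINT y|lborel. indicator (T s) y * norm (G y))"
        by (rule zero_trace_translate_estimate[OF z e _ Qb Tb])
          (use s in \<open>auto simp: Q_def T_def base_shift height_shift\<close>)
      finally show ?thesis by (simp add: J_def)
    qed
    ultimately have "a * m h \<le> real (Suc N) * (s * J s)"
      by (metis mult.left_commute mult_left_mono of_nat_0_le_iff)
    also have "\<dots> = (real (Suc N) * s) * J s" by simp
    also have "\<dots> = h * J s" by (simp only: s(3))
    finally show ?thesis by (simp add: s_def)
  qed
  \<comment> \<open>The sets \<open>T s\<close> shrink to a piece of the graph, which lies outside \<open>\<Omega>\<close>, where \<open>G\<close> vanishes.\<close>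
  have "(\<lambda>N. J (h / real (Suc N))) \<longlonglongrightarrow> (LINT y|(lborel :: (real^'n) measure). 0)"
    unfolding J_def
  proof (rule integral_dominated_convergence[where w="\<lambda>y. norm (G y)"])
    show "AE y in lborel. (\<lambda>N. indicator (T (h / real (Suc N))) y * norm (G y)) \<longlonglongrightarrow> 0"
    proof (rule AE_I2)
      fix y
      show "(\<lambda>N. indicator (T (h / real (Suc N))) y * norm (G y)) \<longlonglongrightarrow> 0"
      proof (cases "height y = 0")
        case True
        have z0: "indicator (T s) y * norm (G y) = 0" for s
        proof (cases "norm (base y - base p) < r")
          case True
          then have "y \<notin> \<Omega>" using loc[OF inball[OF True]] \<open>height y = 0\<close> h by auto
          then show ?thesis using off(2) by simp
        qed (auto simp: T_def)
        show ?thesis by (simp only: z0 tendsto_const)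
      next
        case False
        have "(\<lambda>N. h / real (Suc N)) \<longlonglongrightarrow> 0"
          using LIMSEQ_inverse_real_of_nat[THEN tendsto_mult_right_zero, of h] by (simp add: field_simps)
        then have "eventually (\<lambda>N. h / real (Suc N) < \<bar>height y\<bar>) sequentially"
          using False by (intro order_tendstoD(2)) auto
        then have "eventually (\<lambda>N. indicator (T (h / real (Suc N))) y * norm (G y) = 0) sequentially"
          by eventually_elim (auto simp: T_def indicator_def abs_if split: if_splits)
        then show ?thesis by (rule tendsto_eventually)
      qed
    qed
    show "(\<lambda>y. indicator (T (h / real (Suc N))) y * norm (G y)) \<in> borel_measurable lborel" for N
      using Tb iG by measurable
  qed (use iG in \<open>auto split: split_indicator\<close>)
  then have "(\<lambda>N. h * J (h / real (Suc N))) \<longlonglongrightarrow> h * 0" by (intro tendsto_mult tendsto_const) simp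
  then have "a * m h \<le> h * 0" using step by (intro LIMSEQ_le_const) auto
  then show False using mult_pos_pos[OF a(1) mpos] by simp
qed

end

text \<open>That a frontier point lies on the graph itself, and not below it, follows from its being a limit of
  points of \<open>\<Omega>\<close>.\<close>

lemma lipschitz_chart:
  assumes \<Omega>: "open \<Omega>" "lipschitz_boundary \<Omega>" and p: "p \<in> frontier \<Omega>"
  obtains e g C \<delta> where "graph_chart e g C" "0 < \<delta>" "graph_chart.height e g p = 0"
    "\<And>y. y \<in> ball p \<delta> \<Longrightarrow> y \<in> \<Omega> \<longleftrightarrow> 0 < graph_chart.height e g y"
proof -
  obtain U e g C where U: "open U" "p \<in> U" and e: "norm e = 1" and g: "C-lipschitz_on {v. v \<bullet> e = 0} g"
    and eq: "\<Omega> \<inter> U = {y \<in> U. g (y - (y \<bullet> e) *\<^sub>R e) < y \<bullet> e}"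
    using bspec[OF \<Omega>(2)[unfolded lipschitz_boundary_def] p] by auto
  interpret graph_chart e g C using e g by unfold_locales
  obtain \<delta> where d: "0 < \<delta>" "ball p \<delta> \<subseteq> U" using U open_contains_ball by blast
  have loc: "y \<in> \<Omega> \<longleftrightarrow> 0 < height y" if "y \<in> U" for y
  proof -
    have "y \<in> \<Omega> \<longleftrightarrow> y \<in> \<Omega> \<inter> U" using that by simp
    also have "\<dots> \<longleftrightarrow> 0 < height y" unfolding eq height_def base_def using that by simp
    finally show ?thesis .
  qed
  have "p \<notin> \<Omega>" "p \<in> closure \<Omega>" using p \<Omega>(1) by (auto simp: frontier_def interior_open)
  then have le: "height p \<le> 0" using loc[OF U(2)] by auto
  have "\<not> height p < 0"
  proof
    assume "height p < 0"
    moreover have "open {y. height y < 0}"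
      using height_continuous[of UNIV] by (intro open_Collect_less) auto
    ultimately have "open (U \<inter> {y. height y < 0})" "p \<in> U \<inter> {y. height y < 0}" using U by auto
    then obtain y where "y \<in> \<Omega>" "y \<in> U" "height y < 0"
      using \<open>p \<in> closure \<Omega>\<close> open_Int_closure_eq_empty[of "U \<inter> {y. height y < 0}" \<Omega>] by blast
    then show False using loc[of y] by auto
  qed
  with le have "height p = 0" by simp
  then show thesis using that[OF graph_chart_axioms d(1)] loc d(2) by blast
qed

text \<open>If the bound failed between \<open>x\<close> and a frontier point \<open>p\<close>, then \<open>w\<close> would stay away from zero in \<open>\<Omega>\<close> near
  \<open>p\<close>, which \<open>no_jump\<close> excludes. For a general outer point \<open>y\<close>, use a frontier point on the segment from
  \<open>x\<close> to \<open>y\<close>.\<close>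

lemma holder_extension_by_zero:
  fixes \<Omega> :: "(real^'n) set"
  assumes \<Omega>: "open \<Omega>" "lipschitz_boundary \<Omega>" and z: "zero_trace \<Omega> w G" and \<gamma>: "0 < \<gamma>" and A: "0 \<le> A"
    and h: "\<And>x y. x \<in> \<Omega> \<Longrightarrow> y \<in> \<Omega> \<Longrightarrow> \<bar>w x - w y\<bar> \<le> A * norm (x - y) powr \<gamma>"
  shows "\<bar>w x - w y\<bar> \<le> A * norm (x - y) powr \<gamma>"
proof -
  have off: "w x = 0" if "x \<notin> \<Omega>" for x using z that by (auto simp: zero_trace_def)
  have front: "\<bar>w x\<bar> \<le> A * norm (x - p) powr \<gamma>" if x: "x \<in> \<Omega>" and p: "p \<in> frontier \<Omega>" for x p
  proof (rule ccontr)
    assume c: "\<not> \<bar>w x\<bar> \<le> A * norm (x - p) powr \<gamma>"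
    \<comment> \<open>Half of the excess is left for the values of \<open>w\<close> near \<open>p\<close>.\<close>
    define a where "a = (\<bar>w x\<bar> - A * norm (x - p) powr \<gamma>) / 2"
    have a: "0 < a" using c by (simp add: a_def)
    have "p \<notin> \<Omega>" using p \<Omega>(1) by (auto simp: frontier_def interior_open)
    then have "x \<noteq> p" using x by auto
    then have "isCont (\<lambda>y. A * norm (x - y) powr \<gamma>) p" by (intro continuous_intros) auto
    then have "\<exists>d>0. \<forall>y. dist y p < d \<longrightarrow> dist (A * norm (x - y) powr \<gamma>) (A * norm (x - p) powr \<gamma>) < a"
      using a unfolding continuous_at_eps_delta dist_real_def dist_norm by (metis real_norm_def)
    then obtain d where d: "0 < d" "\<And>y. dist y p < d \<Longrightarrow> \<bar>A * norm (x - y) powr \<gamma> - A * norm (x - p) powr \<gamma>\<bar> < a"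
      by (auto simp: dist_real_def)
    obtain e g C \<delta> where ch: "graph_chart e g C" "0 < \<delta>" "graph_chart.height e g p = 0"
      "\<And>y. y \<in> ball p \<delta> \<Longrightarrow> y \<in> \<Omega> \<longleftrightarrow> 0 < graph_chart.height e g y"
      using lipschitz_chart[OF \<Omega> p] by blast
    show False
    proof (rule graph_chart.no_jump[OF ch(1) z ch(3), of "min d \<delta>" a])
      show "0 < min d \<delta>" using d ch by simp
      show "(y \<in> \<Omega>) = (0 < graph_chart.height e g y)" if "y \<in> ball p (min d \<delta>)" for y using ch(4) that by simp
      show "0 < a" by (rule a)
      show "a \<le> \<bar>w y\<bar>" if y: "y \<in> \<Omega>" "y \<in> ball p (min d \<delta>)" for y
      proof -
        have "A * norm (x - y) powr \<gamma> < A * norm (x - p) powr \<gamma> + a" using d(2)[of y] y(2) by (simp add: dist_commute)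
        moreover have "\<bar>w x\<bar> - \<bar>w y\<bar> \<le> A * norm (x - y) powr \<gamma>" using h[OF x y(1)] by linarith
        moreover have "\<bar>w x\<bar> = A * norm (x - p) powr \<gamma> + 2 * a"
          by (simp add: a_def diff_divide_distrib)
        ultimately show ?thesis by linarith
      qed
    qed
  qed
  have mixed: "\<bar>w x\<bar> \<le> A * norm (x - y) powr \<gamma>" if x: "x \<in> \<Omega>" and y: "y \<notin> \<Omega>" for x y
  proof -
    have "closed_segment x y \<inter> frontier \<Omega> \<noteq> {}"
      using x y by (intro connected_Int_frontier) auto
    then obtain p where p: "p \<in> closed_segment x y" "p \<in> frontier \<Omega>" by blast
    have "norm (x - p) \<le> norm (x - y)" using dist_in_closed_segment[OF p(1)] by (simp add: dist_norm norm_minus_commute)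
    then have "norm (x - p) powr \<gamma> \<le> norm (x - y) powr \<gamma>" using \<gamma> by (intro powr_mono2) auto
    then show ?thesis using front[OF x p(2)] mult_left_mono[OF _ A] order_trans by blast
  qed
  show ?thesis
  proof (cases "x \<in> \<Omega>")
    case True
    then show ?thesis using h mixed[OF True, of y] off[of y] by (cases "y \<in> \<Omega>") auto
  next
    case False
    then show ?thesis using mixed[of y x] off A
      by (cases "y \<in> \<Omega>") (auto simp: norm_minus_commute)
  qed
qed

text \<open>Near each point of the closure the domain can be pushed inwards: \<open>e = 0\<close> in the interior, the
  vertical direction near the boundary.\<close>

definition pushes :: "(real^'n) set \<Rightarrow> real^'n \<Rightarrow> real \<Rightarrow> real^'n \<Rightarrow> real \<Rightarrow> real \<Rightarrow> bool" where
  "pushes \<Omega> p R e \<epsilon> t0 \<longleftrightarrow> 0 < R \<and> norm e \<le> 1 \<and>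
     (\<forall>x\<in>\<Omega> \<inter> ball p R. \<forall>t. 0 < t \<and> t \<le> t0 \<longrightarrow> cball (x + t *\<^sub>R e) (t * \<epsilon>) \<subseteq> \<Omega>)"

lemma pushes_exists:
  assumes \<Omega>: "open \<Omega>" "lipschitz_boundary \<Omega>" and p: "p \<in> closure \<Omega>"
  shows "\<exists>R e \<epsilon> t0. 0 < \<epsilon> \<and> \<epsilon> \<le> 1 \<and> 0 < t0 \<and> pushes \<Omega> p R e \<epsilon> t0"
proof (cases "p \<in> \<Omega>")
  case True
  then obtain \<delta> where d: "0 < \<delta>" "ball p \<delta> \<subseteq> \<Omega>" using \<Omega>(1) open_contains_ball by blast
  have "pushes \<Omega> p (\<delta> / 2) 0 1 (\<delta> / 4)"
    unfolding pushes_def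
  proof (intro conjI ballI allI impI subsetI)
    fix x t y assume x: "x \<in> \<Omega> \<inter> ball p (\<delta> / 2)" and t: "0 < t \<and> t \<le> \<delta> / 4" and y: "y \<in> cball (x + t *\<^sub>R 0) (t * 1)"
    have "dist p y < \<delta>" using x t y dist_triangle[of p y x] d(1) by (simp add: dist_commute)
    then show "y \<in> \<Omega>" using d(2) by auto
  qed (use d in auto)
  then show ?thesis using d by (intro exI[of _ "\<delta> / 2"] exI[of _ 0] exI[of _ 1] exI[of _ "\<delta> / 4"]) auto
next
  case False
  then have "p \<in> frontier \<Omega>" using p \<Omega>(1) by (auto simp: frontier_def interior_open)
  then obtain e g C \<delta> where ch: "graph_chart e g C" "0 < \<delta>"
      "\<And>y. y \<in> ball p \<delta> \<Longrightarrow> y \<in> \<Omega> \<longleftrightarrow> 0 < graph_chart.height e g y"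
    using lipschitz_chart[OF \<Omega>] by metis
  interpret graph_chart e g C by (rule ch(1))
  \<comment> \<open>A shift by \<open>t\<close> raises the height by \<open>t\<close>, and the height is Lipschitz with constant \<open>1 + C\<close>, so a ball
    of radius \<open>t / (1 + C)\<close> about the shifted point remains above the graph.\<close>
  define \<epsilon> where "\<epsilon> = 1 / (1 + C)"
  have eps: "0 < \<epsilon>" "\<epsilon> \<le> 1" "(1 + C) * \<epsilon> = 1" using C_nonneg by (auto simp: \<epsilon>_def)
  have "pushes \<Omega> p (\<delta> / 2) e \<epsilon> (\<delta> / 8)"
    unfolding pushes_def
  proof (intro conjI ballI allI impI subsetI)
    fix x t y assume x: "x \<in> \<Omega> \<inter> ball p (\<delta> / 2)" and t: "0 < t \<and> t \<le> \<delta> / 8" and y: "y \<in> cball (x + t *\<^sub>R e) (t * \<epsilon>)"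
    have te: "t * \<epsilon> \<le> t" using t eps by (simp add: mult_left_le)
    have "dist x (x + t *\<^sub>R e) = t" using t e by (simp add: dist_norm)
    moreover have "dist (x + t *\<^sub>R e) y \<le> t * \<epsilon>" "dist p x < \<delta> / 2" using x y by auto
    ultimately have "dist p y < \<delta>"
      using t te dist_triangle[of p y x] dist_triangle[of x y "x + t *\<^sub>R e"] ch(2) by linarith
    then have yb: "y \<in> ball p \<delta>" by simp
    have "(1 + C) * norm (y - (x + t *\<^sub>R e)) \<le> (1 + C) * (t * \<epsilon>)"
      using y C_nonneg by (intro mult_left_mono) (auto simp: dist_norm norm_minus_commute)
    also have "\<dots> = t * ((1 + C) * \<epsilon>)" by (rule mult.left_commute)
    also have "\<dots> = t" using eps(3) by simp
    finally have "\<bar>height y - height (x + t *\<^sub>R e)\<bar> \<le> t" using height_diff[of y "x + t *\<^sub>R e"] by linarith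
    moreover have "0 < height x" using ch(3)[of x] x ch(2) by auto
    ultimately have "0 < height y" unfolding height_shift by linarith
    then show "y \<in> \<Omega>" using ch(3)[OF yb] by simp
  qed (use ch e in auto)
  then show ?thesis using eps ch(2)
    by (intro exI[of _ "\<delta> / 2"] exI[of _ e] exI[of _ \<epsilon>] exI[of _ "\<delta> / 8"]) auto
qed

lemma pushes_mono:
  assumes "pushes \<Omega> p R e \<epsilon> t0" "\<epsilon>' \<le> \<epsilon>" "t0' \<le> t0" shows "pushes \<Omega> p R e \<epsilon>' t0'"
  unfolding pushes_def
proof (intro conjI ballI allI impI)
  fix x t assume x: "x \<in> \<Omega> \<inter> ball p R" and t: "0 < t \<and> t \<le> t0'"
  have "t * \<epsilon>' \<le> t * \<epsilon>" using t assms by (intro mult_left_mono) auto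
  then have "cball (x + t *\<^sub>R e) (t * \<epsilon>') \<subseteq> cball (x + t *\<^sub>R e) (t * \<epsilon>)" by (rule subset_cball)
  also have "\<dots> \<subseteq> \<Omega>" using assms x t by (auto simp: pushes_def)
  finally show "cball (x + t *\<^sub>R e) (t * \<epsilon>') \<subseteq> \<Omega>" .
qed (use assms in \<open>auto simp: pushes_def\<close>)

lemma lipschitz_cover:
  assumes \<Omega>: "bounded_lipschitz_domain \<Omega>"
  obtains I R e \<epsilon> t0 where "finite I" "0 < \<epsilon>" "\<epsilon> \<le> 1" "0 < t0" "\<And>p. p \<in> I \<Longrightarrow> pushes \<Omega> p (R p) (e p) \<epsilon> t0"
    "\<Omega> \<subseteq> (\<Union>p\<in>I. ball p (R p / 2))"
proof -
  have o: "open \<Omega>" "lipschitz_boundary \<Omega>" "bounded \<Omega>" "\<Omega> \<noteq> {}" using \<Omega> by (auto simp: bounded_lipschitz_domain_def)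
  have "\<forall>p. \<exists>R e \<epsilon> t0. p \<in> closure \<Omega> \<longrightarrow> 0 < \<epsilon> \<and> \<epsilon> \<le> 1 \<and> 0 < t0 \<and> pushes \<Omega> p R e \<epsilon> t0"
    using pushes_exists[OF o(1,2)] by blast
  then obtain R e \<epsilon> t0 where ch: "\<And>p. p \<in> closure \<Omega> \<Longrightarrow> 0 < \<epsilon> p \<and> \<epsilon> p \<le> 1 \<and> 0 < t0 p \<and> pushes \<Omega> p (R p) (e p) (\<epsilon> p) (t0 p)"
    by metis
  have R: "0 < R p" if "p \<in> closure \<Omega>" for p using ch[OF that] by (simp add: pushes_def)
  have "compact (closure \<Omega>)" using o(3) by simp
  moreover have "closure \<Omega> \<subseteq> (\<Union>p\<in>closure \<Omega>. ball p (R p / 2))"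
  proof
    fix x assume "x \<in> closure \<Omega>"
    then show "x \<in> (\<Union>p\<in>closure \<Omega>. ball p (R p / 2))" using R[of x] by (intro UN_I[of x]) auto
  qed
  moreover have "\<And>p. p \<in> closure \<Omega> \<Longrightarrow> open (ball p (R p / 2))" by simp
  ultimately obtain I where I: "I \<subseteq> closure \<Omega>" "finite I" "closure \<Omega> \<subseteq> (\<Union>p\<in>I. ball p (R p / 2))"
    using compactE_image[of "closure \<Omega>" "closure \<Omega>" "\<lambda>p. ball p (R p / 2)" thesis] by blast
  have ne: "I \<noteq> {}" using I(3) o(4) by auto
  show thesis
  proof
    show "finite I" by (rule I(2))
    show "0 < Min (\<epsilon> ` I)" "0 < Min (t0 ` I)" using I ne ch by (auto simp: Min_gr_iff)
    obtain q where q: "q \<in> I" using ne by blast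
    then have "Min (\<epsilon> ` I) \<le> \<epsilon> q" using I(2) by (intro Min_le) auto
    then show "Min (\<epsilon> ` I) \<le> 1" using ch[of q] q I(1) by auto
    show "pushes \<Omega> p (R p) (e p) (Min (\<epsilon> ` I)) (Min (t0 ` I))" if "p \<in> I" for p
    proof (rule pushes_mono)
      show "pushes \<Omega> p (R p) (e p) (\<epsilon> p) (t0 p)" using ch[of p] that I(1) by blast
    qed (use I(2) that in \<open>auto intro: Min_le\<close>)
    show "\<Omega> \<subseteq> (\<Union>p\<in>I. ball p (R p / 2))" using I(3) closure_subset[of \<Omega>] by (rule subset_trans[rotated])
  qed
qed

section \<open>A partition of unity\<close>

text \<open>The positive part squared is of class $C^1$, and so is \<open>s \<mapsto> pos_sq (1 - pos_sq s)\<close>, which falls from \<open>1\<close>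
  to \<open>0\<close> on the unit interval. This suffices for cutoff functions, since smoothness of the approximations
  comes from the mollifier.\<close>

definition pos_sq :: "real \<Rightarrow> real" where "pos_sq s = (max 0 s)\<^sup>2"

lemma pos_sq_DERIV: "DERIV pos_sq s :> 2 * max 0 s"
proof -
  consider "0 < s" | "s < 0" | "s = 0" by linarith
  then show ?thesis
  proof cases
    case 1
    have "eventually (\<lambda>t. t\<^sup>2 = pos_sq t) (nhds s)"
      using eventually_nhds_in_open[of "{0<..}" s] 1 by (auto simp: pos_sq_def elim!: eventually_mono)
    moreover have "DERIV (\<lambda>t. t\<^sup>2) s :> 2 * max 0 s" using 1 by (auto intro!: derivative_eq_intros)
    ultimately show ?thesis using DERIV_cong_ev[OF refl _ refl, of "\<lambda>t. t\<^sup>2" pos_sq s] by simp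
  next
    case 2
    have "eventually (\<lambda>t. 0 = pos_sq t) (nhds s)"
      using eventually_nhds_in_open[of "{..<0}" s] 2 by (auto simp: pos_sq_def elim!: eventually_mono)
    moreover have "DERIV (\<lambda>t. 0) s :> 2 * max 0 s" using 2 by auto
    ultimately show ?thesis using DERIV_cong_ev[OF refl _ refl, of "\<lambda>t. 0" pos_sq s] by simp
  next
    case 3
    have "((\<lambda>h. max 0 h) \<longlongrightarrow> max 0 (0::real)) (at 0)" by (intro tendsto_intros)
    then have "((\<lambda>h. max 0 h) \<longlongrightarrow> (0::real)) (at 0)" by simp
    then have "((\<lambda>h. pos_sq h / h) \<longlongrightarrow> 0) (at 0)"
      by (rule Lim_transform_eventually)
        (auto simp: eventually_at_filter pos_sq_def power2_eq_square max_def)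
    then show ?thesis using 3 by (simp add: DERIV_def pos_sq_def[of 0])
  qed
qed

lemma cutoff_exists:
  fixes p :: "real^'n"
  assumes "0 < R"
  shows "\<exists>b D. C1b b D \<and> (\<forall>x. 0 \<le> b x \<and> b x \<le> 1) \<and> (\<forall>x. x \<notin> ball p R \<longrightarrow> b x = 0) \<and>
    (\<forall>x\<in>ball p (R / 2). b x = (1::real))"
proof -
  define f where "f x = ((x - p) \<bullet> (x - p) - (R / 2)\<^sup>2) / (R\<^sup>2 * (3 / 4))" for x :: "real^'n"
  define k where "k s = pos_sq (1 - pos_sq s)" for s
  define k' where "k' s = - (4 * max 0 (1 - pos_sq s) * max 0 s)" for s
  have kD: "DERIV k s :> k' s" for s
    unfolding k_def k'_def
    by (rule DERIV_cong[OF DERIV_chain2[OF pos_sq_DERIV DERIV_diff[OF DERIV_const pos_sq_DERIV]]]) simp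
  have fD: "GDERIV f x :> (2 / (R\<^sup>2 * (3 / 4))) *\<^sub>R (x - p)" for x
    unfolding gderiv_def f_def
    by (rule has_derivative_eq_rhs, (rule derivative_intros)+)
      (use assms in \<open>auto simp: fun_eq_iff inner_commute divide_simps\<close>)
  have f0: "f x \<le> 0" if "x \<in> ball p (R / 2)" for x
  proof -
    have "norm (x - p) ^ 2 \<le> (R / 2)\<^sup>2" using that by (intro power_mono) (auto simp: dist_norm norm_minus_commute)
    then show ?thesis unfolding f_def power2_norm_eq_inner using assms by (auto intro!: divide_nonpos_nonneg)
  qed
  have f1: "1 \<le> f x" if "x \<notin> ball p R" for x
  proof -
    have "R\<^sup>2 \<le> norm (x - p) ^ 2" using that assms by (intro power_mono) (auto simp: dist_norm norm_minus_commute)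
    then show ?thesis unfolding f_def power2_norm_eq_inner using assms by (simp add: divide_simps power2_eq_square)
  qed
  let ?D = "\<lambda>x. k' (f x) *\<^sub>R ((2 / (R\<^sup>2 * (3 / 4))) *\<^sub>R (x - p))"
  have k1: "k s = 1" if "s \<le> 0" for s using that by (simp add: k_def pos_sq_def)
  have k0: "k s = 0" if "1 \<le> s" for s
    using that one_le_power[of s 2] by (simp add: k_def pos_sq_def)
  have k01: "0 \<le> k s \<and> k s \<le> 1" for s
    unfolding k_def pos_sq_def by (auto simp: abs_square_le_1 max_def power_le_one_iff)
  have "C1c (norm p + R) (\<lambda>x. k (f x)) ?D"
  proof (rule C1cI)
    show "GDERIV (\<lambda>x. k (f x)) x :> ?D x" for x by (rule GDERIV_DERIV_compose[OF fD kD])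
    have "continuous_on UNIV pos_sq" using pos_sq_DERIV DERIV_isCont continuous_at_imp_continuous_on by blast
    then have "continuous_on UNIV k'" unfolding k'_def by (intro continuous_intros)
    moreover have "continuous_on UNIV f" using fD by (rule GDERIV_continuous_on)
    ultimately show "continuous_on UNIV ?D"
      by (intro continuous_intros continuous_on_compose2[of UNIV k' UNIV f]) auto
    show "k (f x) = 0" if "norm p + R < norm x" for x
    proof (intro k0 f1)
      show "x \<notin> ball p R" using that norm_triangle_sub[of x p] by (auto simp: dist_norm norm_minus_commute)
    qed
  qed
  then show ?thesis using k01 k0 k1 f0 f1
    by (intro exI[of _ "\<lambda>x. k (f x)"] exI[of _ ?D]) (auto simp: C1c_def)
qed

lemma C1b_one_minus: "C1b f D \<Longrightarrow> C1b (\<lambda>x. 1 - f x) (\<lambda>x. (-1) *\<^sub>R D x)"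
  by (rule C1b_compose[where g="\<lambda>s. 1 - s" and g'="\<lambda>_. -1"]) (auto intro!: derivative_eq_intros)

text \<open>Cutoffs \<open>b p\<close> are made to add up to \<open>1\<close> by the telescoping identity
  \<open>1 - (1 - b q) P = b q P + (1 - P)\<close>, where \<open>P\<close> is the product of the factors \<open>1 - b p\<close> treated before.\<close>

lemma partition_of_unity:
  fixes R :: "real^'n \<Rightarrow> real"
  assumes "finite I" "\<And>p. p \<in> I \<Longrightarrow> 0 < R p"
  obtains \<psi> D where "\<And>p. p \<in> I \<Longrightarrow> C1b (\<psi> p) (D p)" "\<And>p x. p \<in> I \<Longrightarrow> 0 \<le> \<psi> p x \<and> \<psi> p x \<le> 1"
    "\<And>p x. p \<in> I \<Longrightarrow> x \<notin> ball p (R p) \<Longrightarrow> \<psi> p x = 0"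
    "\<And>x. x \<in> (\<Union>p\<in>I. ball p (R p / 2)) \<Longrightarrow> (\<Sum>p\<in>I. \<psi> p x) = 1"
proof -
  have "\<forall>p. \<exists>b D. p \<in> I \<longrightarrow> C1b b D \<and> (\<forall>x. 0 \<le> b x \<and> b x \<le> 1) \<and> (\<forall>x. x \<notin> ball p (R p) \<longrightarrow> b x = 0) \<and>
    (\<forall>x\<in>ball p (R p / 2). b x = (1::real))"
    using cutoff_exists assms(2) by blast
  then obtain b B where b: "\<And>p. p \<in> I \<Longrightarrow> C1b (b p) (B p)" "\<And>p x. p \<in> I \<Longrightarrow> 0 \<le> b p x \<and> b p x \<le> (1::real)"
    "\<And>p x. p \<in> I \<Longrightarrow> x \<notin> ball p (R p) \<Longrightarrow> b p x = 0" "\<And>p x. p \<in> I \<Longrightarrow> x \<in> ball p (R p / 2) \<Longrightarrow> b p x = 1"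
    by metis
  have prod: "\<exists>E. C1b (\<lambda>x. \<Prod>p\<in>J. 1 - b p x) E" if "J \<subseteq> I" for J
  proof -
    have "finite J" using that assms(1) finite_subset by blast
    then show ?thesis using that
    proof (induction J)
      case empty show ?case using C1b_const[of 1] by auto
    next
      case (insert p J)
      then obtain E where "C1b (\<lambda>x. \<Prod>p\<in>J. 1 - b p x) E" by auto
      from C1b_mult[OF C1b_one_minus[OF b(1)[of p]] this] insert show ?case by auto
    qed
  qed
  have "\<exists>\<psi>. (\<forall>p\<in>J. (\<exists>D. C1b (\<psi> p) D) \<and> (\<forall>x. 0 \<le> \<psi> p x \<and> \<psi> p x \<le> 1) \<and> (\<forall>x. x \<notin> ball p (R p) \<longrightarrow> \<psi> p x = 0)) \<and>
      (\<forall>x. (\<Sum>p\<in>J. \<psi> p x) = 1 - (\<Prod>p\<in>J. 1 - b p x))" if "J \<subseteq> I" for J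
  proof -
    have "finite J" using that assms(1) finite_subset by blast
    then show ?thesis using that
    proof (induction J)
      case empty show ?case by auto
    next
      case (insert q J)
      then obtain \<psi> where psi: "\<forall>p\<in>J. (\<exists>D. C1b (\<psi> p) D) \<and> (\<forall>x. 0 \<le> \<psi> p x \<and> \<psi> p x \<le> 1) \<and> (\<forall>x. x \<notin> ball p (R p) \<longrightarrow> \<psi> p x = 0)"
        "\<forall>x. (\<Sum>p\<in>J. \<psi> p x) = 1 - (\<Prod>p\<in>J. 1 - b p x)" by auto
      define \<xi> where "\<xi> x = b q x * (\<Prod>p\<in>J. 1 - b p x)" for x
      obtain E where "C1b (\<lambda>x. \<Prod>p\<in>J. 1 - b p x) E" using prod[of J] insert by auto
      then have 1: "\<exists>D. C1b \<xi> D" unfolding \<xi>_def using C1b_mult[OF b(1)[of q]] insert by blast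
      have P: "0 \<le> (\<Prod>p\<in>J. 1 - b p x) \<and> (\<Prod>p\<in>J. 1 - b p x) \<le> 1" for x
        using insert.prems b(2) by (auto intro!: prod_nonneg prod_le_1 simp: subset_eq)
      have 2: "0 \<le> \<xi> x \<and> \<xi> x \<le> 1" for x
        unfolding \<xi>_def using P[of x] b(2)[of q x] insert.prems by (auto intro: mult_le_one)
      have 3: "\<xi> x = 0" if "x \<notin> ball q (R q)" for x unfolding \<xi>_def using b(3)[of q x] insert.prems that by auto
      have 4: "\<xi> x + (1 - (\<Prod>p\<in>J. 1 - b p x)) = 1 - (1 - b q x) * (\<Prod>p\<in>J. 1 - b p x)" for x
        unfolding \<xi>_def by (simp add: algebra_simps)
      have "(\<Sum>p\<in>J. (\<psi>(q := \<xi>)) p x) = (\<Sum>p\<in>J. \<psi> p x)" for x using insert by (intro sum.cong) auto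
      then show ?case using 1 2 3 4 psi insert
        by (intro exI[of _ "\<psi>(q := \<xi>)"]) auto
    qed
  qed
  from this[OF order_refl] obtain \<psi> where
    psi: "\<forall>p\<in>I. (\<exists>D. C1b (\<psi> p) D) \<and> (\<forall>x. 0 \<le> \<psi> p x \<and> \<psi> p x \<le> 1) \<and> (\<forall>x. x \<notin> ball p (R p) \<longrightarrow> \<psi> p x = 0)"
      "\<And>x. (\<Sum>p\<in>I. \<psi> p x) = 1 - (\<Prod>p\<in>I. 1 - b p x)" by blast
  then obtain D where D: "\<And>p. p \<in> I \<Longrightarrow> C1b (\<psi> p) (D p)" by metis
  have "(\<Sum>p\<in>I. \<psi> p x) = 1" if "x \<in> (\<Union>p\<in>I. ball p (R p / 2))" for x
  proof -
    have "(\<Prod>p\<in>I. 1 - b p x) = 0" using that b(4) assms(1) by (intro prod_zero) auto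
    then show ?thesis using psi(2) by simp
  qed
  then show thesis using that[of \<psi> D] D psi(1) by blast
qed

section \<open>Jensen's inequality with a truncated weight\<close>

text \<open>Separate the closed epigraph from a point strictly below it. The defect \<open>e\<close> spares the construction
  of an exact supporting hyperplane.\<close>

lemma affine_minorant:
  fixes f :: "'a::euclidean_space \<Rightarrow> real"
  assumes f: "convex_on UNIV f" and e: "0 < e"
  obtains v where "\<And>y. f a - e + v \<bullet> (y - a) \<le> f y"
proof -
  have c: "continuous_on UNIV f" using convex_on_continuous[OF open_UNIV f] .
  have "closed {z. f (fst z) \<le> snd z}"
    by (intro closed_Collect_le continuous_intros continuous_on_compose2[OF c]) auto
  then have cl: "closed (epigraph UNIV f)" by (simp add: epigraph_def)
  have out: "(a, f a - e) \<notin> epigraph UNIV f" using e by (simp add: epigraph_def)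
  obtain n b where n: "n \<bullet> (a, f a - e) < b" "\<And>z. z \<in> epigraph UNIV f \<Longrightarrow> b < n \<bullet> z"
    using separating_hyperplane_closed_point[OF convex_epigraphI[OF f] cl out] by blast
  obtain u \<tau> where nn: "n = (u, \<tau>)" by (cases n)
  have lt: "u \<bullet> a + \<tau> * (f a - e) < u \<bullet> y + \<tau> * f y" for y
    using n(1) n(2)[of "(y, f y)"] by (simp add: nn epigraph_def)
  have "0 < \<tau> * e" using lt[of a] by (simp add: algebra_simps)
  then have tau: "0 < \<tau>" using e by (simp add: zero_less_mult_iff)
  show thesis
  proof (rule that[of "(- (1 / \<tau>)) *\<^sub>R u"])
    fix y
    have "\<tau> * (f a - e - (1 / \<tau>) * (u \<bullet> (y - a))) < \<tau> * f y"
      using lt[of y] tau by (simp add: algebra_simps inner_diff_right)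
    then show "f a - e + (- (1 / \<tau>)) *\<^sub>R u \<bullet> (y - a) \<le> f y" using tau by simp
  qed
qed

lemma convex_ray:
  fixes f :: "'a::real_vector \<Rightarrow> real"
  assumes "convex_on UNIV f" "f 0 = 0" "0 \<le> c" "c \<le> 1" shows "f (c *\<^sub>R x) \<le> c * f x"
  using convex_onD[OF assms(1), of c 0 x] assms by simp

text \<open>The weight \<open>a = max 1 (q / k)\<close> shortens the vectors \<open>g\<close> so much that the hypothesis on \<open>f\<close> applies
  to \<open>g / a\<close>; its mean is at most \<open>2\<close> unless the mean of \<open>q\<close> exceeds \<open>k\<close>, and in that case the bound
  \<open>k + 1\<close> on \<open>f\<close> at the mean of \<open>g\<close> is enough.\<close>

lemma truncated_jensen:
  fixes f :: "'a::euclidean_space \<Rightarrow> real" and g :: "'b \<Rightarrow> 'a"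
  assumes f: "convex_on UNIV f" "f 0 = 0" "\<And>x. 0 \<le> f x"
    and \<rho>: "\<And>z. 0 \<le> \<rho> z" "integrable N \<rho>" "(LINT z|N. \<rho> z) = 1"
    and g: "integrable N (\<lambda>z. \<rho> z *\<^sub>R g z)"
    and q: "\<And>z. 0 \<le> q z" "integrable N (\<lambda>z. \<rho> z * q z)" "q \<in> borel_measurable N"
    and k: "0 < k"
    and small: "\<And>z s. \<rho> z \<noteq> 0 \<Longrightarrow> 0 < s \<Longrightarrow> s \<le> 1 \<Longrightarrow> s * q z \<le> k \<Longrightarrow> f (s *\<^sub>R g z) \<le> s * q z + 1"
    and big: "0 < c" "f (c *\<^sub>R (LINT z|N. \<rho> z *\<^sub>R g z)) \<le> k + 1"
  shows "f (min c (1 / 2) *\<^sub>R (LINT z|N. \<rho> z *\<^sub>R g z)) \<le> (LINT z|N. \<rho> z * q z) + 1"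
proof -
  define I where "I = (LINT z|N. \<rho> z *\<^sub>R g z)"
  define J where "J = (LINT z|N. \<rho> z * q z)"
  have shrink: "f (b *\<^sub>R x) \<le> f x" if "0 \<le> b" "b \<le> 1" for b x
  proof -
    have "f (b *\<^sub>R x) \<le> b * f x" by (rule convex_ray[OF f(1,2) that])
    also have "\<dots> \<le> 1 * f x" using that f(3) by (intro mult_right_mono) auto
    finally show ?thesis by simp
  qed
  have "f (min c (1 / 2) *\<^sub>R I) \<le> J + 1"
  proof (cases "J \<le> k")
    case False
    have "min c (1 / 2) *\<^sub>R I = (min c (1 / 2) / c) *\<^sub>R (c *\<^sub>R I)" using big(1) by simp
    then have "f (min c (1 / 2) *\<^sub>R I) \<le> f (c *\<^sub>R I)" using big(1) by (simp only:) (rule shrink, auto)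
    then show ?thesis using False big(2) unfolding I_def by linarith
  next
    case True
    \<comment> \<open>With this weight, \<open>q z / a z\<close> is at most \<open>k\<close>.\<close>
    define a where "a z = max 1 (q z / k)" for z
    have a1: "1 \<le> a z" for z by (simp add: a_def)
    have ale: "a z \<le> 1 + q z / k" for z using q(1)[of z] k by (simp add: a_def)
    have am: "a \<in> borel_measurable N" unfolding a_def using q(3) by measurable
    have bd: "integrable N (\<lambda>z. \<rho> z + \<rho> z * q z / k)"
      using \<rho>(2) q(2) by (intro Bochner_Integration.integrable_add integrable_divide_zero) auto
    have ra: "\<rho> z * a z \<le> \<rho> z + \<rho> z * q z / k" for z
      using mult_left_mono[OF ale \<rho>(1)[of z], of z] by (simp add: distrib_left)
    have ia: "integrable N (\<lambda>z. \<rho> z * a z)"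
    proof (rule Bochner_Integration.integrable_bound[OF bd])
      show "(\<lambda>z. \<rho> z * a z) \<in> borel_measurable N" using am \<rho>(2) by auto
      have "0 \<le> \<rho> z * a z" for z using \<rho>(1)[of z] a1[of z] by simp
      then show "AE z in N. norm (\<rho> z * a z) \<le> norm (\<rho> z + \<rho> z * q z / k)" using ra by (intro AE_I2) (smt (verit) real_norm_def)
    qed
    define W where "W = (LINT z|N. \<rho> z * a z)"
    have "\<rho> z \<le> \<rho> z * a z" for z using mult_left_mono[OF a1 \<rho>(1)[of z], of z] by simp
    then have "1 \<le> W" unfolding W_def \<rho>(3)[symmetric] by (intro integral_mono[OF \<rho>(2) ia])
    have "W \<le> (LINT z|N. \<rho> z + \<rho> z * q z / k)" unfolding W_def by (rule integral_mono[OF ia bd ra])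
    also have "\<dots> = 1 + J / k" using \<rho>(2,3) q(2) by (simp add: J_def)
    also have "\<dots> \<le> 2" using True k by simp
    finally have W2: "W \<le> 2" .
    \<comment> \<open>\<open>A\<close> is the mean of the shortened vectors \<open>g z / a z\<close> for the probability density \<open>\<rho> z * a z / W\<close>, so
      Jensen's inequality for this density bounds \<open>f A\<close>.\<close>
    define A where "A = (1 / W) *\<^sub>R I"
    have WA: "W *\<^sub>R A = I" using \<open>1 \<le> W\<close> by (simp add: A_def)
    have fA: "f A \<le> J + 1"
    proof (rule field_le_epsilon)
      fix e :: real assume e: "0 < e"
      obtain v where v: "\<And>y. f A - e + v \<bullet> (y - A) \<le> f y" using affine_minorant[OF f(1) e] by blast
      have pt: "\<rho> z * a z * (f A - e) + v \<bullet> (\<rho> z *\<^sub>R g z - (\<rho> z * a z) *\<^sub>R A) \<le> \<rho> z * q z + \<rho> z * a z" for z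
      proof (cases "\<rho> z = 0")
        case False
        define s where "s = 1 / a z"
        have as: "a z * s = 1" "0 < s" "s \<le> 1" using a1[of z] by (auto simp: s_def)
        have "q z / k \<le> a z" by (simp add: a_def)
        then have "q z \<le> a z * k" using k by (simp add: pos_divide_le_eq)
        then have "s * q z \<le> s * (a z * k)" using as by (intro mult_left_mono) auto
        also have "\<dots> = (a z * s) * k" by simp
        also have "\<dots> = k" using as(1) by simp
        finally have "f (s *\<^sub>R g z) \<le> s * q z + 1" using small[OF False as(2,3)] by blast
        then have "f A - e + v \<bullet> (s *\<^sub>R g z - A) \<le> s * q z + 1" using v[of "s *\<^sub>R g z"] by linarith
        then have "(\<rho> z * a z) * (f A - e + v \<bullet> (s *\<^sub>R g z - A)) \<le> (\<rho> z * a z) * (s * q z + 1)"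
          using \<rho>(1)[of z] a1[of z] by (intro mult_left_mono) auto
        moreover have "(\<rho> z * a z) * (s * q z + 1) = \<rho> z * q z * (a z * s) + \<rho> z * a z" by (simp add: algebra_simps)
        moreover have "(\<rho> z * a z) * (f A - e + v \<bullet> (s *\<^sub>R g z - A)) =
            \<rho> z * a z * (f A - e) + (\<rho> z * (a z * s) * (v \<bullet> g z) - \<rho> z * a z * (v \<bullet> A))"
          by (simp add: algebra_simps inner_diff_right)
        ultimately show ?thesis using as(1) by (simp add: inner_diff_right)
      qed simp
      have i1: "integrable N (\<lambda>z. \<rho> z *\<^sub>R g z - (\<rho> z * a z) *\<^sub>R A)"
        using g ia by (intro Bochner_Integration.integrable_diff integrable_scaleR_left)
      have i2: "integrable N (\<lambda>z. v \<bullet> (\<rho> z *\<^sub>R g z - (\<rho> z * a z) *\<^sub>R A))"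
        by (rule integrable_inner_right[OF i1])
      have z0: "(LINT z|N. v \<bullet> (\<rho> z *\<^sub>R g z - (\<rho> z * a z) *\<^sub>R A)) = 0"
      proof -
        have "(LINT z|N. \<rho> z *\<^sub>R g z - (\<rho> z * a z) *\<^sub>R A) = I - W *\<^sub>R A"
          unfolding I_def W_def using g ia by (simp add: Bochner_Integration.integral_diff)
        then show ?thesis using integral_inner_right[OF i1, of v] WA by simp
      qed
      have "(LINT z|N. \<rho> z * a z * (f A - e) + v \<bullet> (\<rho> z *\<^sub>R g z - (\<rho> z * a z) *\<^sub>R A)) \<le> (LINT z|N. \<rho> z * q z + \<rho> z * a z)"
        using i2 ia q(2) by (intro integral_mono pt) auto
      then have "W * (f A - e) \<le> J + W" using i2 ia q(2) z0 by (simp add: W_def J_def)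
      then have "W * (f A - e - 1) \<le> J" by (simp add: algebra_simps)
      moreover have "f A - e - 1 \<le> W * (f A - e - 1) \<or> f A - e - 1 \<le> 0"
        using mult_right_mono[of 1 W "f A - e - 1"] \<open>1 \<le> W\<close> by (cases "0 \<le> f A - e - 1") auto
      moreover have "0 \<le> J" unfolding J_def using q(1) \<rho>(1) by (intro integral_nonneg_AE) auto
      ultimately show "f A \<le> J + 1 + e" by linarith
    qed
    have "min c (1 / 2) *\<^sub>R I = (min c (1 / 2) * W) *\<^sub>R A" using WA by (metis scaleR_scaleR)
    moreover have "min c (1 / 2) * W \<le> (1 / 2) * 2" using W2 \<open>1 \<le> W\<close> by (intro mult_mono) auto
    moreover have "0 \<le> min c (1 / 2) * W" using big(1) \<open>1 \<le> W\<close> by simp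
    ultimately have "f (min c (1 / 2) *\<^sub>R I) \<le> f A" using shrink[of "min c (1 / 2) * W" A] by simp
    then show ?thesis using fA by linarith
  qed
  then show ?thesis by (simp add: I_def J_def)
qed

section \<open>Weak \<open>N\<close>-functions\<close>

text \<open>A set of full measure is dense. By continuity in \<open>x\<close>, properties of a weak \<open>N\<close>-function that hold
  almost everywhere and are closed under limits therefore hold at every point of \<open>\<Omega>\<close>.\<close>

lemma AE_dense:
  fixes \<Omega> :: "'a::euclidean_space set"
  assumes \<Omega>: "open \<Omega>" and P: "AE x in lebesgue_on \<Omega>. P x" and x: "x \<in> \<Omega>"
  obtains y where "\<And>n. y n \<in> \<Omega>" "\<And>n. P (y n)" "y \<longlonglongrightarrow> x"
proof -
  have "\<exists>y. y \<in> \<Omega> \<and> P y \<and> dist y x < inverse (real (Suc n))" for n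
  proof (rule ccontr)
    assume c: "\<not> (\<exists>y. y \<in> \<Omega> \<and> P y \<and> dist y x < inverse (real (Suc n)))"
    define U where "U = \<Omega> \<inter> ball x (inverse (real (Suc n)))"
    have U: "open U" "x \<in> U" using \<Omega> x by (auto simp: U_def)
    have "AE y in lborel. y \<in> \<Omega> \<longrightarrow> P y" using P by (simp add: AE_lebesgue_on_iff[OF \<Omega>])
    then have "AE y in lborel. y \<notin> U"
      by eventually_elim (use c in \<open>auto simp: U_def dist_commute\<close>)
    then have "U \<in> null_sets lborel" using U by (subst AE_iff_null_sets) auto
    then have "U \<in> null_sets lebesgue" by (rule null_sets_completionI)
    then have "negligible U" by (simp add: negligible_iff_null_sets)
    then show False using open_not_negligible[OF U(1)] U(2) by auto
  qed
  then obtain y where y: "\<And>n. y n \<in> \<Omega>" "\<And>n. P (y n)" "\<And>n. dist (y n) x < inverse (real (Suc n))" by metis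
  have "(\<lambda>n. dist (y n) x) \<longlonglongrightarrow> 0"
    by (rule tendsto_sandwich[OF _ _ tendsto_const LIMSEQ_inverse_real_of_nat])
      (use y(3) in \<open>auto intro!: always_eventually less_imp_le simp del: of_nat_Suc\<close>)
  then have "y \<longlonglongrightarrow> x" by (subst tendsto_dist_iff)
  then show thesis using that y by blast
qed

locale N_function =
  fixes \<Omega> :: "(real^'n) set" and M :: "real^'n \<Rightarrow> real^'n \<Rightarrow> real"
  assumes op: "open \<Omega>" and weakN: "weak_N_function \<Omega> UNIV M"
    and cont: "continuous_on (\<Omega> \<times> UNIV) (\<lambda>(x, \<xi>). M x \<xi>)"
begin

lemma nonneg: "x \<in> \<Omega> \<Longrightarrow> 0 \<le> M x \<xi>"
  using weakN by (simp add: weak_N_function_def)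

lemma tendsto_M:
  assumes "\<And>n. y n \<in> \<Omega>" "x \<in> \<Omega>" "y \<longlonglongrightarrow> x" "\<zeta> \<longlonglongrightarrow> \<xi>"
  shows "(\<lambda>n. M (y n) (\<zeta> n)) \<longlonglongrightarrow> M x \<xi>"
  using continuous_on_tendsto_compose[OF cont tendsto_Pair[OF assms(3,4)]] assms(1,2) by simp

lemma zero: assumes x: "x \<in> \<Omega>" shows "M x 0 = 0"
proof -
  have "AE x in lebesgue_on \<Omega>. M x 0 = 0 \<and> convex_on UNIV (M x)" using weakN by (simp add: weak_N_function_def)
  from AE_dense[OF op this x] obtain y where y: "\<And>n. y n \<in> \<Omega>" "\<And>n. M (y n) 0 = 0 \<and> convex_on UNIV (M (y n))" "y \<longlonglongrightarrow> x"
    by blast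
  have "(\<lambda>n. M (y n) 0) \<longlonglongrightarrow> M x 0" using tendsto_M[OF y(1) x y(3) tendsto_const] .
  then show ?thesis using y(2) by (simp add: LIMSEQ_const_iff)
qed

lemma convex: assumes x: "x \<in> \<Omega>" shows "convex_on UNIV (M x)"
proof -
  have "AE x in lebesgue_on \<Omega>. M x 0 = 0 \<and> convex_on UNIV (M x)" using weakN by (simp add: weak_N_function_def)
  from AE_dense[OF op this x] obtain y where y: "\<And>n. y n \<in> \<Omega>" "\<And>n. M (y n) 0 = 0 \<and> convex_on UNIV (M (y n))" "y \<longlonglongrightarrow> x"
    by blast
  have lim: "(\<lambda>n. M (y n) \<xi>) \<longlonglongrightarrow> M x \<xi>" for \<xi> using tendsto_M[OF y(1) x y(3) tendsto_const] .
  show ?thesis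
  proof (rule convex_onI)
    fix t \<xi> \<eta> assume t: "0 < t" "t < (1::real)"
    show "M x ((1 - t) *\<^sub>R \<xi> + t *\<^sub>R \<eta>) \<le> (1 - t) * M x \<xi> + t * M x \<eta>"
    proof (rule LIMSEQ_le[OF lim])
      show "(\<lambda>n. (1 - t) * M (y n) \<xi> + t * M (y n) \<eta>) \<longlonglongrightarrow> (1 - t) * M x \<xi> + t * M x \<eta>"
        by (intro tendsto_intros lim)
      have cv: "convex_on UNIV (M (y n))" for n using y(2) by blast
      have "M (y n) ((1 - t) *\<^sub>R \<xi> + t *\<^sub>R \<eta>) \<le> (1 - t) * M (y n) \<xi> + t * M (y n) \<eta>" for n
        using convex_onD[OF cv, of t \<xi> \<eta> n] t by simp
      then show "\<exists>N. \<forall>n\<ge>N. M (y n) ((1 - t) *\<^sub>R \<xi> + t *\<^sub>R \<eta>) \<le> (1 - t) * M (y n) \<xi> + t * M (y n) \<eta>"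
        by blast
    qed
  qed simp
qed

lemma ray: "x \<in> \<Omega> \<Longrightarrow> 0 \<le> c \<Longrightarrow> c \<le> 1 \<Longrightarrow> M x (c *\<^sub>R \<xi>) \<le> c * M x \<xi>"
  using convex_ray[OF convex zero] by blast

lemma shrink: "x \<in> \<Omega> \<Longrightarrow> 0 \<le> c \<Longrightarrow> c \<le> 1 \<Longrightarrow> M x (c *\<^sub>R \<xi>) \<le> M x \<xi>"
  using ray[of x c \<xi>] mult_left_le_one_le[OF nonneg[of x \<xi>], of c] by linarith

lemma shrink_le:
  assumes "x \<in> \<Omega>" "0 \<le> c" "c \<le> d" shows "M x (c *\<^sub>R \<xi>) \<le> M x (d *\<^sub>R \<xi>)"
proof (cases "d = 0")
  case False
  then have "c *\<^sub>R \<xi> = (c / d) *\<^sub>R (d *\<^sub>R \<xi>)" by simp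
  then show ?thesis using shrink[OF assms(1), of "c / d" "d *\<^sub>R \<xi>"] assms False by simp
qed (use assms in auto)

lemma bounded_above: "\<exists>B\<ge>0. \<forall>x\<in>\<Omega>. \<forall>\<xi>. norm \<xi> \<le> R \<longrightarrow> M x \<xi> \<le> B"
proof -
  obtain m2 :: "real \<Rightarrow> real" where m2: "convex_on {0..} m2" "AE x in lebesgue_on \<Omega>. \<forall>\<xi>. M x \<xi> \<le> m2 (norm \<xi>)"
  proof -
    obtain m1 m2 :: "real \<Rightarrow> real" where "convex_on {0..} m2" "AE x in lebesgue_on \<Omega>. \<forall>\<xi>\<in>UNIV. m1 (norm \<xi>) \<le> M x \<xi> \<and> M x \<xi> \<le> m2 (norm \<xi>)"
      using weakN unfolding weak_N_function_def by blast
    then show thesis by (intro that) (auto elim: eventually_mono)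
  qed
  define B where "B = max 0 (max (m2 0) (m2 R))"
  have le: "m2 s \<le> B" if "0 \<le> s" "s \<le> R" for s
  proof (cases "R = 0")
    case False
    then have R: "0 < R" using that by auto
    define t where "t = s / R"
    have t: "0 \<le> t" "t \<le> 1" "(1 - t) *\<^sub>R 0 + t *\<^sub>R R = s" using that R by (auto simp: t_def)
    have "m2 s \<le> (1 - t) * m2 0 + t * m2 R" using convex_onD[OF m2(1), of t 0 R] t R by simp
    also have "\<dots> \<le> (1 - t) * B + t * B" using t by (intro add_mono mult_left_mono) (auto simp: B_def)
    finally show ?thesis by (simp add: algebra_simps)
  qed (use that in \<open>auto simp: B_def\<close>)
  have "M x \<xi> \<le> B" if x: "x \<in> \<Omega>" and xi: "norm \<xi> \<le> R" for x \<xi>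
  proof -
    obtain y where y: "\<And>n. y n \<in> \<Omega>" "\<And>n. \<forall>\<xi>. M (y n) \<xi> \<le> m2 (norm \<xi>)" "y \<longlonglongrightarrow> x"
      using AE_dense[OF op m2(2) x] by blast
    have "M (y n) \<xi> \<le> B" for n using y(2)[of n] le[OF norm_ge_zero xi] order_trans by blast
    then show ?thesis using LIMSEQ_le_const2[OF tendsto_M[OF y(1) x y(3) tendsto_const]] by blast
  qed
  then show ?thesis by (intro exI[of _ B]) (auto simp: B_def)
qed

lemma positive_below:
  assumes "0 < s"
  shows "\<exists>a>0. AE x in lebesgue_on \<Omega>. \<forall>\<xi>. norm \<xi> = s \<longrightarrow> a \<le> M x \<xi>"
proof -
  obtain m1 m2 :: "real \<Rightarrow> real" where m: "\<forall>s>0. 0 < m1 s"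
     "AE x in lebesgue_on \<Omega>. \<forall>\<xi>\<in>UNIV. m1 (norm \<xi>) \<le> M x \<xi> \<and> M x \<xi> \<le> m2 (norm \<xi>)"
    using weakN unfolding weak_N_function_def by blast
  from m(2) have "AE x in lebesgue_on \<Omega>. \<forall>\<xi>. norm \<xi> = s \<longrightarrow> m1 s \<le> M x \<xi>"
    by eventually_elim auto
  then show ?thesis using m(1) assms by blast
qed

lemma measurable_ext:
  assumes [measurable]: "f \<in> borel_measurable borel"
  shows "(\<lambda>x. if x \<in> \<Omega> then M x (f x) else 0) \<in> borel_measurable borel"
proof -
  have "\<Omega> \<times> UNIV \<in> sets (borel :: ((real^'n) \<times> (real^'n)) measure)" using op by (intro borel_open open_Times) auto
  from borel_measurable_continuous_on_indicator[OF this cont]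
  have m: "(\<lambda>z. indicator (\<Omega> \<times> UNIV) z *\<^sub>R (case z of (x, \<xi>) \<Rightarrow> M x \<xi>)) \<in> borel_measurable borel" .
  have "(\<lambda>x. (x, f x)) \<in> measurable borel (borel :: ((real^'n) \<times> (real^'n)) measure)"
    by (intro borel_measurable_Pair) auto
  from measurable_compose[OF this m]
  show ?thesis by (rule measurable_cong[THEN iffD1, rotated]) (auto simp: indicator_def)
qed

text \<open>The condition on balls in a form without essential suprema. The number \<open>k\<close> is the threshold
  up to which the condition applies.\<close>

definition ball_condition :: "real \<Rightarrow> nat \<Rightarrow> ('n \<Rightarrow> nat) \<Rightarrow> real \<Rightarrow> real \<Rightarrow> bool" where
  "ball_condition \<gamma> K b \<kappa> C \<longleftrightarrow> 0 < \<kappa> \<and> 1 < C \<and>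
     (\<forall>x\<in>\<Omega>. \<forall>\<xi>. M x \<xi> = (\<Sum>j<K. M x (block_part b j \<xi>))) \<and>
     (\<forall>x\<in>\<Omega>. \<forall>r. 0 < r \<and> r \<le> 1 \<longrightarrow> (\<forall>j<K. \<exists>k>0.
        (\<forall>\<xi>\<in>block_space b j. norm \<xi> \<le> \<kappa> * r powr (\<gamma> - 1) \<longrightarrow> M x \<xi> \<le> k + 1) \<and>
        (\<forall>y\<in>\<Omega> \<inter> ball x r. \<forall>\<xi>\<in>block_space b j. M y (C *\<^sub>R \<xi>) \<le> k \<longrightarrow> M x \<xi> \<le> M y (C *\<^sub>R \<xi>) + 1)))"

lemma block_part_space: "block_part b j \<xi> \<in> block_space b j"
  by (simp add: block_part_def block_space_def)

lemma block_part_id: "\<xi> \<in> block_space b j \<Longrightarrow> block_part b i \<xi> = (if i = j then \<xi> else 0)"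
  by (auto simp: block_part_def block_space_def vec_eq_iff)

lemma block_space_scaleR: "\<xi> \<in> block_space b j \<Longrightarrow> c *\<^sub>R \<xi> \<in> block_space b j"
  by (simp add: block_space_def)

text \<open>The summands of the decomposition are recovered from \<open>M\<close> itself, almost everywhere, by inserting
  vectors from one factor; continuity of \<open>M\<close> then replaces essential bounds by pointwise ones. The threshold \<open>k\<close> is
  the supremum in the condition on balls. It is finite and positive because \<open>M\<close> is bounded on bounded sets
  and bounded below on spheres.\<close>

lemma B_gen_ball_condition:
  assumes B: "B_gen \<gamma> \<Omega> M"
  shows "\<exists>K b \<kappa> C. ball_condition \<gamma> K b \<kappa> C"
proof -
  let ?cond = "\<lambda>Mj c C p r j V \<xi>. N_minus \<Omega> (Mj j) (ball p r) (C *\<^sub>R \<xi>)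
                \<le> (SUP \<eta>\<in>{\<eta> \<in> V. norm \<eta> = 1}.
                      N_minus \<Omega> (Mj j) (ball p r) ((c * r powr (\<gamma> - 1)) *\<^sub>R \<eta>))
              \<longrightarrow> N_plus \<Omega> (Mj j) (ball p r) \<xi>
                \<le> N_minus \<Omega> (Mj j) (ball p r) (C *\<^sub>R \<xi>) + 1"
  obtain K b Mj c C where K: "1 \<le> K" "range b = {..<K}"
    and wN': "\<forall>j<K. weak_N_function \<Omega> (block_space b j) (Mj j)"
    and sum': "\<forall>x\<in>\<Omega>. \<forall>\<xi>. M x \<xi> = (\<Sum>j<K. Mj j x (block_part b j \<xi>))"
    and cC: "1 < c" "1 < C" and cond': "\<forall>p r. 0 < r \<and> r \<le> 1 \<longrightarrow>
        (\<forall>j<K. \<forall>\<xi>\<in>block_space b j. ?cond Mj c C p r j (block_space b j) \<xi>)"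
    using B unfolding B_gen_def by (elim exE conjE) (rule that)
  have cond: "?cond Mj c C p r j (block_space b j) \<xi>"
    if "0 < r" "r \<le> 1" "j < K" "\<xi> \<in> block_space b j" for p r j \<xi>
    using cond' that by blast
  have wN: "weak_N_function \<Omega> (block_space b j) (Mj j)" if "j < K" for j using wN' that by blast
  have sum: "M x \<xi> = (\<Sum>j<K. Mj j x (block_part b j \<xi>))" if "x \<in> \<Omega>" for x \<xi> using sum' that by blast
  have "AE x in lebesgue_on \<Omega>. \<forall>j\<in>{..<K}. Mj j x 0 = 0"
    using wN by (intro AE_finite_allI) (auto simp: weak_N_function_def elim: eventually_mono)
  then have z: "AE x in lebesgue_on \<Omega>. \<forall>j<K. Mj j x 0 = 0" by eventually_elim auto
  have ae0: "AE x in lborel. x \<in> \<Omega> \<longrightarrow> (\<forall>j<K. \<forall>\<xi>\<in>block_space b j. Mj j x \<xi> = M x \<xi>)"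
    using z unfolding AE_lebesgue_on_iff[OF op]
  proof eventually_elim
    case (elim x)
    show ?case
    proof (intro impI allI ballI)
      fix j \<xi> assume x: "x \<in> \<Omega>" and j: "j < K" and xi: "\<xi> \<in> block_space b j"
      have "M x \<xi> = (\<Sum>i<K. if i = j then Mj j x \<xi> else 0)"
        unfolding sum[OF x] using elim x by (intro sum.cong) (auto simp: block_part_id[OF xi])
      then show "Mj j x \<xi> = M x \<xi>" using j by simp
    qed
  qed
  have decomp: "M x \<xi> = (\<Sum>j<K. M x (block_part b j \<xi>))" if x: "x \<in> \<Omega>" for x \<xi>
  proof -
    have "AE x in lebesgue_on \<Omega>. \<forall>\<xi>. M x \<xi> = (\<Sum>j<K. M x (block_part b j \<xi>))"
      unfolding AE_lebesgue_on_iff[OF op] using ae0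
      by eventually_elim (auto simp: sum block_part_space)
    from AE_dense[OF op this x] obtain y where
      y: "\<And>n. y n \<in> \<Omega>" "\<And>n. \<forall>\<xi>. M (y n) \<xi> = (\<Sum>j<K. M (y n) (block_part b j \<xi>))" "y \<longlonglongrightarrow> x" by blast
    have lim: "(\<lambda>n. M (y n) \<xi>) \<longlonglongrightarrow> M x \<xi>" for \<xi> using tendsto_M[OF y(1) x y(3) tendsto_const] .
    have "(\<lambda>n. \<Sum>j<K. M (y n) (block_part b j \<xi>)) \<longlonglongrightarrow> (\<Sum>j<K. M x (block_part b j \<xi>))"
      by (intro tendsto_sum lim)
    moreover have "(\<lambda>n. \<Sum>j<K. M (y n) (block_part b j \<xi>)) = (\<lambda>n. M (y n) \<xi>)"
      by (rule ext) (rule y(2)[rule_format, symmetric])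
    ultimately have "(\<lambda>n. M (y n) \<xi>) \<longlonglongrightarrow> (\<Sum>j<K. M x (block_part b j \<xi>))" by (simp only:)
    then show ?thesis by (rule LIMSEQ_unique[OF lim])
  qed
  have key: "\<exists>k>0. (\<forall>\<xi>\<in>block_space b j. norm \<xi> \<le> (c / C) * r powr (\<gamma> - 1) \<longrightarrow> M x \<xi> \<le> k + 1) \<and>
        (\<forall>y\<in>\<Omega> \<inter> ball x r. \<forall>\<xi>\<in>block_space b j. M y (C *\<^sub>R \<xi>) \<le> k \<longrightarrow> M x \<xi> \<le> M y (C *\<^sub>R \<xi>) + 1)"
    if x: "x \<in> \<Omega>" and r: "0 < r" "r \<le> 1" and j: "j < K" for x r j
  proof -
    define U where "U = ball x r \<inter> \<Omega>"
    have U: "open U" "x \<in> U" "U \<subseteq> \<Omega>" using op x r by (auto simp: U_def)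
    let ?m = "\<lambda>\<xi>. N_minus \<Omega> (Mj j) (ball x r) \<xi>"
    let ?p = "\<lambda>\<xi>. N_plus \<Omega> (Mj j) (ball x r) \<xi>"
    define V where "V = block_space b j"
    have aeU: "AE y in lebesgue_on U. y \<in> U \<and> (\<forall>\<xi>\<in>V. Mj j y \<xi> = M y \<xi>)"
      unfolding AE_lebesgue_on_iff[OF U(1)] using ae0 by eventually_elim (use U(3) j V_def in auto)
    have meas: "(\<lambda>y. ereal (Mj j y \<xi>)) \<in> borel_measurable (lebesgue_on U)" if "\<xi> \<in> V" for \<xi>
    proof -
      have "(\<lambda>y. Mj j y \<xi>) \<in> borel_measurable (lebesgue_on \<Omega>)"
        using wN[OF j] that by (simp add: weak_N_function_def V_def)
      then have "(\<lambda>y. Mj j y \<xi>) \<in> borel_measurable (lebesgue_on U)"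
        using U(3) by (rule measurable_restrict_mono)
      then show ?thesis by measurable
    qed
    have lim: "(\<lambda>n. ereal (M (y n) \<xi>)) \<longlonglongrightarrow> ereal (M z \<xi>)"
      if "\<And>n. y n \<in> U" "z \<in> U" "y \<longlonglongrightarrow> z" for y z \<xi>
      using tendsto_M[OF _ _ that(3) tendsto_const, of \<xi>] that U(3) by auto
    have minus_le: "?m \<xi> \<le> ereal (M y \<xi>)" if y: "y \<in> U" and xi: "\<xi> \<in> V" for y \<xi>
    proof -
      have "AE y in lebesgue_on U. - ereal (Mj j y \<xi>) \<le> esssup (lebesgue_on U) (\<lambda>y. - ereal (Mj j y \<xi>))"
        by (rule esssup_AE)
      with aeU have "AE y in lebesgue_on U. y \<in> U \<and> ?m \<xi> \<le> ereal (M y \<xi>)"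
        by eventually_elim (use xi in \<open>auto simp: N_minus_def U_def ereal_uminus_le_reorder\<close>)
      from AE_dense[OF U(1) this y] obtain s where s: "\<And>n. s n \<in> U" "\<And>n. s n \<in> U \<and> ?m \<xi> \<le> ereal (M (s n) \<xi>)" "s \<longlonglongrightarrow> y"
        by blast
      show ?thesis using LIMSEQ_le_const[OF lim[OF s(1) y s(3)]] s(2) by blast
    qed
    have plus_ge: "ereal (M y \<xi>) \<le> ?p \<xi>" if y: "y \<in> U" and xi: "\<xi> \<in> V" for y \<xi>
    proof -
      have "AE y in lebesgue_on U. ereal (Mj j y \<xi>) \<le> esssup (lebesgue_on U) (\<lambda>y. ereal (Mj j y \<xi>))"
        by (rule esssup_AE)
      with aeU have "AE y in lebesgue_on U. y \<in> U \<and> ereal (M y \<xi>) \<le> ?p \<xi>"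
        by eventually_elim (use xi in \<open>auto simp: N_plus_def U_def\<close>)
      from AE_dense[OF U(1) this y] obtain s where s: "\<And>n. s n \<in> U" "\<And>n. s n \<in> U \<and> ereal (M (s n) \<xi>) \<le> ?p \<xi>" "s \<longlonglongrightarrow> y"
        by blast
      show ?thesis using LIMSEQ_le_const2[OF lim[OF s(1) y s(3)]] s(2) by blast
    qed
    have minus_mono: "?m \<xi> \<le> ?m \<eta>" if "\<xi> \<in> V" "\<eta> \<in> V" "\<And>y. y \<in> U \<Longrightarrow> M y \<xi> \<le> M y \<eta>" for \<xi> \<eta>
    proof -
      have "esssup (lebesgue_on U) (\<lambda>y. - ereal (Mj j y \<eta>)) \<le> esssup (lebesgue_on U) (\<lambda>y. - ereal (Mj j y \<xi>))"
      proof (rule esssup_AE_mono)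
        show "(\<lambda>y. - ereal (Mj j y \<eta>)) \<in> borel_measurable (lebesgue_on U)" using meas[OF that(2)] by measurable
        show "AE y in lebesgue_on U. - ereal (Mj j y \<eta>) \<le> - ereal (Mj j y \<xi>)"
          using aeU by eventually_elim (use that in auto)
      qed
      then show ?thesis by (simp add: N_minus_def U_def)
    qed
    have minus_ge: "ereal a \<le> ?m \<xi>" if "\<xi> \<in> V" "AE y in lebesgue_on U. a \<le> M y \<xi>" for a \<xi>
    proof -
      have "esssup (lebesgue_on U) (\<lambda>y. - ereal (Mj j y \<xi>)) \<le> - ereal a"
      proof (rule esssup_I)
        show "(\<lambda>y. - ereal (Mj j y \<xi>)) \<in> borel_measurable (lebesgue_on U)" using meas[OF that(1)] by measurable
        show "AE y in lebesgue_on U. - ereal (Mj j y \<xi>) \<le> - ereal a"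
          using aeU that(2) by eventually_elim (use that(1) in auto)
      qed
      then have "- (- ereal a) \<le> - esssup (lebesgue_on U) (\<lambda>y. - ereal (Mj j y \<xi>))"
        by (simp only: ereal_minus_le_minus)
      then show ?thesis by (simp add: N_minus_def U_def)
    qed
    define R where "R = c * r powr (\<gamma> - 1)"
    have R: "0 < R" using cC r by (simp add: R_def)
    define S where "S = {\<eta> \<in> V. norm \<eta> = 1}"
    define T where "T = (SUP \<eta>\<in>S. ?m (R *\<^sub>R \<eta>))"
    obtain i where i: "b i = j" using K(2) j by (metis imageE lessThan_iff)
    have e1: "axis i 1 \<in> S" using i by (auto simp: S_def V_def block_space_def axis_def norm_axis_1[unfolded axis_def])
    obtain B where "\<forall>x\<in>\<Omega>. \<forall>\<xi>. norm \<xi> \<le> R \<longrightarrow> M x \<xi> \<le> B" using bounded_above by blast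
    then have "?m (R *\<^sub>R \<eta>) \<le> ereal B" if "\<eta> \<in> S" for \<eta>
      using minus_le[OF U(2), of "R *\<^sub>R \<eta>"] that x R block_space_scaleR[of \<eta> b j R]
      by (auto simp: S_def V_def intro: order_trans)
    then have T_le: "T \<le> ereal B" unfolding T_def by (rule SUP_least)
    obtain a where a: "0 < a" "AE x in lebesgue_on \<Omega>. \<forall>\<xi>. norm \<xi> = R \<longrightarrow> a \<le> M x \<xi>"
      using positive_below[OF R] by blast
    have "AE y in lebesgue_on U. a \<le> M y (R *\<^sub>R axis i 1)"
      using a(2) unfolding AE_lebesgue_on_iff[OF U(1)] AE_lebesgue_on_iff[OF op]
      by eventually_elim (use U(3) R in \<open>auto simp: norm_axis_1\<close>)
    then have "ereal a \<le> ?m (R *\<^sub>R axis i 1)"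
      using e1 block_space_scaleR by (intro minus_ge) (auto simp: S_def V_def)
    also have "\<dots> \<le> T" unfolding T_def using e1 by (intro SUP_upper)
    finally have aT: "ereal a \<le> T" .
    obtain k where k: "T = ereal k" using aT T_le by (cases T) auto
    have k0: "0 < k" using aT a(1) by (simp add: k)
    have cond': "?p \<xi> \<le> ?m (C *\<^sub>R \<xi>) + 1" if "\<xi> \<in> V" "?m (C *\<^sub>R \<xi>) \<le> T" for \<xi>
      using cond[OF r j, of \<xi> x] that by (simp add: V_def T_def S_def R_def)
    show ?thesis
    proof (intro exI[of _ k] conjI ballI impI k0)
      \<comment> \<open>Here \<open>C *\<^sub>R \<xi>\<close> has length at most \<open>R\<close>, so by monotonicity along its ray the infimum at \<open>C *\<^sub>R \<xi>\<close>
        is at most the threshold.\<close>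
      fix \<xi> assume xi: "\<xi> \<in> block_space b j" and le: "norm \<xi> \<le> c / C * r powr (\<gamma> - 1)"
      have xiV: "\<xi> \<in> V" "C *\<^sub>R \<xi> \<in> V" using xi block_space_scaleR by (auto simp: V_def)
      have "?m (C *\<^sub>R \<xi>) \<le> T"
      proof (cases "\<xi> = 0")
        case True
        have "?m (C *\<^sub>R \<xi>) \<le> ereal (M x (C *\<^sub>R \<xi>))" by (rule minus_le[OF U(2) xiV(2)])
        also have "\<dots> = 0" using True zero[OF x] by simp
        also have "\<dots> \<le> T" using k0 by (simp add: k)
        finally show ?thesis .
      next
        case False
        define \<eta> where "\<eta> = (1 / norm \<xi>) *\<^sub>R \<xi>"
        have eta: "\<eta> \<in> S" using False xiV(1) block_space_scaleR by (auto simp: S_def V_def \<eta>_def)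
        have Cle: "C * norm \<xi> \<le> R" using le cC by (simp add: R_def field_simps)
        have eq: "C *\<^sub>R \<xi> = (C * norm \<xi>) *\<^sub>R \<eta>" using False by (simp add: \<eta>_def)
        have "?m (C *\<^sub>R \<xi>) \<le> ?m (R *\<^sub>R \<eta>)"
        proof (rule minus_mono[OF xiV(2)])
          show "R *\<^sub>R \<eta> \<in> V" using eta block_space_scaleR by (auto simp: S_def V_def)
          show "M y (C *\<^sub>R \<xi>) \<le> M y (R *\<^sub>R \<eta>)" if "y \<in> U" for y
            unfolding eq using that U(3) Cle cC by (intro shrink_le) auto
        qed
        also have "\<dots> \<le> T" unfolding T_def using eta by (intro SUP_upper)
        finally show ?thesis .
      qed
      then have "ereal (M x \<xi>) \<le> T + 1"
        using plus_ge[OF U(2) xiV(1)] cond'[OF xiV(1)] add_right_mono[of "?m (C *\<^sub>R \<xi>)" T 1] by (meson order_trans)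
      then show "M x \<xi> \<le> k + 1" by (simp add: k one_ereal_def)
    next
      fix y \<xi> assume y: "y \<in> \<Omega> \<inter> ball x r" and xi: "\<xi> \<in> block_space b j" and le: "M y (C *\<^sub>R \<xi>) \<le> k"
      have xiV: "\<xi> \<in> V" "C *\<^sub>R \<xi> \<in> V" using xi block_space_scaleR by (auto simp: V_def)
      have yU: "y \<in> U" using y by (simp add: U_def)
      have m: "?m (C *\<^sub>R \<xi>) \<le> ereal (M y (C *\<^sub>R \<xi>))" by (rule minus_le[OF yU xiV(2)])
      then have "?m (C *\<^sub>R \<xi>) \<le> T" unfolding k using le by (meson ereal_less_eq(3) order_trans)
      then have "ereal (M x \<xi>) \<le> ereal (M y (C *\<^sub>R \<xi>)) + 1"
        using plus_ge[OF U(2) xiV(1)] cond'[OF xiV(1)] add_right_mono[OF m, of 1] by (meson order_trans)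
      then show "M x \<xi> \<le> M y (C *\<^sub>R \<xi>) + 1" by (simp add: one_ereal_def)
    qed
  qed
  have "ball_condition \<gamma> K b (c / C) C"
    unfolding ball_condition_def using cC decomp key by auto
  then show ?thesis by blast
qed

end

section \<open>Smooth approximation\<close>

text \<open>The test function that expresses the smeared value at \<open>x\<close>: the reflected kernel times the cutoff. The
  variable of differentiation is \<open>y\<close>, hence the sign of the second term.\<close>

lemma smear_test_function:
  fixes w :: "real^'n \<Rightarrow> real" and e x :: "real^'n"
  assumes psi: "C1b \<psi> D" and e: "norm e \<le> 1" and eps: "0 < \<epsilon>" "\<epsilon> \<le> 1" and t: "0 < t"
  defines "E \<equiv> \<lambda>y. shift_kernel e \<epsilon> t (x - y) *\<^sub>R D y - \<psi> y *\<^sub>R grad (shift_kernel e \<epsilon> t) (x - y)"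
  shows "C1c (norm x + 2 * t) (\<lambda>y. shift_kernel e \<epsilon> t (x - y) * \<psi> y) E"
proof -
  note K = shift_kernel_C1c[OF t eps e]
  have "C1b (\<lambda>y. shift_kernel e \<epsilon> t (x + (-1) *\<^sub>R y) * \<psi> y)
      (\<lambda>y. shift_kernel e \<epsilon> t (x + (-1) *\<^sub>R y) *\<^sub>R D y + \<psi> y *\<^sub>R ((-1) *\<^sub>R grad (shift_kernel e \<epsilon> t) (x + (-1) *\<^sub>R y)))"
    by (rule C1b_mult[OF C1b_affine[OF C1c_C1b[OF K]] psi])
  then have b: "C1b (\<lambda>y. shift_kernel e \<epsilon> t (x - y) * \<psi> y) E" by (simp add: E_def)
  have "2 * t < norm (x - y)" if "norm x + 2 * t < norm y" for y
    using that norm_triangle_ineq2[of y x] by (simp add: norm_minus_commute)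
  then show ?thesis using K b unfolding C1c_def by (simp add: E_def)
qed

lemma smear_product_gradient:
  fixes w :: "real^'n \<Rightarrow> real" and e x :: "real^'n"
  assumes gw: "global_wgrad w G" and psi: "C1b \<psi> D" and e: "norm e \<le> 1" and eps: "0 < \<epsilon>" "\<epsilon> \<le> 1" and t: "0 < t"
  shows "smear e \<epsilon> t (\<lambda>y. \<psi> y *\<^sub>R G y) x =
      - (LINT y|lborel. w y *\<^sub>R (shift_kernel e \<epsilon> t (x - y) *\<^sub>R D y - \<psi> y *\<^sub>R grad (shift_kernel e \<epsilon> t) (x - y)))"
proof -
  have iG: "integrable lborel G" using gw by (simp add: global_wgrad_def)
  have [measurable]: "G \<in> borel_measurable borel" "\<psi> \<in> borel_measurable borel" using iG C1b_borel[OF psi] by auto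
  have "smear e \<epsilon> t (\<lambda>y. \<psi> y *\<^sub>R G y) x = (LINT y|lborel. (shift_kernel e \<epsilon> t (x - y) * \<psi> y) *\<^sub>R G y)"
    by (subst smear_eq_conv[OF t eps(1)]) simp_all
  moreover have "(LINT y|lborel. w y *\<^sub>R (shift_kernel e \<epsilon> t (x - y) *\<^sub>R D y - \<psi> y *\<^sub>R grad (shift_kernel e \<epsilon> t) (x - y))) =
      - (LINT y|lborel. (shift_kernel e \<epsilon> t (x - y) * \<psi> y) *\<^sub>R G y)"
    using gw C1c_C1b[OF smear_test_function[OF psi e eps t, of x]] unfolding global_wgrad_def by blast
  ultimately show ?thesis by simp
qed

text \<open>The test function has a gradient of mean zero, so \<open>w y\<close> may be replaced by \<open>w y - w x\<close>, of order
  \<open>t powr \<gamma>\<close> on the support of the kernel. For \<open>\<gamma> = 0\<close> the hypothesis on \<open>w\<close> says that its oscillation is bounded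
  (\<open>norm (x - y) powr 0\<close> is \<open>1\<close> for distinct points), so that both cases of the theorem share this estimate.\<close>

lemma smear_gradient_bound:
  fixes w :: "real^'n \<Rightarrow> real" and e :: "real^'n"
  assumes gw: "global_wgrad w G" and psi: "C1b \<psi> D" and e: "norm e \<le> 1" and eps: "0 < \<epsilon>" "\<epsilon> \<le> 1"
    and \<gamma>: "0 \<le> \<gamma>" "\<gamma> \<le> 1" and A: "0 \<le> A" "\<And>x y. \<bar>w x - w y\<bar> \<le> A * norm (x - y) powr \<gamma>"
  shows "\<exists>\<Lambda>>0. \<forall>t x. 0 < t \<and> t \<le> 1 \<longrightarrow> norm (smear e \<epsilon> t (\<lambda>y. \<psi> y *\<^sub>R G y) x) \<le> \<Lambda> * t powr (\<gamma> - 1)"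
proof -
  obtain B where B: "0 \<le> B" "\<And>x. \<bar>\<psi> x\<bar> \<le> B" "\<And>x. norm (D x) \<le> B" using C1b_bound[OF psi] by metis
  define S where "S = (LINT z|lborel. norm (grad mollifier (z::real^'n)))"
  have S: "0 \<le> S" unfolding S_def by simp
  define \<Lambda> where "\<Lambda> = 2 * A * B * (1 + S / \<epsilon>) + 1"
  have L: "0 < \<Lambda>" unfolding \<Lambda>_def using A B S eps by (intro add_nonneg_pos mult_nonneg_nonneg) auto
  have iw: "integrable lborel w" using gw by (simp add: global_wgrad_def)
  have wb: "w \<in> borel_measurable borel" using iw by auto
  have "norm (smear e \<epsilon> t (\<lambda>y. \<psi> y *\<^sub>R G y) x) \<le> \<Lambda> * t powr (\<gamma> - 1)" if t: "0 < t" "t \<le> 1" for t x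
  proof -
    let ?K = "shift_kernel e \<epsilon> t" and ?k = "grad (shift_kernel e \<epsilon> t)"
    define E where "E y = ?K (x - y) *\<^sub>R D y - \<psi> y *\<^sub>R ?k (x - y)" for y
    have cE: "C1c (norm x + 2 * t) (\<lambda>y. ?K (x - y) * \<psi> y) E"
      unfolding E_def by (rule smear_test_function[OF psi e eps t(1)])
    obtain b where b: "\<And>y. norm (E y) \<le> b" using C1b_bound[OF C1c_C1b[OF cE]] by metis
    have iE: "integrable lborel E" by (rule C1c_integrable(2)[OF cE])
    have Eb: "E \<in> borel_measurable borel" using iE by auto
    have iwE: "integrable lborel (\<lambda>y. w y *\<^sub>R E y)"
      by (rule integrable_scaleR_bounded[OF iw _ b]) (use Eb in auto)
    have icE: "integrable lborel (\<lambda>y. w x *\<^sub>R E y)" using iE by (rule integrable_scaleR_right)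
    note cK = shift_kernel_C1c[OF t(1) eps e]
    have off: "?K u = 0 \<and> ?k u = 0" if "2 * t < norm u" for u using cK that by (simp add: C1c_def)
    have iK: "integrable lborel (\<lambda>y. ?K (x - y))" "integrable lborel (\<lambda>y. norm (?k (x - y)))"
      using C1c_integrable[OF cK] lborel_integral_reflect(1)[of ?K x] lborel_integral_reflect(1)[of ?k x]
      by (auto intro: integrable_norm)
    define c where "c = A * (2 * t) powr \<gamma>"
    have c0: "0 \<le> c" using A by (simp add: c_def)
    have bound: "norm ((w y - w x) *\<^sub>R E y) \<le> c * (B * ?K (x - y) + B * norm (?k (x - y)))" for y
    proof (cases "2 * t < norm (x - y)")
      case True then show ?thesis using off[OF True] by (simp add: E_def)
    next
      case False
      have "\<bar>w y - w x\<bar> \<le> A * norm (y - x) powr \<gamma>" by (rule A(2))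
      also have "\<dots> \<le> c" unfolding c_def using False A(1) \<gamma>
        by (intro mult_left_mono powr_mono2) (auto simp: norm_minus_commute)
      finally have 1: "\<bar>w y - w x\<bar> \<le> c" .
      have "norm (E y) \<le> norm (?K (x - y) *\<^sub>R D y) + norm (\<psi> y *\<^sub>R ?k (x - y))" unfolding E_def by (rule norm_triangle_ineq4)
      also have "\<dots> \<le> ?K (x - y) * B + B * norm (?k (x - y))"
        using B shift_kernel_nonneg[OF t(1) eps(1), of e "x - y"] by (auto intro!: add_mono mult_mono)
      finally show ?thesis unfolding norm_scaleR using 1 c0
        by (intro mult_mono) (auto simp: mult.commute)
    qed
    have "smear e \<epsilon> t (\<lambda>y. \<psi> y *\<^sub>R G y) x = - (LINT y|lborel. w y *\<^sub>R E y)"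
      unfolding E_def by (rule smear_product_gradient[OF gw psi e eps t(1)])
    also have "(LINT y|lborel. w y *\<^sub>R E y) = (LINT y|lborel. (w y - w x) *\<^sub>R E y)"
      unfolding scaleR_diff_left using iwE icE C1c_integral_grad[OF cE] by simp
    finally have "norm (smear e \<epsilon> t (\<lambda>y. \<psi> y *\<^sub>R G y) x) = norm (LINT y|lborel. (w y - w x) *\<^sub>R E y)" by simp
    also have "\<dots> \<le> (LINT y|lborel. norm ((w y - w x) *\<^sub>R E y))" by (rule integral_norm_bound)
    also have "\<dots> \<le> (LINT y|lborel. c * (B * ?K (x - y) + B * norm (?k (x - y))))"
    proof (rule integral_mono[OF _ _ bound])
      show "integrable lborel (\<lambda>y. norm ((w y - w x) *\<^sub>R E y))"
        unfolding scaleR_diff_left using iwE icE by (intro integrable_norm Bochner_Integration.integrable_diff)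
      show "integrable lborel (\<lambda>y. c * (B * ?K (x - y) + B * norm (?k (x - y))))"
        using iK by (intro integrable_mult_right Bochner_Integration.integrable_add)
    qed
    also have "\<dots> = c * (B * 1 + B * (S / (t * \<epsilon>)))"
      using iK shift_kernel_mass[OF t(1) eps(1), of e x] shift_kernel_grad_mass[OF t(1) eps(1), of e x]
      by (simp add: S_def)
    \<comment> \<open>For \<open>t \<le> 1\<close> the first term is at most of the order \<open>1 / t\<close> of the second.\<close>
    also have "\<dots> \<le> c * (B * (1 / t) + B * (S / (t * \<epsilon>)))"
      using c0 B t by (intro mult_left_mono add_right_mono) auto
    also have "\<dots> = A * B * (1 + S / \<epsilon>) * ((2 * t) powr \<gamma> / t)"
      using t eps by (simp add: c_def field_simps)
    also have "\<dots> \<le> A * B * (1 + S / \<epsilon>) * (2 * t powr (\<gamma> - 1))"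
    proof (rule mult_left_mono)
      have "(2::real) powr \<gamma> \<le> 2 powr 1" using \<gamma> by (intro powr_mono) auto
      then have "2 powr \<gamma> * (t powr \<gamma> / t) \<le> 2 * (t powr \<gamma> / t)" using t by (intro mult_right_mono) auto
      then show "(2 * t) powr \<gamma> / t \<le> 2 * t powr (\<gamma> - 1)" using t by (simp add: powr_mult powr_diff)
      show "0 \<le> A * B * (1 + S / \<epsilon>)" using A B S eps by (intro mult_nonneg_nonneg) auto
    qed
    also have "\<dots> \<le> \<Lambda> * t powr (\<gamma> - 1)" unfolding \<Lambda>_def by (simp add: algebra_simps)
    finally show ?thesis .
  qed
  then show ?thesis using L by blast
qed

lemma smear_GDERIV:
  fixes w :: "real^'n \<Rightarrow> real" and e x :: "real^'n"
  assumes gw: "global_wgrad w G" and psi: "C1b \<psi> D" and e: "norm e \<le> 1" and eps: "0 < \<epsilon>" "\<epsilon> \<le> 1" and t: "0 < t"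
  shows "GDERIV (smear e \<epsilon> t (\<lambda>y. \<psi> y * w y)) x :> smear e \<epsilon> t (\<lambda>y. \<psi> y *\<^sub>R G y + w y *\<^sub>R D y) x"
    and "Ck k (smear e \<epsilon> t (\<lambda>y. \<psi> y * w y))"
proof -
  let ?K = "shift_kernel e \<epsilon> t" and ?k = "grad (shift_kernel e \<epsilon> t)"
  obtain B where B: "0 \<le> B" "\<And>x. \<bar>\<psi> x\<bar> \<le> B" "\<And>x. norm (D x) \<le> B" using C1b_bound[OF psi] by metis
  have iw: "integrable lborel w" and iG: "integrable lborel G" using gw by (auto simp: global_wgrad_def)
  note [measurable] = C1b_borel[OF psi]
  have wb [measurable]: "w \<in> borel_measurable borel" "G \<in> borel_measurable borel" using iw iG by auto
  note cK = shift_kernel_C1c[OF t eps e]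
  note kb = C1b_borel[OF C1c_C1b[OF cK]]
  note [measurable] = kb
  obtain C where C: "\<And>x. \<bar>?K x\<bar> \<le> C" "\<And>x. norm (?k x) \<le> C" using C1b_bound[OF C1c_C1b[OF cK]] by metis
  have ip: "integrable lborel (\<lambda>y. \<psi> y * w y)"
    using integrable_bounded_scaleR[OF iw, of \<psi> B] B(2) by simp
  have eq: "smear e \<epsilon> t (\<lambda>y. \<psi> y * w y) = conv ?K (\<lambda>y. \<psi> y * w y)"
    unfolding conv_def by (rule ext, subst smear_eq_conv[OF t eps(1)]) (simp_all add: mult.commute)
  have "Ck k (conv ?K (\<lambda>y. \<psi> y * w y))"
    by (rule conv_smooth[OF ip shift_kernel_smooth, where R="2 * t"]) (use cK in \<open>simp add: C1c_def\<close>)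
  then show "Ck k (smear e \<epsilon> t (\<lambda>y. \<psi> y * w y))" by (simp add: eq)
  have g: "GDERIV (conv ?K (\<lambda>y. \<psi> y * w y)) x :> conv ?k (\<lambda>y. \<psi> y * w y) x"
    by (rule conv_GDERIV[OF ip C1c_C1b[OF cK] C1c_uniformly_continuous(2)[OF cK]])
  have iD: "integrable lborel (\<lambda>y. w y *\<^sub>R D y)" by (rule integrable_scaleR_bounded[OF iw _ B(3)]) measurable
  have ipG: "integrable lborel (\<lambda>y. \<psi> y *\<^sub>R G y)" by (rule integrable_bounded_scaleR[OF iG _ B(2)]) measurable
  have iKD: "integrable lborel (\<lambda>y. ?K (x - y) *\<^sub>R w y *\<^sub>R D y)"
    by (rule integrable_bounded_scaleR[OF iD _ C(1)]) measurable
  have iKG: "integrable lborel (\<lambda>y. ?K (x - y) *\<^sub>R \<psi> y *\<^sub>R G y)"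
    by (rule integrable_bounded_scaleR[OF ipG _ C(1)]) measurable
  have ik: "integrable lborel (\<lambda>y. (\<psi> y * w y) *\<^sub>R ?k (x - y))"
    by (rule integrable_scaleR_bounded[OF ip _ C(2)]) measurable
  have "smear e \<epsilon> t (\<lambda>y. \<psi> y *\<^sub>R G y) x =
      - (LINT y|lborel. w y *\<^sub>R (?K (x - y) *\<^sub>R D y - \<psi> y *\<^sub>R ?k (x - y)))"
    by (rule smear_product_gradient[OF gw psi e eps t])
  also have "\<dots> = - (LINT y|lborel. ?K (x - y) *\<^sub>R w y *\<^sub>R D y - (\<psi> y * w y) *\<^sub>R ?k (x - y))"
    by (simp add: scaleR_diff_right mult.commute)
  also have "\<dots> = conv ?k (\<lambda>y. \<psi> y * w y) x - (LINT y|lborel. ?K (x - y) *\<^sub>R w y *\<^sub>R D y)"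
    unfolding conv_def using iKD ik by simp
  finally have 1: "(LINT y|lborel. ?K (x - y) *\<^sub>R \<psi> y *\<^sub>R G y) =
      conv ?k (\<lambda>y. \<psi> y * w y) x - (LINT y|lborel. ?K (x - y) *\<^sub>R w y *\<^sub>R D y)"
    by (subst (asm) smear_eq_conv[OF t eps(1)]) measurable
  have "smear e \<epsilon> t (\<lambda>y. \<psi> y *\<^sub>R G y + w y *\<^sub>R D y) x =
      (LINT y|lborel. ?K (x - y) *\<^sub>R \<psi> y *\<^sub>R G y + ?K (x - y) *\<^sub>R w y *\<^sub>R D y)"
    by (subst smear_eq_conv[OF t eps(1)]) (simp_all add: scaleR_add_right)
  also have "\<dots> = conv ?k (\<lambda>y. \<psi> y * w y) x" using iKG iKD 1 by simp
  finally show "GDERIV (smear e \<epsilon> t (\<lambda>y. \<psi> y * w y)) x :> smear e \<epsilon> t (\<lambda>y. \<psi> y *\<^sub>R G y + w y *\<^sub>R D y) x"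
    using g by (simp add: eq)
qed

lemma Ck_add: "Ck k f \<Longrightarrow> Ck k g \<Longrightarrow> Ck k (\<lambda>x. f x + g x)"
proof (induction k arbitrary: f g)
  case 0 then show ?case by (auto intro: continuous_intros)
next
  case (Suc k)
  have f: "GDERIV f x :> grad f x" "Ck k (\<lambda>x. grad f x $ i)" for x i using Suc.prems(1)[unfolded Ck_Suc] by blast+
  have g: "GDERIV g x :> grad g x" "Ck k (\<lambda>x. grad g x $ i)" for x i using Suc.prems(2)[unfolded Ck_Suc] by blast+
  have fg: "GDERIV (\<lambda>x. f x + g x) x :> grad f x + grad g x" for x
    by (rule GDERIV_add[OF f(1) g(1)])
  have "grad (\<lambda>x. f x + g x) = (\<lambda>x. grad f x + grad g x)"
    by (rule ext) (rule GDERIV_imp_grad[OF fg])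
  then show ?case unfolding Ck_Suc using fg Suc.IH[OF f(2) g(2)] by simp
qed

lemma Ck_zero: "Ck k (\<lambda>x. 0)"
  using bump_alg_Ck[OF bump_alg.const[of 0]] .

lemma Cc_infinity_sum:
  assumes "finite I" "\<And>p. p \<in> I \<Longrightarrow> f p \<in> Cc_infinity \<Omega>"
  shows "(\<lambda>x. \<Sum>p\<in>I. f p x) \<in> Cc_infinity \<Omega>"
  using assms
proof (induction I)
  case empty
  show ?case by (simp add: Cc_infinity_def Ck_zero)
next
  case (insert q I)
  let ?g = "\<lambda>x. \<Sum>p\<in>I. f p x"
  have g: "?g \<in> Cc_infinity \<Omega>" and q: "f q \<in> Cc_infinity \<Omega>" using insert by auto
  have "{x. f q x + ?g x \<noteq> 0} \<subseteq> {x. f q x \<noteq> 0} \<union> {x. ?g x \<noteq> 0}" by auto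
  then have "closure {x. f q x + ?g x \<noteq> 0} \<subseteq> closure ({x. f q x \<noteq> 0} \<union> {x. ?g x \<noteq> 0})" by (rule closure_mono)
  then have sub: "closure {x. f q x + ?g x \<noteq> 0} \<subseteq> closure {x. f q x \<noteq> 0} \<union> closure {x. ?g x \<noteq> 0}"
    by simp
  have "compact (closure {x. f q x \<noteq> 0} \<union> closure {x. ?g x \<noteq> 0})"
    using g q by (intro compact_Un) (auto simp: Cc_infinity_def)
  then have "bounded (closure {x. f q x + ?g x \<noteq> 0})" using compact_imp_bounded bounded_subset[OF _ sub] by blast
  then have c: "compact (closure {x. f q x + ?g x \<noteq> 0})" by (simp add: compact_eq_bounded_closed)
  have "closure {x. f q x + ?g x \<noteq> 0} \<subseteq> \<Omega>" using sub g q unfolding Cc_infinity_def by blast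
  moreover have "Ck k (\<lambda>x. f q x + ?g x)" for k using g q by (intro Ck_add) (auto simp: Cc_infinity_def)
  ultimately show ?case using c insert(1,2) by (simp add: Cc_infinity_def)
qed

text \<open>The mollification runs at half of the admissible scale; the other half absorbs the passage to the
  closure of the support.\<close>

lemma smear_pushed_in:
  fixes w :: "real^'n \<Rightarrow> real" and e :: "real^'n"
  assumes \<Omega>: "bounded \<Omega>" and push: "pushes \<Omega> p R e \<epsilon> t0" and eps: "0 < \<epsilon>" "\<epsilon> \<le> 1" and t: "0 < t" "t \<le> t0"
    and gw: "global_wgrad w G" and psi: "C1b \<psi> D" and off: "\<And>x. x \<notin> \<Omega> \<Longrightarrow> w x = 0" "\<And>x. x \<notin> ball p R \<Longrightarrow> \<psi> x = 0"
  shows "smear e (\<epsilon> / 2) t (\<lambda>y. \<psi> y * w y) \<in> Cc_infinity \<Omega>"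
proof -
  let ?F = "smear e (\<epsilon> / 2) t (\<lambda>y. \<psi> y * w y)"
  have e: "norm e \<le> 1" using push by (simp add: pushes_def)
  have eps2: "0 < \<epsilon> / 2" "\<epsilon> / 2 \<le> 1" using eps by auto
  have [measurable]: "(\<lambda>y. \<psi> y * w y) \<in> borel_measurable borel"
    using C1b_borel[OF psi] gw by (auto simp: global_wgrad_def)
  have supp: "\<exists>y\<in>\<Omega> \<inter> ball p R. norm (x - y - t *\<^sub>R e) < t * (\<epsilon> / 2)" if "?F x \<noteq> 0" for x
  proof (rule ccontr)
    assume c: "\<not> ?thesis"
    have "shift_kernel e (\<epsilon> / 2) t (x - y) *\<^sub>R (\<psi> y * w y) = 0" for y
      using c shift_kernel_support[OF t(1) eps2(1), of e "x - y"] off by (cases "y \<in> \<Omega> \<inter> ball p R") auto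
    then have "(\<lambda>y. shift_kernel e (\<epsilon> / 2) t (x - y) *\<^sub>R (\<psi> y * w y)) = (\<lambda>y. 0)" by (rule ext)
    then have "?F x = 0" by (subst smear_eq_conv[OF t(1) eps2(1)]) simp_all
    then show False using that by simp
  qed
  have cl: "closure {x. ?F x \<noteq> 0} \<subseteq> \<Omega>"
  proof
    fix x assume "x \<in> closure {x. ?F x \<noteq> 0}"
    moreover have "0 < t * (\<epsilon> / 2)" using t eps by simp
    ultimately obtain x' where x': "?F x' \<noteq> 0" "dist x' x < t * (\<epsilon> / 2)" unfolding closure_approachable by blast
    obtain y where y: "y \<in> \<Omega> \<inter> ball p R" "norm (x' - y - t *\<^sub>R e) < t * (\<epsilon> / 2)" using supp[OF x'(1)] by blast
    have eq: "(x - x') + (x' - y - t *\<^sub>R e) = x - y - t *\<^sub>R e" by simp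
    have "norm (x - y - t *\<^sub>R e) \<le> norm (x - x') + norm (x' - y - t *\<^sub>R e)"
      using norm_triangle_ineq[of "x - x'" "x' - y - t *\<^sub>R e"] unfolding eq .
    moreover have "norm (x - x') < t * (\<epsilon> / 2)" using x'(2) by (simp add: dist_norm norm_minus_commute)
    moreover have "t * (\<epsilon> / 2) + t * (\<epsilon> / 2) = t * \<epsilon>" by simp
    ultimately have "norm (x - y - t *\<^sub>R e) \<le> t * \<epsilon>" using y(2) by linarith
    then have "x \<in> cball (y + t *\<^sub>R e) (t * \<epsilon>)" by (simp add: dist_norm norm_minus_commute algebra_simps)
    then show "x \<in> \<Omega>" using push y(1) t unfolding pushes_def by blast
  qed
  have "bounded (closure {x. ?F x \<noteq> 0})" using bounded_subset[OF \<Omega> cl] .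
  then have "compact (closure {x. ?F x \<noteq> 0})" by (simp add: compact_eq_bounded_closed)
  then show ?thesis using cl smear_GDERIV(2)[OF gw psi e eps2 t(1)] by (simp add: Cc_infinity_def)
qed

lemma L1_sum_tendsto:
  fixes u :: "'p \<Rightarrow> nat \<Rightarrow> 'a \<Rightarrow> 'b::{banach, second_countable_topology}"
  assumes I: "finite I" and i: "\<And>p m. p \<in> I \<Longrightarrow> integrable N (u p m)" "\<And>p. p \<in> I \<Longrightarrow> integrable N (v p)"
    and l: "\<And>p. p \<in> I \<Longrightarrow> (\<lambda>m. LINT x|N. norm (u p m x - v p x)) \<longlonglongrightarrow> 0"
  shows "(\<lambda>m. LINT x|N. norm ((\<Sum>p\<in>I. u p m x) - (\<Sum>p\<in>I. v p x))) \<longlonglongrightarrow> 0"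
proof (rule Lim_null_comparison)
  have "(\<lambda>m. \<Sum>p\<in>I. (LINT x|N. norm (u p m x - v p x))) \<longlonglongrightarrow> (\<Sum>p\<in>I. 0)" by (intro tendsto_sum l)
  then show "(\<lambda>m. \<Sum>p\<in>I. (LINT x|N. norm (u p m x - v p x))) \<longlonglongrightarrow> 0" by simp
  have "(LINT x|N. norm ((\<Sum>p\<in>I. u p m x) - (\<Sum>p\<in>I. v p x))) \<le> (\<Sum>p\<in>I. (LINT x|N. norm (u p m x - v p x)))" for m
  proof -
    have d: "integrable N (\<lambda>x. norm (u p m x - v p x))" if "p \<in> I" for p using i that by auto
    have "(LINT x|N. norm ((\<Sum>p\<in>I. u p m x) - (\<Sum>p\<in>I. v p x))) \<le> (LINT x|N. (\<Sum>p\<in>I. norm (u p m x - v p x)))"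
    proof (rule integral_mono)
      show "integrable N (\<lambda>x. norm ((\<Sum>p\<in>I. u p m x) - (\<Sum>p\<in>I. v p x)))" using i by (intro integrable_norm Bochner_Integration.integrable_diff Bochner_Integration.integrable_sum) auto
      show "integrable N (\<lambda>x. \<Sum>p\<in>I. norm (u p m x - v p x))" using d by (intro Bochner_Integration.integrable_sum) auto
      show "norm ((\<Sum>p\<in>I. u p m x) - (\<Sum>p\<in>I. v p x)) \<le> (\<Sum>p\<in>I. norm (u p m x - v p x))" for x
        unfolding sum_subtractf[symmetric] by (rule norm_sum)
    qed
    also have "\<dots> = (\<Sum>p\<in>I. (LINT x|N. norm (u p m x - v p x)))" using d by (intro Bochner_Integration.integral_sum) auto
    finally show ?thesis .
  qed
  then show "eventually (\<lambda>m. norm (LINT x|N. norm ((\<Sum>p\<in>I. u p m x) - (\<Sum>p\<in>I. v p x))) \<le>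
      (\<Sum>p\<in>I. (LINT x|N. norm (u p m x - v p x)))) sequentially" by simp
qed

lemma smear_add:
  fixes f g :: "real^'n \<Rightarrow> 'b::{banach, second_countable_topology}"
  assumes f: "integrable lborel f" and g: "integrable lborel g" and t: "t * \<epsilon> \<noteq> 0"
  shows "smear e \<epsilon> t (\<lambda>y. f y + g y) x = smear e \<epsilon> t f x + smear e \<epsilon> t g x"
proof -
  have "smear e \<epsilon> t (\<lambda>y. f y + g y) x = (LINT z|lborel. mollifier z *\<^sub>R f (x - t *\<^sub>R (e + \<epsilon> *\<^sub>R z)) +
      mollifier z *\<^sub>R g (x - t *\<^sub>R (e + \<epsilon> *\<^sub>R z)))"
    unfolding smear_def by (intro Bochner_Integration.integral_cong refl scaleR_add_right)
  also have "\<dots> = smear e \<epsilon> t f x + smear e \<epsilon> t g x"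
    unfolding smear_def
    by (rule Bochner_Integration.integral_add[OF smear_integrable_at(2)[OF f t] smear_integrable_at(2)[OF g t]])
  finally show ?thesis .
qed

lemma smear_bounded:
  fixes f :: "real^'n \<Rightarrow> 'b::{banach, second_countable_topology}"
  assumes f: "integrable lborel f" "\<And>x. norm (f x) \<le> B" and t: "t * \<epsilon> \<noteq> 0"
  shows "norm (smear e \<epsilon> t f x) \<le> B"
proof -
  have "norm (smear e \<epsilon> t f x) \<le> (LINT z|lborel. norm (mollifier z *\<^sub>R f (x - t *\<^sub>R (e + \<epsilon> *\<^sub>R z))))"
    unfolding smear_def by (rule integral_norm_bound)
  also have "\<dots> \<le> (LINT z|lborel. mollifier (z::real^'n) * B)"
  proof (rule integral_mono)
    show "integrable lborel (\<lambda>z. norm (mollifier z *\<^sub>R f (x - t *\<^sub>R (e + \<epsilon> *\<^sub>R z))))"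
      using smear_integrable_at(2)[OF f(1) t] by (rule integrable_norm)
    show "integrable lborel (\<lambda>z. mollifier (z::real^'n) * B)" by (rule integrable_mult_left[OF mollifier(4)])
    show "norm (mollifier z *\<^sub>R f (x - t *\<^sub>R (e + \<epsilon> *\<^sub>R z))) \<le> mollifier z * B" for z
      unfolding norm_scaleR using f(2) mollifier(3)[of z] by (simp add: mult_left_mono)
  qed
  also have "\<dots> = B" by (simp add: mollifier(5))
  finally show ?thesis .
qed

lemma block_part_linear: "bounded_linear (block_part b j :: real^'n \<Rightarrow> real^'n)"
  unfolding linear_conv_bounded_linear[symmetric]
  by (rule linearI) (auto simp: block_part_def vec_eq_iff)

lemma block_part_norm: "norm (block_part b j \<xi>) \<le> norm (\<xi> :: real^'n)"
  by (rule norm_le_componentwise_cart) (simp add: block_part_def)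

lemma block_part_scaleR: "block_part b j (c *\<^sub>R \<xi>) = c *\<^sub>R block_part b j (\<xi> :: real^'n)"
  by (simp add: block_part_def vec_eq_iff)

context N_function
begin

text \<open>Everything in the average at \<open>x\<close> comes from the ball of radius \<open>3 t\<close>, since the shifts have length
  at most \<open>2 t\<close>. The comparison on this ball applies to the mean because of its size, and to the values in the average
  after truncation. Each factor of the decomposition contributes one unit to the constant.\<close>

lemma smear_modular:
  fixes w :: "real^'n \<Rightarrow> real" and e :: "real^'n"
  assumes us: "ball_condition \<gamma> K b \<kappa> C" and gw: "global_wgrad w G" and off: "\<And>x. x \<notin> \<Omega> \<Longrightarrow> G x = 0"
    and psi: "C1b \<psi> D" "\<And>x. 0 \<le> \<psi> x \<and> \<psi> x \<le> 1" and e: "norm e \<le> 1" and eps: "0 < \<epsilon>" "\<epsilon> \<le> 1"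
    and \<gamma>: "0 \<le> \<gamma>" "\<gamma> \<le> 1" and A: "0 \<le> A" "\<And>x y. \<bar>w x - w y\<bar> \<le> A * norm (x - y) powr \<gamma>"
    and H: "integrable lborel (\<lambda>y. if y \<in> \<Omega> then M y (C *\<^sub>R G y) else 0)"
  shows "\<exists>c>0. \<forall>t x. 0 < t \<and> t \<le> 1 / 3 \<and> x \<in> \<Omega> \<longrightarrow>
     M x (c *\<^sub>R smear e \<epsilon> t (\<lambda>y. \<psi> y *\<^sub>R G y) x) \<le>
       smear e \<epsilon> t (\<lambda>y. if y \<in> \<Omega> then M y (C *\<^sub>R G y) else 0) x + real K"
proof -
  obtain \<Lambda> where L: "0 < \<Lambda>" "\<And>t x. 0 < t \<Longrightarrow> t \<le> 1 \<Longrightarrow> norm (smear e \<epsilon> t (\<lambda>y. \<psi> y *\<^sub>R G y) x) \<le> \<Lambda> * t powr (\<gamma> - 1)"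
    using smear_gradient_bound[OF gw psi(1) e eps \<gamma> A] by blast
  have kC: "0 < \<kappa>" "1 < C" using us by (auto simp: ball_condition_def)
  have decomp: "M x \<xi> = (\<Sum>j<K. M x (block_part b j \<xi>))" if "x \<in> \<Omega>" for x \<xi> using us that unfolding ball_condition_def by blast
  \<comment> \<open>The factor \<open>3\<close> compensates the passage from \<open>t\<close> to the radius \<open>3 t\<close>, since
    \<open>3 powr (\<gamma> - 1)\<close> is at least \<open>1 / 3\<close>.\<close>
  define c where "c = \<kappa> / (3 * \<Lambda>)"
  have c0: "0 < c" using kC L by (simp add: c_def)
  have iG: "integrable lborel G" using gw by (simp add: global_wgrad_def)
  note [measurable] = C1b_borel[OF psi(1)]
  have Gb [measurable]: "G \<in> borel_measurable borel" using iG by auto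
  have ipG: "integrable lborel (\<lambda>y. \<psi> y *\<^sub>R G y)"
    by (rule integrable_bounded_scaleR[OF iG, of _ 1]) (use psi(2) in auto)
  let ?H = "\<lambda>y. if y \<in> \<Omega> then M y (C *\<^sub>R G y) else 0"
  show ?thesis
  proof (intro exI[of _ "min c (1 / 2)"] conjI allI impI)
    show "0 < min c (1 / 2)" using c0 by simp
    fix t :: real and x assume tx: "0 < t \<and> t \<le> 1 / 3 \<and> x \<in> \<Omega>"
    then have t: "0 < t" "t \<le> 1 / 3" and x: "x \<in> \<Omega>" by auto
    have te: "t * \<epsilon> \<noteq> 0" using t eps by simp
    define Y where "Y z = x - t *\<^sub>R (e + \<epsilon> *\<^sub>R z)" for z
    have [measurable]: "Y \<in> borel_measurable borel" unfolding Y_def by measurable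
    define v where "v = smear e \<epsilon> t (\<lambda>y. \<psi> y *\<^sub>R G y) x"
    have near: "Y z \<in> ball x (3 * t)" if "mollifier z \<noteq> 0" for z
    proof -
      have z: "norm z < 1" using mollifier(2)[of z] that by (auto simp: not_le[symmetric])
      have "norm (e + \<epsilon> *\<^sub>R z) \<le> norm e + \<bar>\<epsilon>\<bar> * norm z" by (metis norm_scaleR norm_triangle_ineq)
      also have "\<dots> \<le> 1 + 1 * 1" using e eps z by (intro add_mono mult_mono) auto
      finally have "t * norm (e + \<epsilon> *\<^sub>R z) \<le> t * 2" using t by (intro mult_left_mono) auto
      then show ?thesis using t by (simp add: Y_def dist_norm)
    qed
    define q where "q j y = (if y \<in> \<Omega> then M y (C *\<^sub>R block_part b j (G y)) else 0)" for j y
    have q0: "0 \<le> q j y" for j y by (simp add: q_def nonneg)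
    have qH: "(\<Sum>j<K. q j y) = ?H y" for y
      using decomp[of y "C *\<^sub>R G y"] by (simp add: q_def block_part_scaleR)
    have qm [measurable]: "q j \<in> borel_measurable borel" for j
    proof -
      have "(\<lambda>y. block_part b j (G y)) \<in> borel_measurable borel"
        using measurable_compose[OF Gb borel_measurable_continuous_onI[OF linear_continuous_on[OF block_part_linear]]] .
      then have "(\<lambda>y. C *\<^sub>R block_part b j (G y)) \<in> borel_measurable borel" by measurable
      from measurable_ext[OF this] show ?thesis unfolding q_def[abs_def] .
    qed
    have iq: "integrable lborel (q j)" if "j < K" for j
    proof (rule Bochner_Integration.integrable_bound[OF H])
      have "q j y \<le> ?H y" for y unfolding qH[symmetric] using that q0 by (intro member_le_sum) auto
      then have "norm (q j y) \<le> norm (?H y)" for y using q0[of j y] by (metis abs_of_nonneg order_trans real_norm_def)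
      then show "AE y in lborel. norm (q j y) \<le> norm (?H y)" by simp
    qed measurable
    have blk: "M x (min c (1 / 2) *\<^sub>R block_part b j v) \<le> (LINT z|lborel. mollifier z * q j (Y z)) + 1" if j: "j < K" for j
    proof -
      have r: "0 < 3 * t" "3 * t \<le> 1" using t by auto
      from us x r j obtain k where k: "0 < k"
        "\<And>\<xi>. \<xi> \<in> block_space b j \<Longrightarrow> norm \<xi> \<le> \<kappa> * (3 * t) powr (\<gamma> - 1) \<Longrightarrow> M x \<xi> \<le> k + 1"
        "\<And>y \<xi>. y \<in> \<Omega> \<Longrightarrow> y \<in> ball x (3 * t) \<Longrightarrow> \<xi> \<in> block_space b j \<Longrightarrow> M y (C *\<^sub>R \<xi>) \<le> k \<Longrightarrow> M x \<xi> \<le> M y (C *\<^sub>R \<xi>) + 1"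
        unfolding ball_condition_def by (metis IntI)
      let ?g = "\<lambda>z. block_part b j (\<psi> (Y z) *\<^sub>R G (Y z))"
      have i0: "integrable lborel (\<lambda>z. mollifier z *\<^sub>R (\<psi> (Y z) *\<^sub>R G (Y z)))"
        using smear_integrable_at(2)[OF ipG te, of x e] by (simp add: Y_def)
      have ig: "integrable lborel (\<lambda>z. mollifier z *\<^sub>R ?g z)"
        using integrable_bounded_linear[OF block_part_linear[of b j] i0] by (simp add: block_part_scaleR)
      have Ig: "(LINT z|lborel. mollifier z *\<^sub>R ?g z) = block_part b j v"
        using integral_bounded_linear[OF block_part_linear[of b j] i0]
        by (simp add: block_part_scaleR v_def smear_def Y_def)
      have "M x (min c (1 / 2) *\<^sub>R (LINT z|lborel. mollifier z *\<^sub>R ?g z)) \<le> (LINT z|lborel. mollifier z * q j (Y z)) + 1"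
      proof (rule truncated_jensen[OF convex[OF x] zero[OF x] nonneg[OF x] mollifier(3) mollifier(4) mollifier(5) ig _ _ _ k(1)])
        show "0 \<le> q j (Y z)" for z by (rule q0)
        show "integrable lborel (\<lambda>z. mollifier z * q j (Y z))"
          using smear_integrable_at(2)[OF iq[OF j] te, of x e] by (simp add: Y_def)
        show "(\<lambda>z. q j (Y z)) \<in> borel_measurable lborel" by measurable
        show "0 < c" by (rule c0)
        show "M x (c *\<^sub>R (LINT z|lborel. mollifier z *\<^sub>R ?g z)) \<le> k + 1"
        proof (rule k(2))
          show "c *\<^sub>R (LINT z|lborel. mollifier z *\<^sub>R ?g z) \<in> block_space b j"
            unfolding Ig by (intro block_space_scaleR block_part_space)
          have "norm (block_part b j v) \<le> \<Lambda> * t powr (\<gamma> - 1)"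
            using block_part_norm[of b j v] L(2)[of t x] t by (simp add: v_def)
          then have "c * norm (block_part b j v) \<le> c * (\<Lambda> * t powr (\<gamma> - 1))" using c0 by (intro mult_left_mono) auto
          also have "\<dots> = \<kappa> * (3 powr (- 1) * t powr (\<gamma> - 1))" using L(1) by (simp add: c_def powr_minus_divide)
          also have "\<dots> \<le> \<kappa> * (3 powr (\<gamma> - 1) * t powr (\<gamma> - 1))"
            using kC \<gamma> by (intro mult_left_mono mult_right_mono powr_mono) auto
          also have "\<dots> = \<kappa> * (3 * t) powr (\<gamma> - 1)" using t by (simp add: powr_mult)
          finally show "norm (c *\<^sub>R (LINT z|lborel. mollifier z *\<^sub>R ?g z)) \<le> \<kappa> * (3 * t) powr (\<gamma> - 1)"
            unfolding Ig using c0 by simp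
        qed
        fix z s assume mz: "mollifier z \<noteq> 0" and s: "0 < s" "s \<le> 1" and le: "s * q j (Y z) \<le> k"
        show "M x (s *\<^sub>R ?g z) \<le> s * q j (Y z) + 1"
        \<comment> \<open>The average may reach beyond \<open>\<Omega>\<close>, where \<open>M\<close> means nothing; there \<open>G\<close> vanishes.\<close>
        proof (cases "Y z \<in> \<Omega>")
          case False
          then have "G (Y z) = 0" "q j (Y z) = 0" using off by (auto simp: q_def)
          then have "s *\<^sub>R ?g z = 0" by (simp add: block_part_def vec_eq_iff)
          then have "M x (s *\<^sub>R ?g z) = M x 0" by (rule arg_cong)
          moreover have "0 \<le> s * q j (Y z)" using s q0 by simp
          ultimately show ?thesis using zero[OF x] by linarith
        next
          case True
          define \<xi> where "\<xi> = s *\<^sub>R ?g z"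
          have xi: "\<xi> \<in> block_space b j" unfolding \<xi>_def by (intro block_space_scaleR block_part_space)
          have p: "0 \<le> \<psi> (Y z)" "\<psi> (Y z) \<le> 1" using psi(2) by auto
          have sp: "0 \<le> s * \<psi> (Y z)" "s * \<psi> (Y z) \<le> 1" using s p by (auto intro: mult_le_one)
          have eq: "C *\<^sub>R \<xi> = (s * \<psi> (Y z)) *\<^sub>R (C *\<^sub>R block_part b j (G (Y z)))"
            by (simp add: \<xi>_def block_part_scaleR)
          have qe: "q j (Y z) = M (Y z) (C *\<^sub>R block_part b j (G (Y z)))" using True by (simp add: q_def)
          have "M (Y z) (C *\<^sub>R \<xi>) \<le> (s * \<psi> (Y z)) * q j (Y z)"
            unfolding eq qe by (rule ray[OF True sp])
          also have "\<dots> \<le> (s * 1) * q j (Y z)" using s p q0 by (intro mult_right_mono mult_left_mono) auto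
          finally have a: "M (Y z) (C *\<^sub>R \<xi>) \<le> s * q j (Y z)" by simp
          then have "M x \<xi> \<le> M (Y z) (C *\<^sub>R \<xi>) + 1" using k(3)[OF True near[OF mz] xi] le by linarith
          then show ?thesis using a by (simp add: \<xi>_def)
        qed
      qed
      then show ?thesis by (simp only: Ig)
    qed
    have "M x (min c (1 / 2) *\<^sub>R v) = (\<Sum>j<K. M x (min c (1 / 2) *\<^sub>R block_part b j v))"
      using decomp[OF x, of "min c (1 / 2) *\<^sub>R v"] by (simp add: block_part_scaleR)
    also have "\<dots> \<le> (\<Sum>j<K. (LINT z|lborel. mollifier z * q j (Y z)) + 1)" using blk by (intro sum_mono) auto
    also have "\<dots> = (\<Sum>j<K. (LINT z|lborel. mollifier z * q j (Y z))) + real K" by (simp add: sum.distrib)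
    also have "(\<Sum>j<K. (LINT z|lborel. mollifier z * q j (Y z))) = (LINT z|lborel. (\<Sum>j<K. mollifier z * q j (Y z)))"
      using smear_integrable_at(2)[OF iq te, of _ x e]
      by (intro Bochner_Integration.integral_sum[symmetric]) (simp add: Y_def)
    also have "\<dots> = smear e \<epsilon> t ?H x"
      unfolding smear_def sum_distrib_left[symmetric] qH Y_def by simp
    finally show "M x (min c (1 / 2) *\<^sub>R smear e \<epsilon> t (\<lambda>y. \<psi> y *\<^sub>R G y) x) \<le> smear e \<epsilon> t ?H x + real K"
      by (simp add: v_def)
  qed
qed

lemma convex_average:
  assumes x: "x \<in> \<Omega>" and I: "finite I" "I \<noteq> {}"
  shows "M x ((1 / (2 * real (card I))) *\<^sub>R (\<Sum>p\<in>I. u p + v p)) \<le> (\<Sum>p\<in>I. M x (u p) + M x (v p))"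
proof -
  have n: "0 < real (card I)" using I by (simp add: card_gt_0_iff)
  have "(1 / (2 * real (card I))) *\<^sub>R (\<Sum>p\<in>I. u p + v p) = (\<Sum>p\<in>I. (1 / real (card I)) *\<^sub>R ((1 / 2) *\<^sub>R (u p + v p)))"
    by (simp add: scaleR_sum_right mult.commute)
  then have "M x ((1 / (2 * real (card I))) *\<^sub>R (\<Sum>p\<in>I. u p + v p)) \<le> (\<Sum>p\<in>I. (1 / real (card I)) * M x ((1 / 2) *\<^sub>R (u p + v p)))"
    using convex_on_sum[OF I convex[OF x], of "\<lambda>_. 1 / real (card I)" "\<lambda>p. (1 / 2) *\<^sub>R (u p + v p)"] n by simp
  also have "\<dots> \<le> (\<Sum>p\<in>I. M x (u p) + M x (v p))"
  proof (rule sum_mono)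
    fix p
    have "M x ((1 / 2) *\<^sub>R (u p + v p)) \<le> (1 / 2) * M x (u p) + (1 / 2) * M x (v p)"
      using convex_onD[OF convex[OF x], of "1 / 2" "u p" "v p"] by (simp add: scaleR_add_right)
    also have "\<dots> \<le> M x (u p) + M x (v p)" using nonneg[OF x, of "u p"] nonneg[OF x, of "v p"] by simp
    finally have *: "M x ((1 / 2) *\<^sub>R (u p + v p)) \<le> M x (u p) + M x (v p)" .
    have "(1 / real (card I)) * M x ((1 / 2) *\<^sub>R (u p + v p)) \<le> 1 * M x ((1 / 2) *\<^sub>R (u p + v p))"
      using n nonneg[OF x] by (intro mult_right_mono) (auto simp: card_gt_0_iff Suc_leI)
    then show "(1 / real (card I)) * M x ((1 / 2) *\<^sub>R (u p + v p)) \<le> M x (u p) + M x (v p)" using * by simp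
  qed
  finally show ?thesis .
qed

text \<open>The pieces \<open>\<psi> p * w\<close> are smeared separately, each in its own direction \<open>e p\<close>. The gradient of the sum
  is the sum of the smeared \<open>\<psi> p *\<^sub>R G\<close>, handled by \<open>smear_modular\<close>, and of the smeared \<open>w *\<^sub>R D p\<close>, which are
  bounded and cancel in the limit since the \<open>D p\<close> add up to zero.\<close>

lemma smooth_approximation:
  fixes w :: "real^'n \<Rightarrow> real"
  assumes \<Omega>: "bounded_lipschitz_domain \<Omega>" and us: "ball_condition \<gamma> K b \<kappa> C" and \<gamma>: "0 \<le> \<gamma>" "\<gamma> \<le> 1"
    and gw: "global_wgrad w G" and off: "\<And>x. x \<notin> \<Omega> \<Longrightarrow> w x = 0 \<and> G x = 0"
    and A: "0 \<le> A" "\<And>x y. \<bar>w x - w y\<bar> \<le> A * norm (x - y) powr \<gamma>"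
    and W: "\<And>x. \<bar>w x\<bar> \<le> W"
    and H: "integrable lborel (\<lambda>y. if y \<in> \<Omega> then M y (C *\<^sub>R G y) else 0)"
  obtains \<Phi> h h' c B where "\<And>m. \<Phi> m \<in> Cc_infinity \<Omega>" "0 < c"
    "(\<lambda>m. LINT x|lborel. norm (\<Phi> m x - w x)) \<longlonglongrightarrow> 0"
    "(\<lambda>m. LINT x|lborel. norm (grad (\<Phi> m) x - G x)) \<longlonglongrightarrow> 0"
    "\<And>m x. x \<in> \<Omega> \<Longrightarrow> M x (c *\<^sub>R grad (\<Phi> m) x) \<le> h m x + B"
    "\<And>m. integrable lborel (h m)" "integrable lborel h'"
    "(\<lambda>m. LINT x|lborel. norm (h m x - h' x)) \<longlonglongrightarrow> 0"
proof -
  obtain I R e \<epsilon>' t0 where cov: "finite I" "0 < \<epsilon>'" "\<epsilon>' \<le> 1" "0 < t0" "\<And>p. p \<in> I \<Longrightarrow> pushes \<Omega> p (R p) (e p) \<epsilon>' t0"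
    "\<Omega> \<subseteq> (\<Union>p\<in>I. ball p (R p / 2))" by (rule lipschitz_cover[OF \<Omega>], rule that)
  define \<epsilon> where "\<epsilon> = \<epsilon>' / 2"
  have eps: "0 < \<epsilon>" "\<epsilon> \<le> 1" using cov by (auto simp: \<epsilon>_def)
  have bd: "bounded \<Omega>" "\<Omega> \<noteq> {}" using \<Omega> by (auto simp: bounded_lipschitz_domain_def)
  have I0: "I \<noteq> {}" using cov(6) bd(2) by auto
  have e: "norm (e p) \<le> 1" and R: "0 < R p" if "p \<in> I" for p using cov(5)[OF that] by (auto simp: pushes_def)
  obtain \<psi> D where psi: "\<And>p. p \<in> I \<Longrightarrow> C1b (\<psi> p) (D p)" "\<And>p x. p \<in> I \<Longrightarrow> 0 \<le> \<psi> p x \<and> \<psi> p x \<le> 1"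
    "\<And>p x. p \<in> I \<Longrightarrow> x \<notin> ball p (R p) \<Longrightarrow> \<psi> p x = 0"
    "\<And>x. x \<in> (\<Union>p\<in>I. ball p (R p / 2)) \<Longrightarrow> (\<Sum>p\<in>I. \<psi> p x) = 1"
    by (rule partition_of_unity[OF cov(1) R], assumption, rule that)
  have one: "(\<Sum>p\<in>I. \<psi> p x) = 1" if "x \<in> \<Omega>" for x using psi(4) cov(6) that by blast
  have dsum: "(\<Sum>p\<in>I. D p x) = 0" if x: "x \<in> \<Omega>" for x
  proof -
    have "((\<lambda>x. \<Sum>p\<in>I. \<psi> p x) has_derivative (\<lambda>h. \<Sum>p\<in>I. h \<bullet> D p x)) (at x)"
      using GDERIV_D[OF C1b_GDERIV[OF psi(1)]] by (intro has_derivative_sum)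
    then have "((\<lambda>x. 1) has_derivative (\<lambda>h. h \<bullet> (\<Sum>p\<in>I. D p x))) (at x)"
      unfolding inner_sum_right[symmetric]
      by (rule has_derivative_transform_within_open[OF _ op x]) (simp add: one)
    then have "(\<lambda>h. h \<bullet> (\<Sum>p\<in>I. D p x)) = (\<lambda>h. 0)" using has_derivative_unique has_derivative_const by blast
    then have "(\<Sum>p\<in>I. D p x) \<bullet> (\<Sum>p\<in>I. D p x) = 0" by metis
    then show ?thesis by simp
  qed
  have iw: "integrable lborel w" and iG: "integrable lborel G" using gw by (auto simp: global_wgrad_def)
  have bnd: "\<exists>B\<ge>0. \<forall>x. \<bar>\<psi> p x\<bar> \<le> B \<and> norm (D p x) \<le> B" if "p \<in> I" for p
    using C1b_bound[OF psi(1)[OF that]] by metis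
  have int: "integrable lborel (\<lambda>y. \<psi> p y * w y)" "integrable lborel (\<lambda>y. \<psi> p y *\<^sub>R G y)" "integrable lborel (\<lambda>y. w y *\<^sub>R D p y)"
    if p: "p \<in> I" for p
  proof -
    obtain B where B: "\<And>x. \<bar>\<psi> p x\<bar> \<le> B" "\<And>x. norm (D p x) \<le> B" using bnd[OF p] by blast
    note m = C1b_borel[OF psi(1)[OF p]]
    show "integrable lborel (\<lambda>y. \<psi> p y * w y)" using integrable_bounded_scaleR[OF iw _ B(1)] m by simp
    show "integrable lborel (\<lambda>y. \<psi> p y *\<^sub>R G y)" using integrable_bounded_scaleR[OF iG _ B(1)] m by simp
    show "integrable lborel (\<lambda>y. w y *\<^sub>R D p y)" using integrable_scaleR_bounded[OF iw _ B(2)] m by simp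
  qed
  define t where "t m = min t0 (1 / 3) * inverse (real (Suc m))" for m
  have t0': "0 < min t0 (1 / 3)" using cov by simp
  have tpos: "0 < t m" for m using t0' by (simp add: t_def del: of_nat_Suc)
  have tle: "t m \<le> min t0 (1 / 3)" for m
    unfolding t_def using t0' by (intro mult_left_le) (auto simp: field_simps)
  have tlim: "t \<longlonglongrightarrow> 0"
    unfolding t_def using tendsto_mult_right_zero[OF LIMSEQ_inverse_real_of_nat] by simp
  have te: "t m * \<epsilon> \<noteq> 0" for m using tpos[of m] eps by simp
  define s where "s p m x = smear (e p) \<epsilon> (t m) (\<lambda>y. \<psi> p y * w y) x" for p m x
  define \<Phi> where "\<Phi> m x = (\<Sum>p\<in>I. s p m x)" for m x
  let ?H = "\<lambda>y. if y \<in> \<Omega> then M y (C *\<^sub>R G y) else 0"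
  define u where "u p m x = smear (e p) \<epsilon> (t m) (\<lambda>y. \<psi> p y *\<^sub>R G y) x" for p m x
  define v where "v p m x = smear (e p) \<epsilon> (t m) (\<lambda>y. w y *\<^sub>R D p y) x" for p m x
  define h where "h m x = (\<Sum>p\<in>I. smear (e p) \<epsilon> (t m) ?H x)" for m x
  have Phi_Cc: "\<Phi> m \<in> Cc_infinity \<Omega>" for m
    unfolding \<Phi>_def s_def \<epsilon>_def
  proof (rule Cc_infinity_sum[OF cov(1)])
    fix p assume p: "p \<in> I"
    show "smear (e p) (\<epsilon>' / 2) (t m) (\<lambda>y. \<psi> p y * w y) \<in> Cc_infinity \<Omega>"
      using tle[of m] off psi(3)[OF p]
      by (intro smear_pushed_in[OF bd(1) cov(5)[OF p] cov(2,3) tpos _ gw psi(1)[OF p]]) auto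
  qed
  have uv: "smear (e p) \<epsilon> (t m) (\<lambda>y. \<psi> p y *\<^sub>R G y + w y *\<^sub>R D p y) x = u p m x + v p m x" if p: "p \<in> I" for p m x
    unfolding u_def v_def by (rule smear_add[OF int(2)[OF p] int(3)[OF p] te])
  have grad_Phi: "grad (\<Phi> m) x = (\<Sum>p\<in>I. smear (e p) \<epsilon> (t m) (\<lambda>y. \<psi> p y *\<^sub>R G y + w y *\<^sub>R D p y) x)" for m x
  proof (rule GDERIV_imp_grad)
    have "((\<lambda>x. \<Sum>p\<in>I. s p m x) has_derivative (\<lambda>h. \<Sum>p\<in>I. h \<bullet> smear (e p) \<epsilon> (t m) (\<lambda>y. \<psi> p y *\<^sub>R G y + w y *\<^sub>R D p y) x)) (at x)"
      unfolding s_def using smear_GDERIV(1)[OF gw psi(1) e eps tpos]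
      by (intro has_derivative_sum GDERIV_D) auto
    then show "GDERIV (\<Phi> m) x :> (\<Sum>p\<in>I. smear (e p) \<epsilon> (t m) (\<lambda>y. \<psi> p y *\<^sub>R G y + w y *\<^sub>R D p y) x)"
      unfolding gderiv_def \<Phi>_def inner_sum_right .
  qed
  have wsum: "(\<Sum>p\<in>I. \<psi> p x * w x) = w x" for x
    using one[of x] off[of x] by (cases "x \<in> \<Omega>") (simp_all add: sum_distrib_right[symmetric])
  have Gsum: "(\<Sum>p\<in>I. \<psi> p x *\<^sub>R G x + w x *\<^sub>R D p x) = G x" for x
    using one[of x] off[of x] dsum[of x]
    by (cases "x \<in> \<Omega>") (simp_all add: sum.distrib scaleR_sum_left[symmetric] scaleR_sum_right[symmetric])
  have Lw: "(\<lambda>m. LINT x|lborel. norm (\<Phi> m x - w x)) \<longlonglongrightarrow> 0"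
  proof -
    have "(\<lambda>m. LINT x|lborel. norm ((\<Sum>p\<in>I. s p m x) - (\<Sum>p\<in>I. \<psi> p x * w x))) \<longlonglongrightarrow> 0"
      unfolding s_def using smear_L1[OF int(1) e eps tpos tlim] int(1) by (intro L1_sum_tendsto[OF cov(1)]) auto
    then show ?thesis by (simp only: wsum \<Phi>_def)
  qed
  have int2: "integrable lborel (\<lambda>y. \<psi> p y *\<^sub>R G y + w y *\<^sub>R D p y)" if "p \<in> I" for p using int(2,3)[OF that] by (rule Bochner_Integration.integrable_add)
  have LG: "(\<lambda>m. LINT x|lborel. norm (grad (\<Phi> m) x - G x)) \<longlonglongrightarrow> 0"
  proof -
    have "(\<lambda>m. LINT x|lborel. norm ((\<Sum>p\<in>I. smear (e p) \<epsilon> (t m) (\<lambda>y. \<psi> p y *\<^sub>R G y + w y *\<^sub>R D p y) x) -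
        (\<Sum>p\<in>I. \<psi> p x *\<^sub>R G x + w x *\<^sub>R D p x))) \<longlonglongrightarrow> 0"
      using smear_L1[OF int2 e eps tpos tlim] int2 by (intro L1_sum_tendsto[OF cov(1)]) auto
    then show ?thesis by (simp only: Gsum grad_Phi)
  qed
  have ih: "integrable lborel (h m)" for m
    unfolding h_def using smear_L1(1)[OF H e eps tpos tlim] by (intro Bochner_Integration.integrable_sum) auto
  have Lh: "(\<lambda>m. LINT x|lborel. norm (h m x - (\<Sum>p\<in>I. ?H x))) \<longlonglongrightarrow> 0"
    unfolding h_def using smear_L1[OF H e eps tpos tlim] H by (intro L1_sum_tendsto[OF cov(1)]) auto
  define Q where "Q p c \<longleftrightarrow> 0 < c \<and> (\<forall>t x. 0 < t \<and> t \<le> 1 / 3 \<and> x \<in> \<Omega> \<longrightarrow>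
     M x (c *\<^sub>R smear (e p) \<epsilon> t (\<lambda>y. \<psi> p y *\<^sub>R G y) x) \<le> smear (e p) \<epsilon> t ?H x + real K)" for p and c :: real
  have "\<exists>c. Q p c" if "p \<in> I" for p
    unfolding Q_def using smear_modular[OF us gw conjunct2[OF off] psi(1,2)[OF that] e[OF that] eps \<gamma> A H] .
  then have "\<forall>p\<in>I. \<exists>c. Q p c" by blast
  then obtain cc where Q: "\<forall>p\<in>I. Q p (cc p)" by (rule bchoice[THEN exE])
  have cc: "0 < cc p" "\<And>t x. 0 < t \<Longrightarrow> t \<le> 1 / 3 \<Longrightarrow> x \<in> \<Omega> \<Longrightarrow>
     M x (cc p *\<^sub>R smear (e p) \<epsilon> t (\<lambda>y. \<psi> p y *\<^sub>R G y) x) \<le> smear (e p) \<epsilon> t ?H x + real K"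
    if "p \<in> I" for p
    using bspec[OF Q that] unfolding Q_def by auto
  \<comment> \<open>At most \<open>1\<close>, so that the bounded terms may be shortened by it as well.\<close>
  define c1 where "c1 = Min (insert 1 (cc ` I))"
  have c1: "0 < c1" "c1 \<le> 1" "\<And>p. p \<in> I \<Longrightarrow> c1 \<le> cc p" unfolding c1_def using cov(1) cc(1) by (auto intro: Min_le simp: Min_gr_iff)
  have "\<exists>B. \<forall>p\<in>I. \<forall>m x. norm (v p m x) \<le> B"
  proof -
    have "\<forall>p\<in>I. \<exists>B. \<forall>m x. norm (v p m x) \<le> B"
    proof
      fix p assume p: "p \<in> I"
      obtain B where B: "0 \<le> B" "\<And>x. norm (D p x) \<le> B" using bnd[OF p] by blast
      have "norm (w x *\<^sub>R D p x) \<le> W * B" for x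
        unfolding norm_scaleR real_norm_def using W[of x] B by (intro mult_mono) auto
      then have "norm (v p m x) \<le> W * B" for m x unfolding v_def by (intro smear_bounded[OF int(3)[OF p] _ te])
      then show "\<exists>B. \<forall>m x. norm (v p m x) \<le> B" by blast
    qed
    then obtain B where B: "\<And>p m x. p \<in> I \<Longrightarrow> norm (v p m x) \<le> B p" by metis
    have "norm (v p m x) \<le> Max (B ` I)" if "p \<in> I" for p m x
    proof -
      have "B p \<le> Max (B ` I)" using cov(1) that by (intro Max_ge) auto
      with B[OF that] show ?thesis by (rule order_trans)
    qed
    then show ?thesis by blast
  qed
  then obtain B where B: "\<And>p m x. p \<in> I \<Longrightarrow> norm (v p m x) \<le> B" by blast
  obtain B' where B': "\<And>x \<xi>. x \<in> \<Omega> \<Longrightarrow> norm \<xi> \<le> B \<Longrightarrow> M x \<xi> \<le> B'" using bounded_above by blast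
  define c where "c = c1 / (2 * real (card I))"
  have mod: "M x (c *\<^sub>R grad (\<Phi> m) x) \<le> h m x + real (card I) * (real K + B')" if x: "x \<in> \<Omega>" for m x
  proof -
    have eq: "c *\<^sub>R grad (\<Phi> m) x = (1 / (2 * real (card I))) *\<^sub>R (\<Sum>p\<in>I. c1 *\<^sub>R u p m x + c1 *\<^sub>R v p m x)"
      unfolding c_def grad_Phi using uv by (simp add: scaleR_add_right[symmetric] scaleR_sum_right[symmetric])
    have "M x (c *\<^sub>R grad (\<Phi> m) x) \<le> (\<Sum>p\<in>I. M x (c1 *\<^sub>R u p m x) + M x (c1 *\<^sub>R v p m x))"
      unfolding eq by (rule convex_average[OF x cov(1) I0])
    also have "\<dots> \<le> (\<Sum>p\<in>I. smear (e p) \<epsilon> (t m) ?H x + (real K + B'))"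
    proof (rule sum_mono)
      fix p assume p: "p \<in> I"
      have "M x (c1 *\<^sub>R u p m x) \<le> M x (cc p *\<^sub>R u p m x)" using c1 p by (intro shrink_le[OF x]) auto
      also have "\<dots> \<le> smear (e p) \<epsilon> (t m) ?H x + real K"
        unfolding u_def using tle[of m] by (intro cc(2)[OF p tpos _ x]) simp
      finally have 1: "M x (c1 *\<^sub>R u p m x) \<le> smear (e p) \<epsilon> (t m) ?H x + real K" .
      have "M x (c1 *\<^sub>R v p m x) \<le> M x (v p m x)" using c1 by (intro shrink[OF x]) auto
      also have "\<dots> \<le> B'" by (rule B'[OF x B[OF p]])
      finally show "M x (c1 *\<^sub>R u p m x) + M x (c1 *\<^sub>R v p m x) \<le> smear (e p) \<epsilon> (t m) ?H x + (real K + B')" using 1 by simp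
    qed
    also have "\<dots> = h m x + real (card I) * (real K + B')" by (simp add: h_def sum.distrib)
    finally show ?thesis .
  qed
  have c0: "0 < c" using c1 cov(1) I0 by (simp add: c_def card_gt_0_iff)
  have ih': "integrable lborel (\<lambda>x. \<Sum>p\<in>I. ?H x)" using H by (intro Bochner_Integration.integrable_sum)
  show thesis by (rule that[OF Phi_Cc c0 Lw LG mod ih ih' Lh])
qed

end

section \<open>Convergence of the functional\<close>

text \<open>Approximate \<open>g\<close> by simple functions, for which only countably many sections of \<open>f\<close> occur.\<close>

lemma caratheodory_measurable:
  fixes f :: "'a \<Rightarrow> 'b::euclidean_space \<Rightarrow> real"
  assumes f: "\<And>v. (\<lambda>x. f x v) \<in> borel_measurable N" "\<And>x. x \<in> space N \<Longrightarrow> continuous_on UNIV (f x)"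
    and g: "g \<in> borel_measurable N"
  shows "(\<lambda>x. f x (g x)) \<in> borel_measurable N"
proof -
  obtain s where s: "\<And>i::nat. simple_function N (s i)" "\<And>x. x \<in> space N \<Longrightarrow> (\<lambda>i. s i x) \<longlonglongrightarrow> g x"
    using borel_measurable_implies_sequence_metric[OF g, of 0] by blast
  have sm: "(\<lambda>x. f x (s i x)) \<in> borel_measurable N" for i
  proof (rule measurable_compose_countable'[where f="\<lambda>v x. f x v" and g="s i" and I="s i ` space N"])
    show "s i \<in> measurable N (count_space (s i ` space N))"
      using s(1)[of i] unfolding simple_function_def by (subst measurable_count_space_eq2) auto
    show "countable (s i ` space N)" using s(1)[of i] by (auto simp: simple_function_def intro: countable_finite)
  qed (rule f(1))
  show ?thesis
  proof (rule borel_measurable_LIMSEQ_metric[OF sm])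
    fix x assume x: "x \<in> space N"
    show "(\<lambda>i. f x (s i x)) \<longlonglongrightarrow> f x (g x)"
      using continuous_on_tendsto_compose[OF f(2)[OF x] s(2)[OF x]] by simp
  qed
qed

text \<open>The truncations \<open>min (f n) g'\<close> converge by dominated convergence, and \<open>f n\<close> exceeds them by at most
  \<open>\<bar>g n - g'\<bar>\<close>, whose integral tends to zero.\<close>

lemma convergence_with_L1_majorants:
  fixes f :: "nat \<Rightarrow> 'a \<Rightarrow> real"
  assumes m: "\<And>n. f n \<in> borel_measurable N" "f' \<in> borel_measurable N"
    and lim: "AE x in N. (\<lambda>n. f n x) \<longlonglongrightarrow> f' x" "AE x in N. (\<lambda>n. g n x) \<longlonglongrightarrow> g' x"
    and le: "\<And>n. AE x in N. 0 \<le> f n x \<and> f n x \<le> g n x"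
    and g: "\<And>n. integrable N (g n)" "integrable N g'" "(\<lambda>n. LINT x|N. norm (g n x - g' x)) \<longlonglongrightarrow> 0"
  shows "(\<lambda>n. \<integral>\<^sup>+x. ennreal (f n x) \<partial>N) \<longlonglongrightarrow> (\<integral>\<^sup>+x. ennreal (f' x) \<partial>N)"
proof -
  have all: "AE x in N. \<forall>n. 0 \<le> f n x \<and> f n x \<le> g n x" using le by (simp add: AE_all_countable)
  have fg: "AE x in N. 0 \<le> f' x \<and> f' x \<le> g' x"
    using all lim by eventually_elim (auto intro: LIMSEQ_le_const LIMSEQ_le)
  have int: "integrable N (f n)" for n
    using le[of n] by (intro Bochner_Integration.integrable_bound[OF g(1)[of n] m(1)]) (auto elim: eventually_mono)
  have int': "integrable N f'"
    using fg by (intro Bochner_Integration.integrable_bound[OF g(2) m(2)]) (auto elim: eventually_mono)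
  have [measurable]: "g' \<in> borel_measurable N" using g(2) by auto
  have mn: "(\<lambda>n. LINT x|N. min (f n x) (g' x)) \<longlonglongrightarrow> (LINT x|N. f' x)"
  proof (rule integral_dominated_convergence[OF m(2) _ g(2)])
    show "(\<lambda>x. min (f n x) (g' x)) \<in> borel_measurable N" for n using m(1)[of n] by measurable
    show "AE x in N. (\<lambda>n. min (f n x) (g' x)) \<longlonglongrightarrow> f' x"
      using lim(1) fg
    proof eventually_elim
      case (elim x)
      have "(\<lambda>n. min (f n x) (g' x)) \<longlonglongrightarrow> min (f' x) (g' x)" using elim by (intro tendsto_intros)
      then show ?case using elim by simp
    qed
    show "AE x in N. norm (min (f n x) (g' x)) \<le> g' x" for n using all fg by eventually_elim auto
  qed
  have "(\<lambda>n. LINT x|N. f n x) \<longlonglongrightarrow> (LINT x|N. f' x)"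
  proof (rule tendsto_sandwich[OF _ _ mn])
    have imin: "integrable N (\<lambda>x. min (f n x) (g' x))" for n using int g(2) by (rule integrable_min)
    have id: "integrable N (\<lambda>x. norm (g n x - g' x))" for n using g by auto
    show "eventually (\<lambda>n. (LINT x|N. min (f n x) (g' x)) \<le> (LINT x|N. f n x)) sequentially"
      using imin int by (intro always_eventually allI integral_mono) auto
    have "(LINT x|N. f n x) \<le> (LINT x|N. min (f n x) (g' x)) + (LINT x|N. norm (g n x - g' x))" for n
    proof -
      have "(LINT x|N. f n x) \<le> (LINT x|N. min (f n x) (g' x) + norm (g n x - g' x))"
      proof (rule integral_mono_AE[OF int])
        show "integrable N (\<lambda>x. min (f n x) (g' x) + norm (g n x - g' x))"
          using imin id by (rule Bochner_Integration.integrable_add)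
        show "AE x in N. f n x \<le> min (f n x) (g' x) + norm (g n x - g' x)"
          using le[of n] by eventually_elim auto
      qed
      also have "\<dots> = (LINT x|N. min (f n x) (g' x)) + (LINT x|N. norm (g n x - g' x))"
        by (rule Bochner_Integration.integral_add[OF imin id])
      finally show ?thesis .
    qed
    then show "eventually (\<lambda>n. (LINT x|N. f n x) \<le> (LINT x|N. min (f n x) (g' x)) + (LINT x|N. norm (g n x - g' x))) sequentially"
      by simp
    show "(\<lambda>n. (LINT x|N. min (f n x) (g' x)) + (LINT x|N. norm (g n x - g' x))) \<longlonglongrightarrow> (LINT x|N. f' x)"
      using tendsto_add[OF mn g(3)] by simp
  qed
  then have "(\<lambda>n. ennreal (LINT x|N. f n x)) \<longlonglongrightarrow> ennreal (LINT x|N. f' x)" by (rule tendsto_ennrealI)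
  moreover have "(\<integral>\<^sup>+x. ennreal (f n x) \<partial>N) = ennreal (LINT x|N. f n x)" for n
    using le[of n] by (intro nn_integral_eq_integral[OF int]) (auto elim: eventually_mono)
  moreover have "(\<integral>\<^sup>+x. ennreal (f' x) \<partial>N) = ennreal (LINT x|N. f' x)"
    using fg by (intro nn_integral_eq_integral[OF int']) (auto elim: eventually_mono)
  ultimately show ?thesis by simp
qed

lemma bounded_finite_measure:
  fixes \<Omega> :: "'a::euclidean_space set"
  assumes "open \<Omega>" "bounded \<Omega>" shows "finite_measure (lebesgue_on \<Omega>)"
proof
  have "\<Omega> \<in> lmeasurable" using assms by (simp add: lmeasurable_open)
  then show "emeasure (lebesgue_on \<Omega>) (space (lebesgue_on \<Omega>)) \<noteq> \<infinity>"
    by (auto simp: emeasure_restrict_space space_restrict_space fmeasurable_def)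
qed

locale Delta2_function = N_function \<Omega> M
  for \<Omega> :: "(real^'n) set" and M +
  assumes bd: "bounded \<Omega>" and D2: "Delta2 \<Omega> M"
begin

sublocale fin: finite_measure "lebesgue_on \<Omega>" by (rule bounded_finite_measure[OF op bd])

lemma even: "AE x in lebesgue_on \<Omega>. \<forall>\<xi>. M x (- \<xi>) = M x \<xi>"
proof -
  have "AE x in lebesgue_on \<Omega>. \<forall>\<xi>\<in>UNIV. M x \<xi> = M x (- \<xi>)"
    using weakN by (simp add: weak_N_function_def)
  then show ?thesis
  proof eventually_elim
    case (elim x)
    show ?case by (rule allI, rule sym, rule bspec[OF elim UNIV_I])
  qed
qed

lemma in_Omega: "AE x in lebesgue_on \<Omega>. x \<in> \<Omega>"
  by (rule AE_I2) (simp add: space_restrict_space)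

text \<open>The vectors of length at most the threshold of \<open>\<Delta>\<^sub>2\<close> only add a constant to the error term,
  and constants are integrable on a bounded set.\<close>

lemma Delta2_everywhere: "\<exists>c h. 0 \<le> c \<and> integrable (lebesgue_on \<Omega>) h \<and> (AE x in lebesgue_on \<Omega>. \<forall>\<xi>. M x (2 *\<^sub>R \<xi>) \<le> c * M x \<xi> + h x)"
proof -
  obtain c R h where c: "0 < c" "0 < R" and h: "\<forall>x\<in>\<Omega>. 0 \<le> h x" "integrable (lebesgue_on \<Omega>) h"
    and le: "AE x in lebesgue_on \<Omega>. \<forall>\<xi>. norm \<xi> > R \<longrightarrow> M x (2 *\<^sub>R \<xi>) \<le> c * M x \<xi> + h x"
    using D2 unfolding Delta2_def by blast
  obtain B where B: "0 \<le> B" "\<forall>x\<in>\<Omega>. \<forall>\<xi>. norm \<xi> \<le> 2 * R \<longrightarrow> M x \<xi> \<le> B" using bounded_above by blast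
  have "AE x in lebesgue_on \<Omega>. \<forall>\<xi>. M x (2 *\<^sub>R \<xi>) \<le> c * M x \<xi> + (h x + B)"
    using le in_Omega
  proof eventually_elim
    case (elim x)
    show ?case
    proof
      fix \<xi>
      have "0 \<le> c * M x \<xi>" using c nonneg[OF elim(2)] by simp
      then show "M x (2 *\<^sub>R \<xi>) \<le> c * M x \<xi> + (h x + B)"
        using elim(1)[rule_format, of \<xi>] B(1) B(2)[rule_format, OF elim(2), of "2 *\<^sub>R \<xi>"] h(1)[rule_format, OF elim(2)]
        by (cases "norm \<xi> > R") auto
    qed
  qed
  moreover have "integrable (lebesgue_on \<Omega>) (\<lambda>x. h x + B)" using h(2) by auto
  ultimately show ?thesis using c(1) by (intro exI[of _ c] exI[of _ "\<lambda>x. h x + B"]) auto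
qed

lemma Delta2_multiple:
  "\<exists>c h. 0 \<le> c \<and> integrable (lebesgue_on \<Omega>) h \<and> (AE x in lebesgue_on \<Omega>. \<forall>\<xi>. M x (a *\<^sub>R \<xi>) \<le> c * M x \<xi> + h x)"
proof -
  obtain c h where d: "0 \<le> c" "integrable (lebesgue_on \<Omega>) h" "AE x in lebesgue_on \<Omega>. \<forall>\<xi>. M x (2 *\<^sub>R \<xi>) \<le> c * M x \<xi> + h x"
    using Delta2_everywhere by blast
  have pow: "\<exists>c h. 0 \<le> c \<and> integrable (lebesgue_on \<Omega>) h \<and> (AE x in lebesgue_on \<Omega>. \<forall>\<xi>. M x (2 ^ n *\<^sub>R \<xi>) \<le> c * M x \<xi> + h x)" for n
  proof (induction n)
    case 0 show ?case by (intro exI[of _ 1] exI[of _ "\<lambda>x. 0"]) auto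
  next
    case (Suc n)
    then obtain c' h' where d': "0 \<le> c'" "integrable (lebesgue_on \<Omega>) h'" "AE x in lebesgue_on \<Omega>. \<forall>\<xi>. M x (2 ^ n *\<^sub>R \<xi>) \<le> c' * M x \<xi> + h' x"
      by blast
    have "AE x in lebesgue_on \<Omega>. \<forall>\<xi>. M x (2 ^ Suc n *\<^sub>R \<xi>) \<le> (c * c') * M x \<xi> + (c * h' x + h x)"
      using d(3) d'(3)
    proof eventually_elim
      case (elim x)
      show ?case
      proof
        fix \<xi>
        have "M x (2 ^ Suc n *\<^sub>R \<xi>) \<le> c * M x (2 ^ n *\<^sub>R \<xi>) + h x" using elim(1)[rule_format, of "2 ^ n *\<^sub>R \<xi>"] by simp
        also have "\<dots> \<le> c * (c' * M x \<xi> + h' x) + h x" using elim(2) d(1) by (intro add_right_mono mult_left_mono) auto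
        finally show "M x (2 ^ Suc n *\<^sub>R \<xi>) \<le> (c * c') * M x \<xi> + (c * h' x + h x)" by (simp add: algebra_simps)
      qed
    qed
    then show ?case using d d' by (intro exI[of _ "c * c'"] exI[of _ "\<lambda>x. c * h' x + h x"]) auto
  qed
  obtain n where n: "\<bar>a\<bar> < 2 ^ n" using real_arch_pow[of 2 "\<bar>a\<bar>"] by auto
  obtain c h where p: "0 \<le> c" "integrable (lebesgue_on \<Omega>) h" "AE x in lebesgue_on \<Omega>. \<forall>\<xi>. M x (2 ^ n *\<^sub>R \<xi>) \<le> c * M x \<xi> + h x"
    using pow by blast
  have "AE x in lebesgue_on \<Omega>. \<forall>\<xi>. M x (a *\<^sub>R \<xi>) \<le> c * M x \<xi> + h x"
    using p(3) even in_Omega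
  proof eventually_elim
    case (elim x)
    show ?case
    proof
      fix \<xi>
      have "M x (a *\<^sub>R \<xi>) = M x (\<bar>a\<bar> *\<^sub>R \<xi>)"
        using elim(2)[rule_format, of "a *\<^sub>R \<xi>"] by (cases "0 \<le> a") auto
      also have "\<dots> \<le> M x (2 ^ n *\<^sub>R \<xi>)" using n by (intro shrink_le[OF elim(3)]) auto
      finally show "M x (a *\<^sub>R \<xi>) \<le> c * M x \<xi> + h x" using elim(1)[rule_format, of \<xi>] by linarith
    qed
  qed
  then show ?thesis using p by blast
qed

lemma M_measurable:
  assumes "\<xi> \<in> borel_measurable (lebesgue_on \<Omega>)" shows "(\<lambda>x. M x (\<xi> x)) \<in> borel_measurable (lebesgue_on \<Omega>)"
proof (rule caratheodory_measurable[OF _ _ assms])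
  show "(\<lambda>x. M x v) \<in> borel_measurable (lebesgue_on \<Omega>)" for v using weakN by (simp add: weak_N_function_def)
  show "continuous_on UNIV (M x)" if "x \<in> space (lebesgue_on \<Omega>)" for x
    using weakN that by (simp add: weak_N_function_def space_restrict_space)
qed

definition modular_finite :: "(real^'n \<Rightarrow> real^'n) \<Rightarrow> bool" where
  "modular_finite \<xi> \<longleftrightarrow> \<xi> \<in> borel_measurable (lebesgue_on \<Omega>) \<and> integrable (lebesgue_on \<Omega>) (\<lambda>x. M x (\<xi> x))"

lemma modular_finite_iff:
  "modular_finite \<xi> \<longleftrightarrow> \<xi> \<in> borel_measurable (lebesgue_on \<Omega>) \<and> (\<integral>\<^sup>+x. ennreal (M x (\<xi> x)) \<partial>lebesgue_on \<Omega>) < \<infinity>"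
proof -
  have "(\<integral>\<^sup>+x. ennreal (norm (M x (\<xi> x))) \<partial>lebesgue_on \<Omega>) = (\<integral>\<^sup>+x. ennreal (M x (\<xi> x)) \<partial>lebesgue_on \<Omega>)"
    by (intro nn_integral_cong) (simp add: space_restrict_space nonneg)
  then show ?thesis unfolding modular_finite_def integrable_iff_bounded using M_measurable by auto
qed

lemma modular_finite_scaleR:
  assumes "modular_finite \<xi>" shows "modular_finite (\<lambda>x. a *\<^sub>R \<xi> x)"
proof -
  have m: "\<xi> \<in> borel_measurable (lebesgue_on \<Omega>)" and i: "integrable (lebesgue_on \<Omega>) (\<lambda>x. M x (\<xi> x))"
    using assms by (auto simp: modular_finite_def)
  obtain c h where ch: "0 \<le> c" "integrable (lebesgue_on \<Omega>) h" "AE x in lebesgue_on \<Omega>. \<forall>\<xi>. M x (a *\<^sub>R \<xi>) \<le> c * M x \<xi> + h x"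
    using Delta2_multiple by blast
  have m': "(\<lambda>x. a *\<^sub>R \<xi> x) \<in> borel_measurable (lebesgue_on \<Omega>)" using m by measurable
  have "integrable (lebesgue_on \<Omega>) (\<lambda>x. M x (a *\<^sub>R \<xi> x))"
  proof (rule Bochner_Integration.integrable_bound)
    show "integrable (lebesgue_on \<Omega>) (\<lambda>x. c * M x (\<xi> x) + h x)" using i ch(2) by auto
    show "(\<lambda>x. M x (a *\<^sub>R \<xi> x)) \<in> borel_measurable (lebesgue_on \<Omega>)" by (rule M_measurable[OF m'])
    show "AE x in lebesgue_on \<Omega>. norm (M x (a *\<^sub>R \<xi> x)) \<le> norm (c * M x (\<xi> x) + h x)"
      using ch(3) in_Omega
    proof eventually_elim
      case (elim x)
      have "M x (a *\<^sub>R \<xi> x) \<le> c * M x (\<xi> x) + h x" using elim(1) by blast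
      then show ?case using nonneg[OF elim(2), of "a *\<^sub>R \<xi> x"] by simp
    qed
  qed
  then show ?thesis using m' by (simp add: modular_finite_def)
qed

lemma half_sum: "x \<in> \<Omega> \<Longrightarrow> M x (\<xi> + \<eta>) \<le> M x (2 *\<^sub>R \<xi>) + M x (2 *\<^sub>R \<eta>)"
  using convex_onD[OF convex, of x "1 / 2" "2 *\<^sub>R \<xi>" "2 *\<^sub>R \<eta>"] nonneg[of x "2 *\<^sub>R \<xi>"] nonneg[of x "2 *\<^sub>R \<eta>"]
  by simp

lemma modular_finite_add:
  assumes "modular_finite \<xi>" "modular_finite \<eta>" shows "modular_finite (\<lambda>x. \<xi> x + \<eta> x)"
proof -
  have m: "(\<lambda>x. \<xi> x + \<eta> x) \<in> borel_measurable (lebesgue_on \<Omega>)"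
    using assms by (auto simp: modular_finite_def)
  have i: "integrable (lebesgue_on \<Omega>) (\<lambda>x. M x (2 *\<^sub>R \<xi> x) + M x (2 *\<^sub>R \<eta> x))"
    using modular_finite_scaleR[OF assms(1), of 2] modular_finite_scaleR[OF assms(2), of 2] by (auto simp: modular_finite_def)
  have "integrable (lebesgue_on \<Omega>) (\<lambda>x. M x (\<xi> x + \<eta> x))"
  proof (rule Bochner_Integration.integrable_bound[OF i M_measurable[OF m]])
    show "AE x in lebesgue_on \<Omega>. norm (M x (\<xi> x + \<eta> x)) \<le> norm (M x (2 *\<^sub>R \<xi> x) + M x (2 *\<^sub>R \<eta> x))"
      using in_Omega
    proof eventually_elim
      case (elim x)
      then show ?case using half_sum[OF elim, of "\<xi> x" "\<eta> x"] nonneg[OF elim, of "\<xi> x + \<eta> x"] by simp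
    qed
  qed
  then show ?thesis using m by (simp add: modular_finite_def)
qed

text \<open>By \<open>\<Delta>\<^sub>2\<close> the functions of finite modular already form a linear space, so nothing is added by
  passing to the linear hull.\<close>

lemma L_space_modular_finite: assumes "\<xi> \<in> L_space \<Omega> M" shows "modular_finite \<xi>"
proof -
  have "linear_space {\<xi>. modular_finite \<xi>}"
    unfolding linear_space_def
  proof (intro conjI ballI allI)
    have "integrable (lebesgue_on \<Omega>) (\<lambda>x. M x 0) \<longleftrightarrow> integrable (lebesgue_on \<Omega>) (\<lambda>x. 0::real)"
      by (intro Bochner_Integration.integrable_cong) (auto simp: space_restrict_space zero)
    then show "(\<lambda>x. 0) \<in> {\<xi>. modular_finite \<xi>}" by (simp add: modular_finite_def)
  qed (auto intro: modular_finite_add modular_finite_scaleR)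
  then have "L_space \<Omega> M \<subseteq> {\<xi>. modular_finite \<xi>}"
    unfolding L_space_def by (intro hull_minimal) (auto simp: modular_finite_iff)
  then show ?thesis using assms by blast
qed

lemma modular_finite_cong_AE:
  assumes "modular_finite \<xi>" "AE x in lebesgue_on \<Omega>. \<xi> x = \<eta> x" "\<eta> \<in> borel_measurable (lebesgue_on \<Omega>)"
  shows "modular_finite \<eta>"
proof -
  have "integrable (lebesgue_on \<Omega>) (\<lambda>x. M x (\<xi> x)) \<longleftrightarrow> integrable (lebesgue_on \<Omega>) (\<lambda>x. M x (\<eta> x))"
    using assms by (intro integrable_cong_AE M_measurable) (auto simp: modular_finite_def elim: eventually_mono)
  then show ?thesis using assms by (simp add: modular_finite_def)
qed

lemma modular_finite_extension:
  assumes G: "G \<in> borel_measurable borel" "modular_finite G"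
  shows "integrable lborel (\<lambda>y. if y \<in> \<Omega> then M y (C *\<^sub>R G y) else 0)"
proof -
  have "(\<lambda>y. C *\<^sub>R G y) \<in> borel_measurable borel" using G(1) by measurable
  from measurable_ext[OF this]
  have m: "(\<lambda>y. if y \<in> \<Omega> then M y (C *\<^sub>R G y) else 0) \<in> borel_measurable borel" .
  have "integrable (lebesgue_on \<Omega>) (\<lambda>y. M y (C *\<^sub>R G y))"
    using modular_finite_scaleR[OF G(2)] by (simp add: modular_finite_def)
  then have "integrable (lebesgue_on \<Omega>) (\<lambda>y. if y \<in> \<Omega> then M y (C *\<^sub>R G y) else 0)"
    by (rule Bochner_Integration.integrable_cong[THEN iffD1, rotated 2]) (auto simp: space_restrict_space)
  then show ?thesis using lebesgue_on_borel(1)[OF op m] by simp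
qed

text \<open>The gradient of a test function is bounded, \<open>M\<close> is bounded on bounded sets, and \<open>\<Omega>\<close> has finite
  measure.\<close>

lemma Cc_infinity_V1L_0:
  assumes phi: "\<phi> \<in> Cc_infinity \<Omega>" shows "\<phi> \<in> V1L_0 \<Omega> M"
proof -
  note h = has_weak_gradient_Cc[OF op phi]
  have W: "\<phi> \<in> W11 \<Omega>" using h by (auto simp: W11_def)
  have "AE x in lebesgue_on \<Omega>. wgrad \<Omega> (\<lambda>x. \<phi> x - \<phi> x) x = grad \<phi> x - grad \<phi> x"
    by (rule wgrad_eq[OF op has_weak_gradient_diff_add(1)[OF h h op]])
  then have "(LINT x|lebesgue_on \<Omega>. norm (wgrad \<Omega> (\<lambda>x. \<phi> x - \<phi> x) x)) = 0"
    by (intro integral_eq_zero_AE) (auto elim: eventually_mono)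
  then have n0: "W11_norm \<Omega> (\<lambda>x. \<phi> x - \<phi> x) = 0" by (simp add: W11_norm_def)
  have W0: "\<phi> \<in> W11_0 \<Omega>"
    unfolding W11_0_def using W phi n0 by (auto intro!: exI[of _ "\<lambda>k. \<phi>"] simp del: diff_self)
  obtain R where c: "C1c R \<phi> (grad \<phi>)" using Cc_infinity_C1c[OF phi] .
  obtain a where a: "\<And>x. norm (grad \<phi> x) \<le> a" using C1b_bound[OF C1c_C1b[OF c]] by metis
  obtain B where B: "\<And>x \<xi>. x \<in> \<Omega> \<Longrightarrow> norm \<xi> \<le> a \<Longrightarrow> M x \<xi> \<le> B" using bounded_above by blast
  have gm: "grad \<phi> \<in> borel_measurable (lebesgue_on \<Omega>)" by (rule borel_lebesgue_on[OF C1b_borel(2)[OF C1c_C1b[OF c]]])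
  have "integrable (lebesgue_on \<Omega>) (\<lambda>x. M x (grad \<phi> x))"
  proof (rule fin.integrable_const_bound[of _ B])
    show "AE x in lebesgue_on \<Omega>. norm (M x (grad \<phi> x)) \<le> B"
      using in_Omega by eventually_elim (use B a nonneg in auto)
  qed (rule M_measurable[OF gm])
  then have mg: "modular_finite (grad \<phi>)" using gm by (simp add: modular_finite_def)
  have "wgrad \<Omega> \<phi> \<in> borel_measurable (lebesgue_on \<Omega>)"
    using has_weak_gradient_wgrad[OF W] by (auto simp: has_weak_gradient_def)
  moreover have "AE x in lebesgue_on \<Omega>. grad \<phi> x = wgrad \<Omega> \<phi> x" using wgrad_eq[OF op h] by eventually_elim simp
  ultimately have "modular_finite (wgrad \<Omega> \<phi>)" using modular_finite_cong_AE[OF mg] by blast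
  then have "wgrad \<Omega> \<phi> \<in> L_space \<Omega> M"
    unfolding L_space_def by (intro hull_inc) (simp add: modular_finite_iff)
  then show ?thesis using W0 by (simp add: V1L_0_def)
qed

end

locale growth = Delta2_function \<Omega> M
  for \<Omega> :: "(real^'n) set" and M +
  fixes F :: "real^'n \<Rightarrow> real \<Rightarrow> real^'n \<Rightarrow> real" and L :: real
  assumes F_meas: "\<And>z \<xi>. (\<lambda>x. F x z \<xi>) \<in> borel_measurable (lebesgue_on \<Omega>)"
    and F_cont: "\<And>x. x \<in> \<Omega> \<Longrightarrow> continuous_on UNIV (\<lambda>(z, \<xi>). F x z \<xi>)"
    and L: "0 \<le> L"
    and F_bound: "\<And>x z \<xi>. x \<in> \<Omega> \<Longrightarrow> 0 \<le> F x z \<xi> \<and> F x z \<xi> \<le> L * (M x \<xi> + 1)"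
begin

lemma F_measurable:
  assumes "v \<in> borel_measurable (lebesgue_on \<Omega>)" "\<xi> \<in> borel_measurable (lebesgue_on \<Omega>)"
  shows "(\<lambda>x. F x (v x) (\<xi> x)) \<in> borel_measurable (lebesgue_on \<Omega>)"
proof -
  have "(\<lambda>x. case_prod (F x) (v x, \<xi> x)) \<in> borel_measurable (lebesgue_on \<Omega>)"
  proof (rule caratheodory_measurable[where f="\<lambda>x. case_prod (F x)"])
    show "(\<lambda>x. case_prod (F x) p) \<in> borel_measurable (lebesgue_on \<Omega>)" for p using F_meas by (cases p) simp
    show "continuous_on UNIV (case_prod (F x))" if "x \<in> space (lebesgue_on \<Omega>)" for x
      using F_cont that by (simp add: space_restrict_space)
    show "(\<lambda>x. (v x, \<xi> x)) \<in> borel_measurable (lebesgue_on \<Omega>)" using assms by measurable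
  qed
  then show ?thesis by simp
qed

text \<open>Since \<open>M\<close> at a sum is at most the sum of \<open>M\<close> at the doubled summands, the fixed part \<open>G0\<close> and the varying part
  of the gradient are majorized separately.\<close>

lemma functional_limit:
  assumes v: "\<And>m. v m \<in> borel_measurable (lebesgue_on \<Omega>)" "v' \<in> borel_measurable (lebesgue_on \<Omega>)"
    and X: "\<And>m. X m \<in> borel_measurable (lebesgue_on \<Omega>)" "X' \<in> borel_measurable (lebesgue_on \<Omega>)"
    and G0: "modular_finite G0"
    and lim: "AE x in lebesgue_on \<Omega>. (\<lambda>m. v m x) \<longlonglongrightarrow> v' x" "AE x in lebesgue_on \<Omega>. (\<lambda>m. X m x) \<longlonglongrightarrow> X' x"
    and le: "\<And>m. AE x in lebesgue_on \<Omega>. M x (2 *\<^sub>R X m x) \<le> p m x"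
    and p: "\<And>m. integrable (lebesgue_on \<Omega>) (p m)" "integrable (lebesgue_on \<Omega>) p'"
      "(\<lambda>m. LINT x|lebesgue_on \<Omega>. norm (p m x - p' x)) \<longlonglongrightarrow> 0" "AE x in lebesgue_on \<Omega>. (\<lambda>m. p m x) \<longlonglongrightarrow> p' x"
  shows "(\<lambda>m. \<integral>\<^sup>+x. ennreal (F x (v m x) (G0 x + X m x)) \<partial>lebesgue_on \<Omega>) \<longlonglongrightarrow>
     (\<integral>\<^sup>+x. ennreal (F x (v' x) (G0 x + X' x)) \<partial>lebesgue_on \<Omega>)"
proof (rule convergence_with_L1_majorants)
  have G0m: "G0 \<in> borel_measurable (lebesgue_on \<Omega>)" using G0 by (simp add: modular_finite_def)
  show "(\<lambda>x. F x (v m x) (G0 x + X m x)) \<in> borel_measurable (lebesgue_on \<Omega>)" for m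
    by (intro F_measurable v borel_measurable_add G0m X)
  show "(\<lambda>x. F x (v' x) (G0 x + X' x)) \<in> borel_measurable (lebesgue_on \<Omega>)"
    by (intro F_measurable v borel_measurable_add G0m X)
  show "AE x in lebesgue_on \<Omega>. (\<lambda>m. F x (v m x) (G0 x + X m x)) \<longlonglongrightarrow> F x (v' x) (G0 x + X' x)"
    using lim in_Omega
  proof eventually_elim
    case (elim x)
    have "(\<lambda>m. (v m x, G0 x + X m x)) \<longlonglongrightarrow> (v' x, G0 x + X' x)" using elim by (intro tendsto_intros)
    from continuous_on_tendsto_compose[OF F_cont[OF elim(3)] this] show ?case by simp
  qed
  let ?g = "\<lambda>p x. L * (M x (2 *\<^sub>R G0 x) + p x + 1)"
  show "AE x in lebesgue_on \<Omega>. (\<lambda>m. ?g (p m) x) \<longlonglongrightarrow> ?g p' x"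
    using p(4) by eventually_elim (intro tendsto_intros)
  show "AE x in lebesgue_on \<Omega>. 0 \<le> F x (v m x) (G0 x + X m x) \<and> F x (v m x) (G0 x + X m x) \<le> ?g (p m) x" for m
    using le[of m] in_Omega
  proof eventually_elim
    case (elim x)
    have "M x (G0 x + X m x) + 1 \<le> M x (2 *\<^sub>R G0 x) + p m x + 1" using half_sum[OF elim(2), of "G0 x" "X m x"] elim(1) by linarith
    then have "L * (M x (G0 x + X m x) + 1) \<le> ?g (p m) x" using L by (rule mult_left_mono)
    then show ?case using F_bound[OF elim(2), of "v m x" "G0 x + X m x"] by linarith
  qed
  have iG: "integrable (lebesgue_on \<Omega>) (\<lambda>x. M x (2 *\<^sub>R G0 x))"
    using modular_finite_scaleR[OF G0] by (simp add: modular_finite_def)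
  show "integrable (lebesgue_on \<Omega>) (?g (p m))" for m using iG p(1) by (intro integrable_mult_right Bochner_Integration.integrable_add) auto
  show "integrable (lebesgue_on \<Omega>) (?g p')" using iG p(2) by (intro integrable_mult_right Bochner_Integration.integrable_add) auto
  have "?g (p m) x - ?g p' x = L * (p m x - p' x)" for m x by (simp add: algebra_simps)
  then have "(LINT x|lebesgue_on \<Omega>. norm (?g (p m) x - ?g p' x)) = L * (LINT x|lebesgue_on \<Omega>. norm (p m x - p' x))" for m
    using L by (simp add: abs_mult)
  then show "(\<lambda>m. LINT x|lebesgue_on \<Omega>. norm (?g (p m) x - ?g p' x)) \<longlonglongrightarrow> 0"
    using tendsto_mult_right_zero[OF p(3)] by simp
qed

lemma functional_translate:
  assumes u0: "has_weak_gradient \<Omega> u0 G0" and w: "has_weak_gradient \<Omega> w G"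
  shows "functional \<Omega> F (\<lambda>x. u0 x + w x) = (\<integral>\<^sup>+x. ennreal (F x (u0 x + w x) (G0 x + G x)) \<partial>lebesgue_on \<Omega>)"
  unfolding functional_def
  using wgrad_eq[OF op has_weak_gradient_diff_add(2)[OF u0 w op]]
  by (intro nn_integral_cong_AE) (auto elim: eventually_mono)

text \<open>The small multiple \<open>c\<close> in the bound for the approximating gradients is compensated by \<open>\<Delta>\<^sub>2\<close> with
  the factor \<open>2 / c\<close>. Along a subsequence the functions, their gradients and the majorants converge almost
  everywhere.\<close>

lemma inf_le_regular:
  assumes \<Omega>: "bounded_lipschitz_domain \<Omega>" and us: "ball_condition \<gamma> K b \<kappa> C" and \<gamma>: "0 \<le> \<gamma>" "\<gamma> \<le> 1"
    and u0: "has_weak_gradient \<Omega> u0 G0" "modular_finite G0"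
    and gw: "global_wgrad w G" and off: "\<And>x. x \<notin> \<Omega> \<Longrightarrow> w x = 0 \<and> G x = 0"
    and A: "0 \<le> A" "\<And>x y. \<bar>w x - w y\<bar> \<le> A * norm (x - y) powr \<gamma>"
    and W: "\<And>x. \<bar>w x\<bar> \<le> W" and mG: "modular_finite G"
  shows "(INF u\<in>translate u0 (Cc_infinity \<Omega>). functional \<Omega> F u) \<le>
    (\<integral>\<^sup>+x. ennreal (F x (u0 x + w x) (G0 x + G x)) \<partial>lebesgue_on \<Omega>)"
proof -
  have iw: "integrable lborel w" and iG: "integrable lborel G" using gw by (auto simp: global_wgrad_def)
  have wb: "w \<in> borel_measurable borel" "G \<in> borel_measurable borel" using iw iG by auto
  obtain \<Phi> h h' c B where ap: "\<And>m. \<Phi> m \<in> Cc_infinity \<Omega>" "0 < c"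
    "(\<lambda>m. LINT x|lborel. norm (\<Phi> m x - w x)) \<longlonglongrightarrow> 0"
    "(\<lambda>m. LINT x|lborel. norm (grad (\<Phi> m) x - G x)) \<longlonglongrightarrow> 0"
    "\<And>m x. x \<in> \<Omega> \<Longrightarrow> M x (c *\<^sub>R grad (\<Phi> m) x) \<le> h m x + B"
    "\<And>m. integrable lborel (h m)" "integrable lborel h'"
    "(\<lambda>m. LINT x|lborel. norm (h m x - h' x)) \<longlonglongrightarrow> 0"
    by (rule smooth_approximation[OF \<Omega> us \<gamma> gw off A W modular_finite_extension[OF wb(2) mG]], assumption, rule that)
  have "\<exists>R. C1c R (\<Phi> m) (grad (\<Phi> m))" for m using Cc_infinity_C1c[OF ap(1)] by blast
  then obtain R where c1: "\<And>m. C1c (R m) (\<Phi> m) (grad (\<Phi> m))" by metis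
  note ip = C1c_integrable[OF c1]
  note pb = C1b_borel[OF C1c_C1b[OF c1]]
  \<comment> \<open>One subsequence has to serve three sequences, so it is chosen for the sum of the distances.\<close>
  define s where "s m x = norm (\<Phi> m x - w x) + norm (grad (\<Phi> m) x - G x) + norm (h m x - h' x)" for m x
  have i3: "integrable lborel (\<lambda>x. norm (\<Phi> m x - w x))" "integrable lborel (\<lambda>x. norm (grad (\<Phi> m) x - G x))"
    "integrable lborel (\<lambda>x. norm (h m x - h' x))" for m
    using ip(1)[of m] ip(2)[of m] iw iG ap(6)[of m] ap(7) by auto
  have "(LINT x|lborel. norm (s m x)) = (LINT x|lborel. norm (\<Phi> m x - w x)) + (LINT x|lborel. norm (grad (\<Phi> m) x - G x)) +
      (LINT x|lborel. norm (h m x - h' x))" for m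
  proof -
    have "norm (s m x) = s m x" for x by (simp add: s_def)
    then show ?thesis using i3[of m] by (simp add: s_def)
  qed
  then have "(\<lambda>m. LINT x|lborel. norm (s m x)) \<longlonglongrightarrow> 0"
    using tendsto_add_zero[OF tendsto_add_zero[OF ap(3,4)] ap(8)] by simp
  moreover have "integrable lborel (s m)" for m unfolding s_def using i3[of m] by auto
  ultimately obtain r where r: "strict_mono r" "AE x in lborel. (\<lambda>m. s (r m) x) \<longlonglongrightarrow> 0"
    using tendsto_L1_AE_subseq[of lborel s] by blast
  have conv: "AE x in lborel. (\<lambda>m. \<Phi> (r m) x) \<longlonglongrightarrow> w x \<and> (\<lambda>m. grad (\<Phi> (r m)) x) \<longlonglongrightarrow> G x \<and> (\<lambda>m. h (r m) x) \<longlonglongrightarrow> h' x"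
    using r(2)
  proof eventually_elim
    case (elim x)
    have *: "f \<longlonglongrightarrow> l" if "\<And>m. norm (f m - l) \<le> s (r m) x" for f :: "nat \<Rightarrow> 'z::real_normed_vector" and l
    proof -
      have "(\<lambda>m. f m - l) \<longlonglongrightarrow> 0" by (rule Lim_null_comparison[OF _ elim]) (use that in simp)
      then show ?thesis by (simp add: LIM_zero_iff)
    qed
    show ?case by (intro conjI *) (auto simp: s_def)
  qed
  obtain c2 h2 where am: "0 \<le> c2" "integrable (lebesgue_on \<Omega>) h2" "AE x in lebesgue_on \<Omega>. \<forall>\<xi>. M x ((2 / c) *\<^sub>R \<xi>) \<le> c2 * M x \<xi> + h2 x"
    using Delta2_multiple by blast
  define p where "p q x = c2 * (q x + B) + h2 x" for q :: "real^'n \<Rightarrow> real" and x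
  have lim: "(\<lambda>m. \<integral>\<^sup>+x. ennreal (F x (u0 x + \<Phi> (r m) x) (G0 x + grad (\<Phi> (r m)) x)) \<partial>lebesgue_on \<Omega>) \<longlonglongrightarrow>
     (\<integral>\<^sup>+x. ennreal (F x (u0 x + w x) (G0 x + G x)) \<partial>lebesgue_on \<Omega>)"
  proof (rule functional_limit[OF _ _ _ _ u0(2)])
    have u0m: "u0 \<in> borel_measurable (lebesgue_on \<Omega>)" using u0(1) by (auto simp: has_weak_gradient_def)
    show "(\<lambda>x. u0 x + \<Phi> (r m) x) \<in> borel_measurable (lebesgue_on \<Omega>)" for m
      by (intro borel_measurable_add u0m borel_lebesgue_on pb)
    show "(\<lambda>x. u0 x + w x) \<in> borel_measurable (lebesgue_on \<Omega>)"
      by (intro borel_measurable_add u0m borel_lebesgue_on wb)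
    show "(\<lambda>x. grad (\<Phi> (r m)) x) \<in> borel_measurable (lebesgue_on \<Omega>)" for m by (intro borel_lebesgue_on pb)
    show "G \<in> borel_measurable (lebesgue_on \<Omega>)" by (intro borel_lebesgue_on wb)
    note cv = AE_lborel_lebesgue_on[OF op conv]
    show "AE x in lebesgue_on \<Omega>. (\<lambda>m. u0 x + \<Phi> (r m) x) \<longlonglongrightarrow> u0 x + w x"
      using cv by eventually_elim (auto intro: tendsto_intros)
    show "AE x in lebesgue_on \<Omega>. (\<lambda>m. grad (\<Phi> (r m)) x) \<longlonglongrightarrow> G x"
      using cv by eventually_elim auto
    show "AE x in lebesgue_on \<Omega>. M x (2 *\<^sub>R grad (\<Phi> (r m)) x) \<le> p (h (r m)) x" for m
      using am(3) in_Omega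
    proof eventually_elim
      case (elim x)
      have "M x (2 *\<^sub>R grad (\<Phi> (r m)) x) = M x ((2 / c) *\<^sub>R (c *\<^sub>R grad (\<Phi> (r m)) x))" using ap(2) by simp
      also have "\<dots> \<le> c2 * M x (c *\<^sub>R grad (\<Phi> (r m)) x) + h2 x" using elim(1) by blast
      also have "\<dots> \<le> p (h (r m)) x" unfolding p_def using ap(5)[OF elim(2)] am(1) by (intro add_right_mono mult_left_mono) auto
      finally show ?case .
    qed
    have ihm: "integrable (lebesgue_on \<Omega>) (h m)" "integrable (lebesgue_on \<Omega>) h'" for m
      using lebesgue_on_restrict_L1(1)[OF op] ap(6,7) by blast+
    show "integrable (lebesgue_on \<Omega>) (p (h (r m)))" for m unfolding p_def using ihm am(2) by auto
    show "integrable (lebesgue_on \<Omega>) (p h')" unfolding p_def using ihm am(2) by auto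
    show "AE x in lebesgue_on \<Omega>. (\<lambda>m. p (h (r m)) x) \<longlonglongrightarrow> p h' x"
      unfolding p_def using cv by eventually_elim (intro tendsto_intros, auto)
    have lc: "(\<lambda>m. c2 * (LINT x|lborel. norm (h (r m) x - h' x))) \<longlonglongrightarrow> 0"
      using tendsto_mult_right_zero[OF LIMSEQ_subseq_LIMSEQ[OF ap(8) r(1)], of c2] by (simp add: o_def)
    have le: "(LINT x|lebesgue_on \<Omega>. norm (p (h (r m)) x - p h' x)) \<le> c2 * (LINT x|lborel. norm (h (r m) x - h' x))" for m
    proof -
      have "norm (p (h (r m)) x - p h' x) = c2 * norm (h (r m) x - h' x)" for x
        using am(1) by (simp add: p_def abs_mult flip: right_diff_distrib)
      then have "(LINT x|lebesgue_on \<Omega>. norm (p (h (r m)) x - p h' x)) = c2 * (LINT x|lebesgue_on \<Omega>. norm (h (r m) x - h' x))" by simp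
      also have "\<dots> \<le> c2 * (LINT x|lborel. norm (h (r m) x - h' x))"
        using am(1) ap(6)[of "r m"] ap(7) by (intro mult_left_mono lebesgue_on_restrict_L1(2)[OF op]) auto
      finally show ?thesis .
    qed
    show "(\<lambda>m. LINT x|lebesgue_on \<Omega>. norm (p (h (r m)) x - p h' x)) \<longlonglongrightarrow> 0"
    proof (rule tendsto_sandwich[OF _ _ tendsto_const lc])
      show "eventually (\<lambda>m. 0 \<le> (LINT x|lebesgue_on \<Omega>. norm (p (h (r m)) x - p h' x))) sequentially" by simp
      show "eventually (\<lambda>m. (LINT x|lebesgue_on \<Omega>. norm (p (h (r m)) x - p h' x)) \<le>
          c2 * (LINT x|lborel. norm (h (r m) x - h' x))) sequentially" by (rule always_eventually) (rule allI, rule le)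
    qed
  qed
  have "(INF u\<in>translate u0 (Cc_infinity \<Omega>). functional \<Omega> F u) \<le>
      (\<integral>\<^sup>+x. ennreal (F x (u0 x + \<Phi> (r m) x) (G0 x + grad (\<Phi> (r m)) x)) \<partial>lebesgue_on \<Omega>)" for m
    unfolding functional_translate[OF u0(1) has_weak_gradient_Cc[OF op ap(1)], symmetric]
    using ap(1) by (intro INF_lower) (auto simp: translate_def)
  then show ?thesis using LIMSEQ_le_const[OF lim] by blast
qed

end

section \<open>Truncation and Hoelder continuity\<close>

text \<open>A truncation of class $C^1$ to which the chain rule applies in its elementary form. The slope lies
  between \<open>0\<close> and \<open>1\<close>, so truncation shortens gradients and does not increase the modular.\<close>

definition soft_trunc :: "nat \<Rightarrow> real \<Rightarrow> real" where
  "soft_trunc k s = real (Suc k) * arctan (s / real (Suc k))"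

definition soft_trunc' :: "nat \<Rightarrow> real \<Rightarrow> real" where
  "soft_trunc' k s = inverse (1 + (s / real (Suc k))\<^sup>2)"

lemma soft_trunc_DERIV: "DERIV (soft_trunc k) s :> soft_trunc' k s"
  unfolding soft_trunc_def soft_trunc'_def
  by (auto intro!: derivative_eq_intros simp del: of_nat_Suc)

lemma soft_trunc_zero: "soft_trunc k 0 = 0" by (simp add: soft_trunc_def)

lemma soft_trunc'_continuous: "continuous_on UNIV (soft_trunc' k)"
proof -
  have "1 + (s / real (Suc k))\<^sup>2 \<noteq> 0" for s by (metis add_cancel_left_left add_nonneg_eq_0_iff one_neq_zero zero_le_one zero_le_power2)
  then show ?thesis unfolding soft_trunc'_def by (intro continuous_intros) auto
qed

lemma soft_trunc'_bounds: "0 \<le> soft_trunc' k s" "soft_trunc' k s \<le> 1"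
  unfolding soft_trunc'_def by (auto intro!: inverse_le_1_iff[THEN iffD2] add_nonneg_nonneg)

lemma soft_trunc_bounded: "\<bar>soft_trunc k s\<bar> \<le> real (Suc k) * pi"
proof -
  have "\<bar>arctan (s / real (Suc k))\<bar> \<le> pi"
    using arctan_lbound[of "s / real (Suc k)"] arctan_ubound[of "s / real (Suc k)"] pi_gt_zero by linarith
  then show ?thesis by (simp add: soft_trunc_def abs_mult mult_left_mono del: of_nat_Suc)
qed

lemma div_Suc_tendsto: "(\<lambda>k. s / real (Suc k)) \<longlonglongrightarrow> 0"
  using tendsto_mult_right_zero[OF LIMSEQ_inverse_real_of_nat, of s] by (simp add: divide_inverse)

lemma soft_trunc_tendsto: "(\<lambda>k. soft_trunc k s) \<longlonglongrightarrow> s"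
proof (cases "s = 0")
  case False
  have "DERIV arctan 0 :> 1" using DERIV_arctan[of 0] by simp
  then have d: "((\<lambda>h. arctan h / h) \<longlongrightarrow> 1) (at 0)" by (simp add: DERIV_def)
  have "filterlim (\<lambda>k. s / real (Suc k)) (at 0) sequentially"
    unfolding filterlim_at using div_Suc_tendsto[of s] False by (auto simp del: of_nat_Suc)
  from filterlim_compose[OF d this] have "(\<lambda>k. arctan (s / real (Suc k)) / (s / real (Suc k))) \<longlonglongrightarrow> 1" .
  from tendsto_mult[OF tendsto_const[of s] this]
  show ?thesis using False by (simp add: soft_trunc_def mult.commute del: of_nat_Suc)
qed (simp add: soft_trunc_zero)

lemma soft_trunc'_tendsto: "(\<lambda>k. soft_trunc' k s) \<longlonglongrightarrow> 1"
proof -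
  have "(\<lambda>k. inverse (1 + (s / real (Suc k))\<^sup>2)) \<longlonglongrightarrow> inverse (1 + 0\<^sup>2)"
    by (intro tendsto_intros div_Suc_tendsto) auto
  then show ?thesis by (simp add: soft_trunc'_def)
qed

lemma holderE:
  assumes "h \<in> holder \<gamma> \<Omega>"
  obtains A where "0 \<le> A" "\<And>x y. x \<in> \<Omega> \<Longrightarrow> y \<in> \<Omega> \<Longrightarrow> \<bar>h x - h y\<bar> \<le> A * norm (x - y) powr \<gamma>"
proof -
  obtain A where A: "\<And>x y. x \<in> \<Omega> \<Longrightarrow> y \<in> \<Omega> \<Longrightarrow> x \<noteq> y \<Longrightarrow> \<bar>h x - h y\<bar> / norm (x - y) powr \<gamma> \<le> A"
    using assms unfolding holder_def bdd_above_def by blast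
  show thesis
  proof (rule that[of "max 0 A"])
    fix x y assume xy: "x \<in> \<Omega>" "y \<in> \<Omega>"
    show "\<bar>h x - h y\<bar> \<le> max 0 A * norm (x - y) powr \<gamma>"
    proof (cases "x = y")
      case False
      then have p: "0 < norm (x - y) powr \<gamma>" by simp
      have "\<bar>h x - h y\<bar> \<le> A * norm (x - y) powr \<gamma>" using A[OF xy False] p by (simp add: pos_divide_le_eq)
      also have "\<dots> \<le> max 0 A * norm (x - y) powr \<gamma>" using p by (intro mult_right_mono) auto
      finally show ?thesis .
    qed simp
  qed simp
qed

lemma Cc_infinity_holder:
  assumes bd: "bounded \<Omega>" and phi: "\<phi> \<in> Cc_infinity \<Omega>" and \<gamma>: "0 < \<gamma>" "\<gamma> \<le> 1" shows "\<phi> \<in> holder \<gamma> \<Omega>"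
proof -
  obtain R where c: "C1c R \<phi> (grad \<phi>)" using Cc_infinity_C1c[OF phi] .
  obtain a where a: "0 \<le> a" "\<And>x. norm (grad \<phi> x) \<le> a" using C1b_bound[OF C1c_C1b[OF c]] by metis
  obtain r where r: "0 < r" "\<And>x. x \<in> \<Omega> \<Longrightarrow> norm x \<le> r" using bd unfolding bounded_pos by blast
  have lip: "\<bar>\<phi> x - \<phi> y\<bar> \<le> a * norm (x - y)" for x y
  proof -
    have "norm (\<phi> x - \<phi> y) \<le> a * norm (x - y)"
    proof (rule differentiable_bound[where S=UNIV and f'="\<lambda>x h. h \<bullet> grad \<phi> x"])
      show "(\<phi> has_derivative (\<lambda>h. h \<bullet> grad \<phi> x)) (at x within UNIV)" for x
        using GDERIV_D[OF C1b_GDERIV[OF C1c_C1b[OF c]]] by simp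
      show "onorm (\<lambda>h. h \<bullet> grad \<phi> x) \<le> a" for x
      proof (rule onorm_le)
        fix h
        have "norm (h \<bullet> grad \<phi> x) \<le> norm h * norm (grad \<phi> x)" using Cauchy_Schwarz_ineq2[of h "grad \<phi> x"] by simp
        also have "\<dots> \<le> norm h * a" using a(2) by (intro mult_left_mono) auto
        finally show "norm (h \<bullet> grad \<phi> x) \<le> a * norm h" by (simp add: mult.commute)
      qed
    qed auto
    then show ?thesis by simp
  qed
  have "\<bar>\<phi> x - \<phi> y\<bar> / norm (x - y) powr \<gamma> \<le> a * (2 * r) powr (1 - \<gamma>)" if xy: "x \<in> \<Omega>" "y \<in> \<Omega>" "x \<noteq> y" for x y
  proof -
    have n: "0 < norm (x - y)" using xy by simp
    have d: "norm (x - y) \<le> 2 * r" using norm_triangle_ineq4[of x y] r(2)[OF xy(1)] r(2)[OF xy(2)] by linarith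
    have "\<bar>\<phi> x - \<phi> y\<bar> / norm (x - y) powr \<gamma> \<le> a * norm (x - y) / norm (x - y) powr \<gamma>"
      using lip by (intro divide_right_mono) auto
    also have "\<dots> = a * norm (x - y) powr (1 - \<gamma>)" using n by (simp add: powr_diff)
    also have "\<dots> \<le> a * (2 * r) powr (1 - \<gamma>)" using a(1) \<gamma> d by (intro mult_left_mono powr_mono2) auto
    finally show ?thesis .
  qed
  then show ?thesis unfolding holder_def bdd_above_def by blast
qed

context growth
begin

text \<open>The truncations \<open>soft_trunc k w\<close> are bounded and have zero boundary values; the functional along them
  tends to its value at \<open>w\<close>, with the fixed majorant \<open>M x (2 *\<^sub>R G x)\<close>.\<close>

lemma inf_le_bounded:
  assumes \<Omega>: "bounded_lipschitz_domain \<Omega>" and B: "B_gen 0 \<Omega> M" and u0: "u0 \<in> V1L \<Omega> M" and w: "w \<in> V1L_0 \<Omega> M"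
  shows "(INF u\<in>translate u0 (Cc_infinity \<Omega>). functional \<Omega> F u) \<le> functional \<Omega> F (\<lambda>x. u0 x + w x)"
proof -
  obtain K b \<kappa> C where us: "ball_condition 0 K b \<kappa> C" using B_gen_ball_condition[OF B] by blast
  have hu: "has_weak_gradient \<Omega> u0 (wgrad \<Omega> u0)" and hw: "has_weak_gradient \<Omega> w (wgrad \<Omega> w)"
    using u0 w by (auto simp: V1L_def V1L_0_def W11_0_def intro: has_weak_gradient_wgrad)
  have G0: "modular_finite (wgrad \<Omega> u0)" and Gw: "modular_finite (wgrad \<Omega> w)"
    using u0 w by (auto simp: V1L_def V1L_0_def intro: L_space_modular_finite)
  have iw: "integrable (lebesgue_on \<Omega>) w" "integrable (lebesgue_on \<Omega>) (wgrad \<Omega> w)" using hw by (auto simp: has_weak_gradient_def)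
  obtain v where v: "v \<in> borel_measurable borel" "\<And>x. x \<notin> \<Omega> \<Longrightarrow> v x = 0" "AE x in lebesgue_on \<Omega>. w x = v x"
    using borel_representative_real[OF op borel_measurable_integrable[OF iw(1)]] by blast
  obtain G where G: "G \<in> borel_measurable borel" "\<And>x. x \<notin> \<Omega> \<Longrightarrow> G x = 0" "AE x in lebesgue_on \<Omega>. wgrad \<Omega> w x = G x"
    using borel_representative_vec[OF op borel_measurable_integrable[OF iw(2)]] by blast
  have z: "zero_trace \<Omega> v G" using w by (intro W11_0_zero_trace[OF op _ v G]) (auto simp: V1L_0_def)
  have mG: "modular_finite G" by (rule modular_finite_cong_AE[OF Gw G(3) borel_lebesgue_on[OF G(1)]])
  have tm: "soft_trunc k \<in> borel_measurable borel" "soft_trunc' k \<in> borel_measurable borel" for k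
  proof -
    have "continuous_on UNIV (soft_trunc k)" using soft_trunc_DERIV DERIV_isCont continuous_at_imp_continuous_on by blast
    then show "soft_trunc k \<in> borel_measurable borel" by (rule borel_measurable_continuous_onI)
    show "soft_trunc' k \<in> borel_measurable borel" by (rule borel_measurable_continuous_onI[OF soft_trunc'_continuous])
  qed
  have vk: "(\<lambda>x. soft_trunc k (v x)) \<in> borel_measurable borel" for k by (rule measurable_compose[OF v(1) tm(1)])
  have Gk: "(\<lambda>x. soft_trunc' k (v x) *\<^sub>R G x) \<in> borel_measurable borel" for k
    by (rule borel_measurable_scaleR[OF measurable_compose[OF v(1) tm(2)] G(1)])
  have le: "M x (a *\<^sub>R soft_trunc' k (v x) *\<^sub>R G x) \<le> M x (a *\<^sub>R G x)" if "x \<in> \<Omega>" for x k a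
    using shrink[OF that soft_trunc'_bounds(1)[of k "v x"] soft_trunc'_bounds(2)[of k "v x"], of "a *\<^sub>R G x"]
    by (simp add: mult.commute)
  have mGk: "modular_finite (\<lambda>x. soft_trunc' k (v x) *\<^sub>R G x)" for k
  proof -
    have "integrable (lebesgue_on \<Omega>) (\<lambda>x. M x (soft_trunc' k (v x) *\<^sub>R G x))"
    proof (rule Bochner_Integration.integrable_bound)
      show "integrable (lebesgue_on \<Omega>) (\<lambda>x. M x (G x))" using mG by (simp add: modular_finite_def)
      show "(\<lambda>x. M x (soft_trunc' k (v x) *\<^sub>R G x)) \<in> borel_measurable (lebesgue_on \<Omega>)"
        by (intro M_measurable borel_lebesgue_on Gk)
      show "AE x in lebesgue_on \<Omega>. norm (M x (soft_trunc' k (v x) *\<^sub>R G x)) \<le> norm (M x (G x))"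
        using in_Omega
      proof eventually_elim
        case (elim x)
        show ?case using le[OF elim, of 1 k] nonneg[OF elim] by simp
      qed
    qed
    then show ?thesis using borel_lebesgue_on[OF Gk] by (simp add: modular_finite_def)
  qed
  have inf: "(INF u\<in>translate u0 (Cc_infinity \<Omega>). functional \<Omega> F u) \<le>
    (\<integral>\<^sup>+x. ennreal (F x (u0 x + soft_trunc k (v x)) (wgrad \<Omega> u0 x + soft_trunc' k (v x) *\<^sub>R G x)) \<partial>lebesgue_on \<Omega>)" for k
  proof (rule inf_le_regular[OF \<Omega> us _ _ hu G0 _ _ _ _ _ mGk])
    show "global_wgrad (\<lambda>x. soft_trunc k (v x)) (\<lambda>x. soft_trunc' k (v x) *\<^sub>R G x)"
      using soft_trunc'_bounds by (intro zero_trace_chain[OF z soft_trunc_DERIV soft_trunc'_continuous soft_trunc_zero]) (simp add: abs_of_nonneg)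
    show "soft_trunc k (v x) = 0 \<and> soft_trunc' k (v x) *\<^sub>R G x = 0" if "x \<notin> \<Omega>" for x
      using v(2)[OF that] G(2)[OF that] soft_trunc_zero by simp
    show "\<bar>soft_trunc k (v x)\<bar> \<le> real (Suc k) * pi" for x by (rule soft_trunc_bounded)
    show "0 \<le> 2 * (real (Suc k) * pi)" by simp
    show "\<bar>soft_trunc k (v x) - soft_trunc k (v y)\<bar> \<le> 2 * (real (Suc k) * pi) * norm (x - y) powr 0" for x y
      using soft_trunc_bounded[of k "v x"] soft_trunc_bounded[of k "v y"] by (cases "x = y") auto
  qed auto
  have "(\<lambda>k. \<integral>\<^sup>+x. ennreal (F x (u0 x + soft_trunc k (v x)) (wgrad \<Omega> u0 x + soft_trunc' k (v x) *\<^sub>R G x)) \<partial>lebesgue_on \<Omega>) \<longlonglongrightarrow>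
    (\<integral>\<^sup>+x. ennreal (F x (u0 x + v x) (wgrad \<Omega> u0 x + G x)) \<partial>lebesgue_on \<Omega>)"
  proof (rule functional_limit[OF _ _ _ _ G0, where p="\<lambda>k x. M x (2 *\<^sub>R G x)" and p'="\<lambda>x. M x (2 *\<^sub>R G x)"])
    have u0m: "u0 \<in> borel_measurable (lebesgue_on \<Omega>)" using hu by (auto simp: has_weak_gradient_def)
    show "(\<lambda>x. u0 x + soft_trunc k (v x)) \<in> borel_measurable (lebesgue_on \<Omega>)" for k
      by (intro borel_measurable_add u0m borel_lebesgue_on vk)
    show "(\<lambda>x. u0 x + v x) \<in> borel_measurable (lebesgue_on \<Omega>)"
      by (intro borel_measurable_add u0m borel_lebesgue_on v)
    show "(\<lambda>x. soft_trunc' k (v x) *\<^sub>R G x) \<in> borel_measurable (lebesgue_on \<Omega>)" for k by (intro borel_lebesgue_on Gk)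
    show "G \<in> borel_measurable (lebesgue_on \<Omega>)" by (intro borel_lebesgue_on G)
    show "AE x in lebesgue_on \<Omega>. (\<lambda>k. u0 x + soft_trunc k (v x)) \<longlonglongrightarrow> u0 x + v x"
      by (intro AE_I2 tendsto_intros soft_trunc_tendsto)
    show "AE x in lebesgue_on \<Omega>. (\<lambda>k. soft_trunc' k (v x) *\<^sub>R G x) \<longlonglongrightarrow> G x"
    proof (rule AE_I2)
      fix x show "(\<lambda>k. soft_trunc' k (v x) *\<^sub>R G x) \<longlonglongrightarrow> G x"
        using tendsto_scaleR[OF soft_trunc'_tendsto tendsto_const, of "v x" "G x"] by simp
    qed
    show "AE x in lebesgue_on \<Omega>. M x (2 *\<^sub>R soft_trunc' k (v x) *\<^sub>R G x) \<le> M x (2 *\<^sub>R G x)" for k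
      using in_Omega by eventually_elim (rule le)
    show "integrable (lebesgue_on \<Omega>) (\<lambda>x. M x (2 *\<^sub>R G x))" "integrable (lebesgue_on \<Omega>) (\<lambda>x. M x (2 *\<^sub>R G x))"
      using modular_finite_scaleR[OF mG] by (auto simp: modular_finite_def)
  qed auto
  then have "(INF u\<in>translate u0 (Cc_infinity \<Omega>). functional \<Omega> F u) \<le>
      (\<integral>\<^sup>+x. ennreal (F x (u0 x + v x) (wgrad \<Omega> u0 x + G x)) \<partial>lebesgue_on \<Omega>)"
    using inf by (intro LIMSEQ_le_const) auto
  also have "\<dots> = functional \<Omega> F (\<lambda>x. u0 x + w x)"
    unfolding functional_translate[OF hu hw]
  proof (rule nn_integral_cong_AE)
    show "AE x in lebesgue_on \<Omega>. ennreal (F x (u0 x + v x) (wgrad \<Omega> u0 x + G x)) =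
        ennreal (F x (u0 x + w x) (wgrad \<Omega> u0 x + wgrad \<Omega> w x))"
      using v(3) G(3) by eventually_elim simp
  qed
  finally show ?thesis .
qed

text \<open>Here the extension by zero is itself Hoelder continuous, and bounded because it is compared with its value
  \<open>0\<close> at a point outside the bounded set \<open>\<Omega>\<close>. The representative is chosen by hand: the Hoelder bound concerns
  the values of \<open>w\<close> at every point of \<open>\<Omega>\<close>, not only almost everywhere.\<close>

lemma inf_le_holder:
  assumes \<Omega>: "bounded_lipschitz_domain \<Omega>" and B: "B_gen \<gamma> \<Omega> M" and \<gamma>: "0 < \<gamma>" "\<gamma> \<le> 1"
    and u0: "u0 \<in> V1L \<Omega> M" and w: "w \<in> V1L_0 \<Omega> M" "w \<in> holder \<gamma> \<Omega>"
  shows "(INF u\<in>translate u0 (Cc_infinity \<Omega>). functional \<Omega> F u) \<le> functional \<Omega> F (\<lambda>x. u0 x + w x)"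
proof -
  obtain K b \<kappa> C where us: "ball_condition \<gamma> K b \<kappa> C" using B_gen_ball_condition[OF B] by blast
  have lip: "lipschitz_boundary \<Omega>" using \<Omega> by (simp add: bounded_lipschitz_domain_def)
  have hu: "has_weak_gradient \<Omega> u0 (wgrad \<Omega> u0)" and hw: "has_weak_gradient \<Omega> w (wgrad \<Omega> w)"
    using u0 w by (auto simp: V1L_def V1L_0_def W11_0_def intro: has_weak_gradient_wgrad)
  have G0: "modular_finite (wgrad \<Omega> u0)" and Gw: "modular_finite (wgrad \<Omega> w)"
    using u0 w by (auto simp: V1L_def V1L_0_def intro: L_space_modular_finite)
  have iw: "integrable (lebesgue_on \<Omega>) (wgrad \<Omega> w)" using hw by (auto simp: has_weak_gradient_def)
  obtain A where A: "0 \<le> A" "\<And>x y. x \<in> \<Omega> \<Longrightarrow> y \<in> \<Omega> \<Longrightarrow> \<bar>w x - w y\<bar> \<le> A * norm (x - y) powr \<gamma>"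
    using holderE[OF w(2)] by blast
  have cw: "continuous_on \<Omega> w"
    unfolding continuous_on_def
  proof
    fix x assume x: "x \<in> \<Omega>"
    have "((\<lambda>y. A * norm (x - y) powr \<gamma>) \<longlongrightarrow> A * norm (x - x) powr \<gamma>) (at x within \<Omega>)"
      using \<gamma> by (intro tendsto_mult tendsto_const tendsto_powr' tendsto_norm tendsto_diff tendsto_ident_at) auto
    then have "((\<lambda>y. A * norm (x - y) powr \<gamma>) \<longlongrightarrow> 0) (at x within \<Omega>)" by simp
    moreover have "eventually (\<lambda>y. norm (w y - w x) \<le> A * norm (x - y) powr \<gamma>) (at x within \<Omega>)"
      unfolding eventually_at_filter
      by (rule always_eventually) (use A(2)[OF x] in \<open>auto simp: abs_minus_commute\<close>)
    ultimately have "((\<lambda>y. w y - w x) \<longlongrightarrow> 0) (at x within \<Omega>)" by (rule Lim_null_comparison[rotated])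
    then show "(w \<longlongrightarrow> w x) (at x within \<Omega>)" by (simp add: LIM_zero_iff)
  qed
  define v where "v x = indicator \<Omega> x *\<^sub>R w x" for x
  have v: "v \<in> borel_measurable borel" "\<And>x. x \<notin> \<Omega> \<Longrightarrow> v x = 0" "AE x in lebesgue_on \<Omega>. w x = v x"
  proof -
    have "\<Omega> \<in> sets borel" using op by simp
    from borel_measurable_continuous_on_indicator[OF this cw] show "v \<in> borel_measurable borel" by (simp add: v_def[abs_def])
    show "AE x in lebesgue_on \<Omega>. w x = v x" using in_Omega by eventually_elim (simp add: v_def)
  qed (simp add: v_def)
  obtain G where G: "G \<in> borel_measurable borel" "\<And>x. x \<notin> \<Omega> \<Longrightarrow> G x = 0" "AE x in lebesgue_on \<Omega>. wgrad \<Omega> w x = G x"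
    using borel_representative_vec[OF op borel_measurable_integrable[OF iw]] by blast
  have z: "zero_trace \<Omega> v G" using w by (intro W11_0_zero_trace[OF op _ v G]) (auto simp: V1L_0_def)
  have mG: "modular_finite G" by (rule modular_finite_cong_AE[OF Gw G(3) borel_lebesgue_on[OF G(1)]])
  have vA: "\<bar>v x - v y\<bar> \<le> A * norm (x - y) powr \<gamma>" for x y
    by (rule holder_extension_by_zero[OF op lip z \<gamma>(1) A(1)]) (use A(2) in \<open>simp add: v_def\<close>)
  have gw: "global_wgrad v G"
    using zero_trace_chain[OF z, of "\<lambda>s. s" "\<lambda>s. 1"] by simp
  obtain r where r: "\<And>x. x \<in> \<Omega> \<Longrightarrow> norm x \<le> r" "0 \<le> r"
    using bd unfolding bounded_iff by (metis (no_types, opaque_lifting) max.cobounded1 max.coboundedI2)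
  obtain y0 :: "real^'n" where y0: "norm y0 = r + 1" using vector_choose_size[of "r + 1"] r(2) by auto
  have "y0 \<notin> \<Omega>" using r(1)[of y0] y0 by auto
  have bound: "\<bar>v x\<bar> \<le> A * (2 * r + 1) powr \<gamma>" for x
  proof (cases "x \<in> \<Omega>")
    case True
    have "norm (x - y0) \<le> 2 * r + 1" using r(1)[OF True] y0 norm_triangle_ineq4[of x y0] by linarith
    then have "norm (x - y0) powr \<gamma> \<le> (2 * r + 1) powr \<gamma>" using \<gamma> by (intro powr_mono2) auto
    then have "A * norm (x - y0) powr \<gamma> \<le> A * (2 * r + 1) powr \<gamma>" using A(1) by (rule mult_left_mono)
    then show ?thesis using vA[of x y0] v(2)[OF \<open>y0 \<notin> \<Omega>\<close>] by simp
  qed (use v(2) A(1) in simp)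
  have "(INF u\<in>translate u0 (Cc_infinity \<Omega>). functional \<Omega> F u) \<le>
      (\<integral>\<^sup>+x. ennreal (F x (u0 x + v x) (wgrad \<Omega> u0 x + G x)) \<partial>lebesgue_on \<Omega>)"
    by (rule inf_le_regular[OF \<Omega> us _ \<gamma>(2) hu G0 gw _ A(1) vA bound mG]) (use \<gamma>(1) v(2) G(2) in auto)
  also have "\<dots> = functional \<Omega> F (\<lambda>x. u0 x + w x)"
    unfolding functional_translate[OF hu hw]
  proof (rule nn_integral_cong_AE)
    show "AE x in lebesgue_on \<Omega>. ennreal (F x (u0 x + v x) (wgrad \<Omega> u0 x + G x)) =
        ennreal (F x (u0 x + w x) (wgrad \<Omega> u0 x + wgrad \<Omega> w x))"
      using v(3) G(3) by eventually_elim simp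
  qed
  finally show ?thesis .
qed

end

theorem theorem3:
  fixes \<Omega> :: "(real^'n) set"
    and F :: "real^'n \<Rightarrow> real \<Rightarrow> real^'n \<Rightarrow> real"
    and M :: "real^'n \<Rightarrow> real^'n \<Rightarrow> real"
    and \<nu> \<beta> L :: real
  assumes "bounded_lipschitz_domain \<Omega>"
    and "\<And>z \<xi>. (\<lambda>x. F x z \<xi>) \<in> borel_measurable (lebesgue_on \<Omega>)"
    and "\<And>x. x \<in> \<Omega> \<Longrightarrow> continuous_on UNIV (\<lambda>(z, \<xi>). F x z \<xi>)"
    and "weak_N_function \<Omega> UNIV M"
    and "continuous_on (\<Omega> \<times> UNIV) (\<lambda>(x, \<xi>). M x \<xi>)"
    and "Delta2 \<Omega> M"
    and "0 < \<nu>" "\<nu> < 1" "0 < \<beta>" "\<beta> < 1" "1 < L"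
    and "\<And>x z \<xi>. x \<in> \<Omega> \<Longrightarrow> \<nu> * M x (\<beta> *\<^sub>R \<xi>) \<le> F x z \<xi> \<and> F x z \<xi> \<le> L * (M x \<xi> + 1)"
  shows "(\<forall>u0. u0 \<in> V1L \<Omega> M \<and> B_gen 0 \<Omega> M \<longrightarrow>
            (INF u\<in>translate u0 (V1L_0 \<Omega> M). functional \<Omega> F u)
              = (INF u\<in>translate u0 (Cc_infinity \<Omega>). functional \<Omega> F u))
       \<and> (\<forall>\<gamma> u0. 0 < \<gamma> \<and> \<gamma> \<le> 1 \<and> u0 \<in> V1L \<Omega> M \<inter> holder \<gamma> \<Omega> \<and> B_gen \<gamma> \<Omega> M \<longrightarrow>
            (INF u\<in>translate u0 (V1L_0 \<Omega> M \<inter> holder \<gamma> \<Omega>). functional \<Omega> F u)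
              = (INF u\<in>translate u0 (Cc_infinity \<Omega>). functional \<Omega> F u))"
proof -
  have o: "open \<Omega>" "bounded \<Omega>" using assms(1) by (auto simp: bounded_lipschitz_domain_def)
  interpret growth \<Omega> M F L
  proof
    show "0 \<le> F x z \<xi> \<and> F x z \<xi> \<le> L * (M x \<xi> + 1)" if x: "x \<in> \<Omega>" for x z \<xi>
    proof -
      have "0 \<le> M x (\<beta> *\<^sub>R \<xi>)" using assms(4) x by (simp add: weak_N_function_def)
      then have "0 \<le> \<nu> * M x (\<beta> *\<^sub>R \<xi>)" using assms(7) by simp
      then show ?thesis using assms(12)[OF x, of \<xi> z] by linarith
    qed
  qed (use o assms(2-6,11) in auto)
  have sub: "translate u0 (Cc_infinity \<Omega>) \<subseteq> translate u0 S" if "Cc_infinity \<Omega> \<subseteq> S" for u0 S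
    using that by (auto simp: translate_def)
  show ?thesis
  proof (intro conjI allI impI)
    fix u0 assume h: "u0 \<in> V1L \<Omega> M \<and> B_gen 0 \<Omega> M"
    show "(INF u\<in>translate u0 (V1L_0 \<Omega> M). functional \<Omega> F u) = (INF u\<in>translate u0 (Cc_infinity \<Omega>). functional \<Omega> F u)"
    proof (rule antisym)
      show "(INF u\<in>translate u0 (V1L_0 \<Omega> M). functional \<Omega> F u) \<le> (INF u\<in>translate u0 (Cc_infinity \<Omega>). functional \<Omega> F u)"
        using Cc_infinity_V1L_0 by (intro INF_superset_mono sub) auto
      show "(INF u\<in>translate u0 (Cc_infinity \<Omega>). functional \<Omega> F u) \<le> (INF u\<in>translate u0 (V1L_0 \<Omega> M). functional \<Omega> F u)"
        using inf_le_bounded[OF assms(1)] h by (intro INF_greatest) (auto simp: translate_def)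
    qed
  next
    fix \<gamma> u0 assume h: "0 < \<gamma> \<and> \<gamma> \<le> 1 \<and> u0 \<in> V1L \<Omega> M \<inter> holder \<gamma> \<Omega> \<and> B_gen \<gamma> \<Omega> M"
    show "(INF u\<in>translate u0 (V1L_0 \<Omega> M \<inter> holder \<gamma> \<Omega>). functional \<Omega> F u) = (INF u\<in>translate u0 (Cc_infinity \<Omega>). functional \<Omega> F u)"
    proof (rule antisym)
      show "(INF u\<in>translate u0 (V1L_0 \<Omega> M \<inter> holder \<gamma> \<Omega>). functional \<Omega> F u) \<le> (INF u\<in>translate u0 (Cc_infinity \<Omega>). functional \<Omega> F u)"
        using Cc_infinity_V1L_0 Cc_infinity_holder[OF bd] h by (intro INF_superset_mono sub) auto
      show "(INF u\<in>translate u0 (Cc_infinity \<Omega>). functional \<Omega> F u) \<le> (INF u\<in>translate u0 (V1L_0 \<Omega> M \<inter> holder \<gamma> \<Omega>). functional \<Omega> F u)"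
        using inf_le_holder[OF assms(1)] h by (intro INF_greatest) (auto simp: translate_def)
    qed
  qed
qed

end
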